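(* Let the one-dimensional system $$-u^k_{xx}=\lambda(u^k)^{q-1}+f_k(x,u)\ \text{ in }(0,1),\qquad u^k\ge0\ \text{ in }(0,1),\qquad u^k(0)=u^k(1)=0,\qquad k=1,\dots,m,$$ satisfy the assumptions listed in the context. Then it admits a maximal one-sided saddle-node point $(u^*,\lambda^* )\in\mathbb U^o\times(0,+\infty)$, and it has no weak solution in $\mathbb U^o$ for $\lambda>\lambda^*$. Furthermore, there exists $v^*\in\mathbb S\setminus\{0\}$ such that $$\lambda^*=\mathcal R(u^*,v^* )=\inf_{v\in\mathbb S\setminus\{0\}}\mathcal R(u^*,v)=\sup_{u\in\mathbb U^o}\inf_{v\in\mathbb S\setminus\{0\}}\mathcal R(u,v).$$ In addition, $$\mathcal F(u^*,\lambda^* )=0\ \text{in }\mathbb W^*,\qquad \langle D_u\mathcal F(u^*,\lambda^* )\xi,v^*\rangle=0\quad\forall\xi\in\mathbb W.$$ If, moreover, $v^*\in\mathbb S^o$, then $$\lambda^*=\min_{v\in\mathbb S\setminus\{0\}}\mathcal R(u^*,v)=\min_{v\in\mathbb S^o}\mathcal R(u^*,v).$$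
   Context: $m\ge1$, $1<q<2$, $\mathbb R_+=[0,\infty)$, $\mathbb W=(H_0^1(0,1))^m$, $g(u)=((u^1)^{q-1},\dots,(u^m)^{q-1})$, $\langle h(\cdot,u),v\rangle_m=\sum_k\int_0^1h_k(x,u)v^k\,dx$, $f_u$ is the Jacobian matrix $(f_{i,u^j})$. Cones: $S^o=\{w\in H_0^1(0,1)\cap C([0,1]):w>0\text{ in }(0,1)\}$, $\mathbb S^o=(S^o)^m$, $\mathbb S=\overline{\mathbb S^o}^{\,\mathbb W}$; $U^o=\{w\in S^o:w''\in L^\infty_{\rm loc}(0,1),\ -w''\ge0\text{ in }\mathcal D'(0,1)\}$, $\mathbb U^o=(U^o)^m$. Assumptions on $f$. For $i=1,\dots,m$: $f_i(\cdot,u)\in C([0,1])$, $f_i(x,\cdot)\in C^1(\mathbb R_+^m)$, $f_i(x,0)=0$. There are $2<\gamma<\infty$ and $C>0$ with $0\le f_i(x,u)\le C|u|^{\gamma-1}$ and $0\le f_{i,u^j}(x,u)\le C|u|^{\gamma-2}$ for all $i,j$; for $i\ne j$, $f_{i,u^j}(x,u)>0$ for a.e. $x\in(0,1)$ and $u\in(0,\infty)^m$. Large growth: with $\lambda_1$ the principal Dirichlet eigenvalue of $-d^2/dx^2$ on $(0,1)$, there are $R,\delta_0>0$ with $\sum_kf_k(x,u)\ge(\lambda_1+\delta_0)\sum_ku^k$ for a.e. $x$ and all $u\in\mathbb R_+^m$, $|u|>R$. Radial monotonicity: $\langle f_u(u)u-f(u),v\rangle_m\ge0$ for all $u\in\mathbb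 U^o$, $v\in\mathbb S\setminus\{0\}$. Picone-type superlinearity: for some $\theta>1$, $Q_f(x,u)\ge\theta\sum_if_i(x,u)u^i$ for a.e. $x$ and all $u\in\mathbb R_+^m$, where $Q_f(x,u)=\sum_if_{i,u^i}(x,u)(u^i)^2+2\sum_{i<j}\sqrt{f_{i,u^j}(x,u)f_{j,u^i}(x,u)}\,u^iu^j$. Operators: $\langle\mathcal F(u,\lambda),\zeta\rangle=\sum_k\int_0^1(u^k)'(\zeta^k)'dx-\langle f(\cdot,u),\zeta\rangle_m-\lambda\langle g(u),\zeta\rangle_m$; $\langle D_u\mathcal F(u,\lambda)\xi,v\rangle=\sum_k\int_0^1(\xi^k)'(v^k)'dx-\langle f_u(\cdot,u)\xi,v\rangle_m-\lambda(q-1)\sum_k\int_0^1(u^k)^{q-2}\xi^kv^k\,dx$ for $u\in\mathbb U^o$. For $u\in\mathbb S^o$, $v\in\mathbb S\setminus\{0\}$, $$\mathcal R(u,v)=\frac{\sum_k\int_0^1(u^k)'(v^k)'dx-\langle f(\cdot,u),v\rangle_m}{\langle g(u),v\rangle_m},\qquad \lambda^*:=\sup_{u\in\mathbb U^o}\inf_{v\in\mathbb S\setminus\{0\}}\mathcal R(u,v).$$ Saddle-node points. A solution $(u_0,\lambda_0)\in\mathbb U^o\times\mathbb R$ of $\mathcal F(u,\lambda)=0$ is called singular if there is $v_0\in\mathbb S\setminus\{0\}$ with $\langle D_u\mathcal F(u_0,\lambda_0)\xi,v_0\rangle=0$ for all $\xi\in\mathbb W$. It is called a one-sided saddle-node point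 in $\mathbb U^o$ if there exist $\varepsilon>0$ and a neighbourhood $V$ of $u_0$ in $\mathbb W$ such that $\mathcal F(u,\lambda)=0$ has no solutions in $\mathbb U^o\cap V$ for $\lambda\in(\lambda_0,\lambda_0+\varepsilon)$. It is called maximal if every one-sided saddle-node point $(\hat u,\hat\lambda)\in\mathbb U^o\times\mathbb R$ satisfies $\hat\lambda\le\lambda_0$. *)

theory Defs
  imports "HOL-Analysis.Analysis"
begin

section \<open>The Sobolev space on the unit interval\<close>

definition test_fun :: "(real \<Rightarrow> real) \<Rightarrow> bool" where
  "test_fun \<phi> \<longleftrightarrow>
     (\<forall>n x. ((deriv ^^ n) \<phi>) field_differentiable (at x)) \<and>
     (\<exists>a b. 0 < a \<and> b < 1 \<and> (\<forall>x. x \<notin> {a..b} \<longrightarrow> \<phi> x = 0))"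

definition L2 :: "(real \<Rightarrow> real) \<Rightarrow> bool" where
  "L2 w \<longleftrightarrow> set_borel_measurable lborel {0<..<1} w \<and> set_integrable lborel {0<..<1} (\<lambda>x. (w x)\<^sup>2)"

definition is_weak_deriv :: "(real \<Rightarrow> real) \<Rightarrow> (real \<Rightarrow> real) \<Rightarrow> bool" where
  "is_weak_deriv u w \<longleftrightarrow>
     (\<forall>\<phi>. test_fun \<phi> \<longrightarrow>
        (LBINT x:{0<..<1}. u x * deriv \<phi> x) = - (LBINT x:{0<..<1}. w x * \<phi> x))"

definition H1 :: "(real \<Rightarrow> real) set" where
  "H1 = {u. L2 u \<and> (\<exists>w. L2 w \<and> is_weak_deriv u w)}"

text \<open>A representative of the weak derivative of a function in \<open>H1\<close>. It is determined only almost
  everywhere, and it is used only under integrals.\<close>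

definition wderiv :: "(real \<Rightarrow> real) \<Rightarrow> real \<Rightarrow> real" where
  "wderiv u = (SOME w. L2 w \<and> is_weak_deriv u w)"

definition H1_norm :: "(real \<Rightarrow> real) \<Rightarrow> real" where
  "H1_norm u = sqrt ((LBINT x:{0<..<1}. (u x)\<^sup>2) + (LBINT x:{0<..<1}. (wderiv u x)\<^sup>2))"

text \<open>The closure of the test functions in the \<open>H1\<close> norm. Every class modulo null sets in this
  space contains exactly one function that is continuous on \<open>[0,1]\<close> and vanishes outside
  \<open>[0,1]\<close>, and that function represents the class here. Hence equality in the space is equality of
  functions, the zero element is the zero function, and intersecting with \<open>C([0,1])\<close> changes
  nothing.\<close>

definition H01 :: "(real \<Rightarrow> real) set" where
  "H01 = {u. continuous_on {0..1} u \<and> (\<forall>x. x \<notin> {0..1} \<longrightarrow> u x = 0) \<and> u \<in> H1 \<and>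
             (\<forall>e>0. \<exists>\<phi>. test_fun \<phi> \<and> H1_norm (\<lambda>x. u x - \<phi> x) < e)}"

text \<open>Vector-valued functions have type \<open>real \<Rightarrow> real^'m\<close>, with \<open>m = CARD('m)\<close>.\<close>

definition WW :: "(real \<Rightarrow> real^'m) set" where
  "WW = {u. \<forall>k. (\<lambda>x. u x $ k) \<in> H01}"

definition WW_norm :: "(real \<Rightarrow> real^'m) \<Rightarrow> real" where
  "WW_norm u = sqrt (\<Sum>k\<in>UNIV. (H1_norm (\<lambda>x. u x $ k))\<^sup>2)"

definition WW_nhd :: "(real \<Rightarrow> real^'m) \<Rightarrow> (real \<Rightarrow> real^'m) set \<Rightarrow> bool" where
  "WW_nhd u0 V \<longleftrightarrow> V \<subseteq> WW \<and> (\<exists>r>0. {u\<in>WW. WW_norm (\<lambda>x. u x - u0 x) < r} \<subseteq> V)"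

definition dirichlet_eigenvalue :: "real \<Rightarrow> bool" where
  "dirichlet_eigenvalue \<mu> \<longleftrightarrow>
     (\<exists>\<phi>\<in>H01. \<phi> \<noteq> (\<lambda>_. 0) \<and>
        (\<forall>\<zeta>\<in>H01. (LBINT x:{0<..<1}. wderiv \<phi> x * wderiv \<zeta> x)
                 = \<mu> * (LBINT x:{0<..<1}. \<phi> x * \<zeta> x)))"

definition principal_eigenvalue :: real where
  "principal_eigenvalue = (LEAST \<mu>. dirichlet_eigenvalue \<mu>)"

section \<open>Cones\<close>

definition S_o :: "(real \<Rightarrow> real) set" where
  "S_o = {w\<in>H01. \<forall>x\<in>{0<..<1}. w x > 0}"

definition second_deriv_Linf_loc :: "(real \<Rightarrow> real) \<Rightarrow> bool" where
  "second_deriv_Linf_loc w \<longleftrightarrow>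
     (\<exists>z. set_borel_measurable lborel {0<..<1} z \<and>
          (\<forall>a b. 0 < a \<and> b < 1 \<longrightarrow> (\<exists>M. AE x\<in>{a..b} in lborel. \<bar>z x\<bar> \<le> M)) \<and>
          (\<forall>\<phi>. test_fun \<phi> \<longrightarrow>
             (LBINT x:{0<..<1}. w x * deriv (deriv \<phi>) x) = (LBINT x:{0<..<1}. z x * \<phi> x)))"

definition neg_second_deriv_nonneg :: "(real \<Rightarrow> real) \<Rightarrow> bool" where
  "neg_second_deriv_nonneg w \<longleftrightarrow>
     (\<forall>\<phi>. test_fun \<phi> \<and> (\<forall>x. \<phi> x \<ge> 0) \<longrightarrow>
        - (LBINT x:{0<..<1}. w x * deriv (deriv \<phi>) x) \<ge> 0)"

definition U_o :: "(real \<Rightarrow> real) set" where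
  "U_o = {w\<in>S_o. second_deriv_Linf_loc w \<and> neg_second_deriv_nonneg w}"

definition SS_o :: "(real \<Rightarrow> real^'m) set" where
  "SS_o = {u. \<forall>k. (\<lambda>x. u x $ k) \<in> S_o}"

definition UU_o :: "(real \<Rightarrow> real^'m) set" where
  "UU_o = {u. \<forall>k. (\<lambda>x. u x $ k) \<in> U_o}"

definition SS :: "(real \<Rightarrow> real^'m) set" where
  "SS = {v\<in>WW. \<forall>e>0. \<exists>s\<in>SS_o. WW_norm (\<lambda>x. v x - s x) < e}"

abbreviation SS_nz :: "(real \<Rightarrow> real^'m) set" where
  "SS_nz \<equiv> SS - {\<lambda>_. 0}"

section \<open>The nonlinearity\<close>

definition orthant :: "(real^'m) set" where
  "orthant = {u. \<forall>k. u $ k \<ge> 0}"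

text \<open>The Jacobian matrix in \<open>u\<close>, one-sided at the boundary of the orthant. Derivatives within
  the orthant are unique because at each of its points, in each coordinate direction, it contains a
  nontrivial segment.\<close>

definition jac :: "(real \<Rightarrow> real^'m \<Rightarrow> real^'m) \<Rightarrow> real \<Rightarrow> real^'m \<Rightarrow> real^'m^'m" where
  "jac f x u = matrix (frechet_derivative (f x) (at u within orthant))"

definition C1_orthant :: "(real \<Rightarrow> real^'m \<Rightarrow> real^'m) \<Rightarrow> real \<Rightarrow> bool" where
  "C1_orthant f x \<longleftrightarrow> f x differentiable_on orthant \<and> continuous_on orthant (jac f x)"

text \<open>The linear order on the index type serves only to sum over pairs \<open>i < j\<close>.\<close>

definition Q_form ::
    "(real \<Rightarrow> real^('m::{finite,linorder}) \<Rightarrow> real^('m::{finite,linorder})) \<Rightarrow>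
      real \<Rightarrow> real^('m::{finite,linorder}) \<Rightarrow> real" where
  "Q_form f x u =
     (\<Sum>i\<in>UNIV. jac f x u $ i $ i * (u $ i)\<^sup>2) +
     2 * (\<Sum>i\<in>UNIV. \<Sum>j\<in>{i<..}. sqrt (jac f x u $ i $ j * jac f x u $ j $ i) * u $ i * u $ j)"

section \<open>Operators and the extended Rayleigh quotient\<close>

definition pairing :: "(real \<Rightarrow> real^'m) \<Rightarrow> (real \<Rightarrow> real^'m) \<Rightarrow> real" where
  "pairing h v = (\<Sum>k\<in>UNIV. LBINT x:{0<..<1}. h x $ k * v x $ k)"

definition dirichlet_form :: "(real \<Rightarrow> real^'m) \<Rightarrow> (real \<Rightarrow> real^'m) \<Rightarrow> real" where
  "dirichlet_form u v =
     (\<Sum>k\<in>UNIV. LBINT x:{0<..<1}. wderiv (\<lambda>y. u y $ k) x * wderiv (\<lambda>y. v y $ k) x)"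

definition g_map :: "real \<Rightarrow> real^'m \<Rightarrow> real^'m" where
  "g_map q u = (\<chi> k. (u $ k) powr (q - 1))"

definition F_op :: "(real \<Rightarrow> real^'m \<Rightarrow> real^'m) \<Rightarrow> real \<Rightarrow> (real \<Rightarrow> real^'m) \<Rightarrow> real \<Rightarrow>
    (real \<Rightarrow> real^'m) \<Rightarrow> real" where
  "F_op f q u lam \<zeta> =
     dirichlet_form u \<zeta> - pairing (\<lambda>x. f x (u x)) \<zeta> - lam * pairing (\<lambda>x. g_map q (u x)) \<zeta>"

definition DF_op :: "(real \<Rightarrow> real^'m \<Rightarrow> real^'m) \<Rightarrow> real \<Rightarrow> (real \<Rightarrow> real^'m) \<Rightarrow> real \<Rightarrow>
    (real \<Rightarrow> real^'m) \<Rightarrow> (real \<Rightarrow> real^'m) \<Rightarrow> real" where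
  "DF_op f q u lam \<xi> v =
     dirichlet_form \<xi> v - pairing (\<lambda>x. jac f x (u x) *v \<xi> x) v
       - lam * (q - 1) * (\<Sum>k\<in>UNIV. LBINT x:{0<..<1}. (u x $ k) powr (q - 2) * \<xi> x $ k * v x $ k)"

definition is_solution :: "(real \<Rightarrow> real^'m \<Rightarrow> real^'m) \<Rightarrow> real \<Rightarrow> (real \<Rightarrow> real^'m) \<Rightarrow> real \<Rightarrow> bool" where
  "is_solution f q u lam \<longleftrightarrow> (\<forall>\<zeta>\<in>WW. F_op f q u lam \<zeta> = 0)"

definition rayleigh :: "(real \<Rightarrow> real^'m \<Rightarrow> real^'m) \<Rightarrow> real \<Rightarrow>
    (real \<Rightarrow> real^'m) \<Rightarrow> (real \<Rightarrow> real^'m) \<Rightarrow> real" where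
  "rayleigh f q u v =
     (dirichlet_form u v - pairing (\<lambda>x. f x (u x)) v) / pairing (\<lambda>x. g_map q (u x)) v"

text \<open>Infima and suprema are taken in the extended reals, since for some \<open>u\<close> in \<open>UU_o\<close> the
  quotient can be unbounded below in \<open>v\<close>.\<close>

definition inf_rayleigh :: "(real \<Rightarrow> real^'m \<Rightarrow> real^'m) \<Rightarrow> real \<Rightarrow> (real \<Rightarrow> real^'m) \<Rightarrow> ereal" where
  "inf_rayleigh f q u = (INF v\<in>SS_nz. ereal (rayleigh f q u v))"

definition lambda_star :: "(real \<Rightarrow> real^'m \<Rightarrow> real^'m) \<Rightarrow> real \<Rightarrow> ereal" where
  "lambda_star f q = (SUP u\<in>UU_o. inf_rayleigh f q u)"

definition is_min_over :: "('a \<Rightarrow> real) \<Rightarrow> 'a set \<Rightarrow> real \<Rightarrow> bool" where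
  "is_min_over \<Phi> A c \<longleftrightarrow> c \<in> \<Phi> ` A \<and> (\<forall>a\<in>A. c \<le> \<Phi> a)"

section \<open>Saddle-node points\<close>

definition singular_solution ::
    "(real \<Rightarrow> real^'m \<Rightarrow> real^'m) \<Rightarrow> real \<Rightarrow> (real \<Rightarrow> real^'m) \<Rightarrow> real \<Rightarrow> bool" where
  "singular_solution f q u0 lam0 \<longleftrightarrow>
     u0 \<in> UU_o \<and> is_solution f q u0 lam0 \<and>
     (\<exists>v0\<in>SS_nz. \<forall>\<xi>\<in>WW. DF_op f q u0 lam0 \<xi> v0 = 0)"

definition one_sided_saddle_node ::
    "(real \<Rightarrow> real^'m \<Rightarrow> real^'m) \<Rightarrow> real \<Rightarrow> (real \<Rightarrow> real^'m) \<Rightarrow> real \<Rightarrow> bool" where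
  "one_sided_saddle_node f q u0 lam0 \<longleftrightarrow>
     singular_solution f q u0 lam0 \<and>
     (\<exists>\<epsilon>>0. \<exists>V. WW_nhd u0 V \<and>
        (\<forall>lam\<in>{lam0<..<lam0 + \<epsilon>}. \<not> (\<exists>u\<in>UU_o \<inter> V. is_solution f q u lam)))"

definition maximal_one_sided_saddle_node ::
    "(real \<Rightarrow> real^'m \<Rightarrow> real^'m) \<Rightarrow> real \<Rightarrow> (real \<Rightarrow> real^'m) \<Rightarrow> real \<Rightarrow> bool" where
  "maximal_one_sided_saddle_node f q u0 lam0 \<longleftrightarrow>
     one_sided_saddle_node f q u0 lam0 \<and>
     (\<forall>u' lam'. one_sided_saddle_node f q u' lam' \<longrightarrow> lam' \<le> lam0)"

end

theory Submission
  imports Defs "HOL-Complex_Analysis.Great_Picard" "HOL-Real_Asymp.Real_Asymp"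
begin

text \<open>
  With the Green operator \<open>K\<close> of the Dirichlet problem, a weak supersolution is a pointwise one:
  \<open>u \<ge> K (f u + \<lambda> g u)\<close>. As \<open>f\<close> and \<open>g\<close> are monotone, iterating \<open>K (f + \<lambda> g)\<close> from a small multiple
  of \<open>sin (\<pi> x)\<close> converges, below any supersolution, to a minimal solution. Large growth bounds the
  admissible \<open>\<lambda>\<close>. A Picone inequality for differences of minimal solutions, together with
  \<open>Q \<ge> \<theta> f u\<close>, bounds them in energy uniformly in \<open>\<lambda>\<close>, so that they increase to an extremal
  solution at the supremum of the admissible \<open>\<lambda>\<close>, which is \<open>\<lambda>*\<close>.

  Difference quotients of minimal solutions below \<open>\<lambda>*\<close> yield a positive supersolution of the
  linearization at the extremal solution; above \<open>\<lambda>*\<close>, where iterates started at the extremal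
  solution must escape, rescaled iterates yield a nonzero nonnegative subsolution. The two confine
  the powers of the adjoint linearized operator from above and from below, and the ergodic averages
  of these powers converge to the null vector \<open>v*\<close>.
\<close>

section \<open>Smooth functions\<close>

text \<open>The obstacle is the boundary. Solutions vanish there, so the coefficient
  \<open>\<lambda> * (q - 1) * u powr (q - 2)\<close> of the linearization is unbounded. However,
  the Green function is bounded below by a product of parabolas, so every positive supersolution
  dominates a multiple of \<open>x * (1 - x)\<close>, and \<open>(x * (1 - x)) powr (q - 2)\<close>
  is still integrable because q > 1. As the Green operator sends integrable functions to C^1
  functions, this one weight yields all dominations and all Lipschitz bounds in the linear part, and
  Arzela-Ascoli gives the limits. The Jacobian of f need not be symmetric, so v* is not a minimizer
  of an energy. Order takes the place of spectral theory, and the positive off-diagonal derivatives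
  carry positivity from one component to all. The minimax formula is cheap in comparison. At a
  solution u the quotient R(u, v) does not depend on v. At any other u, an infimum above \<lambda>
  makes u a supersolution for \<lambda>; this is seen by testing with v = \<open>Kop\<close> \<eta>,
  \<eta> the positive part of the deficit in one component.\<close>

fun times_differentiable :: "nat \<Rightarrow> (real \<Rightarrow> real) \<Rightarrow> bool" where
  "times_differentiable 0 f \<longleftrightarrow> True"
| "times_differentiable (Suc n) f \<longleftrightarrow>
     (\<exists>f'. (\<forall>x. (f has_real_derivative f' x) (at x)) \<and> times_differentiable n f')"

text \<open>Derivatives are carried as witnesses instead of iterates of \<open>deriv\<close>, so
  that closure under sums, products and affine substitutions is an induction on the order;
  \<open>smooth_test_fun\<close> links the two forms.\<close>

definition smooth :: "(real \<Rightarrow> real) \<Rightarrow> bool" where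
  "smooth f \<longleftrightarrow> (\<forall>n. times_differentiable n f)"

lemma times_differentiable_SucD: "times_differentiable (Suc n) f \<Longrightarrow> times_differentiable n f"
  by (induction n arbitrary: f) (simp, metis times_differentiable.simps(2))

lemma smooth_deriv:
  assumes "smooth f"
  shows "(f has_real_derivative deriv f x) (at x)" "smooth (deriv f)"
proof -
  have 1: "\<exists>f'. (\<forall>x. (f has_real_derivative f' x) (at x)) \<and> times_differentiable n f'" for n
    using assms by (metis smooth_def times_differentiable.simps(2))
  have 2: "f' = deriv f" if "\<forall>x. (f has_real_derivative f' x) (at x)" for f'
    using that DERIV_imp_deriv by (metis ext)
  show "(f has_real_derivative deriv f x) (at x)" using 1 2 by metis
  show "smooth (deriv f)" unfolding smooth_def using 1 2 by metis
qed

lemma smooth_antideriv: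
  assumes "\<And>x. (F has_real_derivative f x) (at x)" "smooth f"
  shows "smooth F"
  unfolding smooth_def
proof
  fix n show "times_differentiable n F"
    using assms by (cases n) (auto simp: smooth_def)
qed

lemma smooth_funpow_deriv: "smooth f \<Longrightarrow> smooth ((deriv ^^ n) f)"
  by (induction n) (auto intro: smooth_deriv)

lemma smooth_continuous_on: "smooth f \<Longrightarrow> continuous_on S f"
  by (meson DERIV_isCont continuous_at_imp_continuous_on smooth_deriv(1))

lemma smooth_test_fun:
  "test_fun \<phi> \<longleftrightarrow> smooth \<phi> \<and> (\<exists>a b. 0 < a \<and> b < 1 \<and> (\<forall>x. x \<notin> {a..b} \<longrightarrow> \<phi> x = 0))"
proof -
  have "(\<forall>n x. ((deriv ^^ n) \<phi>) field_differentiable (at x)) \<longleftrightarrow> smooth \<phi>"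
  proof
    assume L: "\<forall>n x. ((deriv ^^ n) \<phi>) field_differentiable (at x)"
    \<comment> \<open>Stated for all iterates at once: lowering the order \<open>n\<close> by one
      raises \<open>k\<close> by one.\<close>
    have "times_differentiable n ((deriv ^^ k) \<phi>)" for n k
    proof (induction n arbitrary: k)
      case (Suc n)
      have "((deriv ^^ k) \<phi> has_real_derivative (deriv ^^ Suc k) \<phi> x) (at x)" for x
        using L by (simp add: DERIV_deriv_iff_field_differentiable)
      then show ?case using Suc[of "Suc k"] by auto
    qed simp
    from this[of _ 0] show "smooth \<phi>" by (simp add: smooth_def)
  next
    assume "smooth \<phi>"
    then show "\<forall>n x. ((deriv ^^ n) \<phi>) field_differentiable (at x)"
      using smooth_funpow_deriv smooth_deriv(1) field_differentiable_def by blast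
  qed
  then show ?thesis by (simp add: test_fun_def)
qed

lemma times_differentiable_add:
  "times_differentiable n f \<Longrightarrow> times_differentiable n g \<Longrightarrow> times_differentiable n (\<lambda>x. f x + g x)"
proof (induction n arbitrary: f g)
  case (Suc n)
  then obtain f' g' where "\<forall>x. (f has_real_derivative f' x) (at x)" "times_differentiable n f'"
    "\<forall>x. (g has_real_derivative g' x) (at x)" "times_differentiable n g'" by auto
  then show ?case using Suc.IH[of f' g']
    by (auto intro!: exI[of _ "\<lambda>x. f' x + g' x"] derivative_intros)
qed simp

lemma times_differentiable_mult:
  "times_differentiable n f \<Longrightarrow> times_differentiable n g \<Longrightarrow> times_differentiable n (\<lambda>x. f x * g x)"
proof (induction n arbitrary: f g)
  case (Suc n)
  then obtain f' g' where f': "\<forall>x. (f has_real_derivative f' x) (at x)" "times_differentiable n f'"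
    and g': "\<forall>x. (g has_real_derivative g' x) (at x)" "times_differentiable n g'" by auto
  have "times_differentiable n (\<lambda>x. f' x * g x + g' x * f x)"
    using Suc.prems times_differentiable_SucD f'(2) g'(2)
    by (intro times_differentiable_add Suc.IH) blast+
  moreover have "((\<lambda>x. f x * g x) has_real_derivative f' x * g x + g' x * f x) (at x)" for x
    using f' g' by (intro DERIV_mult) auto
  ultimately show ?case by (auto intro!: exI[of _ "\<lambda>x. f' x * g x + g' x * f x"])
qed simp

lemma times_differentiable_const: "times_differentiable n (\<lambda>x. c)"
  by (induction n arbitrary: c) (auto intro!: exI[of _ "\<lambda>x. 0"] derivative_eq_intros)

lemma smooth_const: "smooth (\<lambda>x. c)"
  by (simp add: smooth_def times_differentiable_const)

lemma smooth_add: "smooth f \<Longrightarrow> smooth g \<Longrightarrow> smooth (\<lambda>x. f x + g x)"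
  by (simp add: smooth_def times_differentiable_add)

lemma smooth_mult: "smooth f \<Longrightarrow> smooth g \<Longrightarrow> smooth (\<lambda>x. f x * g x)"
  by (simp add: smooth_def times_differentiable_mult)

lemma smooth_diff: "smooth f \<Longrightarrow> smooth g \<Longrightarrow> smooth (\<lambda>x. f x - g x)"
  using smooth_add[of f "\<lambda>x. (-1) * g x"] smooth_mult[OF smooth_const[of "-1"], of g] by simp

lemma smooth_affine: "smooth f \<Longrightarrow> smooth (\<lambda>x. f (a * x + b))"
proof -
  have "times_differentiable n f \<Longrightarrow> times_differentiable n (\<lambda>x. f (a * x + b))" for n
  proof (induction n arbitrary: f)
    case (Suc n)
    then obtain f' where f': "\<forall>x. (f has_real_derivative f' x) (at x)" "times_differentiable n f'"
      by auto
    have "((\<lambda>x. f (a * x + b)) has_real_derivative f' (a * x + b) * a) (at x)" for x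
      using f' by (auto intro!: DERIV_chain'[of "\<lambda>x. a * x + b" a x UNIV f] derivative_eq_intros)
    moreover have "times_differentiable n (\<lambda>x. f' (a * x + b) * a)"
      using Suc.IH[OF f'(2)] times_differentiable_const by (intro times_differentiable_mult)
    ultimately show ?case by (auto intro!: exI[of _ "\<lambda>x. f' (a * x + b) * a"])
  qed simp
  then show "smooth f \<Longrightarrow> smooth (\<lambda>x. f (a * x + b))" by (simp add: smooth_def)
qed

lemma smooth_real_polynomial_function:
  assumes "real_polynomial_function p"
  shows "smooth p"
proof -
  have "times_differentiable n p" if "real_polynomial_function p" for n p
    using that
  proof (induction n arbitrary: p)
    case (Suc n)
    then show ?case using has_real_derivative_polynomial_function by (metis times_differentiable.simps(2))
  qed simp
  then show ?thesis using assms by (simp add: smooth_def)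
qed

section \<open>The flat exponential and a smooth step\<close>

definition exp_flat :: "nat \<Rightarrow> real \<Rightarrow> real" where
  "exp_flat k x = (if x > 0 then exp (- (1 / x)) / x ^ k else 0)"

lemma exp_flat_tendsto: "(exp_flat k \<longlongrightarrow> 0) (at 0)"
proof -
  have "((\<lambda>x::real. (1 / x) ^ k / exp (1 / x)) \<longlongrightarrow> 0) (at_right 0)"
    using filterlim_compose[OF tendsto_power_div_exp_0 filterlim_inverse_at_top_right]
    by (simp add: inverse_eq_divide)
  moreover have "\<forall>\<^sub>F x::real in at_right 0. (1 / x) ^ k / exp (1 / x) = exp_flat k x"
    by (auto simp: eventually_at_right_less exp_flat_def exp_minus power_divide field_simps
        intro!: eventually_mono[OF eventually_at_right_less])
  ultimately have "(exp_flat k \<longlongrightarrow> 0) (at_right 0)" by (rule Lim_transform_eventually)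
  moreover have "(exp_flat k \<longlongrightarrow> 0) (at_left 0)"
    by (rule tendsto_eventually) (auto simp: eventually_at_left_field exp_flat_def intro: exI[of _ "-1"])
  ultimately show ?thesis by (simp add: filterlim_split_at)
qed

text \<open>The factors \<open>1 / x ^ k\<close> close the family under differentiation up to linear
  combinations, so one induction makes all its members smooth.\<close>

lemma exp_flat_deriv:
  "(exp_flat k has_real_derivative exp_flat (k + 2) x - real k * exp_flat (Suc k) x) (at x)"
proof -
  consider "x > 0" | "x < 0" | "x = 0" by linarith
  then show ?thesis
  proof cases
    case 1
    have k: "real k * x ^ (k - Suc 0) = real k * x ^ k / x" using 1 by (cases k) auto
    have "((\<lambda>x. exp (- (1 / x)) / x ^ k) has_real_derivative
       (exp (- (1 / x)) * (1 / x\<^sup>2) * x ^ k - exp (- (1 / x)) * (real k * x ^ (k - Suc 0)))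
         / (x ^ k * x ^ k)) (at x)"
      using 1 by (auto intro!: derivative_eq_intros simp: power2_eq_square)
    also have "(exp (- (1 / x)) * (1 / x\<^sup>2) * x ^ k - exp (- (1 / x)) * (real k * x ^ (k - Suc 0)))
         / (x ^ k * x ^ k) = exp_flat (k + 2) x - real k * exp_flat (Suc k) x"
      unfolding k using 1 by (simp add: exp_flat_def field_simps power2_eq_square)
    finally have "((\<lambda>x. exp (- (1 / x)) / x ^ k) has_real_derivative
       exp_flat (k + 2) x - real k * exp_flat (Suc k) x) (at x)" .
    then show ?thesis
      by (rule has_field_derivative_transform_within[where d = x]) (use 1 in \<open>auto simp: exp_flat_def dist_real_def\<close>)
  next
    case 2
    have "((\<lambda>x. 0) has_real_derivative 0) (at x)" by simp
    then have "(exp_flat k has_real_derivative 0) (at x)"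
      by (rule has_field_derivative_transform_within[where d = "-x"])
        (use 2 in \<open>auto simp: exp_flat_def dist_real_def\<close>)
    then show ?thesis using 2 by (simp add: exp_flat_def)
  next
    case 3
    \<comment> \<open>The difference quotient at 0 is the next member of the family, which tends to
      0.\<close>
    have "(\<lambda>h. (exp_flat k (0 + h) - exp_flat k 0) / h) = exp_flat (Suc k)"
      by (auto simp: exp_flat_def fun_eq_iff field_simps)
    then have "(exp_flat k has_real_derivative 0) (at 0)"
      unfolding DERIV_def using exp_flat_tendsto[of "Suc k"] by simp
    then show ?thesis using 3 by (simp add: exp_flat_def)
  qed
qed

lemma smooth_exp_flat: "smooth (exp_flat k)"
proof -
  have "times_differentiable n (exp_flat k)" for n k
  proof (induction n arbitrary: k)
    case (Suc n)
    have "times_differentiable n (\<lambda>x. exp_flat (k + 2) x + (- real k) * exp_flat (Suc k) x)"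
      by (intro times_differentiable_add times_differentiable_mult times_differentiable_const Suc)
    then show ?case using exp_flat_deriv[of k]
      by (auto intro!: exI[of _ "\<lambda>x. exp_flat (k + 2) x - real k * exp_flat (Suc k) x"])
  qed simp
  then show ?thesis by (simp add: smooth_def)
qed

text \<open>The step is the normalised antiderivative of the bump
  \<open>exp_flat 0 t * exp_flat 0 (1 - t)\<close>. Its derivative will serve as a mollifier, the
  step itself as a cutoff.\<close>

lemma smooth_step_exists:
  obtains B :: "real \<Rightarrow> real" where "smooth B" "\<And>t. t \<le> 0 \<Longrightarrow> B t = 0" "\<And>t. t \<ge> 1 \<Longrightarrow> B t = 1"
    "\<And>t. deriv B t \<ge> 0" "\<And>t. t \<notin> {0..1} \<Longrightarrow> deriv B t = 0" "\<And>t. B t \<in> {0..1}"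
proof -
  define b where "b t = exp_flat 0 t * exp_flat 0 (1 - t)" for t
  have sb: "smooth b"
    unfolding b_def using smooth_mult[OF smooth_exp_flat[of 0] smooth_affine[OF smooth_exp_flat[of 0], of "-1" 1]]
    by (simp add: add.commute)
  have b0: "b t \<ge> 0" for t by (simp add: b_def exp_flat_def)
  have bz: "b t = 0" if "t \<le> 0 \<or> t \<ge> 1" for t using that by (auto simp: b_def exp_flat_def)
  have bp: "b t > 0" if "0 < t" "t < 1" for t using that by (auto simp: b_def exp_flat_def)
  have "\<exists>F. \<forall>x::real. -\<infinity> < x \<longrightarrow> x < (\<infinity>::ereal) \<longrightarrow> (F has_vector_derivative b x) (at x)"
    by (rule einterval_antiderivative)
      (use smooth_continuous_on[OF sb, of UNIV] in \<open>auto simp: continuous_on_eq_continuous_at\<close>)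
  then obtain F where F: "\<And>x. (F has_real_derivative b x) (at x)"
    by (auto simp: has_real_derivative_iff_has_vector_derivative)
  have mono: "F x \<le> F y" if "x \<le> y" for x y
    by (rule DERIV_nonneg_imp_nondecreasing[OF that]) (use F b0 in blast)
  have cF: "continuous_on S F" for S
    using F DERIV_isCont continuous_at_imp_continuous_on by blast
  have F0: "F t = F 0" if "t \<le> 0" for t
  proof (cases "t = 0")
    case False
    with that have "F 0 = F t"
      using F bz by (intro DERIV_isconst_end cF) (auto, metis less_imp_le)
    then show ?thesis by simp
  qed simp
  have F1: "F t = F 1" if "t \<ge> 1" for t
  proof (cases "t = 1")
    case False
    with that show ?thesis
      using F bz by (intro DERIV_isconst_end cF) (auto, metis less_imp_le)
  qed simp
  have lt: "F 0 < F 1"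
  proof -
    have "\<exists>z::real. 0 < z \<and> z < 1 \<and> F 1 - F 0 = (1 - 0) * b z" using F by (intro MVT2) auto
    then obtain z where "0 < z" "z < 1" "F 1 - F 0 = b z" by auto
    then show ?thesis using bp[of z] by simp
  qed
  define B where "B t = (1 / (F 1 - F 0)) * F t + (- F 0 / (F 1 - F 0))" for t
  have dB: "(B has_real_derivative b t / (F 1 - F 0)) (at t)" for t
    proof -
    have "(B has_real_derivative (1 / (F 1 - F 0)) * b t + 0) (at t)"
      unfolding B_def by (intro DERIV_add DERIV_cmult F DERIV_const)
    then show ?thesis by simp
  qed
  have sF: "smooth F" using F sb by (rule smooth_antideriv)
  have "smooth B" unfolding B_def by (intro smooth_add smooth_mult smooth_const sF)
  have dB': "deriv B t = b t / (F 1 - F 0)" for t using dB by (rule DERIV_imp_deriv)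
  have le1: "F t \<le> F 1" for t
  proof (cases "t \<le> 1")
    case False then show ?thesis using F1[of t] by linarith
  qed (rule mono)
  have ge0: "F 0 \<le> F t" for t
  proof (cases "t \<ge> 0")
    case False then show ?thesis using F0[of t] by linarith
  qed (rule mono)
  have Beq: "B t = (F t - F 0) / (F 1 - F 0)" for t
    by (simp add: B_def diff_divide_distrib)
  show thesis
  proof (rule that[of B])
    fix t
    show "smooth B" by fact
    show "deriv B t \<ge> 0" using lt b0[of t] dB' by simp
    show "B t \<in> {0..1}" using lt le1[of t] ge0[of t] by (simp add: Beq divide_le_eq)
    show "B t = 0" if "t \<le> 0" using F0[OF that] by (simp add: Beq)
    show "B t = 1" if "t \<ge> 1" using F1[OF that] lt by (simp add: Beq)
    show "deriv B t = 0" if "t \<notin> {0..1}" using bz[of t] that dB' by auto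
  qed
qed

section \<open>Lebesgue measure on the open unit interval\<close>

text \<open>A space of total mass 1 without the endpoints: constants are their own integrals,
  bounded measurable functions are integrable, and pointwise estimates are needed only strictly
  inside.\<close>

definition I01 :: "real measure" where
  "I01 = restrict_space lborel {0<..<1}"

lemma space_I01 [simp]: "space I01 = {0<..<1}"
  by (simp add: I01_def space_restrict_space)

lemma finite_measure_I01: "finite_measure I01"
  by (rule finite_measureI) (simp add: I01_def space_restrict_space emeasure_restrict_space)

interpretation I01: finite_measure I01 by (rule finite_measure_I01)

lemma measure_I01 [simp]: "measure I01 {0<..<1} = 1"
  unfolding I01_def by (subst measure_restrict_space) auto

lemma borel_measurable_I01I:
  "f \<in> borel_measurable borel \<Longrightarrow> f \<in> borel_measurable I01"
  unfolding I01_def by (rule measurable_restrict_space1) simp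

lemma continuous_measurable_I01:
  fixes f :: "real \<Rightarrow> 'a::topological_space"
  assumes "continuous_on {0<..<1} f"
  shows "f \<in> borel_measurable I01"
  using borel_measurable_continuous_on_restrict[OF assms] unfolding I01_def
  by (simp cong: measurable_cong_sets add: sets_restrict_space)

lemma continuous_measurable_I01':
  fixes f :: "real \<Rightarrow> 'a::topological_space"
  assumes "continuous_on {0..1} f"
  shows "f \<in> borel_measurable I01"
  by (rule continuous_measurable_I01[OF continuous_on_subset[OF assms]]) auto

lemma LBINT_I01: "(LBINT x:{0<..<1}. f x) = integral\<^sup>L I01 f" for f :: "real \<Rightarrow> real"
  unfolding set_lebesgue_integral_def I01_def by (subst integral_restrict_space) auto

lemma set_integrable_I01: "set_integrable lborel {0<..<1} f \<longleftrightarrow> integrable I01 f" for f :: "real \<Rightarrow> real"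
  unfolding set_integrable_def I01_def by (subst integrable_restrict_space) auto

lemma set_borel_measurable_I01:
  "set_borel_measurable lborel {0<..<1} f \<longleftrightarrow> f \<in> borel_measurable I01" for f :: "real \<Rightarrow> real"
  unfolding set_borel_measurable_def I01_def by (subst borel_measurable_restrict_space_iff) auto

lemma AE_I01: "(AE x\<in>{0<..<1} in lborel. P x) \<longleftrightarrow> (AE x in I01. P x)"
  unfolding I01_def by (subst AE_restrict_space_iff) auto

lemma AE_I01_I: "(\<And>x. 0 < x \<Longrightarrow> x < 1 \<Longrightarrow> P x) \<Longrightarrow> AE x in I01. P x"
  by (rule AE_I2) auto

lemma AE_I01_neq: "AE x in I01. x \<noteq> c"
proof -
  have "AE x in lborel. x \<noteq> c" by (rule AE_lborel_singleton)
  then have "AE x\<in>{0<..<1} in lborel. x \<noteq> c" by (rule AE_mp) auto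
  then show ?thesis by (simp only: AE_I01)
qed

lemma integrable_I01_bounded:
  fixes f :: "real \<Rightarrow> real"
  assumes "f \<in> borel_measurable I01" "\<And>x. 0 < x \<Longrightarrow> x < 1 \<Longrightarrow> \<bar>f x\<bar> \<le> B"
  shows "integrable I01 f"
  by (rule I01.integrable_const_bound[of _ B]) (use assms in auto)

lemma integrable_I01_continuous:
  fixes f :: "real \<Rightarrow> real"
  assumes "continuous_on {0..1} f"
  shows "integrable I01 f"
proof -
  have "bounded (f ` {0..1})" by (intro compact_imp_bounded compact_continuous_image assms) auto
  then obtain B where "\<forall>x\<in>{0..1}. \<bar>f x\<bar> \<le> B" by (auto simp: bounded_iff)
  then show ?thesis by (intro integrable_I01_bounded[of _ B] continuous_measurable_I01' assms) auto
qed

lemma integral_I01_FTC: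
  fixes f F :: "real \<Rightarrow> real"
  assumes ab: "0 \<le> a" "a \<le> b" "b \<le> 1"
    and F: "\<And>x. x \<in> {a..b} \<Longrightarrow> (F has_real_derivative f x) (at x within {a..b})"
    and f: "continuous_on {a..b} f"
  shows "(\<integral>x. indicator {a<..b} x * f x \<partial>I01) = F b - F a"
proof -
  have i: "set_integrable lborel {a..b} f" by (rule borel_integrable_atLeastAtMost'[OF f])
  have [measurable]: "(\<lambda>x. indicator {a..b} x * f x) \<in> borel_measurable borel"
    using i unfolding set_integrable_def by (simp add: borel_measurable_integrable)
  have "(\<integral>x. indicator {a<..b} x * f x \<partial>I01) = (\<integral>x. indicator {0<..<1} x * (indicator {a<..b} x * f x) \<partial>lborel)"
    unfolding I01_def by (subst integral_restrict_space) auto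
  also have "\<dots> = (\<integral>x. indicator {0<..<1} x * (indicator {a<..b} x * (indicator {a..b} x * f x)) \<partial>lborel)"
    by (intro Bochner_Integration.integral_cong) (auto simp: indicator_def)
  \<comment> \<open>The integrands can differ only at \<open>a\<close>, 0 and 1.\<close>
  also have "\<dots> = (\<integral>x. indicator {a..b} x *\<^sub>R f x \<partial>lborel)"
  proof (rule integral_cong_AE)
    have "AE x in lborel. x \<noteq> a" "AE x in lborel. x \<noteq> 1" "AE x in lborel. x \<noteq> 0"
      by (rule AE_lborel_singleton)+
    then show "AE x in lborel. indicator {0<..<1} x * (indicator {a<..b} x * (indicator {a..b} x * f x)) = indicator {a..b} x *\<^sub>R f x"
      by eventually_elim (use ab in \<open>auto simp: indicator_def\<close>)
  qed simp_all
  also have "\<dots> = F b - F a"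
    using F by (intro integral_FTC_atLeastAtMost[OF ab(2) _ f]) (auto simp: has_real_derivative_iff_has_vector_derivative)
  finally show ?thesis .
qed

lemma integral_I01_FTC01:
  fixes f F :: "real \<Rightarrow> real"
  assumes F: "\<And>x. x \<in> {0..1} \<Longrightarrow> (F has_real_derivative f x) (at x within {0..1})"
    and f: "continuous_on {0..1} f"
  shows "integral\<^sup>L I01 f = F 1 - F 0"
proof -
  have "integral\<^sup>L I01 f = (\<integral>x. indicator {0<..1} x * f x \<partial>I01)"
    by (intro Bochner_Integration.integral_cong) (auto simp: indicator_def)
  then show ?thesis using integral_I01_FTC[of 0 1 F f] assms by simp
qed

section \<open>Square-integrable functions\<close>

lemma integrable_I01_L2:
  fixes f :: "real \<Rightarrow> real"
  assumes "f \<in> borel_measurable I01" "integrable I01 (\<lambda>x. (f x)\<^sup>2)"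
  shows "integrable I01 f"
proof (rule Bochner_Integration.integrable_bound[of _ "\<lambda>x. 1 + (f x)\<^sup>2"])
  have "\<bar>t\<bar> \<le> 1 + t\<^sup>2" for t :: real
    using zero_le_power2[of "\<bar>t\<bar> - 1"] by (simp add: power2_eq_square algebra_simps)
  then show "AE x in I01. norm (f x) \<le> norm (1 + (f x)\<^sup>2)" by simp
qed (use assms in auto)

text \<open>Cauchy-Schwarz against the constant 1: the variance of \<open>\<bar>f\<bar>\<close> on a
  space of mass 1 is nonnegative.\<close>

lemma integral_abs_le_L2:
  fixes f :: "real \<Rightarrow> real"
  assumes "f \<in> borel_measurable I01" "integrable I01 (\<lambda>x. (f x)\<^sup>2)"
  shows "(\<integral>x. \<bar>f x\<bar> \<partial>I01)\<^sup>2 \<le> (\<integral>x. (f x)\<^sup>2 \<partial>I01)"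
proof -
  define c where "c = (\<integral>x. \<bar>f x\<bar> \<partial>I01)"
  have i: "integrable I01 (\<lambda>x. \<bar>f x\<bar>)" using integrable_I01_L2[OF assms] by simp
  have "0 \<le> (\<integral>x. (\<bar>f x\<bar> - c)\<^sup>2 \<partial>I01)" by simp
  also have "\<dots> = (\<integral>x. (f x)\<^sup>2 - 2 * c * \<bar>f x\<bar> + c\<^sup>2 \<partial>I01)"
    by (intro Bochner_Integration.integral_cong) (auto simp: power2_eq_square algebra_simps)
  also have "\<dots> = (\<integral>x. (f x)\<^sup>2 \<partial>I01) - 2 * c * c + c\<^sup>2"
    using assms i by (simp add: c_def)
  finally show ?thesis by (simp add: c_def power2_eq_square)
qed

lemma integrable_mult_L2:
  fixes f g :: "real \<Rightarrow> real"
  assumes "f \<in> borel_measurable I01" "integrable I01 (\<lambda>x. (f x)\<^sup>2)"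
    "g \<in> borel_measurable I01" "integrable I01 (\<lambda>x. (g x)\<^sup>2)"
  shows "integrable I01 (\<lambda>x. f x * g x)"
proof (rule Bochner_Integration.integrable_bound[of _ "\<lambda>x. (f x)\<^sup>2 + (g x)\<^sup>2"])
  have "\<bar>s * t\<bar> \<le> s\<^sup>2 + t\<^sup>2" for s t :: real
  proof -
    have "0 \<le> (\<bar>s\<bar> - \<bar>t\<bar>)\<^sup>2" "0 \<le> \<bar>s\<bar> * \<bar>t\<bar>" by simp_all
    moreover have "(\<bar>s\<bar> - \<bar>t\<bar>)\<^sup>2 = s\<^sup>2 + t\<^sup>2 - 2 * (\<bar>s\<bar> * \<bar>t\<bar>)"
      by (simp add: power2_diff)
    ultimately show ?thesis unfolding abs_mult by linarith
  qed
  then show "AE x in I01. norm (f x * g x) \<le> norm ((f x)\<^sup>2 + (g x)\<^sup>2)" by simp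
qed (use assms in auto)

lemma integrable_add_L2:
  fixes f g :: "real \<Rightarrow> real"
  assumes "f \<in> borel_measurable I01" "integrable I01 (\<lambda>x. (f x)\<^sup>2)"
    "g \<in> borel_measurable I01" "integrable I01 (\<lambda>x. (g x)\<^sup>2)"
  shows "integrable I01 (\<lambda>x. (f x + g x)\<^sup>2)"
proof -
  have "(\<lambda>x. (f x + g x)\<^sup>2) = (\<lambda>x. (f x)\<^sup>2 + (g x)\<^sup>2 + 2 * (f x * g x))"
    by (auto simp: power2_eq_square algebra_simps)
  then show ?thesis using assms integrable_mult_L2[OF assms] by simp
qed

lemma L2_iff: "L2 w \<longleftrightarrow> w \<in> borel_measurable I01 \<and> integrable I01 (\<lambda>x. (w x)\<^sup>2)"
  by (simp add: L2_def set_borel_measurable_I01 set_integrable_I01)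

lemma L2_continuous: "continuous_on {0..1} w \<Longrightarrow> L2 w"
  by (auto simp: L2_iff intro!: continuous_measurable_I01' integrable_I01_continuous continuous_intros)

lemma L2_diff: "L2 f \<Longrightarrow> L2 g \<Longrightarrow> L2 (\<lambda>x. f x - g x)"
  using integrable_add_L2[of f "\<lambda>x. - g x"] by (auto simp: L2_iff)

lemma L2_integrable: "L2 f \<Longrightarrow> integrable I01 f"
  by (simp add: L2_iff integrable_I01_L2)

lemma integrable_mult_indicator_I01:
  fixes f :: "real \<Rightarrow> real"
  assumes "integrable I01 f" "A \<in> sets borel"
  shows "integrable I01 (\<lambda>x. indicator A x * f x)"
proof (rule Bochner_Integration.integrable_bound[OF assms(1)])
  show "(\<lambda>x. indicator A x * f x) \<in> borel_measurable I01"
    using assms by (intro borel_measurable_times borel_measurable_I01I[OF borel_measurable_indicator]) auto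
qed (auto simp: indicator_def)

text \<open>Initial segments are an intersection-stable generator of the Borel sets, so equality of
  the integrals spreads from them to all Borel sets, and an integrable density is determined by its
  integrals.\<close>

lemma AE_I01_eqI:
  fixes f g :: "real \<Rightarrow> real"
  assumes f: "integrable I01 f" and g: "integrable I01 g"
    and eq: "\<And>c. c \<in> {0..1} \<Longrightarrow> (\<integral>x. indicator {..c} x * f x \<partial>I01) = (\<integral>x. indicator {..c} x * g x \<partial>I01)"
  shows "AE x in I01. f x = g x"
proof (rule density_unique_real[OF f g])
  define I where "I A h = (\<integral>x. indicator A x * h x \<partial>I01)" for A :: "real set" and h :: "real \<Rightarrow> real"
  have Iic: "I {..c} f = I {..c} g" for c
  proof -
    consider "c < 0" | "c > 1" | "c \<in> {0..1}" by fastforce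
    then show ?thesis
    proof cases
      case 1
      then have "I {..c} h = 0" for h unfolding I_def
        by (subst Bochner_Integration.integral_cong[OF refl, of _ _ "\<lambda>_. 0"]) (auto simp: indicator_def)
      then show ?thesis by simp
    next
      case 2
      then have "I {..c} h = I {..1} h" for h unfolding I_def
        by (intro Bochner_Integration.integral_cong) (auto simp: indicator_def)
      then show ?thesis using eq[of 1] by (simp add: I_def)
    next
      case 3 then show ?thesis using eq by (simp add: I_def)
    qed
  qed
  have main: "I A f = I A g" if "A \<in> sigma_sets UNIV (range (\<lambda>a::real. {..a}))" for A
    using _ _ that
  proof (rule sigma_sets_induct_disjoint)
    show "Int_stable (range (\<lambda>a::real. {..a}))" by (auto simp: Int_stable_def intro!: image_eqI)
    show "range (\<lambda>a::real. {..a}) \<subseteq> Pow UNIV" by simp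
    show "I A f = I A g" if "A \<in> range (\<lambda>a. {..a})" for A using that Iic by auto
    show "I {} f = I {} g" by (simp add: I_def)
    have borel: "A \<in> sets borel" if "A \<in> sigma_sets UNIV (range (\<lambda>a::real. {..a}))" for A
      using that by (simp add: borel_eq_atMost)
    show "I (UNIV - A) f = I (UNIV - A) g"
      if A: "A \<in> sigma_sets UNIV (range (\<lambda>a::real. {..a}))" and IA: "I A f = I A g" for A
    proof -
      have "I (UNIV - A) h = integral\<^sup>L I01 h - I A h" if "integrable I01 h" for h
      proof -
        have "I (UNIV - A) h = (\<integral>x. h x - indicator A x * h x \<partial>I01)" unfolding I_def
          by (intro Bochner_Integration.integral_cong) (auto simp: indicator_def)
        then show ?thesis unfolding I_def
          using that integrable_mult_indicator_I01[OF that borel[OF A]] by simp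
      qed
      moreover have "integral\<^sup>L I01 h = I {..1} h" for h unfolding I_def
        by (intro Bochner_Integration.integral_cong) (auto simp: indicator_def)
      ultimately show ?thesis using f g IA Iic by simp
    qed
    fix A :: "nat \<Rightarrow> real set"
    assume dis: "disjoint_family A" and A: "range A \<subseteq> sigma_sets UNIV (range (\<lambda>a::real. {..a}))"
      and IA: "\<And>i. I (A i) f = I (A i) g"
    have "I (\<Union>i. A i) h = (\<Sum>i. I (A i) h)" if h: "integrable I01 h" for h
    proof -
      have eq: "I C h = (LINT x:C|lborel. indicator {0<..<1} x * h x)" for C
        unfolding I_def I01_def set_lebesgue_integral_def
        by (subst integral_restrict_space) (auto intro!: Bochner_Integration.integral_cong)
      have Ai: "A i \<in> sets borel" for i using A borel by auto
      have "integrable lborel (\<lambda>x. indicator {0<..<1} x * h x)"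
        using h by (simp add: set_integrable_I01[symmetric] set_integrable_def)
      then have "set_integrable lborel (\<Union>i. A i) (\<lambda>x. indicator {0<..<1} x * h x)"
        unfolding set_integrable_def using Ai by (intro integrable_mult_indicator) auto
      then show ?thesis unfolding eq
        using Ai dis by (intro lebesgue_integral_countable_add) (auto simp: disjoint_family_on_def)
    qed
    then show "I (\<Union>i. A i) f = I (\<Union>i. A i) g" using IA f g by simp
  qed
  fix A assume "A \<in> sets I01"
  then have "A \<in> sets borel" "A \<subseteq> {0<..<1}" by (auto simp: I01_def sets_restrict_space)
  then show "set_lebesgue_integral I01 A f = set_lebesgue_integral I01 A g"
    using main[of A] by (simp add: borel_eq_atMost I_def set_lebesgue_integral_def)
qed

section \<open>Functions with a weak derivative on the unit interval\<close>

lemma is_weak_deriv_iff: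
  "is_weak_deriv u w \<longleftrightarrow>
     (\<forall>\<phi>. test_fun \<phi> \<longrightarrow> (\<integral>x. u x * deriv \<phi> x \<partial>I01) = - (\<integral>x. w x * \<phi> x \<partial>I01))"
  by (simp add: is_weak_deriv_def LBINT_I01)

lemma test_funD:
  assumes "test_fun \<phi>"
  shows "smooth \<phi>" "(\<phi> has_real_derivative deriv \<phi> x) (at x)" "continuous_on S \<phi>"
    "continuous_on S (deriv \<phi>)" "\<phi> 0 = 0" "\<phi> 1 = 0" "x \<notin> {0..1} \<Longrightarrow> \<phi> x = 0"
  using assms smooth_deriv[of \<phi>] smooth_continuous_on[of \<phi>] smooth_continuous_on[of "deriv \<phi>"]
  by (auto simp: smooth_test_fun)

lemma test_fun_deriv:
  assumes "test_fun \<phi>"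
  shows "test_fun (deriv \<phi>)"
proof -
  obtain a b where ab: "0 < a" "b < 1" "\<And>x. x \<notin> {a..b} \<Longrightarrow> \<phi> x = 0"
    using assms by (auto simp: smooth_test_fun)
  have "deriv \<phi> x = 0" if "x \<notin> {a..b}" for x
  proof -
    have "((\<lambda>x. 0) has_real_derivative 0) (at x)" by simp
    moreover have "open (- {a..b})" by (simp add: open_Compl)
    ultimately have "(\<phi> has_real_derivative 0) (at x)"
      by (rule has_field_derivative_transform_within_open) (use that ab in auto)
    then show ?thesis by (rule DERIV_imp_deriv)
  qed
  then show ?thesis using ab smooth_deriv[of \<phi>] assms by (auto simp: smooth_test_fun)
qed

lemma weak_deriv_C1:
  assumes u: "\<And>x. x \<in> {0..1} \<Longrightarrow> (u has_real_derivative h x) (at x within {0..1})"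
    and h: "continuous_on {0..1} h"
  shows "is_weak_deriv u h"
  unfolding is_weak_deriv_iff
proof (intro allI impI)
  fix \<phi> assume \<phi>: "test_fun \<phi>"
  note t = test_funD[OF \<phi>]
  have cu: "continuous_on {0..1} u"
    using u DERIV_continuous continuous_on_eq_continuous_within by blast
  have "((\<lambda>x. u x * \<phi> x) has_real_derivative h x * \<phi> x + u x * deriv \<phi> x) (at x within {0..1})"
    if "x \<in> {0..1}" for x
    using DERIV_mult[OF u[OF that] has_field_derivative_at_within[OF t(2)[of x]]]
    by (simp add: mult.commute add.commute)
  then have "(\<integral>x. h x * \<phi> x + u x * deriv \<phi> x \<partial>I01) = u 1 * \<phi> 1 - u 0 * \<phi> 0"
    using t cu h by (intro integral_I01_FTC01) (auto intro!: continuous_intros)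
  moreover have "integrable I01 (\<lambda>x. h x * \<phi> x)" "integrable I01 (\<lambda>x. u x * deriv \<phi> x)"
    using t cu h by (auto intro!: integrable_I01_continuous continuous_intros)
  ultimately show "(\<integral>x. u x * deriv \<phi> x \<partial>I01) = - (\<integral>x. h x * \<phi> x \<partial>I01)"
    using t by simp
qed

lemma weak_deriv_test_fun: "test_fun \<phi> \<Longrightarrow> is_weak_deriv \<phi> (deriv \<phi>)"
  by (intro weak_deriv_C1) (auto intro: test_funD has_field_derivative_at_within)

lemma weak_deriv_diff:
  assumes "is_weak_deriv u w" "is_weak_deriv v z" "L2 u" "L2 v" "L2 w" "L2 z"
  shows "is_weak_deriv (\<lambda>x. u x - v x) (\<lambda>x. w x - z x)"
  unfolding is_weak_deriv_iff
proof (intro allI impI)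
  fix \<phi> assume \<phi>: "test_fun \<phi>"
  have "L2 \<phi>" "L2 (deriv \<phi>)" using test_funD[OF \<phi>] by (auto intro: L2_continuous)
  then have "integrable I01 (\<lambda>x. u x * deriv \<phi> x)" "integrable I01 (\<lambda>x. v x * deriv \<phi> x)"
    "integrable I01 (\<lambda>x. w x * \<phi> x)" "integrable I01 (\<lambda>x. z x * \<phi> x)"
    using assms by (auto simp: L2_iff intro!: integrable_mult_L2)
  then show "(\<integral>x. (u x - v x) * deriv \<phi> x \<partial>I01) = - (\<integral>x. (w x - z x) * \<phi> x \<partial>I01)"
    using assms \<phi> by (simp add: is_weak_deriv_iff left_diff_distrib)
qed

text \<open>The kernels are nonnegative, supported in \<open>{a..a + 1 / n}\<close>, and have mass 1
  once this interval lies in \<open>{0..1}\<close>; continuity of \<open>u\<close> at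
  \<open>a\<close> does the rest.\<close>

lemma approximate_identity:
  assumes B: "smooth B" "\<And>t. t \<le> 0 \<Longrightarrow> B t = 0" "\<And>t. t \<ge> 1 \<Longrightarrow> B t = (1::real)"
    "\<And>t. deriv B t \<ge> 0" "\<And>t. t \<notin> {0..1} \<Longrightarrow> deriv B t = 0"
    and u: "continuous_on {0..1} u" and a: "0 < a" "a < 1"
  shows "(\<lambda>n. \<integral>t. u t * (real n * deriv B (real n * (t - a))) \<partial>I01) \<longlonglongrightarrow> u a"
proof (rule LIMSEQ_I)
  fix e :: real assume "e > 0"
  have "\<forall>e>0. \<exists>\<delta>>0. \<forall>t\<in>{0..1}. dist t a < \<delta> \<longrightarrow> dist (u t) (u a) < e"
    using u a unfolding continuous_on_iff by (metis atLeastAtMost_iff less_imp_le)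
  then have "\<exists>\<delta>>0. \<forall>t\<in>{0..1}. dist t a < \<delta> \<longrightarrow> dist (u t) (u a) < e / 2"
    using half_gt_zero[OF \<open>e > 0\<close>] by blast
  then obtain \<delta> where \<delta>: "\<delta> > 0" "\<And>t. t \<in> {0..1} \<Longrightarrow> \<bar>t - a\<bar> < \<delta> \<Longrightarrow> \<bar>u t - u a\<bar> < e / 2"
    unfolding dist_real_def by blast
  \<comment> \<open>The first demand makes the support shorter than \<open>\<delta>\<close>, the
    second keeps it to the left of 1, so that no mass is lost.\<close>
  obtain N where N: "real N > 1 / \<delta>" "real N > 1 / (1 - a)" using reals_Archimedean2[of "max (1/\<delta>) (1/(1-a))"] by auto
  show "\<exists>no. \<forall>n\<ge>no. norm ((\<integral>t. u t * (real n * deriv B (real n * (t - a))) \<partial>I01) - u a) < e"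
  proof (intro exI[of _ N] allI impI)
    fix n assume "n \<ge> N"
    then have n: "real n > 1 / \<delta>" "real n > 1 / (1 - a)" using N by auto
    have "1 / \<delta> > 0" using \<delta>(1) by simp
    then have n0: "real n > 0" using n(1) by linarith
    have n1: "real n * (1 - a) \<ge> 1" "real n * \<delta> > 1" using n a \<delta>(1) by (simp_all add: field_simps)
    define k where "k t = real n * deriv B (real n * (t - a))" for t
    have ck: "continuous_on {0..1} k" unfolding k_def
      by (intro continuous_intros continuous_on_compose2[OF smooth_continuous_on[OF smooth_deriv(2)[OF B(1)], of UNIV]]) auto
    have "((\<lambda>t. B (real n * (t - a))) has_real_derivative k t) (at t within {0..1})" for t
    proof -
      have "((\<lambda>t. real n * (t - a)) has_real_derivative real n) (at t)"
        by (auto intro!: derivative_eq_intros)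
      from has_field_derivative_at_within[OF DERIV_chain2[OF smooth_deriv(1)[OF B(1)] this]] show ?thesis
        unfolding k_def by (simp add: mult.commute)
    qed
    then have "integral\<^sup>L I01 k = B (real n * (1 - a)) - B (real n * (0 - a))"
      using ck by (intro integral_I01_FTC01)
    moreover have "real n * (0 - a) \<le> 0" using n0 a by (intro mult_nonneg_nonpos) auto
    ultimately have ik: "integral\<^sup>L I01 k = 1"
      using B(3)[OF n1(1)] B(2) by simp
    have k0: "k t \<ge> 0" for t using B(4) n0 by (simp add: k_def)
    have bnd: "\<bar>(u t - u a) * k t\<bar> \<le> e / 2 * k t" if "0 < t" "t < 1" for t
    proof (cases "k t = 0")
      case False
      then have "deriv B (real n * (t - a)) \<noteq> 0" by (simp add: k_def)
      then have "real n * (t - a) \<in> {0..1}" using B(5)[of "real n * (t - a)"] by blast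
      then have "0 \<le> real n * (t - a)" "real n * (t - a) < real n * \<delta>" using n1(2) by auto
      then have "\<bar>t - a\<bar> < \<delta>" using n0 mult_less_cancel_left_pos[OF n0] zero_le_mult_iff[of "real n" "t - a"] by auto
      then have "\<bar>u t - u a\<bar> \<le> e / 2" using \<delta>(2)[of t] that by fastforce
      from mult_right_mono[OF this k0[of t]] show ?thesis using k0[of t] by (simp add: abs_mult)
    qed simp
    have i1: "integrable I01 k" "integrable I01 (\<lambda>t. (u t - u a) * k t)" "integrable I01 (\<lambda>t. u t * k t)"
      using ck u by (auto intro!: integrable_I01_continuous continuous_intros)
    have "(\<integral>t. u t * k t \<partial>I01) - u a = (\<integral>t. u t * k t \<partial>I01) - u a * integral\<^sup>L I01 k"
      by (simp add: ik)
    also have "\<dots> = (\<integral>t. (u t - u a) * k t \<partial>I01)"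
      using i1 by (simp add: left_diff_distrib)
    finally have "\<bar>(\<integral>t. u t * k t \<partial>I01) - u a\<bar> \<le> (\<integral>t. \<bar>(u t - u a) * k t\<bar> \<partial>I01)"
      using integral_abs_bound[of I01 "\<lambda>t. (u t - u a) * k t"] by (simp only:)
    also have "\<dots> \<le> (\<integral>t. e / 2 * k t \<partial>I01)"
    proof (rule integral_mono_AE)
      show "integrable I01 (\<lambda>t. \<bar>(u t - u a) * k t\<bar>)" using i1(2) by (rule integrable_abs)
      show "integrable I01 (\<lambda>t. e / 2 * k t)" using i1(1) by (rule integrable_mult_right)
      show "AE t in I01. \<bar>(u t - u a) * k t\<bar> \<le> e / 2 * k t" by (rule AE_I01_I) (rule bnd)
    qed
    also have "\<dots> = e / 2" using ik by simp
    finally show "norm ((\<integral>t. u t * (real n * deriv B (real n * (t - a))) \<partial>I01) - u a) < e"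
      unfolding k_def real_norm_def using \<open>e > 0\<close> by linarith
  qed
qed

text \<open>The difference of two smooth steps, at \<open>a\<close> and at \<open>b\<close>, is a
  test function close to the indicator of \<open>{a<..b}\<close>, and its derivative is a difference
  of two approximate identities. The weak derivative formula passes to the limit on both
  sides.\<close>

lemma weak_deriv_FTC_interior:
  assumes u: "continuous_on {0..1} u" and w: "L2 w" "is_weak_deriv u w"
    and ab: "0 < a" "a \<le> b" "b < 1"
  shows "u b - u a = (\<integral>x. indicator {a<..b} x * w x \<partial>I01)"
proof -
  obtain B :: "real \<Rightarrow> real" where B: "smooth B" "\<And>t. t \<le> 0 \<Longrightarrow> B t = 0" "\<And>t. t \<ge> 1 \<Longrightarrow> B t = 1"
    "\<And>t. deriv B t \<ge> 0" "\<And>t. t \<notin> {0..1} \<Longrightarrow> deriv B t = 0" "\<And>t. B t \<in> {0..1}"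
    using smooth_step_exists by blast
  define \<phi> where "\<phi> n t = B (real n * (t - a)) - B (real n * (t - b))" for n t
  have sm: "smooth (\<lambda>t. B (real n * (t - c)))" for n c
    using smooth_affine[OF B(1), of "real n" "- real n * c"] by (simp add: algebra_simps)
  have dB: "((\<lambda>t. B (real n * (t - c))) has_real_derivative real n * deriv B (real n * (t - c))) (at t)" for n c t
  proof -
    have "((\<lambda>t. real n * (t - c)) has_real_derivative real n) (at t)"
      by (auto intro!: derivative_eq_intros)
    from DERIV_chain2[OF smooth_deriv(1)[OF B(1)] this] show ?thesis by (simp add: mult.commute)
  qed
  have d\<phi>: "deriv (\<phi> n) t = real n * deriv B (real n * (t - a)) - real n * deriv B (real n * (t - b))" for n t
    unfolding \<phi>_def by (intro DERIV_imp_deriv DERIV_diff dB)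
  obtain N where N: "real N > 1 / (1 - b)" using reals_Archimedean2 by blast
  have ev: "(\<integral>x. u x * deriv (\<phi> n) x \<partial>I01) = - (\<integral>x. w x * \<phi> n x \<partial>I01)" if "n \<ge> N" for n
  proof -
    have n: "real n > 1 / (1 - b)" using N that by simp
    have "1 / (1 - b) > 0" using ab by simp
    then have n0: "real n > 0" using n by linarith
    \<comment> \<open>The step at \<open>b\<close> is complete only at \<open>b + 1 / n\<close>,
      which must stay below 1.\<close>
    define b' where "b' = b + 1 / real n"
    have b': "b' < 1" using n n0 ab by (simp add: b'_def field_simps)
    have "\<phi> n x = 0" if "x \<notin> {a..b'}" for x
    proof (cases "x < a")
      case True then show ?thesis
        using B(2) n0 ab by (simp add: \<phi>_def mult_nonneg_nonpos)
    next
      case False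
      with that have "x > b'" by auto
      then have *: "real n * (x - b) \<ge> 1" using n0 by (simp add: b'_def field_simps)
      moreover have "real n * (x - b) \<le> real n * (x - a)" using ab by (intro mult_left_mono) auto
      ultimately have "real n * (x - b) \<ge> 1" "real n * (x - a) \<ge> 1" by auto
      then show ?thesis using B(3) by (simp add: \<phi>_def)
    qed
    moreover have "smooth (\<phi> n)" unfolding \<phi>_def by (rule smooth_diff[OF sm sm])
    ultimately have "test_fun (\<phi> n)" unfolding smooth_test_fun using ab b' by blast
    then show ?thesis using w by (simp add: is_weak_deriv_iff)
  qed
  have cd: "continuous_on {0..1} (\<lambda>t. deriv B (real n * (t - c)))" for n c
    by (intro continuous_intros continuous_on_compose2[OF smooth_continuous_on[OF smooth_deriv(2)[OF B(1)], of UNIV]]) auto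
  have "(\<integral>x. u x * deriv (\<phi> n) x \<partial>I01) = (\<integral>t. u t * (real n * deriv B (real n * (t - a))) \<partial>I01)
      - (\<integral>t. u t * (real n * deriv B (real n * (t - b))) \<partial>I01)" for n
    unfolding d\<phi> right_diff_distrib[of "u _"]
    by (intro Bochner_Integration.integral_diff integrable_I01_continuous continuous_on_mult continuous_on_const u cd)
  then have "(\<lambda>n. \<integral>x. u x * deriv (\<phi> n) x \<partial>I01) \<longlonglongrightarrow> u a - u b"
    using ab by (auto intro!: tendsto_diff approximate_identity B u)
  then have l1: "(\<lambda>n. - (\<integral>x. w x * \<phi> n x \<partial>I01)) \<longlonglongrightarrow> u a - u b"
    by (rule Lim_transform_eventually) (use ev in \<open>auto simp: eventually_sequentially\<close>)
  have "(\<lambda>n. (\<integral>x. w x * \<phi> n x \<partial>I01)) \<longlonglongrightarrow> (\<integral>x. indicator {a<..b} x * w x \<partial>I01)"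
  proof (rule integral_dominated_convergence[where w = "\<lambda>x. \<bar>w x\<bar>"])
    have wb: "w \<in> borel_measurable I01" using w by (simp add: L2_iff)
    show "(\<lambda>x. w x * \<phi> n x) \<in> borel_measurable I01" for n
      using smooth_continuous_on[OF smooth_diff[OF sm sm]] unfolding \<phi>_def
      by (intro borel_measurable_times wb continuous_measurable_I01')
    show "(\<lambda>x. indicator {a<..b} x * w x) \<in> borel_measurable I01"
      by (intro borel_measurable_times wb borel_measurable_I01I[OF borel_measurable_indicator]) auto
    show "integrable I01 (\<lambda>x. \<bar>w x\<bar>)" using L2_integrable[OF w(1)] by simp
    have "\<bar>\<phi> n x\<bar> \<le> 1" for n x
      using B(6)[of "real n * (x - a)"] B(6)[of "real n * (x - b)"] by (auto simp: \<phi>_def)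
    then show "AE x in I01. norm (w x * \<phi> n x) \<le> \<bar>w x\<bar>" for n
      by (intro AE_I2) (auto simp: abs_mult mult_left_le)
    have lim: "(\<lambda>n. B (real n * (x - c))) \<longlonglongrightarrow> indicator {c<..} x" for x c
    proof (cases "x > c")
      case True
      obtain N where "real N > 1 / (x - c)" using reals_Archimedean2 by blast
      then have N: "real N * (x - c) > 1" using True by (simp add: field_simps)
      have "real n * (x - c) \<ge> 1" if "n \<ge> N" for n
      proof -
        have "real N * (x - c) \<le> real n * (x - c)" using True that by (intro mult_right_mono) auto
        then show ?thesis using N by simp
      qed
      then have "\<forall>\<^sub>F n in sequentially. B (real n * (x - c)) = 1"
        using B(3) by (auto simp: eventually_sequentially)
      then show ?thesis using True by (simp add: tendsto_eventually)
    qed (use B(2) in \<open>simp add: mult_nonneg_nonpos\<close>)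
    have "indicator {a<..b} x = (indicator {a<..} x - indicator {b<..} x :: real)" for x
      using ab by (auto simp: indicator_def)
    then have "(\<lambda>n. w x * \<phi> n x) \<longlonglongrightarrow> indicator {a<..b} x * w x" for x
      unfolding \<phi>_def using tendsto_mult[OF tendsto_const[of "w x"] tendsto_diff[OF lim[of x a] lim[of x b]]]
      by (simp add: mult.commute)
    then show "AE x in I01. (\<lambda>n. w x * \<phi> n x) \<longlonglongrightarrow> indicator {a<..b} x * w x" by simp
  qed
  from LIMSEQ_unique[OF l1 tendsto_minus[OF this]] show ?thesis by simp
qed

text \<open>Only the endpoints 0 and 1 are new; they are approached from inside the
  interval.\<close>

lemma weak_deriv_FTC:
  assumes u: "continuous_on {0..1} u" and w: "L2 w" "is_weak_deriv u w"
    and ab: "0 \<le> a" "a \<le> b" "b \<le> 1"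
  shows "u b - u a = (\<integral>x. indicator {a<..b} x * w x \<partial>I01)"
proof -
  define t where "t n = 1 / (real n + 1)" for n
  have t: "0 < t n" "t n \<le> 1" for n by (auto simp: t_def)
  have t0: "t \<longlonglongrightarrow> 0" unfolding t_def by real_asymp
  \<comment> \<open>A contraction towards the midpoint: it moves all of \<open>{0..1}\<close> into
    the open interval and preserves the order of \<open>a\<close> and \<open>b\<close>.\<close>
  define s where "s c n = (1 - t n) * c + t n / 2" for c :: real and n
  have sl: "s c \<longlonglongrightarrow> c" for c unfolding s_def
    by (rule tendsto_eq_intros t0 refl)+ (use t0 in auto)
  have s01: "0 < s c n" "s c n < 1" if "c \<in> {0..1}" for c n
  proof -
    have "0 \<le> (1 - t n) * c" using that t[of n] by auto
    moreover have "(1 - t n) * c \<le> (1 - t n) * 1" using that t[of n] by (intro mult_left_mono) auto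
    ultimately have "0 \<le> (1 - t n) * c" "(1 - t n) * c \<le> (1 - t n) * 1" .
    then show "0 < s c n" "s c n < 1" using t[of n] by (auto simp: s_def)
  qed
  have smono: "s a n \<le> s b n" for n using ab t[of n] by (auto simp: s_def intro: mult_left_mono)
  have ul: "(\<lambda>n. u (s c n)) \<longlonglongrightarrow> u c" if "c \<in> {0..1}" for c
    by (rule continuous_on_tendsto_compose[OF u sl that]) (use s01[OF that] in \<open>auto intro!: always_eventually less_imp_le\<close>)
  have lim: "(\<lambda>n. u (s b n) - u (s a n)) \<longlonglongrightarrow> u b - u a"
    using ab by (intro tendsto_diff ul) auto
  have eq: "u (s b n) - u (s a n) = (\<integral>x. indicator {s a n<..s b n} x * w x \<partial>I01)" for n
    using s01[of a n] s01[of b n] smono ab by (intro weak_deriv_FTC_interior u w) auto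
  have "(\<lambda>n. \<integral>x. indicator {s a n<..s b n} x * w x \<partial>I01) \<longlonglongrightarrow> (\<integral>x. indicator {a<..b} x * w x \<partial>I01)"
  proof (rule integral_dominated_convergence[where w = "\<lambda>x. \<bar>w x\<bar>"])
    have wb: "w \<in> borel_measurable I01" using w by (simp add: L2_iff)
    show "(\<lambda>x. indicator {c<..d} x * w x) \<in> borel_measurable I01" for c d
      by (intro borel_measurable_times wb borel_measurable_I01I[OF borel_measurable_indicator]) auto
    then show "(\<lambda>x. indicator {c<..d} x * w x) \<in> borel_measurable I01" for c d .
    show "integrable I01 (\<lambda>x. \<bar>w x\<bar>)" using L2_integrable[OF w(1)] by simp
    show "AE x in I01. norm (indicator {s a n<..s b n} x * w x) \<le> \<bar>w x\<bar>" for n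
      by (auto simp: indicator_def)
    show "AE x in I01. (\<lambda>n. indicator {s a n<..s b n} x * w x) \<longlonglongrightarrow> indicator {a<..b} x * w x"
      using AE_I01_neq[of a] AE_I01_neq[of b]
    proof eventually_elim
      case (elim x)
      have "\<forall>\<^sub>F n in sequentially. (s c n < x) = (c < x) \<and> (x \<le> s c n) = (x \<le> c)" if "x \<noteq> c" for c
      proof (cases "c < x")
        case True
        show ?thesis by (rule eventually_mono[OF order_tendstoD(2)[OF sl[of c] True]]) (use True in auto)
      next
        case False
        then have "x < c" using that by simp
        show ?thesis by (rule eventually_mono[OF order_tendstoD(1)[OF sl[of c] \<open>x < c\<close>]]) (use \<open>x < c\<close> in auto)
      qed
      from this[OF elim(1)] this[OF elim(2)] have "\<forall>\<^sub>F n in sequentially. indicator {s a n<..s b n} x * w x = indicator {a<..b} x * w x"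
        by eventually_elim (auto simp: indicator_def)
      then show ?case by (rule tendsto_eventually)
    qed
  qed
  from LIMSEQ_unique[OF lim[unfolded eq] this] show ?thesis .
qed

lemma wderiv_props:
  assumes "u \<in> H1"
  shows "L2 u" "L2 (wderiv u)" "is_weak_deriv u (wderiv u)"
  using assms someI_ex[of "\<lambda>w. L2 w \<and> is_weak_deriv u w"] by (auto simp: H1_def wderiv_def)

text \<open>Two weak derivatives of one continuous function have equal integrals over all initial
  segments. This makes the choice in \<open>wderiv\<close> harmless: any explicit weak derivative
  may replace it under an integral.\<close>

lemma wderiv_unique:
  assumes u: "continuous_on {0..1} u" and w: "L2 w" "is_weak_deriv u w"
  shows "AE x in I01. wderiv u x = w x"
proof -
  have "u \<in> H1" using assms by (auto simp: H1_def intro: L2_continuous)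
  note d = wderiv_props[OF this]
  have eq: "(\<integral>x. indicator {..c} x * z x \<partial>I01) = (\<integral>x. indicator {0<..c} x * z x \<partial>I01)" for c z
    by (intro Bochner_Integration.integral_cong) (auto simp: indicator_def)
  show ?thesis
    using weak_deriv_FTC[OF u d(2,3), of 0] weak_deriv_FTC[OF u w, of 0]
    by (intro AE_I01_eqI L2_integrable d w) (auto simp: eq)
qed

lemma H1_norm_eq: "H1_norm u = sqrt ((\<integral>x. (u x)\<^sup>2 \<partial>I01) + (\<integral>x. (wderiv u x)\<^sup>2 \<partial>I01))"
  by (simp add: H1_norm_def LBINT_I01)

text \<open>The one-dimensional Sobolev embedding: \<open>\<bar>u a\<bar>\<close> exceeds
  \<open>\<bar>u x\<bar>\<close> by at most the integral of the derivative, and averaging over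
  \<open>x\<close> costs a second copy of the norm.\<close>

lemma H1_sup_bound:
  assumes u: "continuous_on {0..1} u" "u \<in> H1" and ab: "a \<in> {0..1}"
  shows "\<bar>u a\<bar> \<le> 2 * H1_norm u"
proof -
  note d = wderiv_props[OF u(2)]
  have L2n: "(\<integral>x. \<bar>v x\<bar> \<partial>I01) \<le> H1_norm u" if "v = u \<or> v = wderiv u" for v
  proof -
    have "(\<integral>x. \<bar>v x\<bar> \<partial>I01)\<^sup>2 \<le> (\<integral>x. (v x)\<^sup>2 \<partial>I01)"
      using that d by (intro integral_abs_le_L2) (auto simp: L2_iff)
    also have "\<dots> \<le> (\<integral>x. (u x)\<^sup>2 \<partial>I01) + (\<integral>x. (wderiv u x)\<^sup>2 \<partial>I01)"
      using that by auto
    finally show ?thesis unfolding H1_norm_eq by (rule real_le_rsqrt)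
  qed
  have le: "\<bar>u b - u c\<bar> \<le> H1_norm u" if "0 \<le> c" "c \<le> b" "b \<le> 1" for b c
  proof -
    have "\<bar>u b - u c\<bar> = \<bar>\<integral>x. indicator {c<..b} x * wderiv u x \<partial>I01\<bar>"
      using weak_deriv_FTC[OF u(1) d(2,3) that] by simp
    also have "\<dots> \<le> (\<integral>x. \<bar>indicator {c<..b} x * wderiv u x\<bar> \<partial>I01)" by (rule integral_abs_bound)
    also have "\<dots> \<le> (\<integral>x. \<bar>wderiv u x\<bar> \<partial>I01)"
      using L2_integrable[OF d(2)]
      by (intro integral_mono integrable_abs integrable_mult_indicator_I01) (auto simp: indicator_def)
    also have "\<dots> \<le> H1_norm u" using L2n by simp
    finally show ?thesis .
  qed
  have "\<bar>u a\<bar> \<le> \<bar>u x\<bar> + H1_norm u" if "0 < x" "x < 1" for x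
    using le[of x a] le[of a x] ab that by (cases "x \<le> a") auto
  then have "(\<integral>x. \<bar>u a\<bar> \<partial>I01) \<le> (\<integral>x. \<bar>u x\<bar> + H1_norm u \<partial>I01)"
    using L2_integrable[OF d(1)] by (intro integral_mono_AE AE_I01_I) auto
  also have "\<dots> = (\<integral>x. \<bar>u x\<bar> \<partial>I01) + H1_norm u"
    using L2_integrable[OF d(1)] by simp
  finally show ?thesis using L2n[of u] by simp
qed

section \<open>Boundary values and density in \<open>H01\<close>\<close>

lemma H01_D:
  assumes "u \<in> H01"
  shows "continuous_on {0..1} u" "u \<in> H1" "x \<notin> {0..1} \<Longrightarrow> u x = 0" "L2 u" "L2 (wderiv u)"
    "is_weak_deriv u (wderiv u)"
  using assms wderiv_props[of u] by (auto simp: H01_def)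

lemma test_fun_L2: "test_fun \<phi> \<Longrightarrow> L2 \<phi>" "test_fun \<phi> \<Longrightarrow> L2 (deriv \<phi>)"
  using test_funD by (auto intro: L2_continuous)

text \<open>Test functions vanish at 0 and 1, and the sup bound carries this through the H1
  limit.\<close>

lemma H01_boundary:
  assumes "u \<in> H01"
  shows "u 0 = 0" "u 1 = 0"
proof -
  note d = H01_D[OF assms]
  have "\<bar>u a\<bar> \<le> 2 * e" if "e > 0" "a = 0 \<or> a = 1" for e a
  proof -
    obtain \<phi> where \<phi>: "test_fun \<phi>" "H1_norm (\<lambda>x. u x - \<phi> x) < e"
      using assms \<open>e > 0\<close> by (auto simp: H01_def)
    note t = test_funD[OF \<phi>(1)]
    have "is_weak_deriv (\<lambda>x. u x - \<phi> x) (\<lambda>x. wderiv u x - deriv \<phi> x)"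
      by (intro weak_deriv_diff d weak_deriv_test_fun \<phi> test_fun_L2)
    then have "(\<lambda>x. u x - \<phi> x) \<in> H1"
      unfolding H1_def using L2_diff[OF d(4) test_fun_L2(1)[OF \<phi>(1)]] L2_diff[OF d(5) test_fun_L2(2)[OF \<phi>(1)]]
      by blast
    then have "\<bar>u a - \<phi> a\<bar> \<le> 2 * H1_norm (\<lambda>x. u x - \<phi> x)"
      using that by (intro H1_sup_bound[of "\<lambda>x. u x - \<phi> x"] continuous_intros d t) auto
    then show ?thesis using t that \<phi> by auto
  qed
  note small = this
  have "\<bar>u a\<bar> \<le> 0" if "a = 0 \<or> a = 1" for a
  proof (rule ccontr)
    assume "\<not> \<bar>u a\<bar> \<le> 0"
    then have "\<bar>u a\<bar> \<le> 2 * (\<bar>u a\<bar> / 4)" using small[of "\<bar>u a\<bar> / 4" a] that by linarith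
    then show False using \<open>\<not> \<bar>u a\<bar> \<le> 0\<close> by simp
  qed
  then show "u 0 = 0" "u 1 = 0" by auto
qed

text \<open>The strict initial segment is the form in which the kernel of \<open>Kder\<close> will
  present this integral.\<close>

lemma H01_FTC:
  assumes "u \<in> H01" "x \<in> {0..1}"
  shows "u x = (\<integral>s. indicator {..<x} s * wderiv u s \<partial>I01)"
proof -
  note d = H01_D[OF assms(1)]
  have "u x - u 0 = (\<integral>s. indicator {0<..x} s * wderiv u s \<partial>I01)"
    using assms by (intro weak_deriv_FTC d) auto
  also have "\<dots> = (\<integral>s. indicator {..<x} s * wderiv u s \<partial>I01)"
  proof (rule integral_cong_AE)
    have wb: "wderiv u \<in> borel_measurable I01" using d by (simp add: L2_iff)
    show "(\<lambda>s. indicator {0<..x} s * wderiv u s) \<in> borel_measurable I01"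
         "(\<lambda>s. indicator {..<x} s * wderiv u s) \<in> borel_measurable I01"
      by (intro borel_measurable_times wb borel_measurable_I01I[OF borel_measurable_indicator]; simp)+
    have "AE s in I01. s > 0" by (rule AE_I01_I)
    then show "AE s in I01. indicator {0<..x} s * wderiv u s = indicator {..<x} s * wderiv u s"
      using AE_I01_neq[of x] by eventually_elim (auto simp: indicator_def)
  qed
  finally show ?thesis using H01_boundary[OF assms(1)] by simp
qed

lemma H1_norm_C1:
  assumes u: "\<And>x. x \<in> {0..1} \<Longrightarrow> (u has_real_derivative h x) (at x within {0..1})"
    and h: "continuous_on {0..1} h"
  shows "AE x in I01. wderiv u x = h x" "H1_norm u = sqrt ((\<integral>x. (u x)\<^sup>2 \<partial>I01) + (\<integral>x. (h x)\<^sup>2 \<partial>I01))"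
    "u \<in> H1"
proof -
  have cu: "continuous_on {0..1} u"
    using u DERIV_continuous continuous_on_eq_continuous_within by blast
  show 1: "AE x in I01. wderiv u x = h x"
    by (intro wderiv_unique cu L2_continuous h weak_deriv_C1 u)
  show 2: "u \<in> H1" unfolding H1_def using weak_deriv_C1[OF u h] L2_continuous[OF cu] L2_continuous[OF h] by blast
  have "(\<integral>x. (wderiv u x)\<^sup>2 \<partial>I01) = (\<integral>x. (h x)\<^sup>2 \<partial>I01)"
    using 1 wderiv_props[OF 2] L2_continuous[OF h] by (intro integral_cong_AE) (auto simp: L2_iff)
  then show "H1_norm u = sqrt ((\<integral>x. (u x)\<^sup>2 \<partial>I01) + (\<integral>x. (h x)\<^sup>2 \<partial>I01))"
    by (simp add: H1_norm_eq)
qed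

text \<open>A pointwise Poincare inequality. It reduces H1 distances to L2 distances of derivatives
  and later turns energies into sup bounds.\<close>

lemma abs_le_integral_deriv:
  assumes u: "\<And>x. x \<in> {0..1} \<Longrightarrow> (u has_real_derivative h x) (at x within {0..1})"
    and h: "continuous_on {0..1} h" and u0: "u 0 = 0" and x: "x \<in> {0..1}"
  shows "(u x)\<^sup>2 \<le> (\<integral>x. (h x)\<^sup>2 \<partial>I01)"
proof -
  have i: "integrable I01 h" by (rule integrable_I01_continuous[OF h])
  have "u x - u 0 = (\<integral>s. indicator {0<..x} s * h s \<partial>I01)"
  proof (rule integral_I01_FTC[symmetric])
    show "(u has_real_derivative h y) (at y within {0..x})" if "y \<in> {0..x}" for y
      by (rule DERIV_subset[OF u]) (use that x in auto)
  qed (use x in \<open>auto intro: continuous_on_subset[OF h]\<close>)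
  then have "\<bar>u x\<bar> \<le> (\<integral>s. \<bar>indicator {0<..x} s * h s\<bar> \<partial>I01)"
    using integral_abs_bound[of I01 "\<lambda>s. indicator {0<..x} s * h s"] u0 by simp
  also have "\<dots> \<le> (\<integral>s. \<bar>h s\<bar> \<partial>I01)"
    by (intro integral_mono integrable_abs integrable_mult_indicator_I01 i) (auto simp: indicator_def)
  finally have "\<bar>u x\<bar>\<^sup>2 \<le> (\<integral>s. \<bar>h s\<bar> \<partial>I01)\<^sup>2" by (intro power_mono) auto
  also have "\<dots> \<le> (\<integral>x. (h x)\<^sup>2 \<partial>I01)"
    using L2_continuous[OF h] by (intro integral_abs_le_L2) (auto simp: L2_iff)
  finally show ?thesis by simp
qed

lemma H1_norm_C1_le:
  assumes u: "\<And>x. x \<in> {0..1} \<Longrightarrow> (u has_real_derivative h x) (at x within {0..1})"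
    and h: "continuous_on {0..1} h" and u0: "u 0 = 0"
  shows "H1_norm u \<le> sqrt (2 * (\<integral>x. (h x)\<^sup>2 \<partial>I01))"
proof -
  have cu: "continuous_on {0..1} u"
    using u DERIV_continuous continuous_on_eq_continuous_within by blast
  have "(\<integral>x. (u x)\<^sup>2 \<partial>I01) \<le> (\<integral>x. (\<integral>x. (h x)\<^sup>2 \<partial>I01) \<partial>I01)"
    using abs_le_integral_deriv[OF u h u0] cu
    by (intro integral_mono_AE AE_I01_I integrable_I01_continuous continuous_intros) auto
  moreover have "H1_norm u = sqrt ((\<integral>x. (u x)\<^sup>2 \<partial>I01) + (\<integral>x. (h x)\<^sup>2 \<partial>I01))"
    by (intro H1_norm_C1 u h)
  ultimately show ?thesis by simp
qed

text \<open>The cutoff has slope of order \<open>n\<close> in its two boundary layers, but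
  \<open>Q\<close> is there at most of order \<open>1 / n\<close>, being Lipschitz and zero at the
  ends. The derivative of the product thus stays bounded while it equals that of \<open>Q\<close>
  off the shrinking layers, and dominated convergence applies.\<close>

lemma H01_density_aux:
  assumes Q: "smooth Q" "Q 0 = 0" "Q 1 = 0" and "e > 0"
  shows "\<exists>\<phi>. test_fun \<phi> \<and> (\<integral>x. (deriv Q x - deriv \<phi> x)\<^sup>2 \<partial>I01) < e"
proof -
  obtain B :: "real \<Rightarrow> real" where B: "smooth B" "\<And>t. t \<le> 0 \<Longrightarrow> B t = 0" "\<And>t. t \<ge> 1 \<Longrightarrow> B t = 1"
    "\<And>t. deriv B t \<ge> 0" "\<And>t. t \<notin> {0..1} \<Longrightarrow> deriv B t = 0" "\<And>t. B t \<in> {0..1}"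
    using smooth_step_exists by blast
  \<comment> \<open>Zero within \<open>1 / n\<close> of either end and one beyond
    \<open>2 / n\<close>; the latter distance is the source of the factor 2 in the bounds
    below.\<close>
  define cut where "cut n x = B (real n * x + (-1)) * B ((- real n) * x + (real n - 1))" for n x
  define cut' where "cut' n x = real n * deriv B (real n * x + (-1)) * B ((- real n) * x + (real n - 1))
     - real n * deriv B ((- real n) * x + (real n - 1)) * B (real n * x + (-1))" for n x
  define \<phi> where "\<phi> n x = cut n x * Q x" for n x
  have scut: "smooth (cut n)" for n unfolding cut_def by (intro smooth_mult smooth_affine B(1))
  have s\<phi>: "smooth (\<phi> n)" for n unfolding \<phi>_def by (intro smooth_mult scut Q)
  have dB: "((\<lambda>x. B (a * x + b)) has_real_derivative deriv B (a * x + b) * a) (at x)" for a b x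
  proof (rule DERIV_chain2[OF smooth_deriv(1)[OF B(1)]])
    show "((\<lambda>x. a * x + b) has_real_derivative a) (at x)" by (auto intro!: derivative_eq_intros)
  qed
  have dcut: "(cut n has_real_derivative cut' n x) (at x)" for n x
    using DERIV_mult[OF dB[of "real n" "-1" x] dB[of "- real n" "real n - 1" x]]
    unfolding cut_def cut'_def by (simp add: algebra_simps)
  have d\<phi>: "deriv (\<phi> n) x = cut' n x * Q x + deriv Q x * cut n x" for n x
    unfolding \<phi>_def by (intro DERIV_imp_deriv DERIV_mult dcut smooth_deriv(1)[OF Q(1)])
  have tf: "test_fun (\<phi> n)" if "n > 0" for n
  proof -
    have "\<phi> n x = 0" if "x \<notin> {1 / real n .. 1 - 1 / real n}" for x
    proof -
      have "real n * x + (-1) \<le> 0 \<or> (- real n) * x + (real n - 1) \<le> 0"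
        using that \<open>n > 0\<close> by (auto simp: field_simps)
      then show ?thesis using B(2) by (auto simp: \<phi>_def cut_def)
    qed
    moreover have "0 < 1 / real n" "1 - 1 / real n < 1" using that by auto
    ultimately show ?thesis unfolding smooth_test_fun using s\<phi> by blast
  qed
  obtain Mb where Mb: "\<And>t. \<bar>deriv B t\<bar> \<le> Mb"
  proof -
    have "bounded (deriv B ` {0..1})"
      by (intro compact_imp_bounded compact_continuous_image smooth_continuous_on smooth_deriv B) auto
    then obtain M where M: "\<forall>t\<in>{0..1}. \<bar>deriv B t\<bar> \<le> M" by (auto simp: bounded_iff)
    have "\<bar>deriv B t\<bar> \<le> max M 0" for t
      using M B(5)[of t] by (cases "t \<in> {0..1}") (auto simp: le_max_iff_disj)
    then show thesis by (rule that)
  qed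
  have Mb0: "Mb \<ge> 0" using Mb[of 0] by linarith
  obtain L where L: "\<And>x. x \<in> {0..1} \<Longrightarrow> \<bar>deriv Q x\<bar> \<le> L"
  proof -
    have "bounded (deriv Q ` {0..1})"
      by (intro compact_imp_bounded compact_continuous_image smooth_continuous_on smooth_deriv Q) auto
    then obtain M where "\<forall>x\<in>{0..1}. \<bar>deriv Q x\<bar> \<le> M" by (auto simp: bounded_iff)
    then show thesis using that by blast
  qed
  have L0: "L \<ge> 0" using L[of 0] by auto
  have lip: "\<bar>Q x - Q y\<bar> \<le> L * \<bar>x - y\<bar>" if "x \<in> {0..1}" "y \<in> {0..1}" for x y
    using field_differentiable_bound[of "{0..1}" Q "deriv Q" L y x] that L
      has_field_derivative_at_within[OF smooth_deriv(1)[OF Q(1)]] by (auto simp: real_norm_def abs_minus_commute)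
  have QL: "\<bar>Q x\<bar> \<le> L * x" "\<bar>Q x\<bar> \<le> L * (1 - x)" if "x \<in> {0..1}" for x
    using lip[of x 0] lip[of x 1] that Q by auto
  have prod_bound: "\<bar>real n * deriv B t * b * Q x\<bar> \<le> 2 * L * Mb"
    if "\<bar>b\<bar> \<le> 1" "t \<in> {0..1} \<Longrightarrow> real n * \<bar>Q x\<bar> \<le> 2 * L" for n t b x
  proof (cases "t \<in> {0..1}")
    case True
    have "\<bar>real n * deriv B t * b * Q x\<bar> = (real n * \<bar>Q x\<bar>) * (\<bar>deriv B t\<bar> * \<bar>b\<bar>)"
      by (simp add: abs_mult)
    also have "\<dots> \<le> (2 * L) * (Mb * 1)"
    proof (rule mult_mono)
      show "real n * \<bar>Q x\<bar> \<le> 2 * L" using that True by simp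
      show "\<bar>deriv B t\<bar> * \<bar>b\<bar> \<le> Mb * 1" using that Mb[of t] Mb0 by (rule_tac mult_mono) auto
    qed (use L0 in auto)
    finally show ?thesis by simp
  qed (use B(5) L0 Mb0 in auto)
  have bnd: "\<bar>deriv Q x - deriv (\<phi> n) x\<bar> \<le> L + 4 * L * Mb" if x: "0 < x" "x < 1" for x n
  proof -
    have b1: "\<bar>B t\<bar> \<le> 1" for t using B(6)[of t] by auto
    have "real n * \<bar>Q x\<bar> \<le> 2 * L" if "real n * x + (-1) \<in> {0..1}"
    proof -
      have "real n * \<bar>Q x\<bar> \<le> real n * (L * x)" using QL[of x] x by (intro mult_left_mono) auto
      also have "\<dots> = (real n * x) * L" by simp
      also have "\<dots> \<le> 2 * L" using that L0 by (intro mult_right_mono) auto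
      finally show ?thesis .
    qed
    from prod_bound[OF b1 this]
    have 1: "\<bar>real n * deriv B (real n * x + (-1)) * B ((- real n) * x + (real n - 1)) * Q x\<bar> \<le> 2 * L * Mb" .
    have "real n * \<bar>Q x\<bar> \<le> 2 * L" if "(- real n) * x + (real n - 1) \<in> {0..1}"
    proof -
      have "real n * \<bar>Q x\<bar> \<le> real n * (L * (1 - x))" using QL[of x] x by (intro mult_left_mono) auto
      also have "\<dots> = (real n * (1 - x)) * L" by simp
      also have "\<dots> \<le> 2 * L" using that L0 by (intro mult_right_mono) (auto simp: algebra_simps)
      finally show ?thesis .
    qed
    from prod_bound[OF b1 this]
    have 2: "\<bar>real n * deriv B ((- real n) * x + (real n - 1)) * B (real n * x + (-1)) * Q x\<bar> \<le> 2 * L * Mb" .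
    have "cut n x \<in> {0..1}" unfolding cut_def using B(6) by (auto intro: mult_le_one)
    then have "\<bar>deriv Q x * (1 - cut n x)\<bar> \<le> L * 1"
      unfolding abs_mult using L[of x] x L0 by (intro mult_mono) auto
    moreover have "deriv Q x - deriv (\<phi> n) x = deriv Q x * (1 - cut n x) -
        real n * deriv B (real n * x + (-1)) * B ((- real n) * x + (real n - 1)) * Q x
       + real n * deriv B ((- real n) * x + (real n - 1)) * B (real n * x + (-1)) * Q x"
      unfolding d\<phi> cut'_def by (simp add: algebra_simps)
    ultimately show ?thesis using 1 2 by linarith
  qed
  have lim: "(\<lambda>n. (deriv Q x - deriv (\<phi> n) x)\<^sup>2) \<longlonglongrightarrow> 0" if x: "0 < x" "x < 1" for x
  proof -
    obtain N where N: "real N > max (2 / x) (2 / (1 - x))" using reals_Archimedean2 by blast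
    have "(deriv Q x - deriv (\<phi> n) x)\<^sup>2 = 0" if "n \<ge> N" for n
    proof -
      have "real n \<ge> real N" using that by simp
      then have "real n > 2 / x" "real n > 2 / (1 - x)" using N by auto
      then have "real n * x + (-1) > 1" "(- real n) * x + (real n - 1) > 1"
        using x by (auto simp: field_simps)
      then show ?thesis using B(3) B(5) unfolding d\<phi> cut'_def cut_def by simp
    qed
    then show ?thesis by (intro tendsto_eventually) (auto simp: eventually_sequentially)
  qed
  have ms: "(\<lambda>x. (deriv Q x - deriv (\<phi> n) x)\<^sup>2) \<in> borel_measurable I01" for n
    by (intro continuous_measurable_I01' continuous_intros smooth_continuous_on smooth_deriv s\<phi> Q)
  have "(\<lambda>n. \<integral>x. (deriv Q x - deriv (\<phi> n) x)\<^sup>2 \<partial>I01) \<longlonglongrightarrow> (\<integral>x. 0 \<partial>I01)"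
  proof (rule integral_dominated_convergence[where w = "\<lambda>x. (L + 4 * L * Mb)\<^sup>2"])
    show "AE x in I01. norm ((deriv Q x - deriv (\<phi> n) x)\<^sup>2) \<le> (L + 4 * L * Mb)\<^sup>2" for n
    proof (rule AE_I01_I)
      fix x :: real assume "0 < x" "x < 1"
      then have "\<bar>deriv Q x - deriv (\<phi> n) x\<bar>\<^sup>2 \<le> (L + 4 * L * Mb)\<^sup>2"
        by (intro power_mono bnd) auto
      then show "norm ((deriv Q x - deriv (\<phi> n) x)\<^sup>2) \<le> (L + 4 * L * Mb)\<^sup>2" by simp
    qed
    show "AE x in I01. (\<lambda>n. (deriv Q x - deriv (\<phi> n) x)\<^sup>2) \<longlonglongrightarrow> 0"
      by (rule AE_I01_I) (rule lim)
  qed (use ms in auto)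
  then have "\<forall>\<^sub>F n in sequentially. (\<integral>x. (deriv Q x - deriv (\<phi> n) x)\<^sup>2 \<partial>I01) < e"
    using \<open>e > 0\<close> by (intro order_tendstoD(2)) auto
  then have "\<forall>\<^sub>F n in sequentially. n > 0 \<and> (\<integral>x. (deriv Q x - deriv (\<phi> n) x)\<^sup>2 \<partial>I01) < e"
    using eventually_gt_at_top[of 0] by eventually_elim auto
  then obtain n where "n > 0" "(\<integral>x. (deriv Q x - deriv (\<phi> n) x)\<^sup>2 \<partial>I01) < e"
    by (auto simp: eventually_sequentially)
  then show ?thesis using tf by blast
qed

text \<open>The derivative is approximated uniformly by a polynomial, whose antiderivative is
  smooth; an affine correction restores the zero boundary values, and \<open>H01_density_aux\<close>
  then gives compact support.\<close>

lemma H01_C1I: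
  assumes u: "\<And>x. x \<in> {0..1} \<Longrightarrow> (u has_real_derivative h x) (at x within {0..1})"
    and h: "continuous_on {0..1} h" and u0: "u 0 = 0" "u 1 = 0" and out: "\<And>x. x \<notin> {0..1} \<Longrightarrow> u x = 0"
  shows "u \<in> H01"
proof -
  have cu: "continuous_on {0..1} u"
    using u DERIV_continuous continuous_on_eq_continuous_within by blast
  have "\<exists>\<phi>. test_fun \<phi> \<and> H1_norm (\<lambda>x. u x - \<phi> x) < e" if "e > 0" for e
  proof -
    \<comment> \<open>The squared derivative error will be at most \<open>10 * d\<^sup>2\<close>;
      \<open>H1_norm_C1_le\<close> doubles it, and \<open>20 * d\<^sup>2\<close> lies below
      \<open>(5 * d)\<^sup>2\<close>.\<close>
    define d where "d = e / 5"
    have d: "d > 0" using that by (simp add: d_def)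
    obtain p where p: "real_polynomial_function p" "\<And>x. x \<in> {0..1} \<Longrightarrow> \<bar>h x - p x\<bar> < d"
      using Stone_Weierstrass_real_polynomial_function[OF _ h d] by auto
    then obtain a n where pa: "p = (\<lambda>x. \<Sum>i\<le>n. a i * x ^ i)"
      using real_polynomial_function_iff_sum by blast
    define P where "P x = (\<Sum>i\<le>n. a i / real (Suc i) * x ^ Suc i)" for x
    have dP: "(P has_real_derivative p x) (at x)" for x
      unfolding P_def pa by (rule derivative_eq_intros refl | simp add: mult.commute)+
    have sp: "smooth p" by (rule smooth_real_polynomial_function[OF p(1)])
    have sP: "smooth P" using dP sp by (rule smooth_antideriv)
    \<comment> \<open>The mean of \<open>p\<close>. It is small because the mean of \<open>h\<close>
      is \<open>u 1 - u 0 = 0\<close>, so the affine correction hardly changes the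
      derivative.\<close>
    define c where "c = P 1 - P 0"
    have cp: "continuous_on {0..1} p" by (rule smooth_continuous_on[OF sp])
    have "c = integral\<^sup>L I01 p"
      unfolding c_def by (rule integral_I01_FTC01[symmetric]) (auto intro: has_field_derivative_at_within dP cp)
    moreover have "integral\<^sup>L I01 h = 0"
      using integral_I01_FTC01[OF u h] u0 by simp
    ultimately have "\<bar>c\<bar> = \<bar>\<integral>x. p x - h x \<partial>I01\<bar>"
      using integrable_I01_continuous[OF cp] integrable_I01_continuous[OF h] by simp
    also have "\<dots> \<le> (\<integral>x. \<bar>p x - h x\<bar> \<partial>I01)" by (rule integral_abs_bound)
    also have "\<dots> \<le> (\<integral>x. d \<partial>I01)"
      using p(2) by (intro integral_mono_AE AE_I01_I integrable_I01_continuous continuous_intros cp h)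
        (auto simp: abs_minus_commute less_imp_le)
    finally have c: "\<bar>c\<bar> \<le> d" by simp
    define Q where "Q x = P x - (c * x + P 0)" for x
    have sQ: "smooth Q" unfolding Q_def
      using smooth_diff[OF sP smooth_affine[OF smooth_real_polynomial_function[OF real_polynomial_function.intros(1)[OF bounded_linear_ident]], of c "P 0"]] .
    have dQ: "(Q has_real_derivative p x - c) (at x)" for x
      unfolding Q_def by (rule derivative_eq_intros dP refl | simp)+
    then have dQ': "deriv Q x = p x - c" for x by (rule DERIV_imp_deriv)
    obtain \<phi> where \<phi>: "test_fun \<phi>" "(\<integral>x. (deriv Q x - deriv \<phi> x)\<^sup>2 \<partial>I01) < d\<^sup>2"
      using H01_density_aux[OF sQ, of "d\<^sup>2"] d by (auto simp: Q_def c_def)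
    note t = test_funD[OF \<phi>(1)]
    have cQ: "continuous_on {0..1} (deriv Q)" unfolding dQ' by (intro continuous_intros cp)
    have hQ: "(h x - deriv Q x)\<^sup>2 \<le> (2 * d)\<^sup>2" if "x \<in> {0..1}" for x
    proof -
      have "\<bar>h x - deriv Q x\<bar>\<^sup>2 \<le> (2 * d)\<^sup>2"
        using p(2)[OF that] c unfolding dQ' by (intro power_mono) auto
      then show ?thesis by simp
    qed
    have "(\<integral>x. (h x - deriv \<phi> x)\<^sup>2 \<partial>I01) \<le> (\<integral>x. 2 * (2 * d)\<^sup>2 + 2 * (deriv Q x - deriv \<phi> x)\<^sup>2 \<partial>I01)"
    proof (rule integral_mono_AE)
      show "AE x in I01. (h x - deriv \<phi> x)\<^sup>2 \<le> 2 * (2 * d)\<^sup>2 + 2 * (deriv Q x - deriv \<phi> x)\<^sup>2"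
      proof (rule AE_I01_I)
        fix x :: real assume x: "0 < x" "x < 1"
        have "0 \<le> ((h x - deriv Q x) - (deriv Q x - deriv \<phi> x))\<^sup>2" by simp
        then have "(h x - deriv \<phi> x)\<^sup>2 \<le> 2 * (h x - deriv Q x)\<^sup>2 + 2 * (deriv Q x - deriv \<phi> x)\<^sup>2"
          by (simp add: power2_eq_square algebra_simps)
        then show "(h x - deriv \<phi> x)\<^sup>2 \<le> 2 * (2 * d)\<^sup>2 + 2 * (deriv Q x - deriv \<phi> x)\<^sup>2"
          using hQ[of x] x by auto
      qed
    qed (intro integrable_I01_continuous continuous_intros h t cQ)+
    also have "\<dots> = 2 * (2 * d)\<^sup>2 + 2 * (\<integral>x. (deriv Q x - deriv \<phi> x)\<^sup>2 \<partial>I01)"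
    proof -
      have "integrable I01 (\<lambda>x. (deriv Q x - deriv \<phi> x)\<^sup>2)"
        by (intro integrable_I01_continuous continuous_intros cQ t)
      then show ?thesis by simp
    qed
    also have "\<dots> < 10 * d\<^sup>2" using \<phi>(2) by (simp add: power_mult_distrib)
    finally have "2 * (\<integral>x. (h x - deriv \<phi> x)\<^sup>2 \<partial>I01) < 20 * d\<^sup>2" by simp
    also have "\<dots> \<le> (5 * d)\<^sup>2" by (simp add: power_mult_distrib)
    finally have "sqrt (2 * (\<integral>x. (h x - deriv \<phi> x)\<^sup>2 \<partial>I01)) < 5 * d"
      using d by (intro real_less_lsqrt) auto
    moreover have "H1_norm (\<lambda>x. u x - \<phi> x) \<le> sqrt (2 * (\<integral>x. (h x - deriv \<phi> x)\<^sup>2 \<partial>I01))"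
    proof (rule H1_norm_C1_le)
      show "((\<lambda>x. u x - \<phi> x) has_real_derivative h x - deriv \<phi> x) (at x within {0..1})"
        if "x \<in> {0..1}" for x
        by (intro DERIV_diff u that has_field_derivative_at_within[OF t(2)])
      show "continuous_on {0..1} (\<lambda>x. h x - deriv \<phi> x)" by (intro continuous_intros h t)
    qed (use t u0 in auto)
    ultimately show ?thesis using \<phi>(1) by (auto simp: d_def)
  qed
  then show ?thesis unfolding H01_def using cu out H1_norm_C1(3)[OF u h] by blast
qed

section \<open>The Green operator of the Dirichlet problem\<close>

text \<open>The Green function of \<open>- w'' = p\<close> with \<open>w 0 = w 1 = 0\<close>: it
  equals \<open>x * (1 - y)\<close> for \<open>x \<le> y\<close> and \<open>y * (1 - x)\<close>
  otherwise.\<close>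

definition green :: "real \<Rightarrow> real \<Rightarrow> real" where
  "green x y = min x y - x * y"

text \<open>The value 0 outside \<open>{0..1}\<close> matches the representatives chosen in
  \<open>H01\<close>, so that identities between functions hold on the whole line.\<close>

definition Kop :: "(real \<Rightarrow> real) \<Rightarrow> real \<Rightarrow> real" where
  "Kop p x = (if x \<in> {0..1} then \<integral>y. green x y * p y \<partial>I01 else 0)"

abbreviation bubble :: "real \<Rightarrow> real" where
  "bubble x \<equiv> x * (1 - x)"

lemma green_sym: "green x y = green y x"
  by (simp add: green_def min.commute mult.commute)

text \<open>The comparison with the parabola in both variables is the source of all boundary
  estimates: the upper bounds give decay, the lower bound gives a quantitative maximum
  principle.\<close>

lemma green_bounds:
  assumes "x \<in> {0..1}" "y \<in> {0..1}"
  shows "0 \<le> green x y" "green x y \<le> bubble x" "green x y \<le> bubble y" "bubble x * bubble y \<le> green x y"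
    "\<bar>green x y\<bar> \<le> 1"
proof -
  have g: "green x y = (if x \<le> y then x * (1 - y) else y * (1 - x))"
    by (auto simp: green_def min_def algebra_simps)
  show nn: "0 \<le> green x y" using assms by (auto simp: g)
  show b: "green x y \<le> bubble x" "green x y \<le> bubble y"
    using assms by (auto simp: g intro: mult_left_mono mult_right_mono)
  have *: "s * (1 - s) * (t * (1 - t)) \<le> s * (1 - t)" if "s \<in> {0..1}" "t \<in> {0..1}" for s t :: real
  proof -
    have "(s * (1 - t)) * ((1 - s) * t) \<le> (s * (1 - t)) * 1"
      using that by (intro mult_left_mono mult_le_one) auto
    then show ?thesis by (simp add: algebra_simps)
  qed
  show "bubble x * bubble y \<le> green x y"
    using *[OF assms] *[OF assms(2,1)] by (auto simp: g mult.commute)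
  have "bubble x \<le> 1" using assms by (auto intro: mult_le_one)
  then show "\<bar>green x y\<bar> \<le> 1" using nn b by auto
qed

text \<open>This Lipschitz bound, uniform in \<open>y\<close>, dominates the difference quotients of
  \<open>Kop p\<close> and makes images of L1-bounded families equicontinuous.\<close>

lemma green_diff:
  assumes "y \<in> {0..1}"
  shows "\<bar>green x y - green x' y\<bar> \<le> \<bar>x - x'\<bar>"
proof -
  have *: "\<bar>green x y - green x' y\<bar> \<le> \<bar>x - x'\<bar>" if "x' \<le> x" for x x'
  proof -
    have "0 \<le> (x - x') * y" "(x - x') * y \<le> (x - x') * 1"
      using that assms mult_left_mono[of y 1 "x - x'"] by auto
    moreover have "0 \<le> min x y - min x' y" "min x y - min x' y \<le> x - x'" using that by (auto simp: min_def)
    moreover have "green x y - green x' y = (min x y - min x' y) - (x - x') * y"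
      by (simp add: green_def algebra_simps)
    ultimately show ?thesis using that by auto
  qed
  show ?thesis using *[of x' x] *[of x x'] by (cases "x \<le> x'") (auto simp: abs_minus_commute)
qed

lemma green_measurable: "green x \<in> borel_measurable I01"
  unfolding green_def by (intro continuous_measurable_I01' continuous_intros)

lemma green_integrable:
  assumes "integrable I01 p" "x \<in> {0..1}"
  shows "integrable I01 (\<lambda>y. green x y * p y)"
proof (rule Bochner_Integration.integrable_bound[OF assms(1)])
  show "(\<lambda>y. green x y * p y) \<in> borel_measurable I01"
    using assms by (intro borel_measurable_times green_measurable) auto
  show "AE y in I01. norm (green x y * p y) \<le> norm (p y)"
    using green_bounds(5)[OF assms(2)] by (intro AE_I01_I) (auto simp: abs_mult intro: mult_left_le_one_le)
qed

lemma Kop_outside: "x \<notin> {0..1} \<Longrightarrow> Kop p x = 0"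
  by (auto simp: Kop_def)

lemma Kop_0 [simp]: "Kop p 0 = 0"
proof -
  have "(\<integral>y. green 0 y * p y \<partial>I01) = (\<integral>y. 0 \<partial>I01)"
    by (intro Bochner_Integration.integral_cong) (auto simp: green_def)
  then show ?thesis by (simp add: Kop_def)
qed

lemma Kop_1 [simp]: "Kop p 1 = 0"
proof -
  have "(\<integral>y. green 1 y * p y \<partial>I01) = (\<integral>y. 0 \<partial>I01)"
    by (intro Bochner_Integration.integral_cong) (auto simp: green_def)
  then show ?thesis by (simp add: Kop_def)
qed

lemma Kop_add: "integrable I01 p \<Longrightarrow> integrable I01 r \<Longrightarrow> Kop (\<lambda>x. p x + r x) x = Kop p x + Kop r x"
  by (auto simp: Kop_def distrib_left green_integrable)

lemma Kop_diff: "integrable I01 p \<Longrightarrow> integrable I01 r \<Longrightarrow> Kop (\<lambda>x. p x - r x) x = Kop p x - Kop r x"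
  by (auto simp: Kop_def right_diff_distrib green_integrable)

lemma Kop_cmult: "Kop (\<lambda>x. c * p x) x = c * Kop p x"
proof -
  have "(\<lambda>y. green x y * (c * p y)) = (\<lambda>y. c * (green x y * p y))" by (auto simp: ac_simps)
  then show ?thesis by (simp add: Kop_def)
qed

lemma Kop_sum:
  assumes "\<And>i. i \<in> I \<Longrightarrow> integrable I01 (p i)"
  shows "Kop (\<lambda>x. \<Sum>i\<in>I. p i x) x = (\<Sum>i\<in>I. Kop (p i) x)"
  using assms by (auto simp: Kop_def sum_distrib_left green_integrable intro!: Bochner_Integration.integral_sum)

lemma Kop_mono_AE:
  assumes "integrable I01 p" "integrable I01 r" "AE y in I01. p y \<le> r y"
  shows "Kop p x \<le> Kop r x"
proof (cases "x \<in> {0..1}")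
  case True
  have "AE y in I01. y \<in> {0..1}" by (rule AE_I01_I) auto
  with assms(3) have "AE y in I01. green x y * p y \<le> green x y * r y"
    by eventually_elim (use green_bounds[OF True] in \<open>auto intro: mult_left_mono\<close>)
  then show ?thesis using True assms green_integrable by (auto simp: Kop_def intro!: integral_mono_AE)
qed (auto simp: Kop_def)

lemma Kop_mono:
  assumes "integrable I01 p" "integrable I01 r" "\<And>y. 0 < y \<Longrightarrow> y < 1 \<Longrightarrow> p y \<le> r y"
  shows "Kop p x \<le> Kop r x"
  using assms by (intro Kop_mono_AE AE_I01_I)

lemma Kop_nonneg:
  assumes "\<And>y. 0 < y \<Longrightarrow> y < 1 \<Longrightarrow> 0 \<le> p y"
  shows "0 \<le> Kop p x"
proof (cases "x \<in> {0..1}")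
  case True
  then show ?thesis
    using green_bounds(1)[OF True] assms by (auto simp: Kop_def intro!: integral_nonneg_AE AE_I01_I)
qed (auto simp: Kop_def)

lemma bubble_integrable:
  assumes "integrable I01 p"
  shows "integrable I01 (\<lambda>y. bubble y * p y)"
proof (rule Bochner_Integration.integrable_bound[OF assms])
  show "(\<lambda>y. bubble y * p y) \<in> borel_measurable I01"
    by (intro borel_measurable_times[OF _ borel_measurable_integrable[OF assms]] continuous_measurable_I01' continuous_intros)
  have "bubble y \<le> 1" if "0 < y" "y < 1" for y :: real using that by (intro mult_le_one) auto
  then show "AE y in I01. norm (bubble y * p y) \<le> norm (p y)"
    by (intro AE_I01_I) (auto simp: abs_mult intro!: mult_left_le_one_le mult_le_one)
qed

text \<open>A quantitative strong maximum principle with Hopf boundary behaviour, read off from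
  \<open>bubble x * bubble y \<le> green x y\<close>.\<close>

lemma Kop_ge_bubble:
  assumes "integrable I01 p" "\<And>y. 0 < y \<Longrightarrow> y < 1 \<Longrightarrow> 0 \<le> p y" "x \<in> {0..1}"
  shows "bubble x * (\<integral>y. bubble y * p y \<partial>I01) \<le> Kop p x"
proof -
  have "(\<integral>y. bubble x * (bubble y * p y) \<partial>I01) \<le> (\<integral>y. green x y * p y \<partial>I01)"
  proof (intro integral_mono_AE AE_I01_I green_integrable integrable_mult_right bubble_integrable assms)
    fix y :: real assume "0 < y" "y < 1"
    then have "bubble x * bubble y * p y \<le> green x y * p y"
      using green_bounds(4)[OF assms(3), of y] assms(2) by (intro mult_right_mono) auto
    then show "bubble x * (bubble y * p y) \<le> green x y * p y" by (simp only: mult.assoc)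
  qed
  then show ?thesis using assms(3) by (simp add: Kop_def)
qed

text \<open>The three bounds serve different ends: boundary decay, control by an integral that
  ignores boundary singularities, and the plain sup bound.\<close>

lemma Kop_abs_le:
  assumes "integrable I01 p" "x \<in> {0..1}"
  shows "\<bar>Kop p x\<bar> \<le> bubble x * (\<integral>y. \<bar>p y\<bar> \<partial>I01)" "\<bar>Kop p x\<bar> \<le> (\<integral>y. bubble y * \<bar>p y\<bar> \<partial>I01)"
    "\<bar>Kop p x\<bar> \<le> (\<integral>y. \<bar>p y\<bar> \<partial>I01)"
proof -
  have a: "\<bar>Kop p x\<bar> \<le> (\<integral>y. \<bar>green x y * p y\<bar> \<partial>I01)"
    using assms integral_abs_bound[of I01 "\<lambda>y. green x y * p y"] by (simp add: Kop_def)
  have i: "integrable I01 (\<lambda>y. \<bar>green x y * p y\<bar>)" using green_integrable[OF assms] by simp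
  have "(\<integral>y. \<bar>green x y * p y\<bar> \<partial>I01) \<le> (\<integral>y. bubble x * \<bar>p y\<bar> \<partial>I01)"
    using i assms green_bounds[OF assms(2)]
    by (intro integral_mono_AE AE_I01_I) (auto simp: abs_mult intro: mult_right_mono)
  then show 1: "\<bar>Kop p x\<bar> \<le> bubble x * (\<integral>y. \<bar>p y\<bar> \<partial>I01)" using a by simp
  have "(\<integral>y. \<bar>green x y * p y\<bar> \<partial>I01) \<le> (\<integral>y. bubble y * \<bar>p y\<bar> \<partial>I01)"
    using i assms green_bounds[OF assms(2)] bubble_integrable[OF integrable_abs[OF assms(1)]]
    by (intro integral_mono_AE AE_I01_I) (auto simp: abs_mult intro: mult_right_mono)
  then show "\<bar>Kop p x\<bar> \<le> (\<integral>y. bubble y * \<bar>p y\<bar> \<partial>I01)" using a by simp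
  have "bubble x \<le> 1" using assms(2) by (intro mult_le_one) auto
  then have "bubble x * (\<integral>y. \<bar>p y\<bar> \<partial>I01) \<le> 1 * (\<integral>y. \<bar>p y\<bar> \<partial>I01)"
    by (intro mult_right_mono) auto
  with 1 show "\<bar>Kop p x\<bar> \<le> (\<integral>y. \<bar>p y\<bar> \<partial>I01)" by simp
qed

lemma Kop_lipschitz:
  assumes "integrable I01 p" "x \<in> {0..1}" "x' \<in> {0..1}"
  shows "\<bar>Kop p x - Kop p x'\<bar> \<le> \<bar>x - x'\<bar> * (\<integral>y. \<bar>p y\<bar> \<partial>I01)"
proof -
  have "\<bar>Kop p x - Kop p x'\<bar> = \<bar>\<integral>y. (green x y - green x' y) * p y \<partial>I01\<bar>"
    using assms green_integrable by (simp add: Kop_def left_diff_distrib)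
  also have "\<dots> \<le> (\<integral>y. \<bar>(green x y - green x' y) * p y\<bar> \<partial>I01)" by (rule integral_abs_bound)
  also have "\<dots> \<le> (\<integral>y. \<bar>x - x'\<bar> * \<bar>p y\<bar> \<partial>I01)"
  proof (intro integral_mono_AE AE_I01_I)
    show "integrable I01 (\<lambda>y. \<bar>(green x y - green x' y) * p y\<bar>)"
      unfolding left_diff_distrib using assms green_integrable by auto
    show "\<bar>(green x y - green x' y) * p y\<bar> \<le> \<bar>x - x'\<bar> * \<bar>p y\<bar>" if "0 < y" "y < 1" for y
      unfolding abs_mult using green_diff that by (intro mult_right_mono) auto
  qed (use assms in auto)
  finally show ?thesis by simp
qed

lemma Kop_limit:
  assumes s: "\<And>n. s n \<in> borel_measurable I01" "p \<in> borel_measurable I01" and w: "integrable I01 w"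
    and b: "\<And>n y. 0 < y \<Longrightarrow> y < 1 \<Longrightarrow> \<bar>s n y\<bar> \<le> w y"
    and l: "\<And>y. 0 < y \<Longrightarrow> y < 1 \<Longrightarrow> (\<lambda>n. s n y) \<longlonglongrightarrow> p y"
  shows "(\<lambda>n. Kop (s n) x) \<longlonglongrightarrow> Kop p x"
proof (cases "x \<in> {0..1}")
  case True
  have "(\<lambda>n. \<integral>y. green x y * s n y \<partial>I01) \<longlonglongrightarrow> (\<integral>y. green x y * p y \<partial>I01)"
  proof (rule integral_dominated_convergence[OF _ _ w])
    show "AE y in I01. norm (green x y * s n y) \<le> w y" for n
    proof (rule AE_I01_I)
      fix y :: real assume y: "0 < y" "y < 1"
      have "\<bar>green x y\<bar> * \<bar>s n y\<bar> \<le> 1 * w y" using green_bounds(5)[OF True, of y] y b[OF y] by (intro mult_mono) auto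
      then show "norm (green x y * s n y) \<le> w y" by (simp add: abs_mult)
    qed
    show "AE y in I01. (\<lambda>n. green x y * s n y) \<longlonglongrightarrow> green x y * p y"
      by (intro AE_I01_I tendsto_mult tendsto_const l)
  qed (intro borel_measurable_times green_measurable s)+
  then show ?thesis using True by (simp add: Kop_def)
next
  case False
  then show ?thesis by (simp only: Kop_outside tendsto_const not_False_eq_True)
qed

text \<open>The kernel is the derivative of \<open>green x y\<close> in \<open>x\<close>. As a
  function of \<open>x\<close> it drops from \<open>1 - y\<close> to \<open>- y\<close> at
  \<open>x = y\<close>.\<close>

definition Kder :: "(real \<Rightarrow> real) \<Rightarrow> real \<Rightarrow> real" where
  "Kder p x = (\<integral>y. ((if x < y then 1 else 0) - y) * p y \<partial>I01)"

lemma ident_measurable_I01: "(\<lambda>x. x) \<in> measurable I01 borel"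
  by (rule borel_measurable_I01I) simp

lemma if_less_measurable: "(\<lambda>y::real. if x < y then 1 else (0::real)) \<in> borel_measurable I01"
  by (rule borel_measurable_I01I) measurable

lemma Kder_continuous:
  assumes p: "integrable I01 p"
  shows "continuous_on UNIV (Kder p)"
proof (rule continuous_on_sequentiallyI)
  fix s :: "nat \<Rightarrow> real" and x assume s: "s \<longlonglongrightarrow> x"
  show "(\<lambda>n. Kder p (s n)) \<longlonglongrightarrow> Kder p x"
    unfolding Kder_def
  proof (rule integral_dominated_convergence[where w = "\<lambda>y. \<bar>p y\<bar>"])
    have m: "(\<lambda>y. ((if x < y then 1 else 0) - y) * p y) \<in> borel_measurable I01" for x
      using p by (intro borel_measurable_times borel_measurable_diff if_less_measurable ident_measurable_I01) auto
    show "(\<lambda>y. ((if x < y then 1 else 0) - y) * p y) \<in> borel_measurable I01"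
     "\<And>n. (\<lambda>y. ((if s n < y then 1 else 0) - y) * p y) \<in> borel_measurable I01" by (rule m)+
    show "AE y in I01. norm (((if s n < y then 1 else 0) - y) * p y) \<le> \<bar>p y\<bar>" for n
      by (intro AE_I01_I) (auto simp: abs_mult intro!: mult_left_le_one_le)
    show "AE y in I01. (\<lambda>n. ((if s n < y then 1 else 0) - y) * p y) \<longlonglongrightarrow> ((if x < y then 1 else 0) - y) * p y"
      using AE_I01_neq[of x]
    proof eventually_elim
      case (elim y)
      have "\<forall>\<^sub>F n in sequentially. (s n < y) = (x < y)"
      proof (cases "x < y")
        case True then show ?thesis using order_tendstoD(2)[OF s True] by (auto elim: eventually_mono)
      next
        case False then have "y < x" using elim by simp
        from order_tendstoD(1)[OF s this] show ?thesis by (rule eventually_mono) (use False in auto)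
      qed
      then have "\<forall>\<^sub>F n in sequentially. ((if s n < y then 1 else 0) - y) * p y = ((if x < y then 1 else 0) - y) * p y"
        by (rule eventually_mono) auto
      then show ?case by (rule tendsto_eventually)
    qed
  qed (use p in auto)
qed

text \<open>Differentiation under the integral sign: the difference quotients of the kernel are
  bounded by 1 and eventually constant for every \<open>y \<noteq> x\<close>.\<close>

lemma Kop_has_derivative:
  assumes p: "integrable I01 p" and x: "x \<in> {0..1}"
  shows "(Kop p has_real_derivative Kder p x) (at x within {0..1})"
  unfolding has_field_derivative_iff tendsto_at_iff_sequentially comp_def
proof (intro allI impI)
  fix s :: "nat \<Rightarrow> real" assume s01: "\<forall>n. s n \<in> {0..1} - {x}" and s: "s \<longlonglongrightarrow> x"
  have i: "integrable I01 (\<lambda>y. green z y * p y)" if "z \<in> {0..1}" for z by (rule green_integrable[OF p that])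
  have "(\<lambda>n. \<integral>y. (green (s n) y - green x y) / (s n - x) * p y \<partial>I01) \<longlonglongrightarrow> Kder p x"
    unfolding Kder_def
  proof (rule integral_dominated_convergence[where w = "\<lambda>y. \<bar>p y\<bar>"])
    show "(\<lambda>y. ((if x < y then 1 else 0) - y) * p y) \<in> borel_measurable I01"
      using p by (intro borel_measurable_times borel_measurable_diff if_less_measurable ident_measurable_I01) auto
    show "(\<lambda>y. (green (s n) y - green x y) / (s n - x) * p y) \<in> borel_measurable I01" for n
      using p by (intro borel_measurable_times borel_measurable_diff borel_measurable_divide green_measurable) auto
    show "AE y in I01. norm ((green (s n) y - green x y) / (s n - x) * p y) \<le> \<bar>p y\<bar>" for n
    proof (rule AE_I01_I)
      fix y :: real assume "0 < y" "y < 1"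
      then have "\<bar>(green (s n) y - green x y) / (s n - x)\<bar> \<le> 1"
        using green_diff[of y "s n" x] s01 by (auto simp: divide_le_eq)
      then show "norm ((green (s n) y - green x y) / (s n - x) * p y) \<le> \<bar>p y\<bar>"
        unfolding real_norm_def abs_mult by (intro mult_left_le_one_le) auto
    qed
    show "AE y in I01. (\<lambda>n. (green (s n) y - green x y) / (s n - x) * p y) \<longlonglongrightarrow> ((if x < y then 1 else 0) - y) * p y"
      using AE_I01_neq[of x]
    proof eventually_elim
      case (elim y)
      have ne: "s n - x \<noteq> 0" for n using s01 by auto
      have "\<forall>\<^sub>F n in sequentially. (green (s n) y - green x y) / (s n - x) = (if x < y then 1 else 0) - y"
      proof (cases "x < y")
        case True
        from order_tendstoD(2)[OF s True] show ?thesis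
          by (rule eventually_mono) (use True ne in \<open>auto simp: green_def field_simps\<close>)
      next
        case False then have yx: "y < x" using elim by simp
        from order_tendstoD(1)[OF s yx] show ?thesis
          by (rule eventually_mono) (use False ne in \<open>auto simp: green_def field_simps\<close>)
      qed
      then have "\<forall>\<^sub>F n in sequentially. (green (s n) y - green x y) / (s n - x) * p y = ((if x < y then 1 else 0) - y) * p y"
        by (rule eventually_mono) auto
      then show ?case by (rule tendsto_eventually)
    qed
  qed (use p in auto)
  moreover have "(\<integral>y. (green (s n) y - green x y) / (s n - x) * p y \<partial>I01) = (Kop p (s n) - Kop p x) / (s n - x)" for n
  proof -
    have "(\<lambda>y. (green (s n) y - green x y) / (s n - x) * p y) = (\<lambda>y. (green (s n) y * p y - green x y * p y) / (s n - x))"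
      by (auto simp: field_simps)
    moreover have "s n \<in> {0..1}" using s01 by auto
    ultimately show ?thesis using x i[of x] i[of "s n"] by (simp add: Kop_def)
  qed
  ultimately show "(\<lambda>n. (Kop p (s n) - Kop p x) / (s n - x)) \<longlonglongrightarrow> Kder p x" by (simp only:)
qed

text \<open>Mere integrability of \<open>p\<close> suffices for C^1 up to the boundary, which admits
  right-hand sides that blow up at the endpoints.\<close>

lemma Kop_H01:
  assumes "integrable I01 p"
  shows "Kop p \<in> H01" "AE x in I01. wderiv (Kop p) x = Kder p x"
proof -
  have c: "continuous_on {0..1} (Kder p)" using Kder_continuous[OF assms] continuous_on_subset by blast
  show "Kop p \<in> H01"
    by (rule H01_C1I[OF Kop_has_derivative[OF assms] c]) (auto simp: Kop_outside)
  show "AE x in I01. wderiv (Kop p) x = Kder p x"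
    by (rule H1_norm_C1(1)[OF Kop_has_derivative[OF assms] c])
qed

lemma Kop_continuous:
  assumes "integrable I01 p" shows "continuous_on {0..1} (Kop p)"
  using H01_D(1)[OF Kop_H01(1)[OF assms]] .

section \<open>Symmetry and the weak formulation of the Green operator\<close>

interpretation I01_pair: pair_sigma_finite I01 I01 ..

lemma Fubini_kernel:
  fixes a b :: "real \<Rightarrow> real" and k :: "real \<Rightarrow> real \<Rightarrow> real"
  assumes a: "integrable I01 a" and b: "integrable I01 b"
    and k: "(\<lambda>(s, y). k s y) \<in> borel_measurable (I01 \<Otimes>\<^sub>M I01)"
    and k1: "\<And>s y. 0 < s \<Longrightarrow> s < 1 \<Longrightarrow> 0 < y \<Longrightarrow> y < 1 \<Longrightarrow> \<bar>k s y\<bar> \<le> 1"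
  shows "(\<integral>s. a s * (\<integral>y. k s y * b y \<partial>I01) \<partial>I01) = (\<integral>y. b y * (\<integral>s. k s y * a s \<partial>I01) \<partial>I01)"
proof -
  have [measurable]: "a \<in> borel_measurable I01" "b \<in> borel_measurable I01" using a b by auto
  note k[measurable]
  have km: "(\<lambda>y. k s y) \<in> borel_measurable I01" if "0 < s" "s < 1" for s
    using measurable_compose[OF measurable_Pair1' k, of s] that by simp
  have kb: "integrable I01 (\<lambda>y. \<bar>k s y * (a s * b y)\<bar>)"
    "(\<integral>y. \<bar>k s y * (a s * b y)\<bar> \<partial>I01) \<le> \<bar>a s\<bar> * (\<integral>y. \<bar>b y\<bar> \<partial>I01)" if s: "0 < s" "s < 1" for s
  proof -
    have le: "\<bar>k s y * (a s * b y)\<bar> \<le> \<bar>a s\<bar> * \<bar>b y\<bar>" if "0 < y" "y < 1" for y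
      unfolding abs_mult using k1[OF s that] by (intro mult_left_le_one_le) auto
    show 1: "integrable I01 (\<lambda>y. \<bar>k s y * (a s * b y)\<bar>)"
    proof (rule Bochner_Integration.integrable_bound[of _ "\<lambda>y. \<bar>a s\<bar> * \<bar>b y\<bar>"])
      show "(\<lambda>y. \<bar>k s y * (a s * b y)\<bar>) \<in> borel_measurable I01" using km[OF s] by measurable
    qed (use b le in \<open>auto intro!: AE_I01_I\<close>)
    have "(\<integral>y. \<bar>k s y * (a s * b y)\<bar> \<partial>I01) \<le> (\<integral>y. \<bar>a s\<bar> * \<bar>b y\<bar> \<partial>I01)"
      using b le 1 by (intro integral_mono_AE AE_I01_I) auto
    then show "(\<integral>y. \<bar>k s y * (a s * b y)\<bar> \<partial>I01) \<le> \<bar>a s\<bar> * (\<integral>y. \<bar>b y\<bar> \<partial>I01)" by simp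
  qed
  have I: "integrable (I01 \<Otimes>\<^sub>M I01) (\<lambda>(s, y). k s y * (a s * b y))"
  proof (rule I01_pair.Fubini_integrable)
    show m: "(\<lambda>(s, y). k s y * (a s * b y)) \<in> borel_measurable (I01 \<Otimes>\<^sub>M I01)" by measurable
    show "AE s in I01. integrable I01 (\<lambda>y. case (s, y) of (s, y) \<Rightarrow> k s y * (a s * b y))"
    proof (rule AE_I01_I)
      fix s :: real assume s: "0 < s" "s < 1"
      have "(\<lambda>y. k s y * (a s * b y)) \<in> borel_measurable I01" using km[OF s] by measurable
      then show "integrable I01 (\<lambda>y. case (s, y) of (s, y) \<Rightarrow> k s y * (a s * b y))"
        using kb(1)[OF s] by (simp add: integrable_abs_iff)
    qed
    show "integrable I01 (\<lambda>s. \<integral>y. norm (case (s, y) of (s, y) \<Rightarrow> k s y * (a s * b y)) \<partial>I01)"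
    proof (rule Bochner_Integration.integrable_bound[of _ "\<lambda>s. \<bar>a s\<bar> * (\<integral>y. \<bar>b y\<bar> \<partial>I01)"])
      have "(\<lambda>(s, y). \<bar>k s y * (a s * b y)\<bar>) \<in> borel_measurable (I01 \<Otimes>\<^sub>M I01)" by measurable
      from I01.borel_measurable_lebesgue_integral[OF this]
      show "(\<lambda>s. \<integral>y. norm (case (s, y) of (s, y) \<Rightarrow> k s y * (a s * b y)) \<partial>I01) \<in> borel_measurable I01"
        by simp
      show "AE s in I01. norm (\<integral>y. norm (case (s, y) of (s, y) \<Rightarrow> k s y * (a s * b y)) \<partial>I01)
          \<le> norm (\<bar>a s\<bar> * (\<integral>y. \<bar>b y\<bar> \<partial>I01))"
        using kb(2) by (intro AE_I01_I) (auto simp: abs_mult)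
    qed (use a in auto)
  qed
  have "(\<integral>s. a s * (\<integral>y. k s y * b y \<partial>I01) \<partial>I01) = (\<integral>s. (\<integral>y. k s y * (a s * b y) \<partial>I01) \<partial>I01)"
  proof (rule Bochner_Integration.integral_cong[OF refl])
    fix s
    have "(\<lambda>y. k s y * (a s * b y)) = (\<lambda>y. a s * (k s y * b y))" by (auto simp: ac_simps)
    then show "a s * (\<integral>y. k s y * b y \<partial>I01) = (\<integral>y. k s y * (a s * b y) \<partial>I01)" by simp
  qed
  also have "\<dots> = (\<integral>y. (\<integral>s. k s y * (a s * b y) \<partial>I01) \<partial>I01)"
    using I01_pair.Fubini_integral[OF I] by simp
  also have "\<dots> = (\<integral>y. b y * (\<integral>s. k s y * a s \<partial>I01) \<partial>I01)"
  proof (rule Bochner_Integration.integral_cong[OF refl])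
    fix y
    have "(\<lambda>s. k s y * (a s * b y)) = (\<lambda>s. b y * (k s y * a s))" by (auto simp: ac_simps)
    then show "(\<integral>s. k s y * (a s * b y) \<partial>I01) = b y * (\<integral>s. k s y * a s \<partial>I01)" by simp
  qed
  finally show ?thesis .
qed

lemma Kop_symmetric:
  assumes "integrable I01 p" "integrable I01 r"
  shows "(\<integral>x. r x * Kop p x \<partial>I01) = (\<integral>x. p x * Kop r x \<partial>I01)"
proof -
  note ident_measurable_I01[measurable]
  have "(\<integral>x. r x * (\<integral>y. green x y * p y \<partial>I01) \<partial>I01) = (\<integral>y. p y * (\<integral>x. green x y * r x \<partial>I01) \<partial>I01)"
  proof (rule Fubini_kernel[OF assms(2,1)])
    show "(\<lambda>(x, y). green x y) \<in> borel_measurable (I01 \<Otimes>\<^sub>M I01)"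
      unfolding green_def by measurable
  qed (rule green_bounds(5), auto)
  moreover have "(\<integral>x. r x * Kop p x \<partial>I01) = (\<integral>x. r x * (\<integral>y. green x y * p y \<partial>I01) \<partial>I01)"
    by (intro Bochner_Integration.integral_cong) (auto simp: Kop_def)
  moreover have "(\<integral>x. p x * Kop r x \<partial>I01) = (\<integral>y. p y * (\<integral>x. green x y * r x \<partial>I01) \<partial>I01)"
    by (intro Bochner_Integration.integral_cong) (auto simp: Kop_def green_sym)
  ultimately show ?thesis by simp
qed

text \<open>After exchanging the integrals, the kernel of \<open>Kder\<close> acts on the derivative
  of \<open>\<zeta>\<close>: the indicator part recovers \<open>\<zeta> y\<close> and the part
  \<open>- y\<close> multiplies the mean of that derivative, which is 0.\<close>

lemma Kop_weak:
  assumes p: "integrable I01 p" and z: "\<zeta> \<in> H01"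
  shows "(\<integral>x. wderiv (Kop p) x * wderiv \<zeta> x \<partial>I01) = (\<integral>x. p x * \<zeta> x \<partial>I01)"
proof -
  note ident_measurable_I01[measurable]
  note d = H01_D[OF z]
  have iz: "integrable I01 (wderiv \<zeta>)" by (rule L2_integrable[OF d(5)])
  have K: "L2 (wderiv (Kop p))" using H01_D[OF Kop_H01(1)[OF p]] by simp
  have "(\<integral>x. wderiv (Kop p) x * wderiv \<zeta> x \<partial>I01) = (\<integral>x. wderiv \<zeta> x * Kder p x \<partial>I01)"
  proof (rule integral_cong_AE)
    show "AE x in I01. wderiv (Kop p) x * wderiv \<zeta> x = wderiv \<zeta> x * Kder p x"
      using Kop_H01(2)[OF p] by eventually_elim simp
    show "(\<lambda>x. wderiv (Kop p) x * wderiv \<zeta> x) \<in> borel_measurable I01"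
      using K d(5) unfolding L2_iff by (intro borel_measurable_times) auto
    show "(\<lambda>x. wderiv \<zeta> x * Kder p x) \<in> borel_measurable I01"
      using d(5) unfolding L2_iff
      by (intro borel_measurable_times[OF _ continuous_measurable_I01'[OF continuous_on_subset[OF Kder_continuous[OF p]]]]) auto
  qed
  also have "\<dots> = (\<integral>y. p y * (\<integral>s. ((if s < y then 1 else 0) - y) * wderiv \<zeta> s \<partial>I01) \<partial>I01)"
    unfolding Kder_def by (rule Fubini_kernel[OF iz p]) auto
  also have "\<dots> = (\<integral>x. p x * \<zeta> x \<partial>I01)"
  proof (rule Bochner_Integration.integral_cong[OF refl])
    fix y assume "y \<in> space I01"
    then have y: "0 < y" "y < 1" by auto
    have eq: "(\<lambda>s. indicator {..<y} s * wderiv \<zeta> s) = (\<lambda>s. (if s < y then 1 else 0) * wderiv \<zeta> s)" for y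
      by (auto simp: indicator_def)
    have i: "integrable I01 (\<lambda>s. (if s < y then 1 else 0) * wderiv \<zeta> s)"
      using integrable_mult_indicator_I01[OF iz, of "{..<y}"] unfolding eq by simp
    have "\<zeta> 1 = integral\<^sup>L I01 (wderiv \<zeta>)"
      unfolding H01_FTC[OF z, of 1, simplified]
      by (rule Bochner_Integration.integral_cong) (auto simp: indicator_def)
    then have 0: "integral\<^sup>L I01 (wderiv \<zeta>) = 0" using H01_boundary[OF z] by simp
    have "(\<integral>s. ((if s < y then 1 else 0) - y) * wderiv \<zeta> s \<partial>I01)
        = (\<integral>s. (if s < y then 1 else 0) * wderiv \<zeta> s \<partial>I01) - y * integral\<^sup>L I01 (wderiv \<zeta>)"
      unfolding left_diff_distrib using i iz by simp
    also have "\<dots> = \<zeta> y" using H01_FTC[OF z, of y] y 0 by (simp add: eq)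
    finally show "p y * (\<integral>s. ((if s < y then 1 else 0) - y) * wderiv \<zeta> s \<partial>I01) = p y * \<zeta> y" by simp
  qed
  finally show ?thesis .
qed

lemma AE_I01_ex:
  assumes "AE x in I01. P x" "0 \<le> a" "a < b" "b \<le> 1"
  shows "\<exists>x\<in>{a<..<b}. P x"
proof (rule ccontr)
  assume n: "\<not> (\<exists>x\<in>{a<..<b}. P x)"
  from assms(1) have "AE x in lborel. x \<in> {0<..<1} \<longrightarrow> P x" by (simp only: AE_I01)
  then have "AE x in lborel. x \<notin> {a<..<b}"
    by eventually_elim (use n assms in auto)
  then have "emeasure lborel {a<..<b} = 0"
    by (rule AE_iff_measurable[THEN iffD1, rotated 2]) (auto simp: set_eq_iff)
  then show False using assms by simp
qed

lemma integral_I01_pos: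
  fixes p :: "real \<Rightarrow> real"
  assumes p: "integrable I01 p" "AE y in I01. 0 \<le> p y"
    and ab: "0 \<le> a" "a < b" "b \<le> 1" and pos: "AE y in I01. y \<in> {a<..<b} \<longrightarrow> 0 < p y"
  shows "0 < integral\<^sup>L I01 p"
proof (rule ccontr)
  assume "\<not> 0 < integral\<^sup>L I01 p"
  then have "integral\<^sup>L I01 p = 0" using integral_nonneg_AE[OF p(2)] by simp
  then have "AE y in I01. p y = 0" using integral_nonneg_eq_0_iff_AE[OF p] by simp
  with pos have "AE y in I01. y \<notin> {a<..<b}" by eventually_elim auto
  then show False using AE_I01_ex[OF _ ab, of "\<lambda>y. y \<notin> {a<..<b}"] by auto
qed

lemma continuous_pos_interval:
  fixes p :: "real \<Rightarrow> real"
  assumes "continuous_on {0..1} p" "x0 \<in> {0..1}" "p x0 > 0"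
  obtains a b where "0 \<le> a" "a < b" "b \<le> 1" "\<And>y. y \<in> {a<..<b} \<Longrightarrow> p y > 0"
proof -
  have "\<exists>d>0. \<forall>x\<in>{0..1}. dist x x0 < d \<longrightarrow> dist (p x) (p x0) < p x0"
    using assms unfolding continuous_on_iff by blast
  then obtain d where d: "d > 0" "\<And>x. x \<in> {0..1} \<Longrightarrow> \<bar>x - x0\<bar> < d \<Longrightarrow> \<bar>p x - p x0\<bar> < p x0"
    unfolding dist_real_def by blast
  have "p y > 0" if "y \<in> {max 0 (x0 - d)<..<min 1 (x0 + d)}" for y
    using d(2)[of y] that by (auto simp: abs_less_iff)
  moreover have "max 0 (x0 - d) < min 1 (x0 + d)" using d(1) assms by auto
  ultimately show thesis using that[of "max 0 (x0 - d)" "min 1 (x0 + d)"] by auto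
qed

lemma integral_I01_pos_continuous:
  fixes p :: "real \<Rightarrow> real"
  assumes "continuous_on {0..1} p" "\<And>x. 0 < x \<Longrightarrow> x < 1 \<Longrightarrow> 0 \<le> p x" "x0 \<in> {0..1}" "p x0 > 0"
  shows "0 < integral\<^sup>L I01 p"
proof -
  obtain a b where "0 \<le> a" "a < b" "b \<le> 1" "\<And>y. y \<in> {a<..<b} \<Longrightarrow> p y > 0"
    by (rule continuous_pos_interval[OF assms(1,3,4)]) auto
  then show ?thesis
    using assms by (intro integral_I01_pos[of p a b] integrable_I01_continuous) (auto intro!: AE_I01_I AE_I2)
qed

text \<open>The Lagrange identity: on either side of \<open>x\<close> the kernel is affine in
  \<open>y\<close>, so its product with \<open>\<phi>''\<close> is an exact derivative. The terms
  with \<open>\<phi>' x\<close> cancel and \<open>(1 - x) * \<phi> x + x * \<phi> x\<close>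
  remains.\<close>

lemma Kop_inverse:
  assumes d1: "\<And>x. x \<in> {0..1} \<Longrightarrow> (\<phi> has_real_derivative \<phi>' x) (at x within {0..1})"
    and d2: "\<And>x. x \<in> {0..1} \<Longrightarrow> (\<phi>' has_real_derivative \<phi>'' x) (at x within {0..1})"
    and c: "continuous_on {0..1} \<phi>''" and b: "\<phi> 0 = 0" "\<phi> 1 = 0" and x: "x \<in> {0..1}"
  shows "Kop (\<lambda>x. - \<phi>'' x) x = \<phi> x"
proof -
  have i: "integrable I01 (\<lambda>y. - \<phi>'' y)" by (intro integrable_I01_continuous continuous_intros c)
  \<comment> \<open>Antiderivatives of the integrand to the left and to the right of
    \<open>x\<close>.\<close>
  define F1 where "F1 y = - (1 - x) * (y * \<phi>' y - \<phi> y)" for y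
  define F2 where "F2 y = - x * ((1 - y) * \<phi>' y + \<phi> y)" for y
  have 1: "(\<integral>y. indicator {0<..x} y * (- (1 - x) * (y * \<phi>'' y)) \<partial>I01) = F1 x - F1 0"
  proof (rule integral_I01_FTC)
    fix y assume y: "y \<in> {0..x}"
    show "(F1 has_real_derivative - (1 - x) * (y * \<phi>'' y)) (at y within {0..x})"
      unfolding F1_def
      by (rule derivative_eq_intros DERIV_subset[OF d1[of y], of "{0..x}"] DERIV_subset[OF d2[of y], of "{0..x}"] refl
         | (use y x in force) | (use y x in \<open>simp add: algebra_simps\<close>))+
  qed (use x in \<open>auto intro!: continuous_intros continuous_on_subset[OF c]\<close>)
  have 2: "(\<integral>y. indicator {x<..1} y * (- x * ((1 - y) * \<phi>'' y)) \<partial>I01) = F2 1 - F2 x"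
  proof (rule integral_I01_FTC)
    fix y assume y: "y \<in> {x..1}"
    show "(F2 has_real_derivative - x * ((1 - y) * \<phi>'' y)) (at y within {x..1})"
      unfolding F2_def
      by (rule derivative_eq_intros DERIV_subset[OF d1[of y], of "{x..1}"] DERIV_subset[OF d2[of y], of "{x..1}"] refl
         | (use y x in force) | (use y x in \<open>simp add: algebra_simps\<close>))+
  qed (use x in \<open>auto intro!: continuous_intros continuous_on_subset[OF c]\<close>)
  have "Kop (\<lambda>x. - \<phi>'' x) x = (\<integral>y. indicator {0<..x} y * (- (1 - x) * (y * \<phi>'' y))
      + indicator {x<..1} y * (- x * ((1 - y) * \<phi>'' y)) \<partial>I01)"
  proof -
    have "green x y * - \<phi>'' y = indicator {0<..x} y * (- (1 - x) * (y * \<phi>'' y))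
      + indicator {x<..1} y * (- x * ((1 - y) * \<phi>'' y))" if "0 < y" "y < 1" for y
      using that by (cases "y \<le> x") (auto simp: green_def algebra_simps)
    note eq = this
    have "Kop (\<lambda>x. - \<phi>'' x) x = (\<integral>y. green x y * - \<phi>'' y \<partial>I01)" unfolding Kop_def using x by (simp only: if_True)
    also have "\<dots> = (\<integral>y. indicator {0<..x} y * (- (1 - x) * (y * \<phi>'' y))
      + indicator {x<..1} y * (- x * ((1 - y) * \<phi>'' y)) \<partial>I01)"
      by (rule Bochner_Integration.integral_cong[OF refl], rule eq) simp_all
    finally show ?thesis .
  qed
  also have "\<dots> = (F1 x - F1 0) + (F2 1 - F2 x)"
    unfolding 1[symmetric] 2[symmetric]
    by (intro Bochner_Integration.integral_add integrable_mult_indicator_I01 integrable_I01_continuous continuous_intros c) auto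
  also have "\<dots> = \<phi> x" using b by (simp add: F1_def F2_def algebra_simps)
  finally show ?thesis .
qed

section \<open>The first Dirichlet eigenfunction\<close>

abbreviation sin\<pi> :: "real \<Rightarrow> real" where "sin\<pi> x \<equiv> sin (pi * x)"

lemma Kop_sin:
  assumes "x \<in> {0..1}"
  shows "Kop sin\<pi> x = sin\<pi> x / pi\<^sup>2"
proof -
  have "Kop (\<lambda>x. - (- pi\<^sup>2 * sin (pi * x))) x = sin (pi * x)"
  proof (rule Kop_inverse[where \<phi>' = "\<lambda>x. pi * cos (pi * x)"])
    fix x :: real
    show "((\<lambda>x. sin (pi * x)) has_real_derivative pi * cos (pi * x)) (at x within {0..1})"
      by (auto intro!: derivative_eq_intros)
    show "((\<lambda>x. pi * cos (pi * x)) has_real_derivative - pi\<^sup>2 * sin (pi * x)) (at x within {0..1})"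
      by (auto intro!: derivative_eq_intros simp: power2_eq_square)
  qed (use assms in \<open>auto intro!: continuous_intros\<close>)
  then have "pi\<^sup>2 * Kop sin\<pi> x = sin\<pi> x" by (simp add: Kop_cmult)
  then show ?thesis by (simp add: field_simps)
qed

lemma sin_nonneg: "x \<in> {0..1} \<Longrightarrow> sin\<pi> x \<ge> 0"
  by (rule sin_ge_zero) auto

lemma sin_pos: "0 < x \<Longrightarrow> x < 1 \<Longrightarrow> sin\<pi> x > 0"
  by (rule sin_gt_zero) auto

lemma continuous_sin: "continuous_on S sin\<pi>"
  by (intro continuous_intros)

lemma integrable_sin: "integrable I01 sin\<pi>"
  by (intro integrable_I01_continuous continuous_sin)

text \<open>An eigenfunction is a multiple of its own image under \<open>Kop\<close>, so the kernel
  bounds make it comparable to \<open>bubble\<close>, here from above and in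
  \<open>bubble_le_sin\<close> from below.\<close>

lemma sin_le_bubble: "x \<in> {0..1} \<Longrightarrow> sin\<pi> x \<le> pi\<^sup>2 * bubble x"
proof -
  assume x: "x \<in> {0..1}"
  have "\<bar>Kop sin\<pi> x\<bar> \<le> bubble x * (\<integral>y. \<bar>sin\<pi> y\<bar> \<partial>I01)"
    by (rule Kop_abs_le(1)[OF integrable_sin x])
  also have "(\<integral>y. \<bar>sin\<pi> y\<bar> \<partial>I01) \<le> (\<integral>y. 1 \<partial>I01)"
    by (intro integral_mono_AE AE_I2 integrable_abs integrable_sin) auto
  then have "bubble x * (\<integral>y. \<bar>sin\<pi> y\<bar> \<partial>I01) \<le> bubble x * 1" using x by (intro mult_left_mono) auto
  finally have "\<bar>sin\<pi> x / pi\<^sup>2\<bar> \<le> bubble x" unfolding Kop_sin[OF x] by simp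
  then have "sin\<pi> x / pi\<^sup>2 \<le> bubble x" by (rule order_trans[OF abs_ge_self])
  then show ?thesis by (simp only: pos_divide_le_eq[of "pi\<^sup>2"] zero_less_power pi_gt_zero mult.commute)
qed

lemma bubble_le_sin: obtains c where "c > 0" "\<And>x. x \<in> {0..1} \<Longrightarrow> c * bubble x \<le> sin\<pi> x"
proof -
  define c where "c = pi\<^sup>2 * (\<integral>y. bubble y * sin\<pi> y \<partial>I01)"
  have "0 < (\<integral>y. bubble y * sin\<pi> y \<partial>I01)"
    by (rule integral_I01_pos_continuous[where ?x0.0 = "1/2"])
      (auto intro!: continuous_intros mult_nonneg_nonneg sin_nonneg)
  moreover have "c * bubble x \<le> sin\<pi> x" if "x \<in> {0..1}" for x
  proof -
    have "bubble x * (\<integral>y. bubble y * sin\<pi> y \<partial>I01) \<le> sin\<pi> x / pi\<^sup>2"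
      unfolding Kop_sin[OF that, symmetric] by (rule Kop_ge_bubble[OF integrable_sin _ that]) (auto intro: sin_nonneg)
    then have "pi\<^sup>2 * (bubble x * (\<integral>y. bubble y * sin\<pi> y \<partial>I01)) \<le> pi\<^sup>2 * (sin\<pi> x / pi\<^sup>2)"
      by (rule mult_left_mono) simp
    then show ?thesis by (simp add: c_def mult_ac)
  qed
  ultimately show thesis using that[of c] by (simp add: c_def)
qed

lemma Kder_has_derivative:
  assumes p: "continuous_on {0..1} p" and x: "x \<in> {0..1}"
  shows "(Kder p has_real_derivative - p x) (at x within {0..1})"
proof -
  define P where "P x = integral {0..x} p" for x
  have dP: "(P has_real_derivative p y) (at y within {0..1})" if "y \<in> {0..1}" for y
    unfolding P_def by (rule integral_has_real_derivative[OF p that])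
  have ip: "integrable I01 p" by (rule integrable_I01_continuous[OF p])
  define c where "c = (\<integral>y. y * p y \<partial>I01)"
  have eq: "Kder p y = P 1 - P y - c" if y: "y \<in> {0..1}" for y
  proof -
    have "(\<integral>s. indicator {y<..1} s * p s \<partial>I01) = P 1 - P y"
    proof (rule integral_I01_FTC)
      show "(P has_real_derivative p s) (at s within {y..1})" if "s \<in> {y..1}" for s
        by (rule DERIV_subset[OF dP]) (use that y in auto)
    qed (use y in \<open>auto intro: continuous_on_subset[OF p]\<close>)
    moreover have "Kder p y = (\<integral>s. indicator {y<..1} s * p s - s * p s \<partial>I01)"
      unfolding Kder_def by (intro Bochner_Integration.integral_cong) (auto simp: indicator_def algebra_simps)
    moreover have "integrable I01 (\<lambda>s. indicator {y<..1} s * p s)"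
      by (rule integrable_mult_indicator_I01[OF ip]) simp
    moreover have "integrable I01 (\<lambda>s. s * p s)"
      by (intro integrable_I01_continuous continuous_intros p)
    ultimately show ?thesis by (simp add: c_def)
  qed
  have "((\<lambda>y. P 1 - P y - c) has_real_derivative - p x) (at x within {0..1})"
    by (rule derivative_eq_intros dP x refl | simp)+
  then show ?thesis
    by (rule has_field_derivative_transform_within[of _ _ _ _ 1]) (use eq x in auto)
qed

lemma Kop_derivs:
  assumes p: "continuous_on {0..1} p" and x: "x \<in> {0..1}"
  shows "(Kop p has_real_derivative Kder p x) (at x within {0..1})"
    "(Kder p has_real_derivative - p x) (at x within {0..1})"
    "continuous_on {0..1} (Kop p)" "continuous_on {0..1} (Kder p)"
  using Kop_has_derivative[OF integrable_I01_continuous[OF p] x] Kder_has_derivative[OF p x]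
    Kop_continuous[OF integrable_I01_continuous[OF p]]
    continuous_on_subset[OF Kder_continuous[OF integrable_I01_continuous[OF p]]] by auto

text \<open>The difference of the two sides is the integral of the square of
  \<open>Kder r - Kop r * Kder p / (Kop p + e)\<close>. The shift \<open>e\<close> keeps the quotient regular at the endpoints,
  where \<open>Kop p\<close> vanishes.\<close>

lemma picone:
  assumes r: "continuous_on {0..1} r" and p: "continuous_on {0..1} p"
    and p0: "\<And>x. x \<in> {0..1} \<Longrightarrow> 0 \<le> p x" and e: "e > 0"
  shows "(\<integral>x. (Kop r x)\<^sup>2 * p x / (Kop p x + e) \<partial>I01) \<le> (\<integral>x. r x * Kop r x \<partial>I01)"
proof -
  have z: "Kop p x + e > 0" for x using Kop_nonneg[of p x] p0 e by (simp add: add_nonneg_pos)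
  note ar = Kop_derivs[OF r] and zp = Kop_derivs[OF p]
  define D where "D x = r x * Kop r x - (Kop r x)\<^sup>2 * p x / (Kop p x + e)
     - (Kder r x - Kop r x * Kder p x / (Kop p x + e))\<^sup>2" for x
  have cz: "\<forall>x\<in>{0..1}. Kop p x + e \<noteq> 0" using z by (metis less_irrefl)
  have cD: "continuous_on {0..1} D" unfolding D_def
    by (intro continuous_intros r p ar(3,4)[of 0] zp(3,4)[of 0] cz) auto
  have "integral\<^sup>L I01 D = (Kop r 1)\<^sup>2 * Kder p 1 / (Kop p 1 + e) - Kop r 1 * Kder r 1
     - ((Kop r 0)\<^sup>2 * Kder p 0 / (Kop p 0 + e) - Kop r 0 * Kder r 0)"
  proof (rule integral_I01_FTC01[OF _ cD])
    fix x :: real assume x: "x \<in> {0..1}"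
    have "((\<lambda>x. (Kop r x)\<^sup>2 * Kder p x / (Kop p x + e) - Kop r x * Kder r x) has_real_derivative
      ((2 * Kop r x * Kder r x * Kder p x + (Kop r x)\<^sup>2 * (- p x)) * (Kop p x + e) -
        (Kop r x)\<^sup>2 * Kder p x * Kder p x) / ((Kop p x + e) * (Kop p x + e))
       - (Kder r x * Kder r x + Kop r x * (- r x))) (at x within {0..1})"
      using z[of x] by (auto intro!: derivative_eq_intros ar(1)[OF x] ar(2)[OF x] zp(1)[OF x] zp(2)[OF x]
          simp: power2_eq_square algebra_simps)
    also have "((2 * Kop r x * Kder r x * Kder p x + (Kop r x)\<^sup>2 * (- p x)) * (Kop p x + e) -
        (Kop r x)\<^sup>2 * Kder p x * Kder p x) / ((Kop p x + e) * (Kop p x + e))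
       - (Kder r x * Kder r x + Kop r x * (- r x)) = D x"
    proof -
      have "((2 * a * a' * z' + a\<^sup>2 * (- t)) * w - a\<^sup>2 * z' * z') / (w * w) - (a' * a' + a * (- s))
         = s * a - a\<^sup>2 * t / w - (a' - a * z' / w)\<^sup>2" if "w \<noteq> 0" for a a' z' t w s :: real
        using that by (simp add: field_simps power2_eq_square)
      then show ?thesis unfolding D_def using z[of x] by simp
    qed
    finally show "((\<lambda>x. (Kop r x)\<^sup>2 * Kder p x / (Kop p x + e) - Kop r x * Kder r x) has_real_derivative D x)
       (at x within {0..1})" .
  qed
  then have "integral\<^sup>L I01 D = 0" by simp
  moreover have "integral\<^sup>L I01 D \<le> (\<integral>x. r x * Kop r x - (Kop r x)\<^sup>2 * p x / (Kop p x + e) \<partial>I01)"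
    by (intro integral_mono_AE AE_I2 integrable_I01_continuous cD continuous_intros r p ar(3,4)[of 0] zp(3,4)[of 0] cz)
      (auto simp: D_def)
  moreover have "integrable I01 (\<lambda>x. r x * Kop r x)" "integrable I01 (\<lambda>x. (Kop r x)\<^sup>2 * p x / (Kop p x + e))"
    by (intro integrable_I01_continuous continuous_intros r p ar(3,4)[of 0] zp(3,4)[of 0] cz; simp)+
  ultimately show ?thesis by simp
qed

text \<open>Integration by parts identifies the right-hand side with the Dirichlet energy of
  \<open>Kop r\<close>, which controls the maximum.\<close>

lemma Kop_energy_bound:
  assumes r: "continuous_on {0..1} r" and x: "x \<in> {0..1}"
  shows "(Kop r x)\<^sup>2 \<le> (\<integral>x. r x * Kop r x \<partial>I01)"
proof -
  note ar = Kop_derivs[OF r]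
  have c: "continuous_on {0..1} (\<lambda>x. (Kder r x)\<^sup>2 - r x * Kop r x)"
    by (intro continuous_intros r ar(3,4)[OF x])
  have "(\<integral>x. (Kder r x)\<^sup>2 - r x * Kop r x \<partial>I01) = Kop r 1 * Kder r 1 - Kop r 0 * Kder r 0"
    by (rule integral_I01_FTC01[OF _ c])
      (auto intro!: derivative_eq_intros ar(1) ar(2) simp: power2_eq_square algebra_simps)
  moreover have "integrable I01 (\<lambda>x. (Kder r x)\<^sup>2)" "integrable I01 (\<lambda>x. r x * Kop r x)"
    by (intro integrable_I01_continuous continuous_intros r ar(3,4)[OF x])+
  ultimately have "(\<integral>x. (Kder r x)\<^sup>2 \<partial>I01) = (\<integral>x. r x * Kop r x \<partial>I01)" by simp
  then show ?thesis using abs_le_integral_deriv[OF ar(1) ar(4)[OF x] _ x] by simp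
qed

text \<open>By symmetry \<open>Kop\<close> can be moved onto the second derivative of a test
  function, where \<open>Kop_inverse\<close> undoes it; so \<open>- p\<close> is the second
  derivative in the sense of distributions.\<close>

lemma Kop_U_o:
  assumes p: "continuous_on {0..1} p" and p0: "\<And>x. 0 < x \<Longrightarrow> x < 1 \<Longrightarrow> 0 \<le> p x"
    and pos: "\<And>x. 0 < x \<Longrightarrow> x < 1 \<Longrightarrow> 0 < Kop p x"
  shows "Kop p \<in> U_o"
proof -
  have i: "integrable I01 p" by (rule integrable_I01_continuous[OF p])
  have second: "(LBINT x:{0<..<1}. Kop p x * deriv (deriv \<phi>) x) = (LBINT x:{0<..<1}. - p x * \<phi> x)"
    if \<phi>: "test_fun \<phi>" for \<phi>
  proof -
    note t = test_funD[OF \<phi>] test_funD[OF test_fun_deriv[OF \<phi>]]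
    have "Kop (\<lambda>x. - deriv (deriv \<phi>) x) x = \<phi> x" if "x \<in> {0..1}" for x
      using that by (intro Kop_inverse[where \<phi>' = "deriv \<phi>"]) (auto intro: has_field_derivative_at_within t)
    moreover have "Kop (\<lambda>x. - deriv (deriv \<phi>) x) x = - Kop (deriv (deriv \<phi>)) x" for x
      using Kop_cmult[of "-1" "deriv (deriv \<phi>)" x] by simp
    ultimately have K: "Kop (deriv (deriv \<phi>)) x = - \<phi> x" if "x \<in> {0..1}" for x using that by fastforce
    have "(\<integral>x. Kop p x * deriv (deriv \<phi>) x \<partial>I01) = (\<integral>x. deriv (deriv \<phi>) x * Kop p x \<partial>I01)"
      by (simp add: mult.commute)
    also have "\<dots> = (\<integral>x. p x * Kop (deriv (deriv \<phi>)) x \<partial>I01)"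
      by (intro Kop_symmetric i integrable_I01_continuous t)
    also have "\<dots> = (\<integral>x. - p x * \<phi> x \<partial>I01)"
      by (intro Bochner_Integration.integral_cong) (auto simp: K)
    finally show ?thesis by (simp add: LBINT_I01)
  qed
  obtain M where M: "\<forall>x\<in>{0..1}. \<bar>p x\<bar> \<le> M"
  proof -
    have "bounded (p ` {0..1})" by (intro compact_imp_bounded compact_continuous_image p) auto
    then obtain M where "\<forall>x\<in>{0..1}. \<bar>p x\<bar> \<le> M" by (auto simp: bounded_iff)
    then show thesis by (rule that)
  qed
  have "second_deriv_Linf_loc (Kop p)"
    unfolding second_deriv_Linf_loc_def set_borel_measurable_I01
  proof (intro exI[of _ "\<lambda>x. - p x"] conjI allI impI)
    show "(\<lambda>x. - p x) \<in> borel_measurable I01" by (intro continuous_measurable_I01' continuous_intros p)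
    show "\<exists>M. AE x\<in>{a..b} in lborel. \<bar>- p x\<bar> \<le> M" if "0 < a \<and> b < 1" for a b
      using that M by (intro exI[of _ M] AE_I2) auto
  qed (rule second)
  moreover have "neg_second_deriv_nonneg (Kop p)"
    unfolding neg_second_deriv_nonneg_def
  proof (intro allI impI)
    fix \<phi> assume \<phi>: "test_fun \<phi> \<and> (\<forall>x. 0 \<le> \<phi> x)"
    have "0 \<le> (\<integral>x. p x * \<phi> x \<partial>I01)" using \<phi> p0 by (intro integral_nonneg_AE AE_I01_I) auto
    then show "0 \<le> - (LBINT x:{0<..<1}. Kop p x * deriv (deriv \<phi>) x)"
      using second[of \<phi>] \<phi> by (simp add: LBINT_I01)
  qed
  ultimately show ?thesis using Kop_H01(1)[OF i] pos by (auto simp: U_o_def S_o_def)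
qed

text \<open>Testing with \<open>Kop \<eta>\<close>, \<open>\<eta>\<close> the positive part of
  \<open>Kop p - u\<close>, and moving \<open>Kop\<close> back by symmetry gives that the integral
  of \<open>\<eta> * (Kop p - u)\<close>, the square of this positive part, is at most 0. The point
  \<open>s\<close> in the hypothesis keeps the test function nonzero, as the Rayleigh quotient
  requires.\<close>

lemma weak_eq_Kop:
  assumes u: "u \<in> H01" and p: "integrable I01 p" and c: "continuous_on {0..1} p"
    and ge: "\<And>\<eta> s. continuous_on {0..1} \<eta> \<Longrightarrow> (\<And>x. 0 \<le> \<eta> x) \<Longrightarrow> s \<in> {0..1} \<Longrightarrow> 0 < \<eta> s \<Longrightarrow>
      (\<integral>x. p x * Kop \<eta> x \<partial>I01) \<le> (\<integral>x. wderiv u x * wderiv (Kop \<eta>) x \<partial>I01)"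
    and x: "x \<in> {0..1}"
  shows "Kop p x \<le> u x"
proof (rule ccontr)
  assume neg: "\<not> Kop p x \<le> u x"
  define \<eta> where "\<eta> x = max 0 (Kop p x - u x)" for x
  note d = H01_D[OF u]
  have c\<eta>: "continuous_on {0..1} \<eta>" unfolding \<eta>_def by (intro continuous_intros Kop_continuous p d)
  have i\<eta>: "integrable I01 \<eta>" by (rule integrable_I01_continuous[OF c\<eta>])
  have "(\<integral>x. p x * Kop \<eta> x \<partial>I01) \<le> (\<integral>x. wderiv u x * wderiv (Kop \<eta>) x \<partial>I01)"
    by (rule ge[OF c\<eta> _ x]) (use neg in \<open>simp_all add: \<eta>_def\<close>)
  also have "\<dots> = (\<integral>x. \<eta> x * u x \<partial>I01)" using Kop_weak[OF i\<eta> u] by (simp add: mult.commute)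
  finally have "(\<integral>x. \<eta> x * Kop p x \<partial>I01) \<le> (\<integral>x. \<eta> x * u x \<partial>I01)" using Kop_symmetric[OF p i\<eta>] by simp
  moreover have "integrable I01 (\<lambda>x. \<eta> x * Kop p x)" "integrable I01 (\<lambda>x. \<eta> x * u x)"
    by (intro integrable_I01_continuous continuous_intros c\<eta> Kop_continuous p d)+
  ultimately have "(\<integral>x. \<eta> x * Kop p x - \<eta> x * u x \<partial>I01) \<le> 0" by simp
  moreover have "0 < (\<integral>x. \<eta> x * Kop p x - \<eta> x * u x \<partial>I01)"
  proof (rule integral_I01_pos_continuous[OF _ _ x])
    show "continuous_on {0..1} (\<lambda>x. \<eta> x * Kop p x - \<eta> x * u x)"
      by (intro continuous_intros c\<eta> Kop_continuous p d)
    show "0 \<le> \<eta> y * Kop p y - \<eta> y * u y" for y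
      unfolding \<eta>_def right_diff_distrib[symmetric] by (simp add: max_def)
    show "0 < \<eta> x * Kop p x - \<eta> x * u x"
      unfolding \<eta>_def right_diff_distrib[symmetric] using neg by (simp add: max_def)
  qed
  ultimately show False by simp
qed

text \<open>An eigenfunction satisfies \<open>\<phi> = \<mu> * Kop \<phi>\<close>. A bound by a
  multiple of \<open>sin\<pi>\<close> improves by the factor \<open>\<mu> / pi\<^sup>2\<close>
  whenever this identity is applied, so \<open>\<mu> < pi\<^sup>2\<close> would force
  \<open>\<phi>\<close> to vanish.\<close>

lemma principal_eigenvalue_eq: "principal_eigenvalue = pi\<^sup>2"
  unfolding principal_eigenvalue_def
proof (rule Least_equality)
  let ?p = "\<lambda>x. pi\<^sup>2 * sin\<pi> x"
  have ip: "integrable I01 ?p" using integrable_sin by simp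
  have K: "Kop ?p x = sin\<pi> x" if "x \<in> {0..1}" for x using that by (simp add: Kop_cmult Kop_sin)
  have "Kop ?p (1/2) \<noteq> 0" using K[of "1/2"] by simp
  then have ne: "Kop ?p \<noteq> (\<lambda>_. 0)" by metis
  have "(\<integral>x. wderiv (Kop ?p) x * wderiv \<zeta> x \<partial>I01) = pi\<^sup>2 * (\<integral>x. Kop ?p x * \<zeta> x \<partial>I01)" if "\<zeta> \<in> H01" for \<zeta>
  proof -
    have "(\<integral>x. wderiv (Kop ?p) x * wderiv \<zeta> x \<partial>I01) = (\<integral>x. pi\<^sup>2 * (Kop ?p x * \<zeta> x) \<partial>I01)"
      unfolding Kop_weak[OF ip that]
    proof (intro Bochner_Integration.integral_cong refl)
      fix x assume "x \<in> space I01"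
      then have "x \<in> {0..1}" by auto
      then show "pi\<^sup>2 * sin\<pi> x * \<zeta> x = pi\<^sup>2 * (Kop ?p x * \<zeta> x)" using K[of x] by simp
    qed
    then show ?thesis by simp
  qed
  then show "dirichlet_eigenvalue (pi\<^sup>2)"
    unfolding dirichlet_eigenvalue_def LBINT_I01 using ne Kop_H01(1)[OF ip] by blast
next
  fix \<mu> assume "dirichlet_eigenvalue \<mu>"
  then obtain \<phi> where \<phi>: "\<phi> \<in> H01" "\<phi> \<noteq> (\<lambda>_. 0)"
    and ev: "\<And>\<zeta>. \<zeta> \<in> H01 \<Longrightarrow> (\<integral>x. wderiv \<phi> x * wderiv \<zeta> x \<partial>I01) = \<mu> * (\<integral>x. \<phi> x * \<zeta> x \<partial>I01)"
    unfolding dirichlet_eigenvalue_def LBINT_I01 by blast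
  note d = H01_D[OF \<phi>(1)]
  have c: "continuous_on {0..1} (\<lambda>x. s * \<phi> x)" for s by (intro continuous_intros d)
  have i: "integrable I01 (\<lambda>x. s * \<phi> x)" for s by (intro integrable_I01_continuous c)
  have le: "Kop (\<lambda>x. \<mu> * \<phi> x) x \<le> \<phi> x" if "x \<in> {0..1}" for x
  proof (rule weak_eq_Kop[OF \<phi>(1) i c _ that])
    fix \<eta> :: "real \<Rightarrow> real" assume "continuous_on {0..1} \<eta>"
    then have "Kop \<eta> \<in> H01" by (intro Kop_H01 integrable_I01_continuous)
    from ev[OF this] show "(\<integral>x. \<mu> * \<phi> x * Kop \<eta> x \<partial>I01) \<le> (\<integral>x. wderiv \<phi> x * wderiv (Kop \<eta>) x \<partial>I01)"
      by (simp add: mult.assoc)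
  qed
  have ge: "\<phi> x \<le> Kop (\<lambda>x. \<mu> * \<phi> x) x" if x: "x \<in> {0..1}" for x
  proof (rule ccontr)
    assume n: "\<not> \<phi> x \<le> Kop (\<lambda>x. \<mu> * \<phi> x) x"
    \<comment> \<open>Testing with \<open>Kop\<close> of the residual makes the integral of its
      square vanish.\<close>
    define \<eta> where "\<eta> x = \<phi> x - \<mu> * Kop \<phi> x" for x
    have Km: "Kop (\<lambda>x. \<mu> * \<phi> x) x = \<mu> * Kop \<phi> x" for x by (rule Kop_cmult)
    have i1: "integrable I01 \<phi>" using i[of 1] by simp
    have c\<eta>: "continuous_on {0..1} \<eta>" unfolding \<eta>_def by (intro continuous_intros Kop_continuous i1 d)
    have i\<eta>: "integrable I01 \<eta>" by (rule integrable_I01_continuous[OF c\<eta>])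
    have "(\<integral>x. \<eta> x * \<phi> x \<partial>I01) = (\<integral>x. wderiv (Kop \<eta>) x * wderiv \<phi> x \<partial>I01)" using Kop_weak[OF i\<eta> \<phi>(1)] by simp
    also have "\<dots> = \<mu> * (\<integral>x. \<phi> x * Kop \<eta> x \<partial>I01)" using ev[OF Kop_H01(1)[OF i\<eta>]] by (simp add: mult.commute)
    also have "\<dots> = \<mu> * (\<integral>x. \<eta> x * Kop \<phi> x \<partial>I01)" using Kop_symmetric[OF i\<eta> i1] by simp
    finally have "(\<integral>x. \<eta> x * \<phi> x \<partial>I01) = (\<integral>x. \<eta> x * (\<mu> * Kop \<phi> x) \<partial>I01)" by (simp add: mult.left_commute)
    moreover have "integrable I01 (\<lambda>x. \<eta> x * \<phi> x)" "integrable I01 (\<lambda>x. \<eta> x * (\<mu> * Kop \<phi> x))"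
      by (intro integrable_I01_continuous continuous_intros c\<eta> Kop_continuous i1 d)+
    ultimately have "(\<integral>x. \<eta> x * \<phi> x - \<eta> x * (\<mu> * Kop \<phi> x) \<partial>I01) = 0" by simp
    moreover have "0 < (\<integral>x. \<eta> x * \<phi> x - \<eta> x * (\<mu> * Kop \<phi> x) \<partial>I01)"
    proof (rule integral_I01_pos_continuous[OF _ _ x])
      show "continuous_on {0..1} (\<lambda>x. \<eta> x * \<phi> x - \<eta> x * (\<mu> * Kop \<phi> x))"
        by (intro continuous_intros c\<eta> Kop_continuous i1 d)
      have e: "\<eta> y * \<phi> y - \<eta> y * (\<mu> * Kop \<phi> y) = (\<eta> y)\<^sup>2" for y
        by (simp add: \<eta>_def power2_eq_square algebra_simps)
      show "0 \<le> \<eta> y * \<phi> y - \<eta> y * (\<mu> * Kop \<phi> y)" for y unfolding e by simp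
      show "0 < \<eta> x * \<phi> x - \<eta> x * (\<mu> * Kop \<phi> x)" unfolding e using n Km by (auto simp: \<eta>_def)
    qed
    ultimately show False by simp
  qed
  have eq: "\<phi> x = \<mu> * Kop \<phi> x" if "x \<in> {0..1}" for x
    using le[OF that] ge[OF that] by (simp add: Kop_cmult)
  obtain x0 where x0: "x0 \<in> {0..1}" "\<phi> x0 \<noteq> 0" using \<phi>(2) d(3) by fastforce
  have "\<mu> \<ge> 0"
  proof (rule ccontr)
    assume "\<not> \<mu> \<ge> 0"
    have "0 < (\<integral>x. \<phi> x * \<phi> x \<partial>I01)"
      by (rule integral_I01_pos_continuous[OF _ _ x0(1)]) (use x0 in \<open>auto intro!: continuous_intros d simp: zero_less_mult_iff linorder_neq_iff\<close>)
    then have "\<mu> * (\<integral>x. \<phi> x * \<phi> x \<partial>I01) < 0" using \<open>\<not> \<mu> \<ge> 0\<close> by (simp add: mult_neg_pos)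
    moreover have "0 \<le> (\<integral>x. wderiv \<phi> x * wderiv \<phi> x \<partial>I01)" by (rule integral_nonneg_AE) auto
    ultimately show False using ev[OF \<phi>(1)] by simp
  qed
  show "pi\<^sup>2 \<le> \<mu>"
  proof (rule ccontr)
    assume "\<not> pi\<^sup>2 \<le> \<mu>"
    define k where "k = \<mu> / pi\<^sup>2"
    have k: "0 \<le> k" "k < 1" using \<open>\<mu> \<ge> 0\<close> \<open>\<not> pi\<^sup>2 \<le> \<mu>\<close> by (auto simp: k_def)
    obtain c where c: "c > 0" "\<And>x. x \<in> {0..1} \<Longrightarrow> c * bubble x \<le> sin\<pi> x" using bubble_le_sin by blast
    have i1: "integrable I01 \<phi>" using i[of 1] by simp
    \<comment> \<open>The start of the iteration: \<open>\<phi>\<close> is at most a multiple of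
      \<open>bubble\<close> by the kernel bound, and \<open>bubble\<close> is at most
      \<open>sin\<pi> / c\<close>.\<close>
    define b where "b = \<mu> * (\<integral>y. \<bar>\<phi> y\<bar> \<partial>I01) / c"
    have b0: "\<bar>\<phi> x\<bar> \<le> b * sin\<pi> x" if "x \<in> {0..1}" for x
    proof -
      have "\<bar>\<phi> x\<bar> = \<mu> * \<bar>Kop \<phi> x\<bar>" using eq[OF that] \<open>\<mu> \<ge> 0\<close> by (simp add: abs_mult)
      also have "\<dots> \<le> \<mu> * (bubble x * (\<integral>y. \<bar>\<phi> y\<bar> \<partial>I01))"
        using \<open>\<mu> \<ge> 0\<close> Kop_abs_le(1)[OF i1 that] by (intro mult_left_mono) auto
      also have "\<dots> = b * (c * bubble x)" using c by (simp add: b_def)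
      also have "\<dots> \<le> b * sin\<pi> x"
        using c \<open>\<mu> \<ge> 0\<close> that by (intro mult_left_mono c) (auto simp: b_def)
      finally show ?thesis .
    qed
    have bn: "\<bar>\<phi> x\<bar> \<le> k ^ n * b * sin\<pi> x" if "x \<in> {0..1}" for n x
      using that
    proof (induction n arbitrary: x)
      case (Suc n)
      have "\<bar>Kop \<phi> x\<bar> \<le> Kop (\<lambda>x. k ^ n * b * sin\<pi> x) x"
      proof -
        have "Kop \<phi> x \<le> Kop (\<lambda>x. k ^ n * b * sin\<pi> x) x"
          using Suc.IH integrable_sin by (intro Kop_mono i1) (auto simp: abs_le_iff)
        moreover have "Kop (\<lambda>x. - 1 * \<phi> x) x \<le> Kop (\<lambda>x. k ^ n * b * sin\<pi> x) x"
          using Suc.IH integrable_sin by (intro Kop_mono i) (auto simp: abs_le_iff)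
        ultimately show ?thesis unfolding Kop_cmult by auto
      qed
      also have "\<dots> = k ^ n * b * (sin\<pi> x / pi\<^sup>2)" using Suc.prems by (simp add: Kop_cmult Kop_sin)
      finally have "\<mu> * \<bar>Kop \<phi> x\<bar> \<le> \<mu> * (k ^ n * b * (sin\<pi> x / pi\<^sup>2))" using \<open>\<mu> \<ge> 0\<close> by (rule mult_left_mono)
      also have "\<dots> = k ^ Suc n * b * sin\<pi> x" by (simp add: k_def)
      finally show ?case using eq[OF Suc.prems] \<open>\<mu> \<ge> 0\<close> by (simp add: abs_mult)
    qed (use b0 in simp)
    have "(\<lambda>n. k ^ n * b * sin\<pi> x0) \<longlonglongrightarrow> 0 * b * sin\<pi> x0"
      using k by (intro tendsto_intros LIMSEQ_realpow_zero) auto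
    then have "\<bar>\<phi> x0\<bar> \<le> 0"
      using bn[OF x0(1)] by (intro LIMSEQ_le_const[of _ 0]) auto
    then show False using x0 by simp
  qed
qed

section \<open>The nonlinear system\<close>

definition KV :: "(real \<Rightarrow> real^'m) \<Rightarrow> real \<Rightarrow> real^'m" where
  "KV p x = (\<chi> k. Kop (\<lambda>y. p y $ k) x)"

lemma KV_nth [simp]: "KV p x $ k = Kop (\<lambda>y. p y $ k) x"
  by (simp add: KV_def)

text \<open>Nonnegativity is required on the whole line and continuity only on
  \<open>{0..1}\<close>, so that order relations can be stated without restricting
  \<open>x\<close>.\<close>

definition nonneg_cont :: "(real \<Rightarrow> real^'m) \<Rightarrow> bool" where
  "nonneg_cont u \<longleftrightarrow> continuous_on {0..1} u \<and> (\<forall>x k. 0 \<le> u x $ k)"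

lemma nonneg_contD:
  assumes "nonneg_cont u"
  shows "continuous_on {0..1} u" "continuous_on {0..1} (\<lambda>x. u x $ k)" "0 \<le> u x $ k" "u x \<in> orthant"
  using assms by (auto simp: nonneg_cont_def orthant_def intro: continuous_intros)

lemma nonneg_contI:
  "(\<And>k. continuous_on {0..1} (\<lambda>x. u x $ k)) \<Longrightarrow> (\<And>x k. 0 \<le> u x $ k) \<Longrightarrow> nonneg_cont u"
  unfolding nonneg_cont_def using continuous_on_vec_lambda[of "{0..1}" "\<lambda>k x. u x $ k"] by simp

lemma norm_le_card_mult:
  fixes u :: "real^'m"
  assumes "\<And>k. 0 \<le> u $ k" "\<And>k. u $ k \<le> b"
  shows "norm u \<le> real CARD('m) * b"
proof -
  have "norm u \<le> (\<Sum>k\<in>UNIV. \<bar>u $ k\<bar>)" by (rule norm_le_l1_cart)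
  also have "\<dots> \<le> (\<Sum>k\<in>(UNIV::'m set). b)" using assms by (intro sum_mono) auto
  finally show ?thesis by simp
qed

locale elliptic_system =
  fixes f :: "real \<Rightarrow> real^('m::{finite,linorder}) \<Rightarrow> real^('m::{finite,linorder})"
    and q \<gamma> C R \<delta>0 \<theta> :: real
  assumes q: "1 < q" "q < 2"
    and f_cont: "\<And>i u. u \<in> orthant \<Longrightarrow> continuous_on {0..1} (\<lambda>x. f x u $ i)"
    and f_C1: "\<And>x. x \<in> {0..1} \<Longrightarrow> C1_orthant f x"
    and \<gamma>: "2 < \<gamma>" and C: "C > 0"
    and f_bound: "\<And>i x u. x \<in> {0..1} \<Longrightarrow> u \<in> orthant \<Longrightarrow>
        0 \<le> f x u $ i \<and> f x u $ i \<le> C * norm u powr (\<gamma> - 1)"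
    and fu_bound: "\<And>i j x u. x \<in> {0..1} \<Longrightarrow> u \<in> orthant \<Longrightarrow>
        0 \<le> jac f x u $ i $ j \<and> jac f x u $ i $ j \<le> C * norm u powr (\<gamma> - 2)"
    and fu_pos: "\<And>i j. i \<noteq> j \<Longrightarrow>
        AE x\<in>{0<..<1} in lborel. \<forall>u. (\<forall>k. u $ k > 0) \<longrightarrow> jac f x u $ i $ j > 0"
    and R: "R > 0" and \<delta>0: "\<delta>0 > 0"
    and large_growth: "AE x\<in>{0<..<1} in lborel. \<forall>u\<in>orthant. norm u > R \<longrightarrow>
        (\<Sum>k\<in>UNIV. f x u $ k) \<ge> (principal_eigenvalue + \<delta>0) * (\<Sum>k\<in>UNIV. u $ k)"
    and \<theta>: "\<theta> > 1"
    and picone_superlinear: "AE x\<in>{0<..<1} in lborel. \<forall>u\<in>orthant.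
        Q_form f x u \<ge> \<theta> * (\<Sum>i\<in>UNIV. f x u $ i * u $ i)"
begin

lemma jac_has_derivative:
  assumes "x \<in> {0..1}" "u \<in> orthant"
  shows "(f x has_derivative (\<lambda>h. jac f x u *v h)) (at u within orthant)"
proof -
  have d: "(f x has_derivative frechet_derivative (f x) (at u within orthant)) (at u within orthant)"
    using f_C1[OF assms(1)] assms(2) by (auto simp: C1_orthant_def differentiable_on_def frechet_derivative_works)
  then have "linear (frechet_derivative (f x) (at u within orthant))"
    by (rule has_derivative_linear)
  then have "frechet_derivative (f x) (at u within orthant) = (\<lambda>h. jac f x u *v h)"
    by (auto simp: jac_def matrix_works)
  then show ?thesis using d by simp
qed

lemma orthant_convex: "u \<in> orthant \<Longrightarrow> v \<in> orthant \<Longrightarrow> 0 \<le> t \<Longrightarrow> t \<le> 1 \<Longrightarrow> u + t *\<^sub>R (v - u) \<in> orthant"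
  for u v :: "real^'n"
proof -
  assume a: "u \<in> orthant" "v \<in> orthant" "0 \<le> t" "t \<le> 1"
  have "u $ k + t * (v $ k - u $ k) = (1 - t) * u $ k + t * v $ k" for k by (simp add: algebra_simps)
  moreover have "0 \<le> (1 - t) * u $ k + t * v $ k" for k using a by (auto simp: orthant_def)
  ultimately show ?thesis by (simp add: orthant_def)
qed

text \<open>The mean value theorem along a segment in the convex orthant. It works for scalar
  functions, so the intermediate point depends on the component \<open>i\<close>.\<close>

lemma f_mvt:
  assumes x: "x \<in> {0..1}" and u: "u \<in> orthant" and v: "v \<in> orthant"
  obtains t where "0 \<le> t" "t \<le> 1"
    "f x v $ i - f x u $ i = (\<Sum>j\<in>UNIV. jac f x (u + t *\<^sub>R (v - u)) $ i $ j * (v $ j - u $ j))"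
proof -
  have "((\<lambda>t. f x (u + t *\<^sub>R (v - u)) $ i) has_derivative
      (\<lambda>s. (jac f x (u + t *\<^sub>R (v - u)) *v (s *\<^sub>R (v - u))) $ i)) (at t within {0..1})"
    if "0 \<le> t" "t \<le> 1" for t
  proof -
    have "((\<lambda>t. u + t *\<^sub>R (v - u)) has_derivative (\<lambda>s. s *\<^sub>R (v - u))) (at t within {0..1})"
      by (auto intro!: derivative_eq_intros)
    moreover have "(f x has_derivative (\<lambda>h. jac f x (u + t *\<^sub>R (v - u)) *v h))
        (at (u + t *\<^sub>R (v - u)) within (\<lambda>t. u + t *\<^sub>R (v - u)) ` {0..1})"
      by (rule has_derivative_subset[OF jac_has_derivative[OF x]]) (use that orthant_convex[OF u v] in auto)
    ultimately have "((\<lambda>t. f x (u + t *\<^sub>R (v - u))) has_derivative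
      (\<lambda>s. jac f x (u + t *\<^sub>R (v - u)) *v (s *\<^sub>R (v - u)))) (at t within {0..1})"
      by (rule has_derivative_in_compose)
    then show ?thesis by (rule bounded_linear.has_derivative[OF bounded_linear_vec_nth])
  qed
  then have "\<exists>t\<in>{0<..<1}. f x (u + 1 *\<^sub>R (v - u)) $ i - f x (u + 0 *\<^sub>R (v - u)) $ i
      = (jac f x (u + t *\<^sub>R (v - u)) *v ((1 - 0) *\<^sub>R (v - u))) $ i"
    by (intro mvt_simple) auto
  then obtain t where "t \<in> {0<..<1}" "f x v $ i - f x u $ i = (jac f x (u + t *\<^sub>R (v - u)) *v (v - u)) $ i"
    by auto
  then show thesis by (intro that[of t]) (auto simp: matrix_vector_mult_def)
qed

text \<open>All entries of the Jacobian are nonnegative, that is, the system is cooperative.\<close>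

lemma f_mono:
  assumes "x \<in> {0..1}" "u \<in> orthant" "\<And>k. u $ k \<le> v $ k"
  shows "f x u $ i \<le> f x v $ i"
proof -
  have v: "v \<in> orthant" using assms by (auto simp: orthant_def intro: order_trans)
  obtain t where t: "0 \<le> t" "t \<le> 1"
    "f x v $ i - f x u $ i = (\<Sum>j\<in>UNIV. jac f x (u + t *\<^sub>R (v - u)) $ i $ j * (v $ j - u $ j))"
    using f_mvt[OF assms(1,2) v] by blast
  have "0 \<le> (\<Sum>j\<in>UNIV. jac f x (u + t *\<^sub>R (v - u)) $ i $ j * (v $ j - u $ j))"
    using fu_bound[OF assms(1) orthant_convex[OF assms(2) v t(1,2)]] assms(3)
    by (intro sum_nonneg mult_nonneg_nonneg) auto
  then show ?thesis using t(3) by simp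
qed

text \<open>A bound for the entries of the Jacobian on the box \<open>0 \<le> u $ k \<le> b\<close>,
  where the norm is at most \<open>m * b\<close>.\<close>

definition lip :: "real \<Rightarrow> real" where
  "lip b = C * (real CARD('m) * b) powr (\<gamma> - 2)"

lemma lip_nonneg: "lip b \<ge> 0"
  using C by (simp add: lip_def)

lemma jac_le_lip:
  assumes "x \<in> {0..1}" "\<And>k. 0 \<le> u $ k" "\<And>k. u $ k \<le> b"
  shows "0 \<le> jac f x u $ i $ j" "jac f x u $ i $ j \<le> lip b"
proof -
  have u: "u \<in> orthant" using assms by (simp add: orthant_def)
  show "0 \<le> jac f x u $ i $ j" using fu_bound[OF assms(1) u] by simp
  have "norm u powr (\<gamma> - 2) \<le> (real CARD('m) * b) powr (\<gamma> - 2)"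
    using norm_le_card_mult[OF assms(2,3)] \<gamma> by (intro powr_mono2) auto
  then show "jac f x u $ i $ j \<le> lip b"
    using fu_bound[OF assms(1) u, of i j] C unfolding lip_def by (meson less_imp_le mult_left_mono order_trans)
qed

lemma f_lipschitz:
  assumes x: "x \<in> {0..1}" and u: "\<And>k. 0 \<le> u $ k" "\<And>k. u $ k \<le> b" and v: "\<And>k. 0 \<le> v $ k" "\<And>k. v $ k \<le> b"
  shows "\<bar>f x v $ i - f x u $ i\<bar> \<le> lip b * (\<Sum>j\<in>UNIV. \<bar>v $ j - u $ j\<bar>)"
proof -
  have o: "u \<in> orthant" "v \<in> orthant" using u v by (auto simp: orthant_def)
  obtain t where t: "0 \<le> t" "t \<le> 1"
    "f x v $ i - f x u $ i = (\<Sum>j\<in>UNIV. jac f x (u + t *\<^sub>R (v - u)) $ i $ j * (v $ j - u $ j))"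
    using f_mvt[OF x o] by blast
  define \<xi> where "\<xi> = u + t *\<^sub>R (v - u)"
  have \<xi>: "0 \<le> \<xi> $ k" "\<xi> $ k \<le> b" for k
  proof -
    show "0 \<le> \<xi> $ k" using orthant_convex[OF o t(1,2)] by (simp add: \<xi>_def orthant_def)
    have "\<xi> $ k = (1 - t) * u $ k + t * v $ k" by (simp add: \<xi>_def algebra_simps)
    also have "\<dots> \<le> (1 - t) * b + t * b" using u v t by (intro add_mono mult_left_mono) auto
    finally show "\<xi> $ k \<le> b" by (simp add: algebra_simps)
  qed
  have "\<bar>f x v $ i - f x u $ i\<bar> \<le> (\<Sum>j\<in>UNIV. \<bar>jac f x \<xi> $ i $ j * (v $ j - u $ j)\<bar>)"
    unfolding t(3) \<xi>_def[symmetric] by (rule sum_abs)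
  also have "\<dots> \<le> (\<Sum>j\<in>UNIV. lip b * \<bar>v $ j - u $ j\<bar>)"
    unfolding abs_mult using jac_le_lip[OF x \<xi>] by (intro sum_mono mult_right_mono) auto
  finally show ?thesis by (simp add: sum_distrib_left)
qed

lemma f_tendsto:
  assumes x: "x \<in> {0..1}" and s: "\<And>n k. 0 \<le> s n $ k" and l: "\<And>k. 0 \<le> l $ k" and lim: "s \<longlonglongrightarrow> l"
  shows "(\<lambda>n. f x (s n) $ i) \<longlonglongrightarrow> f x l $ i"
proof -
  have "f x differentiable_on orthant" using f_C1[OF x] by (simp add: C1_orthant_def)
  then have "continuous_on orthant (f x)" by (rule differentiable_imp_continuous_on)
  then have "(\<lambda>n. f x (s n)) \<longlonglongrightarrow> f x l"
    using s l lim by (intro continuous_on_tendsto_compose[of orthant "f x" s]) (auto simp: orthant_def)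
  then show ?thesis by (rule tendsto_vec_nth)
qed

text \<open>\<open>f\<close> is assumed continuous in \<open>x\<close> only for fixed
  \<open>u\<close>. The Lipschitz bound in \<open>u\<close>, uniform in \<open>x\<close>, supplies
  the joint continuity needed along \<open>u x\<close>.\<close>

lemma f_comp_continuous:
  assumes u: "nonneg_cont u"
  shows "continuous_on {0..1} (\<lambda>x. f x (u x) $ i)"
proof (rule continuous_on_sequentiallyI)
  fix s :: "nat \<Rightarrow> real" and a assume s: "\<forall>n. s n \<in> {0..1}" and a: "a \<in> {0..1}" and lim: "s \<longlonglongrightarrow> a"
  note nu = nonneg_contD[OF u]
  have "compact (u ` {0..1})" by (intro compact_continuous_image nu) auto
  then obtain b where b: "\<And>x. x \<in> {0..1} \<Longrightarrow> norm (u x) \<le> b"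
    using compact_imp_bounded bounded_iff by (metis imageI)
  have bk: "u x $ k \<le> b" if "x \<in> {0..1}" for x k
    using b[OF that] component_le_norm_cart[of "u x" k] by simp
  have ul: "(\<lambda>n. u (s n) $ k) \<longlonglongrightarrow> u a $ k" for k
    using s by (intro continuous_on_tendsto_compose[OF nu(2) lim a]) auto
  have "(\<lambda>n. lip b * (\<Sum>j\<in>UNIV. \<bar>u (s n) $ j - u a $ j\<bar>)) \<longlonglongrightarrow> lip b * (\<Sum>j\<in>(UNIV::'m set). \<bar>u a $ j - u a $ j\<bar>)"
    by (intro tendsto_intros ul)
  then have "(\<lambda>n. lip b * (\<Sum>j\<in>UNIV. \<bar>u (s n) $ j - u a $ j\<bar>)) \<longlonglongrightarrow> 0" by simp
  then have 1: "(\<lambda>n. f (s n) (u (s n)) $ i - f (s n) (u a) $ i) \<longlonglongrightarrow> 0"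
    by (rule Lim_null_comparison[rotated])
      (use s a bk nu(3) in \<open>auto intro!: always_eventually f_lipschitz\<close>)
  have 2: "(\<lambda>n. f (s n) (u a) $ i) \<longlonglongrightarrow> f a (u a) $ i"
    using s by (intro continuous_on_tendsto_compose[OF f_cont[OF nu(4)] lim a]) auto
  show "(\<lambda>n. f (s n) (u (s n)) $ i) \<longlonglongrightarrow> f a (u a) $ i"
    using tendsto_add[OF 1 2] by simp
qed

definition Nl where
  "Nl lam u x = (\<chi> k. f x (u x) $ k + lam * (u x $ k) powr (q - 1))"

lemma Nl_nth [simp]: "Nl lam u x $ k = f x (u x) $ k + lam * (u x $ k) powr (q - 1)"
  by (simp add: Nl_def)

lemma g_continuous:
  assumes "nonneg_cont u"
  shows "continuous_on {0..1} (\<lambda>x. (u x $ k) powr (q - 1))"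
  using nonneg_contD[OF assms] q by (intro continuous_on_powr') (auto intro: continuous_intros)

lemma Nl_continuous:
  assumes "nonneg_cont u"
  shows "continuous_on {0..1} (\<lambda>x. Nl lam u x $ k)"
  unfolding Nl_nth by (intro continuous_intros f_comp_continuous g_continuous assms)

lemma Nl_integrable: "nonneg_cont u \<Longrightarrow> integrable I01 (\<lambda>x. Nl lam u x $ k)"
  by (intro integrable_I01_continuous Nl_continuous)

lemma Nl_nonneg:
  assumes "x \<in> {0..1}" "u x \<in> orthant" "lam \<ge> 0"
  shows "0 \<le> Nl lam u x $ k"
  unfolding Nl_nth using f_bound[OF assms(1,2)] assms(3) by (intro add_nonneg_nonneg) auto

lemma Nl_mono:
  assumes "x \<in> {0..1}" "\<And>k. 0 \<le> u x $ k" "\<And>k. u x $ k \<le> v x $ k" "0 \<le> lam" "lam \<le> lam'"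
  shows "Nl lam u x $ k \<le> Nl lam' v x $ k"
  unfolding Nl_nth using assms q
  by (intro add_mono mult_mono f_mono powr_mono2) (auto simp: orthant_def)

text \<open>Fixed points are solutions in integral form, and \<open>step lam w \<le> w\<close> is
  the pointwise notion of supersolution.\<close>

definition step where
  "step lam u = KV (Nl lam u)"

lemma step_nth: "step lam u x $ k = Kop (\<lambda>y. Nl lam u y $ k) x"
  by (simp add: step_def del: Nl_nth)

lemma step_nonneg_cont:
  assumes "nonneg_cont u" "lam \<ge> 0"
  shows "nonneg_cont (step lam u)"
proof (rule nonneg_contI)
  show "continuous_on {0..1} (\<lambda>x. step lam u x $ k)" for k
    unfolding step_nth by (intro Kop_continuous Nl_integrable assms)
  show "0 \<le> step lam u x $ k" for x k
    unfolding step_nth using assms nonneg_contD(4)[OF assms(1)] by (intro Kop_nonneg Nl_nonneg) auto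
qed

lemma step_mono:
  assumes "nonneg_cont u" "nonneg_cont v" "\<And>x k. u x $ k \<le> v x $ k" "0 \<le> lam" "lam \<le> lam'"
  shows "step lam u x $ k \<le> step lam' v x $ k"
  unfolding step_nth using assms nonneg_contD[OF assms(1)] by (intro Kop_mono Nl_integrable Nl_mono) auto

text \<open>Dominated convergence with a constant bound; the parameter may vary along the sequence.
  The L1 convergence in the third claim upgrades pointwise to uniform convergence of images under
  \<open>Kop\<close>.\<close>

lemma step_tendsto:
  assumes s: "\<And>n. nonneg_cont (s n)" "\<And>n x k. s n x $ k \<le> b" and l: "l \<longlonglongrightarrow> lam" "\<And>n. 0 \<le> l n"
    and u: "\<And>x k. 0 < x \<Longrightarrow> x < 1 \<Longrightarrow> (\<lambda>n. s n x $ k) \<longlonglongrightarrow> u x $ k"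
  shows "(\<lambda>n. step (l n) (s n) x $ k) \<longlonglongrightarrow> step lam u x $ k" "integrable I01 (\<lambda>x. Nl lam u x $ k)"
    "(\<lambda>n. \<integral>x. \<bar>Nl (l n) (s n) x $ k - Nl lam u x $ k\<bar> \<partial>I01) \<longlonglongrightarrow> 0"
proof -
  have u0: "0 \<le> u x $ k" if "0 < x" "x < 1" for x k
    using nonneg_contD(3)[OF s(1)] by (intro LIMSEQ_le_const[OF u[OF that]]) auto
  have uv: "(\<lambda>n. s n x) \<longlonglongrightarrow> u x" if "0 < x" "x < 1" for x
    by (rule vec_tendstoI) (rule u[OF that])
  obtain lb where lb: "\<And>n. \<bar>l n\<bar> \<le> lb"
    using convergent_imp_bounded[OF l(1)] by (auto simp: bounded_iff)
  have lim: "(\<lambda>n. Nl (l n) (s n) x $ k) \<longlonglongrightarrow> Nl lam u x $ k" if "0 < x" "x < 1" for x k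
    unfolding Nl_nth using that u[OF that] u0[OF that] q nonneg_contD(3)[OF s(1)]
    by (intro tendsto_add tendsto_mult l f_tendsto uv tendsto_powr2 tendsto_const) auto
  define B where "B = C * (real CARD('m) * b) powr (\<gamma> - 1) + lb * b powr (q - 1)"
  have bnd: "\<bar>Nl (l n) (s n) x $ k\<bar> \<le> B" if "0 < x" "x < 1" for n x k
  proof -
    have x: "x \<in> {0..1}" using that by auto
    have o: "s n x \<in> orthant" by (rule nonneg_contD(4)[OF s(1)])
    have "norm (s n x) powr (\<gamma> - 1) \<le> (real CARD('m) * b) powr (\<gamma> - 1)"
      using norm_le_card_mult[of "s n x" b] nonneg_contD(3)[OF s(1)] s(2) \<gamma> by (intro powr_mono2) auto
    then have "C * norm (s n x) powr (\<gamma> - 1) \<le> C * (real CARD('m) * b) powr (\<gamma> - 1)"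
      using C by (intro mult_left_mono) auto
    then have "f x (s n x) $ k \<le> C * (real CARD('m) * b) powr (\<gamma> - 1)"
      using f_bound[OF x o, of k] by linarith
    moreover have "l n * (s n x $ k) powr (q - 1) \<le> lb * b powr (q - 1)"
      using lb[of n] l(2)[of n] q s nonneg_contD(3)[OF s(1)] by (intro mult_mono powr_mono2) auto
    ultimately have "Nl (l n) (s n) x $ k \<le> B" by (simp add: B_def)
    then show ?thesis using Nl_nonneg[of x "s n" "l n" k, OF x o l(2)] by (simp del: Nl_nth)
  qed
  have m: "(\<lambda>x. Nl (l n) (s n) x $ k) \<in> borel_measurable I01" for n k
    by (intro continuous_measurable_I01' Nl_continuous s)
  have mu: "(\<lambda>x. Nl lam u x $ k) \<in> borel_measurable I01" for k
    by (rule borel_measurable_LIMSEQ_real[OF _ m[of _ k]]) (use lim in auto)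
  have bu: "\<bar>Nl lam u x $ k\<bar> \<le> B" if "0 < x" "x < 1" for x k
    using bnd[OF that] by (intro LIMSEQ_le_const2[OF tendsto_rabs[OF lim[OF that]]]) auto
  show i: "integrable I01 (\<lambda>x. Nl lam u x $ k)" by (rule integrable_I01_bounded[OF mu bu])
  show "(\<lambda>n. step (l n) (s n) x $ k) \<longlonglongrightarrow> step lam u x $ k"
    unfolding step_nth by (rule Kop_limit[OF m mu _ bnd lim]) auto
  have "(\<lambda>n. \<integral>x. \<bar>Nl (l n) (s n) x $ k - Nl lam u x $ k\<bar> \<partial>I01) \<longlonglongrightarrow> (\<integral>x. 0 \<partial>I01)"
  proof (rule integral_dominated_convergence[where w = "\<lambda>x. 2 * B"])
    show "AE x in I01. norm \<bar>Nl (l n) (s n) x $ k - Nl lam u x $ k\<bar> \<le> 2 * B" for n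
    proof (rule AE_I01_I)
      fix x :: real assume "0 < x" "x < 1"
      from bnd[OF this, of n k] bu[OF this, of k]
      show "norm \<bar>Nl (l n) (s n) x $ k - Nl lam u x $ k\<bar> \<le> 2 * B" by (simp del: Nl_nth)
    qed
    show "AE x in I01. (\<lambda>n. \<bar>Nl (l n) (s n) x $ k - Nl lam u x $ k\<bar>) \<longlonglongrightarrow> 0"
      by (rule AE_I01_I) (intro tendsto_rabs_zero LIM_zero lim)
  qed (use m mu in \<open>auto simp del: Nl_nth\<close>)
  then show "(\<lambda>n. \<integral>x. \<bar>Nl (l n) (s n) x $ k - Nl lam u x $ k\<bar> \<partial>I01) \<longlonglongrightarrow> 0" by simp
qed

text \<open>A pointwise limit carries no continuity by itself; it regains it because it lies in the
  range of \<open>Kop\<close>.\<close>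

lemma limit_solution:
  assumes s: "\<And>n. nonneg_cont (s n)" "\<And>n x k. s n x $ k \<le> b" and l: "l \<longlonglongrightarrow> lam" "\<And>n. 0 \<le> l n"
    and u: "\<And>x k. (\<lambda>n. s n x $ k) \<longlonglongrightarrow> u x $ k"
    and su: "\<And>x k. (\<lambda>n. step (l n) (s n) x $ k) \<longlonglongrightarrow> u x $ k"
  shows "nonneg_cont u" "step lam u = u"
proof -
  note lim = step_tendsto[OF s l u]
  show eq: "step lam u = u"
    unfolding fun_eq_iff vec_eq_iff using LIMSEQ_unique[OF lim(1) su] by blast
  have "continuous_on {0..1} (\<lambda>x. step lam u x $ k)" for k
    unfolding step_nth by (intro Kop_continuous lim)
  then show "nonneg_cont u" unfolding eq
    using nonneg_contD(3)[OF s(1)] by (intro nonneg_contI LIMSEQ_le_const[OF u]) auto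
qed

definition iter where
  "iter lam u n = (step lam ^^ n) u"

lemma iter_simps [simp]: "iter lam u 0 = u" "iter lam u (Suc n) = step lam (iter lam u n)"
  by (simp_all add: iter_def)

lemma iter_nonneg_cont: "nonneg_cont u \<Longrightarrow> lam \<ge> 0 \<Longrightarrow> nonneg_cont (iter lam u n)"
  by (induction n) (auto intro: step_nonneg_cont)

lemma iter_mono_Suc:
  assumes "nonneg_cont u" "lam \<ge> 0" "\<And>x k. u x $ k \<le> step lam u x $ k"
  shows "iter lam u n x $ k \<le> iter lam u (Suc n) x $ k"
proof (induction n arbitrary: x k)
  case (Suc n)
  have "step lam (iter lam u n) x $ k \<le> step lam (iter lam u (Suc n)) x $ k"
    using assms by (intro step_mono iter_nonneg_cont Suc) auto
  then show ?case by simp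
qed (use assms in simp)

lemma iter_le_super:
  assumes "nonneg_cont u" "lam \<ge> 0" "nonneg_cont w" "\<And>x k. u x $ k \<le> w x $ k"
    "\<And>x k. step lam w x $ k \<le> w x $ k"
  shows "iter lam u n x $ k \<le> w x $ k"
proof (induction n arbitrary: x k)
  case (Suc n)
  have "step lam (iter lam u n) x $ k \<le> step lam w x $ k"
    using Suc assms by (intro step_mono iter_nonneg_cont) auto
  then show ?case using assms(5)[of x k] by simp
qed (use assms in simp)

lemma iter_limit:
  assumes u: "nonneg_cont u" and lam: "lam \<ge> 0" and sub: "\<And>x k. u x $ k \<le> step lam u x $ k"
    and b: "\<And>n x k. iter lam u n x $ k \<le> b"
  obtains v where "nonneg_cont v" "step lam v = v" "\<And>n x k. iter lam u n x $ k \<le> v x $ k"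
    "\<And>x k. (\<lambda>n. iter lam u n x $ k) \<longlonglongrightarrow> v x $ k"
proof -
  define v where "v x = (\<chi> k. lim (\<lambda>n. iter lam u n x $ k))" for x
  have mono: "incseq (\<lambda>n. iter lam u n x $ k)" for x k
    by (intro incseq_SucI iter_mono_Suc u lam sub)
  have lim: "(\<lambda>n. iter lam u n x $ k) \<longlonglongrightarrow> v x $ k" for x k
  proof -
    obtain L where L: "(\<lambda>n. iter lam u n x $ k) \<longlonglongrightarrow> L"
      by (rule incseq_convergent[OF mono[of x k], of b]) (use b in auto)
    then have "v x $ k = L" unfolding v_def by (simp only: vec_lambda_beta limI[OF L])
    with L show ?thesis by (simp only:)
  qed
  have lim': "(\<lambda>n. step lam (iter lam u n) x $ k) \<longlonglongrightarrow> v x $ k" for x k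
    using LIMSEQ_Suc[OF lim[of x k]] by (simp only: iter_simps)
  note v = limit_solution[OF iter_nonneg_cont[OF u lam] b tendsto_const lam lim lim']
  show thesis by (rule that[OF v incseq_le[OF mono lim] lim])
qed

end

section \<open>Elements of the cones\<close>

lemma UU_oD:
  assumes "u \<in> UU_o"
  shows "nonneg_cont u" "(\<lambda>x. u x $ k) \<in> H01" "0 < x \<Longrightarrow> x < 1 \<Longrightarrow> 0 < u x $ k"
    "\<not> (0 < x \<and> x < 1) \<Longrightarrow> u x $ k = 0" "u \<in> WW"
proof -
  have h: "(\<lambda>x. u x $ k) \<in> H01" and p: "0 < x \<Longrightarrow> x < 1 \<Longrightarrow> 0 < u x $ k" for k x
    using assms by (auto simp: UU_o_def U_o_def S_o_def)
  show "(\<lambda>x. u x $ k) \<in> H01" "0 < x \<Longrightarrow> x < 1 \<Longrightarrow> 0 < u x $ k" by (fact h, fact p)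
  show "u \<in> WW" using h by (simp add: WW_def)
  have z: "u x $ k = 0" if "\<not> (0 < x \<and> x < 1)" for x k
  proof (cases "x = 0 \<or> x = 1")
    case True then show ?thesis using H01_boundary[OF h[of k]] by auto
  next
    case False
    then have "x \<notin> {0..1}" using that by auto
    then show ?thesis using H01_D(3)[OF h[of k]] by simp
  qed
  then show "\<not> (0 < x \<and> x < 1) \<Longrightarrow> u x $ k = 0" .
  have "0 \<le> u x $ k" for x k using z[of x k] p[of x k] by (cases "0 < x \<and> x < 1") auto
  then show "nonneg_cont u" using H01_D(1)[OF h] by (intro nonneg_contI)
qed

text \<open>Adding a small constant \<open>d\<close> to the source makes every component strictly
  positive inside and moves it by at most \<open>sqrt 2 * d\<close> in the H1 norm. Thus test
  functions with vanishing components are allowed.\<close>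

lemma KV_SS:
  assumes p: "\<And>k. integrable I01 (\<lambda>x. p x $ k)" and nn: "\<And>x k. 0 \<le> KV p x $ k"
  shows "KV p \<in> SS"
  unfolding SS_def
proof (intro CollectI conjI allI impI)
  have "(\<lambda>x. KV p x $ k) \<in> H01" for k
    unfolding KV_nth by (rule Kop_H01(1)[OF p])
  then show "KV p \<in> WW" unfolding WW_def by blast
  fix e :: real assume e: "e > 0"
  \<comment> \<open>Chosen so that \<open>2 * d\<^sup>2\<close>, summed over the components, is
    \<open>e\<^sup>2 / 2\<close>.\<close>
  define d where "d = e / (2 * sqrt (real CARD('a)))"
  have d: "d > 0" using e by (simp add: d_def)
  define s where "s = KV (\<lambda>x. \<chi> k. p x $ k + d)"
  have sk: "(\<lambda>x. s x $ k) = Kop (\<lambda>x. p x $ k + d)" for k by (simp add: s_def fun_eq_iff)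
  have sadd: "s x $ k = KV p x $ k + Kop (\<lambda>_. d) x" for x k
    unfolding sk[THEN fun_cong] KV_nth using p by (intro Kop_add) auto
  have Kpos: "0 < Kop (\<lambda>_. d) x" if "0 < x" "x < 1" for x
  proof -
    have "0 < (\<integral>y. bubble y * d \<partial>I01)"
      using d by (intro integral_I01_pos_continuous[where ?x0.0 = "1/2"] continuous_intros) auto
    then have "0 < bubble x * (\<integral>y. bubble y * d \<partial>I01)" using that by simp
    also have "\<dots> \<le> Kop (\<lambda>_. d) x" using d that by (intro Kop_ge_bubble) auto
    finally show ?thesis .
  qed
  have "s \<in> SS_o" unfolding SS_o_def S_o_def
  proof (intro CollectI allI conjI ballI)
    show "(\<lambda>x. s x $ k) \<in> H01" for k unfolding sk using p by (intro Kop_H01) auto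
    show "0 < s x $ k" if "x \<in> {0<..<1}" for x k
      unfolding sadd using that nn[of x k] Kpos[of x] by (simp add: add_nonneg_pos)
  qed
  have H: "H1_norm (\<lambda>x. (KV p x - s x) $ k) \<le> sqrt (2 * d\<^sup>2)" for k
  proof -
    have "(\<lambda>x. (KV p x - s x) $ k) = Kop (\<lambda>_. - d)"
      using Kop_cmult[of "-1" "\<lambda>_. d"] by (simp add: fun_eq_iff sadd)
    moreover have "H1_norm (Kop (\<lambda>_. - d)) \<le> sqrt (2 * (\<integral>x. (Kder (\<lambda>_. - d) x)\<^sup>2 \<partial>I01))"
      by (rule H1_norm_C1_le[OF Kop_derivs(1)]) (auto intro: Kop_derivs(4)[of _ 0])
    moreover have "(\<integral>x. (Kder (\<lambda>_. - d) x)\<^sup>2 \<partial>I01) \<le> (\<integral>x. d\<^sup>2 \<partial>I01)"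
    proof (intro integral_mono_AE AE_I01_I)
      show "integrable I01 (\<lambda>x. (Kder (\<lambda>_. - d) x)\<^sup>2)"
        by (intro integrable_I01_continuous continuous_intros Kop_derivs(4)[of _ 0]) auto
      fix x :: real assume x: "0 < x" "x < 1"
      have "\<bar>Kder (\<lambda>_. - d) x\<bar> \<le> (\<integral>y. \<bar>((if x < y then 1 else 0) - y) * - d\<bar> \<partial>I01)"
        unfolding Kder_def by (rule integral_abs_bound)
      also have "\<dots> \<le> (\<integral>y. d \<partial>I01)"
      proof (intro integral_mono_AE AE_I01_I)
        show "integrable I01 (\<lambda>y. \<bar>((if x < y then 1 else 0) - y) * - d\<bar>)"
          using d by (intro integrable_I01_bounded[of _ d] borel_measurable_abs borel_measurable_times
             borel_measurable_diff if_less_measurable ident_measurable_I01 borel_measurable_const)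
            (auto simp: abs_mult intro!: mult_left_le_one_le)
        show "\<bar>((if x < y then 1 else 0) - y) * - d\<bar> \<le> d" if "0 < y" "y < 1" for y
          using that d by (auto simp: abs_mult intro!: mult_left_le_one_le)
      qed auto
      finally have "\<bar>Kder (\<lambda>_. - d) x\<bar>\<^sup>2 \<le> d\<^sup>2" by (intro power_mono) auto
      then show "(Kder (\<lambda>_. - d) x)\<^sup>2 \<le> d\<^sup>2" by simp
    qed auto
    then have "sqrt (2 * (\<integral>x. (Kder (\<lambda>_. - d) x)\<^sup>2 \<partial>I01)) \<le> sqrt (2 * d\<^sup>2)"
      by (intro real_sqrt_le_mono) simp
    ultimately show ?thesis by (simp only: order_trans)
  qed
  have "WW_norm (\<lambda>x. KV p x - s x) \<le> sqrt (\<Sum>k\<in>(UNIV::'a set). 2 * d\<^sup>2)"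
    unfolding WW_norm_def
  proof (intro real_sqrt_le_mono sum_mono)
    fix k
    have "0 \<le> H1_norm (\<lambda>x. (KV p x - s x) $ k)" by (simp add: H1_norm_eq)
    then have "(H1_norm (\<lambda>x. (KV p x - s x) $ k))\<^sup>2 \<le> (sqrt (2 * d\<^sup>2))\<^sup>2" using H by (intro power_mono) auto
    then show "(H1_norm (\<lambda>x. (KV p x - s x) $ k))\<^sup>2 \<le> 2 * d\<^sup>2" by simp
  qed
  also have "\<dots> < e"
  proof (rule real_less_lsqrt)
    have "(2 * d * sqrt (real CARD('a)))\<^sup>2 = e\<^sup>2" by (simp add: d_def)
    then have "4 * d\<^sup>2 * real CARD('a) = e\<^sup>2" by (simp add: power_mult_distrib)
    moreover have "2 * d\<^sup>2 * real CARD('a) < 4 * d\<^sup>2 * real CARD('a)" using d by simp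
    ultimately show "(\<Sum>k\<in>(UNIV::'a set). 2 * d\<^sup>2) < e\<^sup>2" by (simp add: mult.commute)
  qed (use e in simp)
  finally show "\<exists>s\<in>SS_o. WW_norm (\<lambda>x. KV p x - s x) < e" using \<open>s \<in> SS_o\<close> by blast
qed

lemma H01_diff_H1:
  assumes "u \<in> H01" "v \<in> H01"
  shows "(\<lambda>x. u x - v x) \<in> H1"
proof -
  note d = H01_D[OF assms(1)] H01_D[OF assms(2)]
  have "is_weak_deriv (\<lambda>x. u x - v x) (\<lambda>x. wderiv u x - wderiv v x)"
    by (intro weak_deriv_diff d)
  then show ?thesis unfolding H1_def using L2_diff d by blast
qed

text \<open>Convergence in the H1 norm is uniform, so pointwise signs pass to the closure.\<close>

lemma SS_nonneg:
  assumes "v \<in> SS"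
  shows "0 \<le> v x $ k"
proof (cases "x \<in> {0..1}")
  case False
  have "(\<lambda>x. v x $ k) \<in> H01" using assms by (auto simp: SS_def WW_def)
  from H01_D(3)[OF this False] show ?thesis by simp
next
  case x: True
  show ?thesis
  proof (rule ccontr)
    assume n: "\<not> 0 \<le> v x $ k"
    \<comment> \<open>The sup bound costs a factor 2; with a quarter of the deficit the approximant
      is still negative at \<open>x\<close>.\<close>
    define e where "e = - (v x $ k) / 4"
    have e: "e > 0" using n by (simp add: e_def)
    obtain s where s: "s \<in> SS_o" "WW_norm (\<lambda>x. v x - s x) < e" using assms e by (auto simp: SS_def)
    have vk: "(\<lambda>x. v x $ k) \<in> H01" using assms by (auto simp: SS_def WW_def)
    have sk: "(\<lambda>x. s x $ k) \<in> H01" using s by (auto simp: SS_o_def S_o_def)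
    have "0 \<le> s x $ k"
    proof (cases "0 < x \<and> x < 1")
      case True then show ?thesis using s by (auto simp: SS_o_def S_o_def intro: less_imp_le)
    next
      case False
      then have "x = 0 \<or> x = 1" using x by auto
      then show ?thesis using H01_boundary[OF sk] by auto
    qed
    have "(H1_norm (\<lambda>x. (v x - s x) $ k))\<^sup>2 \<le> (\<Sum>k\<in>UNIV. (H1_norm (\<lambda>x. (v x - s x) $ k))\<^sup>2)"
      by (rule member_le_sum) auto
    then have "H1_norm (\<lambda>x. (v x - s x) $ k) \<le> WW_norm (\<lambda>x. v x - s x)"
      unfolding WW_norm_def by (rule real_le_rsqrt)
    moreover have "\<bar>(\<lambda>x. v x $ k - s x $ k) x\<bar> \<le> 2 * H1_norm (\<lambda>x. v x $ k - s x $ k)"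
      by (rule H1_sup_bound[OF _ H01_diff_H1[OF vk sk] x]) (intro continuous_intros H01_D(1) vk sk)
    ultimately have "\<bar>v x $ k - s x $ k\<bar> < 2 * e" using s(2) by simp
    then show False using \<open>0 \<le> s x $ k\<close> e by (simp add: e_def)
  qed
qed

section \<open>Weak formulation and fixed points of \<open>step\<close>\<close>

context elliptic_system begin

lemma pairing_I01: "pairing h v = (\<Sum>k\<in>UNIV. \<integral>x. h x $ k * v x $ k \<partial>I01)"
  by (simp add: pairing_def LBINT_I01)

lemma F_op_eq:
  assumes u: "nonneg_cont u" and z: "\<zeta> \<in> WW"
  shows "F_op f q u lam \<zeta> = (\<Sum>k\<in>UNIV. (\<integral>x. wderiv (\<lambda>y. u y $ k) x * wderiv (\<lambda>y. \<zeta> y $ k) x \<partial>I01)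
     - (\<integral>x. Nl lam u x $ k * \<zeta> x $ k \<partial>I01))"
proof -
  have "(\<integral>x. Nl lam u x $ k * \<zeta> x $ k \<partial>I01) = (\<integral>x. f x (u x) $ k * \<zeta> x $ k \<partial>I01)
     + lam * (\<integral>x. g_map q (u x) $ k * \<zeta> x $ k \<partial>I01)" for k
  proof -
    have c: "continuous_on {0..1} (\<lambda>x. \<zeta> x $ k)" using z by (auto simp: WW_def intro: H01_D(1))
    have "(\<integral>x. Nl lam u x $ k * \<zeta> x $ k \<partial>I01) = (\<integral>x. f x (u x) $ k * \<zeta> x $ k + lam * (g_map q (u x) $ k * \<zeta> x $ k) \<partial>I01)"
      by (intro Bochner_Integration.integral_cong) (auto simp: g_map_def algebra_simps)
    also have "\<dots> = (\<integral>x. f x (u x) $ k * \<zeta> x $ k \<partial>I01) + (\<integral>x. lam * (g_map q (u x) $ k * \<zeta> x $ k) \<partial>I01)"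
      by (intro Bochner_Integration.integral_add integrable_I01_continuous)
        (auto simp: g_map_def intro!: continuous_intros f_comp_continuous g_continuous u c)
    finally show ?thesis by simp
  qed
  then show ?thesis
    by (simp add: F_op_def dirichlet_form_def pairing_I01 LBINT_I01 sum_subtractf sum.distrib sum_distrib_left)
qed

lemma solution_UU_o:
  assumes u: "nonneg_cont u" and fix_: "step lam u = u" and lam: "lam \<ge> 0"
    and pos: "\<And>x k. 0 < x \<Longrightarrow> x < 1 \<Longrightarrow> 0 < u x $ k"
  shows "u \<in> UU_o" "is_solution f q u lam"
proof -
  have uk: "(\<lambda>x. u x $ k) = Kop (\<lambda>x. Nl lam u x $ k)" for k
    using fix_ by (metis (no_types) step_nth ext)
  show "u \<in> UU_o" unfolding UU_o_def
  proof (intro CollectI allI)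
    fix k
    show "(\<lambda>x. u x $ k) \<in> U_o" unfolding uk[of k]
      using Nl_nonneg[OF _ nonneg_contD(4)[OF u] lam] pos[of _ k] uk[of k, THEN fun_cong]
      by (intro Kop_U_o Nl_continuous u) (auto simp del: Nl_nth)
  qed
  show "is_solution f q u lam" unfolding is_solution_def
  proof
    fix \<zeta> :: "real \<Rightarrow> (real, 'm) vec" assume z: "\<zeta> \<in> WW"
    have "(\<integral>x. wderiv (\<lambda>y. u y $ k) x * wderiv (\<lambda>y. \<zeta> y $ k) x \<partial>I01) = (\<integral>x. Nl lam u x $ k * \<zeta> x $ k \<partial>I01)" for k
      unfolding uk[of k] using z by (intro Kop_weak Nl_integrable u) (auto simp: WW_def)
    then show "F_op f q u lam \<zeta> = 0" unfolding F_op_eq[OF u z] by simp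
  qed
qed

lemma g_pairing_pos:
  assumes u: "u \<in> UU_o" and v: "v \<in> SS_nz"
  shows "0 < pairing (\<lambda>x. g_map q (u x)) v"
proof -
  have vS: "v \<in> SS" and vn: "v \<noteq> (\<lambda>_. 0)" using v by auto
  have vH: "(\<lambda>x. v x $ k) \<in> H01" for k using vS by (auto simp: SS_def WW_def)
  note uD = UU_oD[OF u]
  obtain x k where xk: "v x $ k \<noteq> 0" using vn by (auto simp: fun_eq_iff vec_eq_iff)
  have x: "0 < x" "x < 1"
    using xk H01_boundary[OF vH[of k]] H01_D(3)[OF vH[of k], of x] by (force simp: order_le_less)+
  have c: "continuous_on {0..1} (\<lambda>x. g_map q (u x) $ k * v x $ k)" for k
    unfolding g_map_def vec_lambda_beta by (rule continuous_on_mult[OF g_continuous[OF uD(1)] H01_D(1)[OF vH]])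
  have nn: "0 \<le> g_map q (u x) $ k * v x $ k" for x k using SS_nonneg[OF vS, of x k] by (simp add: g_map_def)
  have "0 < (\<integral>x. g_map q (u x) $ k * v x $ k \<partial>I01)"
    using SS_nonneg[OF vS, of x k] xk x uD(3)[OF x, of k]
    by (intro integral_I01_pos_continuous[OF c nn, of x]) (auto simp: g_map_def)
  also have "\<dots> \<le> pairing (\<lambda>x. g_map q (u x)) v"
    unfolding pairing_I01 using nn by (intro member_le_sum integral_nonneg_AE) auto
  finally show ?thesis .
qed

text \<open>The weak equation tested with \<open>v\<close> makes the quotient independent of
  \<open>v\<close>. Every claim about infima and minima over \<open>v\<close> at a solution rests on
  this.\<close>

lemma rayleigh_solution:
  assumes u: "u \<in> UU_o" and s: "is_solution f q u lam" and v: "v \<in> SS_nz"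
  shows "rayleigh f q u v = lam"
proof -
  have "v \<in> WW" using v by (auto simp: SS_def)
  then have "F_op f q u lam v = 0" using s by (simp add: is_solution_def)
  then show ?thesis using g_pairing_pos[OF u v] by (simp add: rayleigh_def F_op_def field_simps)
qed

text \<open>The weak inequality holds only against the cone. \<open>weak_eq_Kop\<close> is content
  with test functions \<open>Kop \<eta>\<close>, placed in one component and 0 elsewhere, and these
  lie in \<open>SS\<close> by \<open>KV_SS\<close>.\<close>

lemma rayleigh_super:
  assumes u: "u \<in> UU_o" and ray: "\<And>v. v \<in> SS_nz \<Longrightarrow> lam \<le> rayleigh f q u v"
  shows "step lam u x $ k \<le> u x $ k"
proof (cases "x \<in> {0..1}")
  case False
  then have "step lam u x $ k = 0" unfolding step_nth by (rule Kop_outside)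
  moreover have "0 \<le> u x $ k" using UU_oD(1)[OF u] nonneg_contD(3) by blast
  ultimately show ?thesis by simp
next
  case True
  note uD = UU_oD[OF u]
  show ?thesis unfolding step_nth
  proof (rule weak_eq_Kop[OF uD(2) Nl_integrable[OF uD(1)] Nl_continuous[OF uD(1)] _ True])
    fix \<eta> :: "real \<Rightarrow> real" and s :: real
    assume \<eta>: "continuous_on {0..1} \<eta>" "\<And>x. 0 \<le> \<eta> x" and s: "s \<in> {0..1}" "0 < \<eta> s"
    \<comment> \<open>The source \<open>\<eta>\<close> in component \<open>k\<close> alone, so that
      the sum over components collapses to the inequality for that component.\<close>
    define p :: "real \<Rightarrow> (real, 'm) vec" where "p y = (\<chi> j. if j = k then \<eta> y else 0)" for y
    have pj: "(\<lambda>y. p y $ j) = (if j = k then \<eta> else (\<lambda>_. 0))" for j by (auto simp: p_def)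
    have i: "integrable I01 (\<lambda>y. p y $ j)" for j
      unfolding pj using integrable_I01_continuous[OF \<eta>(1)] by auto
    have K0: "Kop (\<lambda>_. 0) y = 0" for y by (simp add: Kop_def)
    have Kp: "KV p y $ j = (if j = k then Kop \<eta> y else 0)" for y j by (simp add: pj K0)
    have "0 < bubble (1/2) * (\<integral>y. bubble y * \<eta> y \<partial>I01)"
    proof -
      obtain a b where ab: "0 \<le> a" "a < b" "b \<le> 1" "\<And>y. y \<in> {a<..<b} \<Longrightarrow> \<eta> y > 0"
        by (rule continuous_pos_interval[OF \<eta>(1) s]) auto
      have "0 < (\<integral>y. bubble y * \<eta> y \<partial>I01)"
        using \<eta> ab by (intro integral_I01_pos[OF _ _ ab(1-3)] integrable_I01_continuous continuous_intros)
          (auto intro!: AE_I01_I mult_pos_pos)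
      then show ?thesis by simp
    qed
    also have "\<dots> \<le> Kop \<eta> (1/2)" using \<eta> by (intro Kop_ge_bubble integrable_I01_continuous) auto
    finally have "KV p (1/2) $ k \<noteq> 0" unfolding Kp by simp
    then have "KV p \<noteq> (\<lambda>_. 0)" by (metis zero_index)
    moreover have "KV p \<in> SS"
      using \<eta>(2) by (intro KV_SS i) (auto simp: pj K0 Kop_nonneg)
    ultimately have nz: "KV p \<in> SS_nz" by simp
    have W: "KV p \<in> WW" using nz by (auto simp: SS_def)
    have "lam * pairing (\<lambda>x. g_map q (u x)) (KV p) \<le> dirichlet_form u (KV p) - pairing (\<lambda>x. f x (u x)) (KV p)"
      using ray[OF nz] g_pairing_pos[OF u nz] by (simp add: rayleigh_def field_simps)
    then have "0 \<le> F_op f q u lam (KV p)" by (simp add: F_op_def)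
    also have "\<dots> = (\<Sum>j\<in>UNIV. if j = k then (\<integral>x. wderiv (\<lambda>y. u y $ k) x * wderiv (Kop \<eta>) x \<partial>I01)
     - (\<integral>x. Nl lam u x $ k * Kop \<eta> x \<partial>I01) else 0)"
      unfolding F_op_eq[OF uD(1) W]
    proof (rule sum.cong[OF refl])
      fix j
      have "Kop (\<lambda>_. 0) = (\<lambda>_. 0)" using K0 by blast
      then have "(\<integral>x. wderiv (\<lambda>y. u y $ j) x * wderiv (\<lambda>_. 0) x \<partial>I01) = 0"
        using Kop_weak[of "\<lambda>_. 0", OF _ uD(2)[of j]] by (simp add: mult.commute)
      then show "(\<integral>x. wderiv (\<lambda>y. u y $ j) x * wderiv (\<lambda>y. KV p y $ j) x \<partial>I01)
         - (\<integral>x. Nl lam u x $ j * KV p x $ j \<partial>I01) = (if j = k then (\<integral>x. wderiv (\<lambda>y. u y $ k) x * wderiv (Kop \<eta>) x \<partial>I01)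
         - (\<integral>x. Nl lam u x $ k * Kop \<eta> x \<partial>I01) else 0)"
        unfolding Kp by (auto simp del: Nl_nth)
    qed
    finally show "(\<integral>x. Nl lam u x $ k * Kop \<eta> x \<partial>I01) \<le> (\<integral>x. wderiv (\<lambda>x. u x $ k) x * wderiv (Kop \<eta>) x \<partial>I01)"
      by (simp del: Nl_nth)
  qed
qed

section \<open>Minimal solutions\<close>

text \<open>Strict positivity excludes the zero function, which is a supersolution for every
  parameter.\<close>

definition pos_super where
  "pos_super lam w \<longleftrightarrow> nonneg_cont w \<and> (\<forall>x k. 0 < x \<longrightarrow> x < 1 \<longrightarrow> 0 < w x $ k) \<and> (\<forall>x k. step lam w x $ k \<le> w x $ k)"

text \<open>The solution of \<open>lam * eps powr (q - 1) = pi\<^sup>2 * eps\<close>. Since \<open>Kop sin\<pi> = sin\<pi> / pi\<^sup>2\<close> and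
  \<open>sin\<pi> powr (q - 1) \<ge> sin\<pi>\<close>, the function \<open>eps * sin\<pi>\<close> is a subsolution.\<close>

definition eps :: "real \<Rightarrow> real" where
  "eps lam = (lam / pi\<^sup>2) powr (1 / (2 - q))"

definition subsol where
  "subsol lam x = (\<chi> k::'m. if x \<in> {0..1} then eps lam * sin\<pi> x else 0)"

lemma subsol_nth: "subsol lam x $ k = (if x \<in> {0..1} then eps lam * sin\<pi> x else 0)"
  by (simp add: subsol_def)

lemma eps_pos: "lam > 0 \<Longrightarrow> eps lam > 0"
  by (simp add: eps_def)

lemma eps_eq: "lam > 0 \<Longrightarrow> lam * eps lam powr (q - 1) / pi\<^sup>2 = eps lam"
proof -
  assume l: "lam > 0"
  have "eps lam powr (2 - q) = lam / pi\<^sup>2" using l q by (simp add: eps_def powr_powr)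
  then have "lam * eps lam powr (q - 1) / pi\<^sup>2 = eps lam powr (2 - q) * eps lam powr (q - 1)" by simp
  also have "\<dots> = eps lam" using eps_pos[OF l] by (simp add: powr_add[symmetric])
  finally show ?thesis .
qed

lemma subsol_nonneg_cont: "lam > 0 \<Longrightarrow> nonneg_cont (subsol lam)"
proof (rule nonneg_contI)
  fix k
  show "continuous_on {0..1} (\<lambda>x. subsol lam x $ k)"
    by (rule continuous_on_eq[of _ "\<lambda>x. eps lam * sin\<pi> x"]) (auto simp: subsol_nth intro!: continuous_intros)
next
  fix x k assume "lam > 0"
  then show "0 \<le> subsol lam x $ k" using eps_pos[of lam] sin_nonneg[of x] by (simp add: subsol_nth)
qed

text \<open>The nonnegative \<open>f\<close> is dropped and the sublinear term alone turns a
  coefficient \<open>c\<close> into \<open>lam * c powr (q - 1) / pi\<^sup>2\<close>, a map that has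
  \<open>eps lam\<close> as its fixed point.\<close>

lemma step_ge_sin:
  assumes w: "nonneg_cont w" and c: "0 \<le> c" "\<And>x. x \<in> {0..1} \<Longrightarrow> c * sin\<pi> x \<le> w x $ k"
    and lam: "lam \<ge> 0" and x: "x \<in> {0..1}"
  shows "lam * c powr (q - 1) / pi\<^sup>2 * sin\<pi> x \<le> step lam w x $ k"
proof -
  have "Kop (\<lambda>y. lam * c powr (q - 1) * sin\<pi> y) x \<le> step lam w x $ k"
    unfolding step_nth
  proof (rule Kop_mono[OF _ Nl_integrable[OF w]])
    show "integrable I01 (\<lambda>y. lam * c powr (q - 1) * sin\<pi> y)" using integrable_sin by simp
    fix y :: real assume y: "0 < y" "y < 1"
    then have y': "y \<in> {0..1}" by auto
    have s: "0 < sin\<pi> y" using sin_pos[OF y] .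
    have "sin\<pi> y = sin\<pi> y powr 1" using s by simp
    also have "\<dots> \<le> sin\<pi> y powr (q - 1)" using q s by (intro powr_mono') auto
    finally have "lam * c powr (q - 1) * sin\<pi> y \<le> lam * c powr (q - 1) * sin\<pi> y powr (q - 1)"
      using lam by (intro mult_left_mono) auto
    then have "lam * c powr (q - 1) * sin\<pi> y \<le> lam * (c powr (q - 1) * sin\<pi> y powr (q - 1))"
      by (simp only: mult.assoc)
    also have "c powr (q - 1) * sin\<pi> y powr (q - 1) = (c * sin\<pi> y) powr (q - 1)"
      using c s by (simp add: powr_mult)
    also have "lam * (c * sin\<pi> y) powr (q - 1) \<le> lam * (w y $ k) powr (q - 1)"
      using c s q lam y' by (intro mult_left_mono powr_mono2) auto
    also have "\<dots> \<le> Nl lam w y $ k"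
      using f_bound[OF y' nonneg_contD(4)[OF w, of y], of k] by simp
    finally show "lam * c powr (q - 1) * sin\<pi> y \<le> Nl lam w y $ k" .
  qed
  then show ?thesis using x by (simp add: Kop_cmult Kop_sin)
qed

lemma subsol_step: "lam > 0 \<Longrightarrow> subsol lam x $ k \<le> step lam (subsol lam) x $ k"
proof (cases "x \<in> {0..1}")
  case True
  assume l: "lam > 0"
  have "lam * eps lam powr (q - 1) / pi\<^sup>2 * sin\<pi> x \<le> step lam (subsol lam) x $ k"
    using l eps_pos[OF l] True by (intro step_ge_sin subsol_nonneg_cont) (auto simp: subsol_nth)
  then show ?thesis using True unfolding eps_eq[OF l] by (simp add: subsol_nth)
next
  case False
  then show ?thesis unfolding step_nth by (auto simp: subsol_nth Kop_def)
qed

lemma pos_super_ge_bubble: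
  assumes w: "pos_super lam w" and lam: "lam > 0"
  obtains c where "c > 0" "\<And>x. x \<in> {0..1} \<Longrightarrow> c * bubble x \<le> w x $ k"
proof -
  have nw: "nonneg_cont w" and wp: "\<And>x k. 0 < x \<Longrightarrow> x < 1 \<Longrightarrow> 0 < w x $ k"
    and ws: "\<And>x k. step lam w x $ k \<le> w x $ k" using w by (auto simp: pos_super_def)
  define c where "c = (\<integral>y. bubble y * Nl lam w y $ k \<partial>I01)"
  have nl: "0 \<le> Nl lam w y $ k" if "y \<in> {0..1}" for y
    using that lam by (intro Nl_nonneg nonneg_contD(4)[OF nw]) auto
  have "0 < Nl lam w (1/2) $ k"
    using f_bound[of "1/2" "w (1/2)" k] nonneg_contD(4)[OF nw] wp[of "1/2" k] lam by (simp add: add_nonneg_pos)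
  then have "c > 0" unfolding c_def
    using nl by (intro integral_I01_pos_continuous[where ?x0.0 = "1/2"] continuous_on_mult continuous_on_diff
        continuous_on_id continuous_on_const Nl_continuous nw) (auto simp del: Nl_nth)
  moreover have "c * bubble x \<le> w x $ k" if x: "x \<in> {0..1}" for x
  proof -
    have "bubble x * c \<le> step lam w x $ k"
      unfolding c_def step_nth using nl by (intro Kop_ge_bubble Nl_integrable nw x) auto
    then show ?thesis using ws[of x k] by (simp add: mult.commute)
  qed
  ultimately show thesis by (rule that)
qed

text \<open>Let \<open>b\<close> be the largest coefficient with \<open>b * sin\<pi>\<close> below
  component \<open>k\<close> of \<open>w\<close>. By \<open>step_ge_sin\<close> also
  \<open>lam * b powr (q - 1) / pi\<^sup>2\<close> is such a coefficient, hence at most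
  \<open>b\<close>, and this means \<open>eps lam \<le> b\<close>.\<close>

lemma pos_super_ge_subsol:
  assumes w: "pos_super lam w" and lam: "lam > 0"
  shows "subsol lam x $ k \<le> w x $ k"
proof -
  have nw: "nonneg_cont w" and ws: "\<And>x k. step lam w x $ k \<le> w x $ k" using w by (auto simp: pos_super_def)
  obtain c0 where c0: "c0 > 0" "\<And>x. x \<in> {0..1} \<Longrightarrow> c0 * bubble x \<le> w x $ k"
    using pos_super_ge_bubble[OF w lam] by blast
  define S where "S = {c. 0 \<le> c \<and> (\<forall>x\<in>{0..1}. c * sin\<pi> x \<le> w x $ k)}"
  \<comment> \<open>Some positive coefficient is admissible, so \<open>b\<close> is positive and
    \<open>b powr (q - 1)\<close> can be cancelled.\<close>
  have in1: "c0 / pi\<^sup>2 \<in> S"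
  proof -
    have "c0 / pi\<^sup>2 * sin\<pi> x \<le> w x $ k" if "x \<in> {0..1}" for x
    proof -
      have "c0 / pi\<^sup>2 * sin\<pi> x \<le> c0 / pi\<^sup>2 * (pi\<^sup>2 * bubble x)"
        using sin_le_bubble[OF that] c0 by (intro mult_left_mono) auto
      also have "\<dots> = c0 * bubble x" by simp
      finally show ?thesis using c0(2)[OF that] by simp
    qed
    then show ?thesis using c0 by (simp add: S_def)
  qed
  have bdd: "bdd_above S"
  proof (rule bdd_aboveI)
    fix c assume "c \<in> S"
    then have "\<forall>x\<in>{0..1}. c * sin\<pi> x \<le> w x $ k" by (simp add: S_def)
    from bspec[OF this, of "1/2"] show "c \<le> w (1/2) $ k" by simp
  qed
  define b where "b = Sup S"
  have "0 < c0 / pi\<^sup>2" using c0 by simp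
  then have b0: "b > 0" using cSup_upper[OF in1 bdd] unfolding b_def by linarith
  have bS: "b * sin\<pi> x \<le> w x $ k" if x: "x \<in> {0..1}" for x
  proof (cases "sin\<pi> x = 0")
    case True then show ?thesis using nonneg_contD(3)[OF nw] by simp
  next
    case False
    then have s: "sin\<pi> x > 0" using sin_nonneg[OF x] by simp
    have "b \<le> w x $ k / sin\<pi> x" unfolding b_def
    proof (rule cSup_least)
      show "S \<noteq> {}" using in1 by blast
      fix c assume "c \<in> S"
      then show "c \<le> w x $ k / sin\<pi> x" using s x by (simp add: S_def pos_le_divide_eq)
    qed
    then show ?thesis using s by (simp add: pos_le_divide_eq)
  qed
  have "lam * b powr (q - 1) / pi\<^sup>2 \<in> S" unfolding S_def
  proof (intro CollectI conjI ballI)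
    fix x :: real assume x: "x \<in> {0..1}"
    have "lam * b powr (q - 1) / pi\<^sup>2 * sin\<pi> x \<le> step lam w x $ k"
      using b0 lam by (intro step_ge_sin nw bS x) auto
    then show "lam * b powr (q - 1) / pi\<^sup>2 * sin\<pi> x \<le> w x $ k" using ws[of x k] by simp
  qed (use lam in auto)
  then have "lam * b powr (q - 1) / pi\<^sup>2 \<le> b" unfolding b_def by (rule cSup_upper[OF _ bdd])
  then have "lam / pi\<^sup>2 * b powr (q - 1) \<le> b powr (2 - q) * b powr (q - 1)"
    using b0 by (simp add: powr_add[symmetric])
  then have "lam / pi\<^sup>2 \<le> b powr (2 - q)" by (rule mult_right_le_imp_le) (use b0 in simp)
  then have "eps lam \<le> (b powr (2 - q)) powr (1 / (2 - q))"
    unfolding eps_def using lam q by (intro powr_mono2) auto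
  also have "\<dots> = b" using b0 q by (simp add: powr_powr)
  finally have "eps lam \<le> b" .
  show ?thesis
  proof (cases "x \<in> {0..1}")
    case True
    have "eps lam * sin\<pi> x \<le> b * sin\<pi> x" using \<open>eps lam \<le> b\<close> sin_nonneg[OF True] by (rule mult_right_mono)
    then show ?thesis using bS[OF True] True by (simp add: subsol_nth)
  qed (use nonneg_contD(3)[OF nw] in \<open>auto simp: subsol_nth\<close>)
qed

lemma pos_super_antimono: "pos_super lam w \<Longrightarrow> 0 \<le> lam' \<Longrightarrow> lam' \<le> lam \<Longrightarrow> pos_super lam' w"
proof -
  assume w: "pos_super lam w" and l: "0 \<le> lam'" "lam' \<le> lam"
  then have nw: "nonneg_cont w" and ws: "\<And>x k. step lam w x $ k \<le> w x $ k" by (auto simp: pos_super_def)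
  have "step lam' w x $ k \<le> w x $ k" for x k
    by (rule order_trans[OF step_mono[OF nw nw order_refl l] ws])
  then show "pos_super lam' w" using w unfolding pos_super_def by blast
qed

definition is_minsol where
  "is_minsol lam v \<longleftrightarrow> nonneg_cont v \<and> step lam v = v \<and> (\<forall>x k. subsol lam x $ k \<le> v x $ k) \<and>
     (\<forall>w. pos_super lam w \<longrightarrow> (\<forall>x k. v x $ k \<le> w x $ k))"

lemma nonneg_cont_bounded:
  assumes "nonneg_cont w" "\<And>x k. x \<notin> {0..1} \<Longrightarrow> w x $ k \<le> 0"
  obtains b where "0 \<le> b" "\<And>x k. w x $ k \<le> b"
proof -
  have "compact (w ` {0..1})" by (intro compact_continuous_image nonneg_contD(1)[OF assms(1)]) auto
  then obtain b where b: "\<And>x. x \<in> {0..1} \<Longrightarrow> norm (w x) \<le> b"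
    using compact_imp_bounded bounded_iff by (metis imageI)
  have "norm (w 0) \<le> b" by (rule b) simp
  then have b0: "0 \<le> b" using norm_ge_zero[of "w 0"] by linarith
  have "w x $ k \<le> b" for x k
    using b[of x] component_le_norm_cart[of "w x" k] assms(2)[of x k] b0 by (cases "x \<in> {0..1}") auto
  with b0 show thesis by (rule that)
qed

lemma step_outside: "x \<notin> {0..1} \<Longrightarrow> step lam u x $ k = 0"
  unfolding step_nth by (rule Kop_outside)

lemma minsol_ex:
  assumes "pos_super lam w" "lam > 0"
  shows "\<exists>v. is_minsol lam v"
proof -
  have nw: "nonneg_cont w" using assms by (auto simp: pos_super_def)
  have ns: "nonneg_cont (step lam w)" using nw assms by (intro step_nonneg_cont) auto
  \<comment> \<open>\<open>w\<close> is bounded only on \<open>{0..1}\<close>. Its image under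
    \<open>step\<close> vanishes outside and still dominates all iterates.\<close>
  obtain b where b: "0 \<le> b" "\<And>x k. step lam w x $ k \<le> b"
    by (rule nonneg_cont_bounded[OF ns]) (simp_all add: step_outside)
  have le: "iter lam (subsol lam) n x $ k \<le> w' x $ k" if "pos_super lam w'" for w' n x k
    using assms(2) pos_super_ge_subsol[OF that assms(2)] that
    by (intro iter_le_super subsol_nonneg_cont) (auto simp: pos_super_def)
  have bnd: "iter lam (subsol lam) n x $ k \<le> b" for n x k
  proof -
    have "iter lam (subsol lam) n x $ k \<le> iter lam (subsol lam) (Suc n) x $ k"
      using assms by (intro iter_mono_Suc subsol_nonneg_cont subsol_step) auto
    also have "\<dots> \<le> step lam w x $ k"
      unfolding iter_simps using assms nw by (intro step_mono iter_nonneg_cont subsol_nonneg_cont le) auto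
    finally show ?thesis using b(2)[of x k] by simp
  qed
  obtain v where v: "nonneg_cont v" "step lam v = v" "\<And>n x k. iter lam (subsol lam) n x $ k \<le> v x $ k"
    "\<And>x k. (\<lambda>n. iter lam (subsol lam) n x $ k) \<longlonglongrightarrow> v x $ k"
    by (rule iter_limit[OF subsol_nonneg_cont[OF assms(2)] less_imp_le[OF assms(2)] subsol_step[OF assms(2)] bnd]) blast
  have "v x $ k \<le> w' x $ k" if "pos_super lam w'" for w' x k
    using le[OF that] by (intro LIMSEQ_le_const2[OF v(4)]) auto
  moreover have "subsol lam x $ k \<le> v x $ k" for x k using v(3)[of 0] by simp
  ultimately show ?thesis using v(1,2) unfolding is_minsol_def by blast
qed

lemma subsol_pos: "lam > 0 \<Longrightarrow> 0 < x \<Longrightarrow> x < 1 \<Longrightarrow> 0 < subsol lam x $ k"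
  using eps_pos[of lam] sin_pos[of x] by (simp add: subsol_nth)

lemma fixed_pos_super:
  assumes "nonneg_cont v" "step lam v = v" "\<And>x k. subsol lam0 x $ k \<le> v x $ k" "lam0 > 0"
  shows "pos_super lam v"
  unfolding pos_super_def assms(2)
  using assms(1) less_le_trans[OF subsol_pos[OF assms(4)] assms(3)] by blast

section \<open>The set of parameters with a positive supersolution\<close>

definition Lam :: "real set" where
  "Lam = {lam. lam > 0 \<and> (\<exists>w. pos_super lam w)}"

text \<open>The supersolution is \<open>Kop\<close> of a small constant \<open>e\<close>. As
  \<open>f\<close> is of order \<open>\<gamma> - 1 > 1\<close>, some \<open>e\<close> makes its
  contribution at most \<open>e / 2\<close>, namely the solution of
  \<open>C * (m * e) powr (\<gamma> - 1) = e / 2\<close>; then \<open>lam\<close> is chosen so that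
  the sublinear term contributes at most \<open>e / 2\<close> as well.\<close>

lemma Lam_nonempty: "Lam \<noteq> {}"
proof -
  define m where "m = real CARD('m)"
  have m: "m \<ge> 1" by (simp add: m_def Suc_le_eq)
  define e where "e = (1 / (2 * C * m powr (\<gamma> - 1))) powr (1 / (\<gamma> - 2))"
  have e: "e > 0" using C m by (simp add: e_def)
  have "e powr (\<gamma> - 2) = 1 / (2 * C * m powr (\<gamma> - 1))" using C m \<gamma> by (simp add: e_def powr_powr)
  then have ee: "C * m powr (\<gamma> - 1) * e powr (\<gamma> - 2) = 1 / 2" using C m by (simp add: field_simps)
  define lam where "lam = e powr (2 - q) / 2"
  have lam: "lam > 0" using e by (simp add: lam_def)
  define w where "w x = (\<chi> k::'m. Kop (\<lambda>_. e) x)" for x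
  have wk: "w x $ k = Kop (\<lambda>_. e) x" for x k by (simp add: w_def)
  have ie: "integrable I01 (\<lambda>_. e)" by simp
  have w0: "0 \<le> w x $ k" for x k unfolding wk using e by (intro Kop_nonneg) auto
  have we: "w x $ k \<le> e" for x k
  proof (cases "x \<in> {0..1}")
    case True
    have "\<bar>Kop (\<lambda>_. e) x\<bar> \<le> (\<integral>y. \<bar>e\<bar> \<partial>I01)" by (rule Kop_abs_le(3)[OF ie True])
    then show ?thesis using e by (simp add: wk)
  next
    case False
    then show ?thesis using e Kop_outside[OF False, of "\<lambda>_. e"] unfolding wk by linarith
  qed
  have nw: "nonneg_cont w"
    by (rule nonneg_contI) (use w0 in \<open>auto simp: wk Kop_continuous\<close>)
  have "pos_super lam w" unfolding pos_super_def
  proof (intro conjI allI impI nw)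
    fix x :: real and k assume x: "0 < x" "x < 1"
    have "0 < (\<integral>y. bubble y * e \<partial>I01)"
      using e by (intro integral_I01_pos_continuous[where ?x0.0 = "1/2"] continuous_intros) auto
    then have "0 < bubble x * (\<integral>y. bubble y * e \<partial>I01)" using x by simp
    also have "\<dots> \<le> Kop (\<lambda>_. e) x" using e x by (intro Kop_ge_bubble) auto
    finally show "0 < w x $ k" by (simp add: wk)
  next
    fix x k
    show "step lam w x $ k \<le> w x $ k" unfolding step_nth wk
    proof (rule Kop_mono[OF Nl_integrable[OF nw] ie])
      fix y :: real assume y: "0 < y" "y < 1"
      have "norm (w y) \<le> m * e" unfolding m_def by (rule norm_le_card_mult[OF w0 we])
      then have "norm (w y) powr (\<gamma> - 1) \<le> (m * e) powr (\<gamma> - 1)" using \<gamma> by (intro powr_mono2) auto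
      then have "C * norm (w y) powr (\<gamma> - 1) \<le> C * (m * e) powr (\<gamma> - 1)" using C by (intro mult_left_mono) auto
      also have "C * (m * e) powr (\<gamma> - 1) = (C * m powr (\<gamma> - 1) * e powr (\<gamma> - 2)) * e"
      proof -
        have "e powr (\<gamma> - 1) = e powr (\<gamma> - 2) * e powr 1" using e unfolding powr_add[symmetric] by simp
        then show ?thesis using e m by (simp add: powr_mult)
      qed
      also have "\<dots> = e / 2" unfolding ee by simp
      finally have "f y (w y) $ k \<le> e / 2"
        using f_bound[OF _ nonneg_contD(4)[OF nw], of y y k] y by simp
      moreover have "lam * (w y $ k) powr (q - 1) \<le> lam * e powr (q - 1)"
        using lam q w0 we by (intro mult_left_mono powr_mono2) auto
      moreover have "lam * e powr (q - 1) = e / 2"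
        using e by (simp add: lam_def powr_add[symmetric])
      ultimately show "Nl lam w y $ k \<le> e" by simp
    qed
  qed
  then show ?thesis using lam by (auto simp: Lam_def)
qed

text \<open>Tested against \<open>sin\<pi>\<close>, a supersolution gives a nonpositive integral of
  the sum of \<open>Nl lam w - pi\<^sup>2 * w\<close>. Beyond the stated bound this sum is positive:
  by large growth where \<open>norm (w x) > R\<close>, and elsewhere because
  \<open>w $ k \<le> R\<close> gives
  \<open>pi\<^sup>2 * w $ k < lam * (w $ k) powr (q - 1)\<close>.\<close>

lemma Lam_bound: "lam \<in> Lam \<Longrightarrow> lam \<le> pi\<^sup>2 * R powr (2 - q)"
proof (rule ccontr)
  assume "lam \<in> Lam" and big: "\<not> lam \<le> pi\<^sup>2 * R powr (2 - q)"
  then obtain w where w: "pos_super lam w" and lam: "lam > 0" by (auto simp: Lam_def)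
  have nw: "nonneg_cont w" and wp: "\<And>x k. 0 < x \<Longrightarrow> x < 1 \<Longrightarrow> 0 < w x $ k"
    and ws: "\<And>x k. step lam w x $ k \<le> w x $ k" using w by (auto simp: pos_super_def)
  define D where "D x = (\<Sum>k\<in>UNIV. Nl lam w x $ k - pi\<^sup>2 * w x $ k)" for x
  have cD: "continuous_on {0..1} D" unfolding D_def
    by (intro continuous_on_sum continuous_on_diff continuous_on_mult continuous_on_const Nl_continuous nw nonneg_contD(2))
  have each: "(\<integral>x. sin\<pi> x * (Nl lam w x $ k - pi\<^sup>2 * w x $ k) \<partial>I01) \<le> 0" for k
  proof -
    have i: "integrable I01 (\<lambda>x. sin\<pi> x * Nl lam w x $ k)" "integrable I01 (\<lambda>x. sin\<pi> x * w x $ k)"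
      "integrable I01 (\<lambda>x. sin\<pi> x * step lam w x $ k)"
      using lam by (intro integrable_I01_continuous continuous_on_mult continuous_sin Nl_continuous nw
          nonneg_contD(2)[OF nw] nonneg_contD(2)[OF step_nonneg_cont[OF nw]]; simp)+
    have "(\<integral>x. sin\<pi> x * Nl lam w x $ k \<partial>I01) = pi\<^sup>2 * (\<integral>x. Nl lam w x $ k * Kop sin\<pi> x \<partial>I01)"
    proof -
      have "(\<integral>x. Nl lam w x $ k * Kop sin\<pi> x \<partial>I01) = (\<integral>x. sin\<pi> x * Nl lam w x $ k / pi\<^sup>2 \<partial>I01)"
      proof (intro Bochner_Integration.integral_cong refl)
        fix x assume "x \<in> space I01"
        then have x: "x \<in> {0..1}" by auto
        show "Nl lam w x $ k * Kop sin\<pi> x = sin\<pi> x * Nl lam w x $ k / pi\<^sup>2"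
          unfolding Kop_sin[OF x] by (simp del: Nl_nth)
      qed
      then show ?thesis by simp
    qed
    also have "(\<integral>x. Nl lam w x $ k * Kop sin\<pi> x \<partial>I01) = (\<integral>x. sin\<pi> x * step lam w x $ k \<partial>I01)"
      unfolding step_nth by (intro Kop_symmetric integrable_sin Nl_integrable nw)
    also have "\<dots> \<le> (\<integral>x. sin\<pi> x * w x $ k \<partial>I01)"
      using ws sin_pos by (intro integral_mono_AE i AE_I01_I mult_left_mono) (auto intro: less_imp_le)
    finally have le: "(\<integral>x. sin\<pi> x * Nl lam w x $ k \<partial>I01) \<le> pi\<^sup>2 * (\<integral>x. sin\<pi> x * w x $ k \<partial>I01)"
      by (simp del: Nl_nth)
    have "(\<lambda>x. sin\<pi> x * (Nl lam w x $ k - pi\<^sup>2 * w x $ k))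
        = (\<lambda>x. sin\<pi> x * Nl lam w x $ k - pi\<^sup>2 * (sin\<pi> x * w x $ k))"
      by (simp add: right_diff_distrib mult.left_commute del: Nl_nth)
    then show ?thesis using i(1,2) le by (simp del: Nl_nth)
  qed
  have "(\<integral>x. sin\<pi> x * D x \<partial>I01) = (\<Sum>k\<in>UNIV. (\<integral>x. sin\<pi> x * (Nl lam w x $ k - pi\<^sup>2 * w x $ k) \<partial>I01))"
    unfolding D_def sum_distrib_left
    by (intro Bochner_Integration.integral_sum integrable_I01_continuous continuous_on_diff continuous_on_const
        continuous_on_mult continuous_sin Nl_continuous nw nonneg_contD(2))
  also have "\<dots> \<le> 0" using each by (intro sum_nonpos) auto
  finally have le: "(\<integral>x. sin\<pi> x * D x \<partial>I01) \<le> 0" .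
  have Dpos: "AE x in I01. 0 < D x"
  proof -
    have "AE x in I01. 0 < x \<and> x < 1" by (rule AE_I01_I) auto
    with large_growth[unfolded AE_I01 principal_eigenvalue_eq] show ?thesis
  proof eventually_elim
    case (elim x)
    then have g: "\<forall>u\<in>orthant. R < norm u \<longrightarrow> (pi\<^sup>2 + \<delta>0) * (\<Sum>k\<in>UNIV. u $ k) \<le> (\<Sum>k\<in>UNIV. f x u $ k)"
      and x: "0 < x" "x < 1" by auto
    have o: "w x \<in> orthant" by (rule nonneg_contD(4)[OF nw])
    show "0 < D x"
    proof (cases "R < norm (w x)")
      case True
      have "(pi\<^sup>2 + \<delta>0) * (\<Sum>k\<in>UNIV. w x $ k) \<le> (\<Sum>k\<in>UNIV. f x (w x) $ k)" using g o True by blast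
      moreover have "0 < \<delta>0 * (\<Sum>k\<in>UNIV. w x $ k)" using \<delta>0 wp[OF x] by (intro mult_pos_pos sum_pos) auto
      moreover have "0 \<le> (\<Sum>k\<in>UNIV. lam * (w x $ k) powr (q - 1))" using lam by (intro sum_nonneg) auto
      moreover have "D x = (\<Sum>k\<in>UNIV. f x (w x) $ k) + (\<Sum>k\<in>UNIV. lam * (w x $ k) powr (q - 1))
          - pi\<^sup>2 * (\<Sum>k\<in>UNIV. w x $ k)"
        by (simp add: D_def sum_subtractf sum.distrib sum_distrib_left)
      ultimately show ?thesis by (simp only: distrib_right)
    next
      case False
      have "0 < Nl lam w x $ k - pi\<^sup>2 * w x $ k" for k
      proof -
        have wk: "0 < w x $ k" "w x $ k \<le> R"
          using wp[OF x] False component_le_norm_cart[of "w x" k] by auto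
        have "w x $ k = (w x $ k) powr (2 - q) * (w x $ k) powr (q - 1)"
          using wk by (simp add: powr_add[symmetric])
        also have "\<dots> \<le> R powr (2 - q) * (w x $ k) powr (q - 1)"
          using wk q by (intro mult_right_mono powr_mono2) auto
        finally have "pi\<^sup>2 * w x $ k \<le> pi\<^sup>2 * (R powr (2 - q) * (w x $ k) powr (q - 1))"
          by (rule mult_left_mono) simp
        also have "\<dots> < lam * (w x $ k) powr (q - 1)"
          unfolding mult.assoc[symmetric] using big wk by (intro mult_strict_right_mono) auto
        finally show ?thesis using f_bound[of x "w x" k] o x by simp
      qed
      then show ?thesis unfolding D_def by (intro sum_pos) (auto simp del: Nl_nth)
    qed
  qed
  qed
  have "0 < (\<integral>x. sin\<pi> x * D x \<partial>I01)"
  proof (rule integral_I01_pos[where a = 0 and b = 1])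
    show "integrable I01 (\<lambda>x. sin\<pi> x * D x)" by (intro integrable_I01_continuous continuous_intros cD)
    have s: "AE x in I01. sin\<pi> x > 0" by (intro AE_I01_I sin_pos)
    show "AE y in I01. 0 \<le> sin\<pi> y * D y" using s Dpos by eventually_elim simp
    show "AE y in I01. y \<in> {0<..<1} \<longrightarrow> 0 < sin\<pi> y * D y" using s Dpos by eventually_elim simp
  qed auto
  with le show False by simp
qed

text \<open>It agrees with \<open>lambda_star\<close>: one inequality comes from
  \<open>rayleigh_super\<close>, the other from a solution at the parameter \<open>Ls\<close>
  itself.\<close>

definition Ls :: real where "Ls = Sup Lam"

lemma Lam_le_Ls: "lam \<in> Lam \<Longrightarrow> lam \<le> Ls"
  unfolding Ls_def using Lam_bound by (intro cSup_upper bdd_aboveI) auto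

lemma Ls_pos: "Ls > 0"
proof -
  obtain l where "l \<in> Lam" using Lam_nonempty by blast
  then show ?thesis using Lam_le_Ls[of l] by (auto simp: Lam_def)
qed

lemma less_Ls_Lam:
  assumes "0 < lam" "lam < Ls"
  shows "lam \<in> Lam"
proof -
  obtain l where l: "l \<in> Lam" "lam < l"
    using less_cSupD[OF Lam_nonempty, of lam] assms(2) unfolding Ls_def by blast
  then obtain w where "pos_super l w" by (auto simp: Lam_def)
  then have "pos_super lam w" by (rule pos_super_antimono) (use assms l in auto)
  then show ?thesis using assms(1) by (auto simp: Lam_def)
qed

definition minsol where "minsol lam = (SOME v. is_minsol lam v)"

lemma minsol:
  assumes "0 < lam" "lam < Ls"
  shows "is_minsol lam (minsol lam)"
proof -
  obtain w where "pos_super lam w" using less_Ls_Lam[OF assms] by (auto simp: Lam_def)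
  from someI_ex[OF minsol_ex[OF this assms(1)]] show ?thesis by (simp add: minsol_def)
qed

lemma minsol_props:
  assumes "0 < lam" "lam < Ls"
  shows "nonneg_cont (minsol lam)" "step lam (minsol lam) = minsol lam"
    "subsol lam x $ k \<le> minsol lam x $ k" "pos_super lam w \<Longrightarrow> minsol lam x $ k \<le> w x $ k"
    "0 < x \<Longrightarrow> x < 1 \<Longrightarrow> 0 < minsol lam x $ k" "x \<notin> {0..1} \<Longrightarrow> minsol lam x $ k = 0"
    "pos_super lam (minsol lam)"
proof -
  note m = minsol[OF assms, unfolded is_minsol_def]
  show 1: "nonneg_cont (minsol lam)" "step lam (minsol lam) = minsol lam"
    "subsol lam x $ k \<le> minsol lam x $ k" "pos_super lam w \<Longrightarrow> minsol lam x $ k \<le> w x $ k"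
    using m by blast+
  show "0 < x \<Longrightarrow> x < 1 \<Longrightarrow> 0 < minsol lam x $ k" using 1(3) subsol_pos[OF assms(1), of x k] by linarith
  show "x \<notin> {0..1} \<Longrightarrow> minsol lam x $ k = 0"
  proof -
    assume "x \<notin> {0..1}"
    from step_outside[OF this, of lam "minsol lam" k] show "minsol lam x $ k = 0" by (simp only: 1(2))
  qed
  show "pos_super lam (minsol lam)" by (rule fixed_pos_super[OF _ _ _ assms(1)]) (use m in blast)+
qed

lemma minsol_mono:
  assumes "0 < lam" "lam \<le> lam'" "lam' < Ls"
  shows "minsol lam x $ k \<le> minsol lam' x $ k"
proof -
  have "pos_super lam (minsol lam')"
    by (rule pos_super_antimono[OF minsol_props(7)[of lam']]) (use assms in auto)
  then show ?thesis using assms by (intro minsol_props(4)) auto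
qed

end

section \<open>Elementary inequalities for the energy estimate\<close>

lemma sum_pairs_linorder:
  fixes b :: "'n::{finite,linorder} \<Rightarrow> 'n \<Rightarrow> real"
  shows "(\<Sum>i\<in>UNIV. \<Sum>j\<in>UNIV. b i j) = (\<Sum>i\<in>UNIV. b i i) + (\<Sum>i\<in>UNIV. \<Sum>j\<in>{i<..}. b i j + b j i)"
proof -
  have 1: "(\<Sum>j\<in>UNIV. b i j) = b i i + (\<Sum>j\<in>{i<..}. b i j) + (\<Sum>j\<in>{..<i}. b i j)" for i
  proof -
    have "(UNIV::'n set) = insert i ({i<..} \<union> {..<i})" by auto
    then have "(\<Sum>j\<in>UNIV. b i j) = (\<Sum>j\<in>insert i ({i<..} \<union> {..<i}). b i j)" by simp
    also have "\<dots> = b i i + (\<Sum>j\<in>{i<..} \<union> {..<i}. b i j)" by (subst sum.insert) auto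
    also have "(\<Sum>j\<in>{i<..} \<union> {..<i}. b i j) = (\<Sum>j\<in>{i<..}. b i j) + (\<Sum>j\<in>{..<i}. b i j)"
      by (rule sum.union_disjoint) auto
    finally show ?thesis by simp
  qed
  have "(\<Sum>i\<in>UNIV. \<Sum>j\<in>{..<i}. b i j) = (\<Sum>j\<in>UNIV. \<Sum>i\<in>{j<..}. b i j)"
    using sum.swap_restrict[of "UNIV::'n set" "UNIV::'n set" b "\<lambda>i j. j < i"]
    by (simp add: greaterThan_def lessThan_def)
  then show ?thesis unfolding 1 by (simp add: sum.distrib)
qed

text \<open>In the product of the terms for \<open>(i, j)\<close> and \<open>(j, i)\<close> the
  quotients \<open>z j / z i\<close> cancel, so the inequality of arithmetic and geometric means
  leaves exactly the geometric means of the off-diagonal entries that appear in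
  \<open>Q_form\<close>.\<close>

lemma picone_sum:
  fixes a :: "'n::{finite,linorder} \<Rightarrow> 'n \<Rightarrow> real"
  assumes a: "\<And>i j. 0 \<le> a i j" and z: "\<And>i. 0 < z i" and u: "\<And>i. 0 \<le> u i"
  shows "(\<Sum>i\<in>UNIV. a i i * (u i)\<^sup>2) + 2 * (\<Sum>i\<in>UNIV. \<Sum>j\<in>{i<..}. sqrt (a i j * a j i) * u i * u j)
    \<le> (\<Sum>i\<in>UNIV. (u i)\<^sup>2 * (\<Sum>j\<in>UNIV. a i j * z j) / z i)"
proof -
  define b where "b i j = (u i)\<^sup>2 * (a i j * z j) / z i" for i j
  have pair: "2 * (sqrt (a i j * a j i) * u i * u j) \<le> b i j + b j i" for i j
  proof -
    have b0: "0 \<le> b i j" for i j using a z u by (simp add: b_def less_imp_le)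
    have "b i j * b j i = (a i j * a j i) * (u i * u j)\<^sup>2"
      using z[of i] z[of j] by (simp add: b_def field_simps power2_eq_square)
    then have "sqrt (b i j * b j i) = sqrt (a i j * a j i) * (u i * u j)"
      using u by (simp add: real_sqrt_mult)
    then show ?thesis using arith_geo_mean_sqrt[OF b0[of i j] b0[of j i]] by (simp add: mult.assoc)
  qed
  have bd: "b i i = a i i * (u i)\<^sup>2" for i using z[of i] by (simp add: b_def)
  have "(\<Sum>i\<in>UNIV. a i i * (u i)\<^sup>2) + 2 * (\<Sum>i\<in>UNIV. \<Sum>j\<in>{i<..}. sqrt (a i j * a j i) * u i * u j)
     \<le> (\<Sum>i\<in>UNIV. b i i) + (\<Sum>i\<in>UNIV. \<Sum>j\<in>{i<..}. b i j + b j i)"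
    unfolding bd sum_distrib_left using pair by (intro add_mono sum_mono) auto
  also have "\<dots> = (\<Sum>i\<in>UNIV. \<Sum>j\<in>UNIV. b i j)" by (rule sum_pairs_linorder[symmetric])
  also have "\<dots> = (\<Sum>i\<in>UNIV. (u i)\<^sup>2 * (\<Sum>j\<in>UNIV. a i j * z j) / z i)"
    by (simp add: b_def sum_distrib_left sum_divide_distrib)
  finally show ?thesis .
qed

text \<open>The power is concave for exponents up to 1, so a secant slope lies between the slopes at
  the two ends.\<close>

lemma powr_secant:
  fixes s u :: real
  assumes "0 < s" "s \<le> u" "0 < a" "a \<le> 1"
  shows "a * u powr (a - 1) * (u - s) \<le> u powr a - s powr a"
    "u powr a - s powr a \<le> a * s powr (a - 1) * (u - s)"
proof -
  have "a * u powr (a - 1) * (u - s) \<le> u powr a - s powr a \<and> u powr a - s powr a \<le> a * s powr (a - 1) * (u - s)"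
  proof (cases "s = u")
    case False
    then have "s < u" using assms by simp
    then have "\<exists>t. s < t \<and> t < u \<and> u powr a - s powr a = (u - s) * (a * t powr (a - 1))"
      using assms by (intro MVT2) (auto intro!: derivative_eq_intros)
    then obtain t where t: "s < t" "t < u" "u powr a - s powr a = (u - s) * (a * t powr (a - 1))" by auto
    have "u powr (a - 1) \<le> t powr (a - 1)" "t powr (a - 1) \<le> s powr (a - 1)"
      using t assms by (auto intro!: powr_mono2')
    then have "(u - s) * (a * u powr (a - 1)) \<le> (u - s) * (a * t powr (a - 1))"
       "(u - s) * (a * t powr (a - 1)) \<le> (u - s) * (a * s powr (a - 1))"
      using \<open>s < u\<close> assms by (auto intro!: mult_left_mono)
    then show ?thesis unfolding t(3) by (simp add: mult_ac)
  qed simp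
  then show "a * u powr (a - 1) * (u - s) \<le> u powr a - s powr a"
    "u powr a - s powr a \<le> a * s powr (a - 1) * (u - s)" by auto
qed

context elliptic_system begin

text \<open>The minimal solutions increase with the parameter. A common bound replaces a
  supersolution at \<open>lam\<close>, so that the limit \<open>lam = Ls\<close> is covered. The
  shift by 2 keeps every \<open>l n\<close> at least \<open>lam / 2\<close>.\<close>

lemma minsol_limit:
  fixes lam :: real
  defines "l \<equiv> \<lambda>n. lam * (1 - 1 / (real n + 2))"
  assumes lam: "0 < lam" "lam \<le> Ls" and b: "\<And>n x k. minsol (l n) x $ k \<le> b"
  obtains v where "nonneg_cont v" "step lam v = v" "\<And>n x k. minsol (l n) x $ k \<le> v x $ k"
    "\<And>x k. (\<lambda>n. minsol (l n) x $ k) \<longlonglongrightarrow> v x $ k" "pos_super lam v" "\<And>x k. v x $ k \<le> b"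
proof -
  have l: "0 < l n" "l n < lam" for n
  proof -
    have "0 < 1 - 1 / (real n + 2)" by (simp add: field_simps)
    then show "0 < l n" unfolding l_def using lam(1) by (rule mult_pos_pos[rotated])
    show "l n < lam" using lam(1) by (simp add: l_def right_diff_distrib)
  qed
  have lL: "l n < Ls" for n using l(2)[of n] lam by simp
  have ll: "l \<longlonglongrightarrow> lam" unfolding l_def by real_asymp
  have lmono: "l n \<le> l (Suc n)" for n unfolding l_def using lam by (intro mult_left_mono) (auto simp: field_simps)
  note m = minsol_props[OF l(1) lL]
  have inc: "incseq (\<lambda>n. minsol (l n) x $ k)" for x k
    by (intro incseq_SucI minsol_mono l lmono lL)
  define v where "v x = (\<chi> k. lim (\<lambda>n. minsol (l n) x $ k))" for x
  have lim: "(\<lambda>n. minsol (l n) x $ k) \<longlonglongrightarrow> v x $ k" for x k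
  proof -
    obtain L where L: "(\<lambda>n. minsol (l n) x $ k) \<longlonglongrightarrow> L"
      by (rule incseq_convergent[OF inc[of x k], of b]) (use b in auto)
    then have "v x $ k = L" unfolding v_def by (simp only: vec_lambda_beta limI[OF L])
    with L show ?thesis by (simp only:)
  qed
  have "(\<lambda>n. step (l n) (minsol (l n)) x $ k) \<longlonglongrightarrow> v x $ k" for x k
    unfolding m(2) by (rule lim)
  note v = limit_solution[OF m(1) b ll less_imp_le[OF l(1)] lim this]
  have le: "minsol (l n) x $ k \<le> v x $ k" for n x k by (rule incseq_le[OF inc lim])
  have "pos_super lam v"
    by (rule fixed_pos_super[OF v order_trans[OF m(3)[of 0] le] l(1)])
  moreover have "v x $ k \<le> b" for x k by (rule LIMSEQ_le_const2[OF lim]) (use b in auto)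
  ultimately show thesis by (intro that[of v] v le lim)
qed

lemma Kop_minsol:
  assumes "step lam v = v"
  shows "Kop (\<lambda>y. Nl lam v y $ k) x = v x $ k"
  using step_nth[of lam v x k] assms by simp

text \<open>The difference of two minimal solutions for \<open>l < lam\<close> is a positive supersolution of a linear
  system whose coefficients are secant slopes of the nonlinearity. The Picone inequality with this difference
  as comparison function gives the estimate in the limit \<open>l \<rightarrow> lam\<close>.\<close>

lemma energy_estimate:
  assumes lam: "0 < lam" "lam < Ls"
  defines "u \<equiv> minsol lam"
  shows "\<theta> * (\<Sum>k\<in>UNIV. \<integral>x. f x (u x) $ k * u x $ k \<partial>I01)
      + lam * (q - 1) * (\<Sum>k\<in>UNIV. \<integral>x. (u x $ k) powr (q - 1) * u x $ k \<partial>I01)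
    \<le> (\<Sum>k\<in>UNIV. \<integral>x. Nl lam u x $ k * u x $ k \<partial>I01)" (is "?L \<le> ?E")
proof -
  note mu = minsol_props[OF lam, folded u_def]
  have nu: "nonneg_cont u" by (rule mu(1))
  have out: "u x $ k \<le> 0" if "x \<notin> {0..1}" for x k using mu(6)[OF that, of k] by simp
  obtain b where b: "0 \<le> b" "\<And>x k. u x $ k \<le> b"
    by (rule nonneg_cont_bounded[OF nu]) (erule out, rule that)
  define l where "l n = lam * (1 - 1 / (real n + 2))" for n
  have l: "0 < l n" "l n < lam" for n
  proof -
    have "0 < 1 - 1 / (real n + 2)" by (simp add: field_simps)
    then show "0 < l n" unfolding l_def using lam(1) by (rule mult_pos_pos[rotated])
    show "l n < lam" using lam(1) by (simp add: l_def right_diff_distrib)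
  qed
  have lL: "l n < Ls" for n using l(2)[of n] lam by simp
  define s where "s n = minsol (l n)" for n
  note ms = minsol_props[OF l(1) lL, folded s_def]
  have su: "s n x $ k \<le> u x $ k" for n x k
    unfolding s_def u_def using l(2)[of n] by (intro minsol_mono l lam less_imp_le)
  have sb: "minsol (lam * (1 - 1 / (real n + 2))) x $ k \<le> b" for n x k
    using su[of n x k] b(2)[of x k] by (simp add: s_def l_def)
  obtain v where v': "nonneg_cont v" "step lam v = v"
    "\<And>x k. (\<lambda>n. minsol (lam * (1 - 1 / (real n + 2))) x $ k) \<longlonglongrightarrow> v x $ k" "pos_super lam v"
    by (rule minsol_limit[OF lam(1) less_imp_le[OF lam(2)] sb]) (rule that)
  then have v: "nonneg_cont v" "step lam v = v" "\<And>x k. (\<lambda>n. s n x $ k) \<longlonglongrightarrow> v x $ k" "pos_super lam v"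
    by (simp_all only: s_def l_def)
  \<comment> \<open>The limit from the left is a positive supersolution at \<open>lam\<close>, hence
    above the minimal solution: the minimal branch is continuous from the left.\<close>
  have "v x $ k \<le> u x $ k" for x k by (rule LIMSEQ_le_const2[OF v(3)]) (use su in auto)
  moreover have "u x $ k \<le> v x $ k" for x k by (rule mu(4)[OF v(4)])
  ultimately have vu: "v x $ k = u x $ k" for x k by (rule order_antisym)
  have lim: "(\<lambda>n. s n x $ k) \<longlonglongrightarrow> u x $ k" for x k using v(3) unfolding vu .
  define r where "r k x = Nl lam u x $ k" for k x
  define p where "p n k x = Nl lam u x $ k - Nl (l n) (s n) x $ k" for n k x
  have Kr: "Kop (r k) x = u x $ k" for k x unfolding r_def by (rule Kop_minsol[OF mu(2)])
  have Kp: "Kop (p n k) x = u x $ k - s n x $ k" for n k x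
    unfolding p_def using Kop_minsol[OF mu(2)] Kop_minsol[OF ms(2)]
    by (subst Kop_diff[OF Nl_integrable[OF nu] Nl_integrable[OF ms(1)]]) (simp del: Nl_nth)
  have cr: "continuous_on {0..1} (r k)" for k unfolding r_def by (rule Nl_continuous[OF nu])
  have cp: "continuous_on {0..1} (p n k)" for n k
    unfolding p_def by (intro continuous_on_diff Nl_continuous nu ms)
  have p0: "0 \<le> p n k x" if "x \<in> {0..1}" for n k x
    unfolding p_def using Nl_mono[of x "s n" u "l n" lam k] that su nonneg_contD(3)[OF ms(1)] l
    by (simp add: less_imp_le del: Nl_nth)
  have cu: "continuous_on {0..1} (\<lambda>x. u x $ k)" for k by (rule nonneg_contD(2)[OF nu])
  have cs: "continuous_on {0..1} (\<lambda>x. s n x $ k)" for n k by (rule nonneg_contD(2)[OF ms(1)])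
  have zpos: "0 < u x $ k - s n x $ k" if x: "0 < x" "x < 1" for n x k
  proof -
    \<comment> \<open>Strictness comes from \<open>l n < lam\<close> in the sublinear term; one
      interior point is enough for \<open>Kop_ge_bubble\<close>.\<close>
    have "0 < p n k (1/2)"
    proof -
      have h: "(1/2::real) \<in> {0..1}" by simp
      have "f (1/2) (s n (1/2)) $ k \<le> f (1/2) (u (1/2)) $ k"
        by (rule f_mono[OF h nonneg_contD(4)[OF ms(1)] su])
      moreover have "l n * (s n (1/2) $ k) powr (q - 1) \<le> l n * (u (1/2) $ k) powr (q - 1)"
        using l(1)[of n] su nonneg_contD(3)[OF ms(1)] q by (intro mult_left_mono powr_mono2) auto
      moreover have "l n * (u (1/2) $ k) powr (q - 1) < lam * (u (1/2) $ k) powr (q - 1)"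
        using l(2) mu(5)[of "1/2" k] by (intro mult_strict_right_mono) auto
      ultimately show ?thesis by (simp add: p_def)
    qed
    then have "0 < (\<integral>y. bubble y * p n k y \<partial>I01)"
      using p0 by (intro integral_I01_pos_continuous[where ?x0.0 = "1/2"] continuous_on_mult continuous_on_diff
          continuous_on_id continuous_on_const cp) auto
    then have "0 < bubble x * (\<integral>y. bubble y * p n k y \<partial>I01)" using x by simp
    also have "\<dots> \<le> Kop (p n k) x" using p0 x by (intro Kop_ge_bubble integrable_I01_continuous cp) auto
    finally show ?thesis by (simp add: Kp)
  qed
  \<comment> \<open>The left-hand integrand of \<open>picone\<close> for
    \<open>Kop (r k) = u $ k\<close> and \<open>Kop (p n k) = u $ k - s n $ k\<close>, summed over
    \<open>k\<close>.\<close>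
  define I where "I n e x = (\<Sum>k\<in>UNIV. (u x $ k)\<^sup>2 * p n k x / (u x $ k - s n x $ k + e))" for n e x
  define H where "H x = \<theta> * (\<Sum>k\<in>UNIV. f x (u x) $ k * u x $ k)
     + lam * (q - 1) * (\<Sum>k\<in>UNIV. (u x $ k) powr (q - 1) * u x $ k)" for x
  have cH: "continuous_on {0..1} H" unfolding H_def
    by (intro continuous_on_add continuous_on_mult continuous_on_const continuous_on_sum f_comp_continuous g_continuous nu cu)
  have H0: "0 \<le> H x" if "0 < x" "x < 1" for x
    unfolding H_def using \<theta> lam q f_bound[of x "u x"] nonneg_contD(3,4)[OF nu] that
    by (intro add_nonneg_nonneg mult_nonneg_nonneg sum_nonneg) auto
  have cI: "continuous_on {0..1} (I n e)" if "e > 0" for n e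
    unfolding I_def
  proof (intro continuous_on_sum continuous_on_divide continuous_on_mult continuous_on_power continuous_on_add continuous_on_diff continuous_on_const cu cp cs ballI)
    fix k x show "u x $ k - s n x $ k + e \<noteq> 0" using su[of n x k] that by simp
  qed
  have Ile: "(\<integral>x. I n e x \<partial>I01) \<le> ?E" if e: "e > 0" for n e
  proof -
    have ci: "integrable I01 (\<lambda>x. (u x $ k)\<^sup>2 * p n k x / (u x $ k - s n x $ k + e))" for k
    proof (intro integrable_I01_continuous continuous_on_divide continuous_on_mult continuous_on_power continuous_on_add continuous_on_diff continuous_on_const cu cp cs ballI)
      fix x show "u x $ k - s n x $ k + e \<noteq> 0" using su[of n x k] that by simp
    qed
    have "(\<integral>x. I n e x \<partial>I01) = (\<Sum>k\<in>UNIV. \<integral>x. (u x $ k)\<^sup>2 * p n k x / (u x $ k - s n x $ k + e) \<partial>I01)"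
      unfolding I_def by (rule Bochner_Integration.integral_sum) (rule ci)
    also have "\<dots> \<le> (\<Sum>k\<in>UNIV. \<integral>x. r k x * u x $ k \<partial>I01)"
    proof (rule sum_mono)
      fix k
      show "(\<integral>x. (u x $ k)\<^sup>2 * p n k x / (u x $ k - s n x $ k + e) \<partial>I01) \<le> (\<integral>x. r k x * u x $ k \<partial>I01)"
        using picone[OF cr[of k] cp[of n k] p0 e] unfolding Kr Kp .
    qed
    finally show ?thesis by (simp add: r_def del: Nl_nth)
  qed
  \<comment> \<open>Truncating at the expected limit \<open>H\<close> supplies an integrable
    majorant, which the unshifted quotients do not have by themselves.\<close>
  define mI where "mI n x = min (I n 0 x) (H x)" for n x
  have mIm: "mI n \<in> borel_measurable I01" for n
  proof -
    have m: "(\<lambda>x. (u x $ k)\<^sup>2 * p n k x / (u x $ k - s n x $ k + 0)) \<in> borel_measurable I01" for k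
      by (intro borel_measurable_divide borel_measurable_times borel_measurable_power borel_measurable_add
          borel_measurable_diff borel_measurable_const continuous_measurable_I01' cu cs cp)
    show ?thesis unfolding mI_def I_def
      by (rule borel_measurable_min[OF continuous_measurable_I01'[OF cH] borel_measurable_sum[OF m]])
  qed
  have iH: "integrable I01 H" by (rule integrable_I01_continuous[OF cH])
  have I0: "0 \<le> I n e x" if "e \<ge> 0" "0 < x" "x < 1" for n e x
    unfolding I_def using that p0[of x n] su[of n x] by (intro sum_nonneg divide_nonneg_nonneg mult_nonneg_nonneg) auto
  have mIle: "(\<integral>x. mI n x \<partial>I01) \<le> ?E" for n
  proof -
    define e where "e j = 1 / (real j + 1)" for j
    have e: "e j > 0" for j by (simp add: e_def)
    have el: "e \<longlonglongrightarrow> 0" unfolding e_def by real_asymp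
    have "(\<lambda>j. \<integral>x. min (I n (e j) x) (H x) \<partial>I01) \<longlonglongrightarrow> (\<integral>x. mI n x \<partial>I01)"
    proof (rule integral_dominated_convergence[OF mIm _ iH])
      show "(\<lambda>x. min (I n (e j) x) (H x)) \<in> borel_measurable I01" for j
        by (intro borel_measurable_min continuous_measurable_I01' cI e cH)
      show "AE x in I01. (\<lambda>j. min (I n (e j) x) (H x)) \<longlonglongrightarrow> mI n x"
      proof (rule AE_I01_I)
        fix x :: real assume x: "0 < x" "x < 1"
        have "(\<lambda>j. I n (e j) x) \<longlonglongrightarrow> I n 0 x" unfolding I_def
          using zpos[OF x, of _ n] by (intro tendsto_intros el) (auto simp: less_imp_neq[symmetric])
        then show "(\<lambda>j. min (I n (e j) x) (H x)) \<longlonglongrightarrow> mI n x" unfolding mI_def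
          by (intro tendsto_min tendsto_const)
      qed
      show "AE x in I01. norm (min (I n (e j) x) (H x)) \<le> H x" for j
        using I0[of "e j"] H0 less_imp_le[OF e] by (intro AE_I01_I) (simp add: min_def)
    qed
    moreover have "(\<integral>x. min (I n (e j) x) (H x) \<partial>I01) \<le> ?E" for j
    proof -
      have "(\<integral>x. min (I n (e j) x) (H x) \<partial>I01) \<le> (\<integral>x. I n (e j) x \<partial>I01)"
        by (intro integral_mono_AE AE_I2 integrable_I01_continuous continuous_on_min cI e cH) simp
      then show ?thesis using Ile[OF e, of n j] by simp
    qed
    ultimately show ?thesis by (intro LIMSEQ_le_const2) auto
  qed
  have conv: "(\<lambda>n. mI n x) \<longlonglongrightarrow> H x" if x: "0 < x" "x < 1" and Q: "Q_form f x (u x) \<ge> \<theta> * (\<Sum>i\<in>UNIV. f x (u x) $ i * u x $ i)" for x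
  proof -
    have x': "x \<in> {0..1}" using x by auto
    define P where "P n i t \<longleftrightarrow> 0 \<le> t \<and> t \<le> 1 \<and> f x (u x) $ i - f x (s n x) $ i =
       (\<Sum>j\<in>UNIV. jac f x (s n x + t *\<^sub>R (u x - s n x)) $ i $ j * (u x $ j - s n x $ j))" for n i t
    have so: "s n x \<in> orthant" and uo: "u x \<in> orthant" for n
      by (rule nonneg_contD(4)[OF ms(1)], rule nonneg_contD(4)[OF nu])
    have "\<exists>t. P n i t" for n i
      by (rule f_mvt[OF x' so[of n] uo, of i]) (auto simp: P_def)
    then obtain t where "\<And>n i. P n i (t n i)" by metis
    then have t: "\<And>n i. 0 \<le> t n i" "\<And>n i. t n i \<le> 1" "\<And>n i. f x (u x) $ i - f x (s n x) $ i =
       (\<Sum>j\<in>UNIV. jac f x (s n x + t n i *\<^sub>R (u x - s n x)) $ i $ j * (u x $ j - s n x $ j))"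
      unfolding P_def by blast+
    define \<xi> where "\<xi> n i = s n x + t n i *\<^sub>R (u x - s n x)" for n i
    have \<xi>o: "\<xi> n i \<in> orthant" for n i
      unfolding \<xi>_def by (intro orthant_convex nonneg_contD(4)[OF ms(1)] nonneg_contD(4)[OF nu] t)
    have \<xi>l: "(\<lambda>n. \<xi> n i) \<longlonglongrightarrow> u x" for i
    proof (rule vec_tendstoI)
      fix k
      show "(\<lambda>n. \<xi> n i $ k) \<longlonglongrightarrow> u x $ k"
      proof (rule tendsto_sandwich[OF _ _ lim[of x k] tendsto_const])
        show "\<forall>\<^sub>F n in sequentially. s n x $ k \<le> \<xi> n i $ k"
          using t(1) su by (simp add: \<xi>_def)
        have "t n i * (u x $ k - s n x $ k) \<le> 1 * (u x $ k - s n x $ k)" for n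
          using t(2) su[of n x k] by (intro mult_right_mono) auto
        then show "\<forall>\<^sub>F n in sequentially. \<xi> n i $ k \<le> u x $ k"
          by (simp add: \<xi>_def algebra_simps)
      qed
    qed
    \<comment> \<open>Each row uses its own intermediate point; all of these converge to
      \<open>u x\<close>, where the Jacobian is continuous.\<close>
    define a where "a n i j = jac f x (\<xi> n i) $ i $ j" for n i j
    have al: "(\<lambda>n. a n i j) \<longlonglongrightarrow> jac f x (u x) $ i $ j" for i j
    proof -
      have "continuous_on orthant (jac f x)" using f_C1[OF x'] by (simp add: C1_orthant_def)
      then have "(\<lambda>n. jac f x (\<xi> n i)) \<longlonglongrightarrow> jac f x (u x)"
        by (rule continuous_on_tendsto_compose[OF _ \<xi>l nonneg_contD(4)[OF nu]]) (use \<xi>o in simp)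
      then show ?thesis unfolding a_def by (intro tendsto_vec_nth)
    qed
    have a0: "0 \<le> a n i j" for n i j unfolding a_def using fu_bound[OF x' \<xi>o] by simp
    \<comment> \<open>By \<open>picone_sum\<close> and the secant bound for the power,
      \<open>J n\<close> lies below \<open>I n 0 x\<close>; its limit contains
      \<open>Q_form\<close>, which the superlinearity assumption bounds below.\<close>
    define J where "J n = (\<Sum>i\<in>UNIV. a n i i * (u x $ i)\<^sup>2) +
       2 * (\<Sum>i\<in>UNIV. \<Sum>j\<in>{i<..}. sqrt (a n i j * a n j i) * u x $ i * u x $ j)
       + lam * (q - 1) * (\<Sum>k\<in>UNIV. (u x $ k) powr (q - 1) * u x $ k)" for n
    have JI: "J n \<le> I n 0 x" for n
    proof -
      have pe: "p n i x = (\<Sum>j\<in>UNIV. a n i j * (u x $ j - s n x $ j)) + (lam * (u x $ i) powr (q - 1) - l n * (s n x $ i) powr (q - 1))" for i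
        unfolding p_def Nl_nth using t(3)[of i n] by (simp add: a_def \<xi>_def)
      have g: "lam * (q - 1) * ((u x $ i) powr (q - 1) * u x $ i)
         \<le> (u x $ i)\<^sup>2 * (lam * (u x $ i) powr (q - 1) - l n * (s n x $ i) powr (q - 1)) / (u x $ i - s n x $ i)" for i
      proof -
        have z: "0 < u x $ i - s n x $ i" by (rule zpos[OF x])
        have ui: "0 < u x $ i" by (rule mu(5)[OF x])
        have si: "0 < s n x $ i" by (rule ms(5)[OF x])
        have "(q - 1) * u x $ i powr (q - 1 - 1) * (u x $ i - s n x $ i) \<le> u x $ i powr (q - 1) - s n x $ i powr (q - 1)"
          using si su q by (intro powr_secant) auto
        then have "lam * ((q - 1) * u x $ i powr (q - 1 - 1) * (u x $ i - s n x $ i))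
            \<le> lam * (u x $ i powr (q - 1) - s n x $ i powr (q - 1))"
          using lam by (intro mult_left_mono) auto
        also have "\<dots> \<le> lam * (u x $ i) powr (q - 1) - l n * (s n x $ i) powr (q - 1)"
          using l(2)[of n] by (simp add: right_diff_distrib mult_right_mono)
        finally have "lam * ((q - 1) * u x $ i powr (q - 1 - 1))
            \<le> (lam * (u x $ i) powr (q - 1) - l n * (s n x $ i) powr (q - 1)) / (u x $ i - s n x $ i)"
          using z by (simp add: pos_le_divide_eq mult.assoc)
        then have "(u x $ i)\<^sup>2 * (lam * ((q - 1) * u x $ i powr (q - 1 - 1)))
            \<le> (u x $ i)\<^sup>2 * ((lam * (u x $ i) powr (q - 1) - l n * (s n x $ i) powr (q - 1)) / (u x $ i - s n x $ i))"
          by (rule mult_left_mono) simp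
        moreover have "(u x $ i)\<^sup>2 * u x $ i powr (q - 1 - 1) = u x $ i powr (q - 1) * u x $ i"
        proof -
          have "u x $ i powr (q - 1) = u x $ i powr (q - 1 - 1) * u x $ i powr 1"
            unfolding powr_add[symmetric] by simp
          then show ?thesis using ui by (simp add: power2_eq_square)
        qed
        ultimately show ?thesis by (simp add: mult_ac)
      qed
      have "J n \<le> (\<Sum>i\<in>UNIV. (u x $ i)\<^sup>2 * (\<Sum>j\<in>UNIV. a n i j * (u x $ j - s n x $ j)) / (u x $ i - s n x $ i))
        + (\<Sum>i\<in>UNIV. (u x $ i)\<^sup>2 * (lam * (u x $ i) powr (q - 1) - l n * (s n x $ i) powr (q - 1)) / (u x $ i - s n x $ i))"
        unfolding J_def sum_distrib_left[of "lam * (q - 1)"]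
        using nonneg_contD(3)[OF nu] by (intro add_mono picone_sum a0 zpos x sum_mono g)
      also have "\<dots> = I n 0 x"
        unfolding I_def pe by (simp add: sum.distrib[symmetric] add_divide_distrib[symmetric] distrib_left)
      finally show ?thesis .
    qed
    have "J \<longlonglongrightarrow> Q_form f x (u x) + lam * (q - 1) * (\<Sum>k\<in>UNIV. (u x $ k) powr (q - 1) * u x $ k)"
      unfolding J_def Q_form_def by (intro tendsto_intros al)
    then have "(\<lambda>n. min (J n) (H x)) \<longlonglongrightarrow> min (Q_form f x (u x) + lam * (q - 1) * (\<Sum>k\<in>UNIV. (u x $ k) powr (q - 1) * u x $ k)) (H x)"
      by (intro tendsto_min tendsto_const)
    also have "min (Q_form f x (u x) + lam * (q - 1) * (\<Sum>k\<in>UNIV. (u x $ k) powr (q - 1) * u x $ k)) (H x) = H x"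
      using Q by (simp add: H_def)
    finally have Jl: "(\<lambda>n. min (J n) (H x)) \<longlonglongrightarrow> H x" .
    show ?thesis
    proof (rule tendsto_sandwich[OF _ _ Jl tendsto_const])
      show "\<forall>\<^sub>F n in sequentially. min (J n) (H x) \<le> mI n x"
        unfolding mI_def using JI by (intro always_eventually allI min.mono) auto
      show "\<forall>\<^sub>F n in sequentially. mI n x \<le> H x"
        unfolding mI_def by (intro always_eventually allI min.cobounded2)
    qed
  qed
  have "(\<lambda>n. \<integral>x. mI n x \<partial>I01) \<longlonglongrightarrow> (\<integral>x. H x \<partial>I01)"
  proof (rule integral_dominated_convergence[OF _ mIm iH])
    show "H \<in> borel_measurable I01" using iH by simp
    have "AE x in I01. 0 < x \<and> x < 1" by (rule AE_I01_I) auto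
    with picone_superlinear[unfolded AE_I01] show "AE x in I01. (\<lambda>n. mI n x) \<longlonglongrightarrow> H x"
      by eventually_elim (use conv nonneg_contD(4)[OF nu] in blast)
    show "AE x in I01. norm (mI n x) \<le> H x" for n
      using I0[of 0] H0 by (intro AE_I01_I) (simp add: mI_def min_def)
  qed
  then have "(\<integral>x. H x \<partial>I01) \<le> ?E" using mIle by (intro LIMSEQ_le_const2) auto
  moreover have "(\<integral>x. H x \<partial>I01) = ?L"
  proof -
    have i: "integrable I01 (\<lambda>x. f x (u x) $ k * u x $ k)" "integrable I01 (\<lambda>x. (u x $ k) powr (q - 1) * u x $ k)" for k
      by (intro integrable_I01_continuous continuous_on_mult f_comp_continuous g_continuous nu cu)+
    then show ?thesis unfolding H_def by (simp add: Bochner_Integration.integral_sum)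
  qed
  ultimately show ?thesis by simp
qed

text \<open>The energy estimate gives \<open>(\<theta> - 1) * Ff \<le> lam * (2 - q) * Gg\<close>,
  so the energy is controlled by the sublinear term \<open>Gg\<close>. With \<open>b\<close> the
  square root of the energy, a bound for the maximum, this reads
  \<open>b\<^sup>2 \<le> D * b powr q\<close>, and \<open>q < 2\<close> bounds
  \<open>b\<close>.\<close>

lemma minsol_bounded:
  obtains b where "\<And>lam x k. 0 < lam \<Longrightarrow> lam < Ls \<Longrightarrow> minsol lam x $ k \<le> b"
proof -
  define D where "D = Ls * (1 + (2 - q) / (\<theta> - 1)) * real CARD('m)"
  have "minsol lam x $ k \<le> D powr (1 / (2 - q))" if lam: "0 < lam" "lam < Ls" for lam x k
  proof -
    define u where "u = minsol lam"
    note mu = minsol_props[OF lam, folded u_def]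
    have nu: "nonneg_cont u" by (rule mu(1))
    define E where "E = (\<Sum>k\<in>UNIV. \<integral>x. Nl lam u x $ k * u x $ k \<partial>I01)"
    define Ff where "Ff = (\<Sum>k\<in>UNIV. \<integral>x. f x (u x) $ k * u x $ k \<partial>I01)"
    define Gg where "Gg = (\<Sum>k\<in>UNIV. \<integral>x. (u x $ k) powr (q - 1) * u x $ k \<partial>I01)"
    have i: "integrable I01 (\<lambda>x. f x (u x) $ k * u x $ k)" "integrable I01 (\<lambda>x. (u x $ k) powr (q - 1) * u x $ k)" for k
      by (intro integrable_I01_continuous continuous_on_mult f_comp_continuous g_continuous nu nonneg_contD(2))+
    have E: "E = Ff + lam * Gg"
      unfolding E_def Ff_def Gg_def using i
      by (simp add: distrib_right mult.assoc sum.distrib sum_distrib_left)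
    have G0: "0 \<le> Gg" unfolding Gg_def using nonneg_contD(3)[OF nu]
      by (intro sum_nonneg integral_nonneg_AE AE_I2) auto
    have "\<theta> * Ff + lam * (q - 1) * Gg \<le> E"
      using energy_estimate[OF lam] by (simp add: E_def Ff_def Gg_def u_def)
    then have "(\<theta> - 1) * Ff \<le> lam * (2 - q) * Gg" unfolding E by (simp add: algebra_simps)
    then have "Ff \<le> lam * (2 - q) * Gg / (\<theta> - 1)" using \<theta> by (simp add: pos_le_divide_eq mult.commute)
    then have "E \<le> lam * (1 + (2 - q) / (\<theta> - 1)) * Gg" unfolding E using \<theta> by (simp add: field_simps)
    also have "\<dots> \<le> Ls * (1 + (2 - q) / (\<theta> - 1)) * Gg"
      using lam G0 q \<theta> by (intro mult_right_mono) auto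
    finally have EG: "E \<le> Ls * (1 + (2 - q) / (\<theta> - 1)) * Gg" .
    have Ek: "0 \<le> (\<integral>x. Nl lam u x $ k * u x $ k \<partial>I01)" for k
      using lam nonneg_contD(3,4)[OF nu] by (intro integral_nonneg_AE AE_I01_I mult_nonneg_nonneg Nl_nonneg) auto
    have bound: "(u x $ k)\<^sup>2 \<le> E" if "x \<in> {0..1}" for x k
    proof -
      have "(u x $ k)\<^sup>2 \<le> (\<integral>x. Nl lam u x $ k * u x $ k \<partial>I01)"
        using Kop_energy_bound[OF Nl_continuous[OF nu, of lam k] that] unfolding Kop_minsol[OF mu(2)] .
      also have "\<dots> \<le> E" unfolding E_def by (rule member_le_sum) (use Ek in auto)
      finally show ?thesis .
    qed
    have E0: "0 \<le> E" unfolding E_def using Ek by (intro sum_nonneg)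
    define b where "b = sqrt E"
    have ub: "u x $ k \<le> b" for x k
    proof (cases "x \<in> {0..1}")
      case True then show ?thesis unfolding b_def using bound by (intro real_le_rsqrt)
    qed (use mu(6) E0 in \<open>simp add: b_def\<close>)
    have b0: "0 < b" using ub[of "1/2" undefined] mu(5)[of "1/2" undefined] by simp
    have "Gg \<le> (\<Sum>k\<in>(UNIV::'m set). b powr (q - 1) * b)"
      unfolding Gg_def
    proof (rule sum_mono)
      fix k
      have "(\<integral>x. (u x $ k) powr (q - 1) * u x $ k \<partial>I01) \<le> (\<integral>x. b powr (q - 1) * b \<partial>I01)"
        using ub nonneg_contD(3)[OF nu] q by (intro integral_mono_AE AE_I2 i mult_mono powr_mono2) auto
      then show "(\<integral>x. (u x $ k) powr (q - 1) * u x $ k \<partial>I01) \<le> b powr (q - 1) * b" by simp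
    qed
    also have "\<dots> = real CARD('m) * (b powr (q - 1) * b)" by simp
    finally have "Ls * (1 + (2 - q) / (\<theta> - 1)) * Gg \<le> Ls * (1 + (2 - q) / (\<theta> - 1)) * (real CARD('m) * (b powr (q - 1) * b))"
      using Ls_pos q \<theta> by (intro mult_left_mono) auto
    with EG have "E \<le> D * (b powr (q - 1) * b)" by (simp add: D_def mult_ac)
    moreover have "E = b powr (2 - q) * (b powr (q - 1) * b)"
    proof -
      have "b powr (2 - q) * b powr (q - 1) = b" using b0 by (simp add: powr_add[symmetric])
      then have "b powr (2 - q) * (b powr (q - 1) * b) = b * b" by (simp add: mult.assoc[symmetric])
      then show ?thesis using E0 by (simp add: b_def)
    qed
    ultimately have "b powr (2 - q) * (b powr (q - 1) * b) \<le> D * (b powr (q - 1) * b)" by simp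
    then have "b powr (2 - q) \<le> D" by (rule mult_right_le_imp_le) (use b0 in simp)
    then have "(b powr (2 - q)) powr (1 / (2 - q)) \<le> D powr (1 / (2 - q))"
      using q by (intro powr_mono2) auto
    then have "b \<le> D powr (1 / (2 - q))" using b0 q by (simp add: powr_powr)
    then show ?thesis using ub[of x k] by (simp add: u_def)
  qed
  then show thesis by (rule that)
qed

end

section \<open>The linearized system\<close>

text \<open>The direction may vary with \<open>n\<close>, the steps may have either sign, and
  differentiability is only within \<open>S\<close>: the limit is taken below and above
  \<open>u\<close>, inside the orthant.\<close>

lemma derivative_quotient_tendsto:
  fixes g :: "'a::real_normed_vector \<Rightarrow> 'b::real_normed_vector"
  assumes d: "(g has_derivative g') (at x within S)" and s: "\<And>n. s n \<noteq> 0" "s \<longlonglongrightarrow> 0"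
    and y: "h \<longlonglongrightarrow> y" and S: "\<And>n. x + s n *\<^sub>R h n \<in> S"
  shows "(\<lambda>n. (1 / s n) *\<^sub>R (g (x + s n *\<^sub>R h n) - g x)) \<longlonglongrightarrow> g' y"
proof -
  interpret bounded_linear g' using d by (rule has_derivative_bounded_linear)
  have l1: "(\<lambda>n. g' (h n)) \<longlonglongrightarrow> g' y" by (rule tendsto[OF y])
  have "(\<lambda>n. (1 / s n) *\<^sub>R (g (x + s n *\<^sub>R h n) - g x) - g' (h n)) \<longlonglongrightarrow> 0"
  proof (rule LIMSEQ_I)
    fix e :: real assume e: "0 < e"
    define e' where "e' = e / (norm y + 1)"
    have yp: "0 < norm y + 1" using norm_ge_zero[of y] by linarith
    have e': "0 < e'" using e yp by (simp add: e'_def)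
    obtain r where r: "0 < r" "\<And>z. z \<in> S \<Longrightarrow> norm (z - x) < r \<Longrightarrow> norm (g z - g x - g' (z - x)) \<le> e' * norm (z - x)"
      using d e' unfolding has_derivative_within_alt by metis
    have "(\<lambda>n. s n *\<^sub>R h n) \<longlonglongrightarrow> 0 *\<^sub>R y" by (intro tendsto_scaleR s y)
    then have "(\<lambda>n. norm (s n *\<^sub>R h n)) \<longlonglongrightarrow> 0" unfolding scaleR_zero_left by (rule tendsto_norm_zero)
    then have ev1: "\<forall>\<^sub>F n in sequentially. norm (s n *\<^sub>R h n) < r" using r(1) by (rule order_tendstoD)
    have ev2: "\<forall>\<^sub>F n in sequentially. norm (h n) < norm y + 1"
      by (rule order_tendstoD(2)[OF tendsto_norm[OF y]]) simp
    have "\<forall>\<^sub>F n in sequentially. norm ((1 / s n) *\<^sub>R (g (x + s n *\<^sub>R h n) - g x) - g' (h n) - 0) < e"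
      using ev1 ev2
    proof eventually_elim
      case (elim n)
      have "norm (g (x + s n *\<^sub>R h n) - g x - g' (s n *\<^sub>R h n)) \<le> e' * norm (s n *\<^sub>R h n)"
        using r(2)[OF S[of n]] elim by simp
      then have "\<bar>1 / s n\<bar> * norm (g (x + s n *\<^sub>R h n) - g x - g' (s n *\<^sub>R h n)) \<le> \<bar>1 / s n\<bar> * (e' * norm (s n *\<^sub>R h n))"
        by (intro mult_left_mono) auto
      also have "\<bar>1 / s n\<bar> * norm (g (x + s n *\<^sub>R h n) - g x - g' (s n *\<^sub>R h n)) =
          norm ((1 / s n) *\<^sub>R (g (x + s n *\<^sub>R h n) - g x - g' (s n *\<^sub>R h n)))" by simp
      also have "(1 / s n) *\<^sub>R (g (x + s n *\<^sub>R h n) - g x - g' (s n *\<^sub>R h n)) =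
          (1 / s n) *\<^sub>R (g (x + s n *\<^sub>R h n) - g x) - g' (h n)"
        using s(1)[of n] by (simp add: scaleR scaleR_diff_right)
      also have "\<bar>1 / s n\<bar> * (e' * norm (s n *\<^sub>R h n)) = e' * norm (h n)" using s(1)[of n] by simp
      also have "\<dots> < e' * (norm y + 1)" using elim e' by (intro mult_strict_left_mono)
      also have "\<dots> = e" using yp by (simp add: e'_def)
      finally show ?case by simp
    qed
    then show "\<exists>no. \<forall>n\<ge>no. norm ((1 / s n) *\<^sub>R (g (x + s n *\<^sub>R h n) - g x) - g' (h n) - 0) < e"
      by (simp add: eventually_sequentially)
  qed
  from tendsto_add[OF this l1] show ?thesis by simp
qed

text \<open>Arzela-Ascoli with extension by 0. Uniformity on the whole line is kept in the
  conclusion, since it prevents a normalised sequence from converging to 0.\<close>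

lemma lipschitz_compactness:
  fixes s :: "nat \<Rightarrow> real \<Rightarrow> real^'n"
  assumes nn: "\<And>n. nonneg_cont (s n)" and out: "\<And>n x k. x \<notin> {0..1} \<Longrightarrow> s n x $ k = 0"
    and b: "\<And>n x k. s n x $ k \<le> b"
    and L: "\<And>n x x' k. x \<in> {0..1} \<Longrightarrow> x' \<in> {0..1} \<Longrightarrow> \<bar>s n x $ k - s n x' $ k\<bar> \<le> \<bar>x - x'\<bar> * L"
  obtains w and r :: "nat \<Rightarrow> nat" where "strict_mono r" "nonneg_cont w" "\<And>x k. x \<notin> {0..1} \<Longrightarrow> w x $ k = 0"
    "\<And>x k. (\<lambda>n. s (r n) x $ k) \<longlonglongrightarrow> w x $ k"
    "\<And>e. e > 0 \<Longrightarrow> \<exists>N. \<forall>n\<ge>N. \<forall>x k. \<bar>s (r n) x $ k - w x $ k\<bar> < e"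
proof -
  have L0: "0 \<le> L" using L[of 0 1 0 undefined] by simp
  define m where "m = real CARD('n)"
  have m: "m \<ge> 1" by (simp add: m_def Suc_le_eq)
  obtain g r where gr: "continuous_on {0..1} g" "strict_mono (r :: nat \<Rightarrow> nat)"
    "\<And>e. 0 < e \<Longrightarrow> \<exists>N. \<forall>n x. n \<ge> N \<and> x \<in> {0..1} \<longrightarrow> norm (s (r n) x - g x) < e"
  proof (rule Arzela_Ascoli[of "{0..1::real}" s "m * b"])
    show "norm (s n x) \<le> m * b" for n x
      unfolding m_def by (rule norm_le_card_mult) (use b nonneg_contD(3)[OF nn] in auto)
    show "\<exists>d. 0 < d \<and> (\<forall>n y. y \<in> {0..1} \<and> norm (x - y) < d \<longrightarrow> norm (s n x - s n y) < e)"
      if x: "x \<in> {0..1}" and e: "0 < e" for x e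
    proof (intro exI conjI allI impI)
      show "0 < e / (m * (L + 1))" using e m L0 by simp
      fix n y assume y: "y \<in> {0..1} \<and> norm (x - y) < e / (m * (L + 1))"
      have "norm (s n x - s n y) \<le> (\<Sum>k\<in>UNIV. \<bar>(s n x - s n y) $ k\<bar>)" by (rule norm_le_l1_cart)
      also have "\<dots> \<le> (\<Sum>k\<in>(UNIV::'n set). \<bar>x - y\<bar> * L)" using L[OF x, of y n] y by (intro sum_mono) auto
      also have "\<dots> = \<bar>x - y\<bar> * (m * L)" by (simp add: m_def)
      also have "\<dots> \<le> \<bar>x - y\<bar> * (m * (L + 1))" using m L0 by (intro mult_left_mono) auto
      also have "\<dots> < e" using y m L0 by (simp add: pos_less_divide_eq)
      finally show "norm (s n x - s n y) < e" .
    qed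
  qed auto
  define w where "w x = (if x \<in> {0..1} then g x else 0)" for x
  have unif: "\<exists>N. \<forall>n\<ge>N. \<forall>x k. \<bar>s (r n) x $ k - w x $ k\<bar> < e" if e: "e > 0" for e
  proof -
    obtain N where N: "\<And>n x. n \<ge> N \<Longrightarrow> x \<in> {0..1} \<Longrightarrow> norm (s (r n) x - g x) < e" using gr(3)[OF e] by blast
    have "\<bar>s (r n) x $ k - w x $ k\<bar> < e" if "n \<ge> N" for n x k
    proof (cases "x \<in> {0..1}")
      case True
      then have "\<bar>(s (r n) x - g x) $ k\<bar> < e" using N[OF that True] component_le_norm_cart[of "s (r n) x - g x" k] by linarith
      then show ?thesis using True by (simp add: w_def)
    next
      case False
      then have "s (r n) x $ k = 0" "w x $ k = 0" using out[OF False] by (auto simp: w_def)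
      then show ?thesis using e by simp
    qed
    then show ?thesis by blast
  qed
  have lim: "(\<lambda>n. s (r n) x $ k) \<longlonglongrightarrow> w x $ k" for x k
    by (rule LIMSEQ_I) (use unif in \<open>fastforce\<close>)
  have "continuous_on {0..1} w" by (rule continuous_on_eq[OF gr(1)]) (simp add: w_def)
  moreover have "0 \<le> w x $ k" for x k
    by (rule LIMSEQ_le_const[OF lim]) (use nonneg_contD(3)[OF nn] in auto)
  ultimately have "nonneg_cont w" by (simp add: nonneg_cont_def)
  moreover have "w x $ k = 0" if "x \<notin> {0..1}" for x k unfolding w_def by (simp only: that if_False zero_index)
  ultimately show thesis using that[OF gr(2) _ _ lim unif] by blast
qed

text \<open>The lower bound \<open>c0\<close> is uniform along the approximating minimal solutions: it dominates their
  powers with exponent \<open>q - 2\<close> by that of \<open>bubble\<close>, which is integrable because \<open>q - 2 > -1\<close>.\<close>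

locale extremal_solution = elliptic_system f q \<gamma> C R \<delta>0 \<theta>
  for f :: "real \<Rightarrow> real^('m::{finite,linorder}) \<Rightarrow> real^('m::{finite,linorder})"
    and q \<gamma> C R \<delta>0 \<theta> :: real +
  fixes u :: "real \<Rightarrow> real^('m::{finite,linorder})" and b c0 :: real
  assumes nu: "nonneg_cont u" and fix_u: "step Ls u = u"
    and b: "\<And>x k. u x $ k \<le> b"
    and c0: "0 < c0" "\<And>n x k. x \<in> {0..1} \<Longrightarrow> c0 * bubble x \<le> minsol (Ls * (1 - 1 / (real n + 2))) x $ k"
    and below: "\<And>n x k. minsol (Ls * (1 - 1 / (real n + 2))) x $ k \<le> u x $ k"
    and limit: "\<And>x k. (\<lambda>n. minsol (Ls * (1 - 1 / (real n + 2))) x $ k) \<longlonglongrightarrow> u x $ k"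
begin

lemma u_ge: "x \<in> {0..1} \<Longrightarrow> c0 * bubble x \<le> u x $ k"
  using c0(2)[of x 0 k] below[of 0 x k] by simp

lemma u_pos: "0 < x \<Longrightarrow> x < 1 \<Longrightarrow> 0 < u x $ k"
proof -
  assume x: "0 < x" "x < 1"
  then have "0 < c0 * bubble x" using c0(1) by simp
  then show ?thesis using u_ge[of x k] x by simp
qed

definition wt :: "real \<Rightarrow> real" where "wt x = bubble x powr (q - 2)"

lemma wt_integrable: "integrable I01 wt"
proof -
  \<comment> \<open>The integrand of the Beta function with both parameters equal to
    \<open>q - 1 > 0\<close>.\<close>
  have "set_integrable lborel {0..1} (\<lambda>t. t powr (q - 1 - 1) * (1 - t) powr (q - 1 - 1))"
    using q by (intro integrable_Beta) auto
  then have "set_integrable lborel {0<..<1} (\<lambda>t. t powr (q - 1 - 1) * (1 - t) powr (q - 1 - 1))"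
    by (rule set_integrable_subset) auto
  then have "integrable I01 (\<lambda>t. t powr (q - 1 - 1) * (1 - t) powr (q - 1 - 1))"
    by (simp only: set_integrable_I01)
  then show ?thesis
  proof (rule Bochner_Integration.integrable_cong[THEN iffD1, OF refl, rotated])
    fix x assume "x \<in> space I01"
    then have "bubble x powr (q - 2) = x powr (q - 2) * (1 - x) powr (q - 2)" by (intro powr_mult)
    then show "x powr (q - 1 - 1) * (1 - x) powr (q - 1 - 1) = wt x" by (simp add: wt_def)
  qed
qed

text \<open>This lets bounded terms be absorbed into the same weight as the singular ones.\<close>

lemma wt_ge_1: "0 < x \<Longrightarrow> x < 1 \<Longrightarrow> 1 \<le> wt x"
proof -
  assume x: "0 < x" "x < 1"
  have "bubble x \<le> 1" using x by (intro mult_le_one) auto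
  then have "1 powr (q - 2) \<le> bubble x powr (q - 2)" using x q by (intro powr_mono2') auto
  then show ?thesis by (simp add: wt_def)
qed

lemma wt_integral: "0 \<le> integral\<^sup>L I01 wt"
  by (rule integral_nonneg_AE) (simp add: wt_def)

lemma powr_le_wt:
  assumes "0 < x" "x < 1" "c0 * bubble x \<le> t"
  shows "t powr (q - 2) \<le> c0 powr (q - 2) * wt x"
proof -
  have p: "0 < bubble x" using assms by simp
  have "t powr (q - 2) \<le> (c0 * bubble x) powr (q - 2)"
    using assms c0(1) q p by (intro powr_mono2' mult_pos_pos) auto
  also have "\<dots> = c0 powr (q - 2) * wt x" using c0(1) p by (simp add: wt_def powr_mult)
  finally show ?thesis .
qed

text \<open>The coefficient matrix of the linearization at \<open>u\<close>, including the singular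
  diagonal term of the power; the linearized equation is \<open>w = Lin A w\<close>.\<close>

definition A where
  "A i j x = jac f x (u x) $ i $ j + (if i = j then Ls * (q - 1) * (u x $ i) powr (q - 2) else 0)"

text \<open>The difference quotient of \<open>Nl Ls\<close> at \<open>u\<close> in direction
  \<open>h\<close>. Negative \<open>s\<close> occurs for approximations from below, positive
  \<open>s\<close> for those from above.\<close>

definition D where
  "D s h i x = ((f x (u x + s *\<^sub>R h x) $ i - f x (u x) $ i)
     + Ls * ((u x $ i + s * h x $ i) powr (q - 1) - (u x $ i) powr (q - 1))) / s"

lemma D_tendsto:
  assumes x: "0 < x" "x < 1" and s: "\<And>n. s n \<noteq> 0" "s \<longlonglongrightarrow> 0"
    and h: "\<And>k. (\<lambda>n. h n x $ k) \<longlonglongrightarrow> y $ k" and o: "\<And>n k. 0 \<le> u x $ k + s n * h n x $ k"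
  shows "(\<lambda>n. D (s n) (h n) i x) \<longlonglongrightarrow> (\<Sum>j\<in>UNIV. A i j x * y $ j)"
proof -
  have hv: "(\<lambda>n. h n x) \<longlonglongrightarrow> y" by (rule vec_tendstoI) (rule h)
  have x': "x \<in> {0..1}" using x by auto
  have "(\<lambda>n. (1 / s n) *\<^sub>R (f x (u x + s n *\<^sub>R h n x) - f x (u x))) \<longlonglongrightarrow> jac f x (u x) *v y"
    by (rule derivative_quotient_tendsto[OF jac_has_derivative[OF x' nonneg_contD(4)[OF nu]] s hv])
      (use o in \<open>simp add: orthant_def\<close>)
  from tendsto_vec_nth[OF this, of i]
  have 1: "(\<lambda>n. (1 / s n) * (f x (u x + s n *\<^sub>R h n x) $ i - f x (u x) $ i)) \<longlonglongrightarrow> (\<Sum>j\<in>UNIV. jac f x (u x) $ i $ j * y $ j)"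
    by (simp add: matrix_vector_mult_def)
  have "((\<lambda>t. t powr (q - 1)) has_real_derivative (q - 1) * (u x $ i) powr (q - 1 - 1)) (at (u x $ i))"
    using u_pos[OF x] by (intro has_real_derivative_powr)
  then have "((\<lambda>t. t powr (q - 1)) has_derivative (*) ((q - 1) * (u x $ i) powr (q - 1 - 1))) (at (u x $ i) within UNIV)"
    by (simp add: has_field_derivative_def)
  from derivative_quotient_tendsto[OF this s h[of i]]
  have 2: "(\<lambda>n. (1 / s n) * ((u x $ i + s n * h n x $ i) powr (q - 1) - (u x $ i) powr (q - 1)))
      \<longlonglongrightarrow> (q - 1) * (u x $ i) powr (q - 2) * y $ i" by simp
  have "(\<lambda>n. (1 / s n) * (f x (u x + s n *\<^sub>R h n x) $ i - f x (u x) $ i)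
      + Ls * ((1 / s n) * ((u x $ i + s n * h n x $ i) powr (q - 1) - (u x $ i) powr (q - 1))))
     \<longlonglongrightarrow> (\<Sum>j\<in>UNIV. jac f x (u x) $ i $ j * y $ j) + Ls * ((q - 1) * (u x $ i) powr (q - 2) * y $ i)"
    by (intro tendsto_add tendsto_mult tendsto_const 1 2)
  also have "(\<lambda>n. (1 / s n) * (f x (u x + s n *\<^sub>R h n x) $ i - f x (u x) $ i)
      + Ls * ((1 / s n) * ((u x $ i + s n * h n x $ i) powr (q - 1) - (u x $ i) powr (q - 1))))
     = (\<lambda>n. D (s n) (h n) i x)"
    by (simp add: D_def add_divide_distrib)
  also have "(\<Sum>j\<in>UNIV. jac f x (u x) $ i $ j * y $ j) + Ls * ((q - 1) * (u x $ i) powr (q - 2) * y $ i)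
     = (\<Sum>j\<in>UNIV. A i j x * y $ j)"
  proof -
    have "(\<Sum>j\<in>UNIV. (if i = j then Ls * (q - 1) * (u x $ i) powr (q - 2) else 0) * y $ j)
       = (\<Sum>j\<in>UNIV. if j = i then Ls * (q - 1) * (u x $ i) powr (q - 2) * y $ i else 0)"
      by (intro sum.cong) auto
    also have "\<dots> = Ls * (q - 1) * (u x $ i) powr (q - 2) * y $ i" by simp
    finally show ?thesis by (simp add: A_def distrib_right sum.distrib mult.assoc)
  qed
  finally show ?thesis .
qed

text \<open>The secant slope of the concave power is at most its derivative at the smaller argument,
  and both arguments are at least \<open>c0 * bubble x\<close>; this produces the weight
  \<open>wt\<close>.\<close>

lemma D_bound:
  assumes x: "0 < x" "x < 1" and s: "s \<noteq> 0" and h: "\<And>k. \<bar>h x $ k\<bar> \<le> hb"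
    and low: "\<And>k. c0 * bubble x \<le> u x $ k + s * h x $ k" and up: "\<And>k. u x $ k + s * h x $ k \<le> b'" "b \<le> b'"
  shows "\<bar>D s h i x\<bar> \<le> (lip b' * real CARD('m) * hb + Ls * (q - 1) * c0 powr (q - 2) * hb) * wt x"
proof -
  have x': "x \<in> {0..1}" using x by auto
  have p: "0 < c0 * bubble x" using x c0(1) by simp
  have hb: "0 \<le> hb" using h[of undefined] by linarith
  have "\<bar>f x (u x + s *\<^sub>R h x) $ i - f x (u x) $ i\<bar> \<le> lip b' * (\<Sum>j\<in>UNIV. \<bar>(u x + s *\<^sub>R h x) $ j - u x $ j\<bar>)"
  proof (rule f_lipschitz[OF x'])
    show "0 \<le> (u x + s *\<^sub>R h x) $ k" for k using order_trans[OF less_imp_le[OF p] low[of k]] by simp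
    show "u x $ k \<le> b'" for k using b[of x k] up(2) by simp
  qed (use nonneg_contD(3)[OF nu] up in auto)
  also have "\<dots> \<le> lip b' * (\<Sum>j\<in>(UNIV::'m set). \<bar>s\<bar> * hb)"
  proof (intro mult_left_mono sum_mono lip_nonneg)
    fix j
    show "\<bar>(u x + s *\<^sub>R h x) $ j - u x $ j\<bar> \<le> \<bar>s\<bar> * hb" using h[of j] by (simp add: abs_mult mult_left_mono)
  qed
  also have "\<dots> = (lip b' * real CARD('m) * hb) * \<bar>s\<bar>" by simp
  finally have 1: "\<bar>f x (u x + s *\<^sub>R h x) $ i - f x (u x) $ i\<bar> \<le> (lip b' * real CARD('m) * hb) * \<bar>s\<bar>" .
  define t where "t = u x $ i + s * h x $ i"
  have t: "c0 * bubble x \<le> t" using low by (simp add: t_def)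
  have ui: "c0 * bubble x \<le> u x $ i" by (rule u_ge[OF x'])
  have sec: "v' powr (q - 1) - v powr (q - 1) \<le> (q - 1) * (c0 powr (q - 2) * wt x) * (v' - v)"
    if "c0 * bubble x \<le> v" "v \<le> v'" for v v'
  proof -
    have "v' powr (q - 1) - v powr (q - 1) \<le> (q - 1) * v powr (q - 1 - 1) * (v' - v)"
      using that p q by (intro powr_secant) auto
    also have "\<dots> \<le> (q - 1) * (c0 powr (q - 2) * wt x) * (v' - v)"
      using powr_le_wt[OF x that(1)] that q by (intro mult_right_mono mult_left_mono) auto
    finally show ?thesis .
  qed
  have "\<bar>t powr (q - 1) - (u x $ i) powr (q - 1)\<bar> \<le> (q - 1) * (c0 powr (q - 2) * wt x) * \<bar>t - u x $ i\<bar>"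
  proof (cases "t \<le> u x $ i")
    case True
    have "t powr (q - 1) \<le> (u x $ i) powr (q - 1)" using True t p q by (intro powr_mono2) auto
    then show ?thesis using sec[OF t True] True by simp
  next
    case False
    then have le: "u x $ i \<le> t" by simp
    have "(u x $ i) powr (q - 1) \<le> t powr (q - 1)" using le ui p q by (intro powr_mono2) auto
    then show ?thesis using sec[OF ui le] le by simp
  qed
  also have "\<bar>t - u x $ i\<bar> \<le> \<bar>s\<bar> * hb" using h[of i] by (simp add: t_def abs_mult mult_left_mono)
  then have "(q - 1) * (c0 powr (q - 2) * wt x) * \<bar>t - u x $ i\<bar> \<le> (q - 1) * (c0 powr (q - 2) * wt x) * (\<bar>s\<bar> * hb)"
    using q by (intro mult_left_mono) (auto simp: wt_def)
  finally have 2: "\<bar>t powr (q - 1) - (u x $ i) powr (q - 1)\<bar> \<le> (q - 1) * (c0 powr (q - 2) * wt x) * (\<bar>s\<bar> * hb)" .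
  have "\<bar>D s h i x\<bar> = \<bar>(f x (u x + s *\<^sub>R h x) $ i - f x (u x) $ i) + Ls * (t powr (q - 1) - (u x $ i) powr (q - 1))\<bar> / \<bar>s\<bar>"
    by (simp add: D_def t_def abs_divide)
  also have "\<dots> \<le> ((lip b' * real CARD('m) * hb) * \<bar>s\<bar> + Ls * ((q - 1) * (c0 powr (q - 2) * wt x) * (\<bar>s\<bar> * hb))) / \<bar>s\<bar>"
  proof (intro divide_right_mono order_trans[OF abs_triangle_ineq] add_mono 1)
    show "\<bar>Ls * (t powr (q - 1) - (u x $ i) powr (q - 1))\<bar> \<le> Ls * ((q - 1) * (c0 powr (q - 2) * wt x) * (\<bar>s\<bar> * hb))"
      unfolding abs_mult using 2 Ls_pos by (auto intro: mult_left_mono)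
  qed auto
  also have "\<dots> = lip b' * real CARD('m) * hb + Ls * (q - 1) * c0 powr (q - 2) * hb * wt x"
    using s by (simp add: field_simps)
  also have "\<dots> \<le> lip b' * real CARD('m) * hb * wt x + Ls * (q - 1) * c0 powr (q - 2) * hb * wt x"
    using mult_left_mono[OF wt_ge_1[OF x], of "lip b' * real CARD('m) * hb"] lip_nonneg[of b'] hb by simp
  finally show ?thesis by (simp add: distrib_right)
qed

lemma D_continuous:
  assumes U: "nonneg_cont (\<lambda>x. u x + s *\<^sub>R h x)" and s: "s \<noteq> 0"
  shows "continuous_on {0..1} (D s h i)"
proof -
  have eq: "D s h i = (\<lambda>x. ((f x (u x + s *\<^sub>R h x) $ i - f x (u x) $ i)
     + Ls * (((u x + s *\<^sub>R h x) $ i) powr (q - 1) - (u x $ i) powr (q - 1))) / s)" by (simp add: D_def fun_eq_iff)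
  show ?thesis unfolding eq using s
    by (intro continuous_on_divide continuous_on_add continuous_on_diff continuous_on_mult
       continuous_on_const f_comp_continuous[OF U] f_comp_continuous[OF nu] g_continuous[OF U] g_continuous[OF nu]) simp
qed

definition CA :: real where "CA = lip b + Ls * (q - 1) * c0 powr (q - 2)"

lemma A_bound:
  assumes x: "0 < x" "x < 1"
  shows "0 \<le> A i j x" "A i j x \<le> CA * wt x"
proof -
  have x': "x \<in> {0..1}" using x by auto
  note j = jac_le_lip[OF x', of "u x" b i j, OF nonneg_contD(3)[OF nu] b]
  show "0 \<le> A i j x" using j Ls_pos q by (simp add: A_def)
  have "lip b \<le> lip b * wt x" using mult_left_mono[OF wt_ge_1[OF x] lip_nonneg[of b]] by simp
  moreover have "(if i = j then Ls * (q - 1) * (u x $ i) powr (q - 2) else 0) \<le> Ls * (q - 1) * (c0 powr (q - 2) * wt x)"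
    using powr_le_wt[OF x u_ge[OF x', of i]] Ls_pos q by (auto intro!: mult_left_mono simp: wt_def)
  ultimately show "A i j x \<le> CA * wt x" using j by (simp add: A_def CA_def distrib_right)
qed

text \<open>The Jacobian carries no regularity assumption in \<open>x\<close>, but each column of
  \<open>A\<close> is the pointwise limit of difference quotients in a coordinate direction, which
  are continuous.\<close>

lemma A_measurable: "A i j \<in> borel_measurable I01"
proof -
  define s where "s n = 1 / (real n + 1)" for n
  have s: "s n > 0" "s n \<noteq> 0" for n by (auto simp: s_def add_pos_pos)
  have sl: "s \<longlonglongrightarrow> 0" unfolding s_def by real_asymp
  define h where "h x = axis j (1::real)" for x :: real
  have hk: "h x $ k = (if k = j then 1 else 0)" for x k by (simp add: h_def axis_def)
  have U: "nonneg_cont (\<lambda>x. u x + s n *\<^sub>R h x)" for n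
  proof (rule nonneg_contI)
    show "continuous_on {0..1} (\<lambda>x. (u x + s n *\<^sub>R h x) $ k)" for k
      unfolding vector_add_component vector_scaleR_component hk
      by (intro continuous_on_add continuous_on_const nonneg_contD(2)[OF nu])
    show "0 \<le> (u x + s n *\<^sub>R h x) $ k" for x k
      using nonneg_contD(3)[OF nu, of x k] s(1)[of n] by (simp add: hk)
  qed
  show ?thesis
  proof (rule borel_measurable_LIMSEQ_real)
    show "D (s n) h i \<in> borel_measurable I01" for n
      by (rule continuous_measurable_I01'[OF D_continuous[OF U s(2)]])
    fix x assume "x \<in> space I01"
    then have x: "0 < x" "x < 1" by auto
    have "(\<lambda>n. D (s n) h i x) \<longlonglongrightarrow> (\<Sum>k\<in>UNIV. A i k x * h x $ k)"
      using nonneg_contD(3)[OF U] by (intro D_tendsto x s sl tendsto_const) simp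
    moreover have "(\<Sum>k\<in>UNIV. A i k x * h x $ k) = A i j x" by (simp add: hk if_distrib cong: if_cong)
    ultimately show "(\<lambda>n. D (s n) h i x) \<longlonglongrightarrow> A i j x" by simp
  qed
qed

section \<open>The linear operators given by \<open>A\<close> and its transpose\<close>

definition Lin where "Lin a w = KV (\<lambda>y. \<chi> i. \<Sum>j\<in>UNIV. a i j y * w y $ j)"

lemma Lin_nth: "Lin a w x $ i = Kop (\<lambda>y. \<Sum>j\<in>UNIV. a i j y * w y $ j) x"
  by (simp add: Lin_def)

definition AT where "AT i j = A j i"

text \<open>One set of estimates serves both the linearization and its adjoint.\<close>

definition admissible where "admissible a \<longleftrightarrow> a = A \<or> a = AT"

lemma admissibleD:
  assumes "admissible a"
  shows "a i j \<in> borel_measurable I01" "0 < x \<Longrightarrow> x < 1 \<Longrightarrow> 0 \<le> a i j x" "0 < x \<Longrightarrow> x < 1 \<Longrightarrow> a i j x \<le> CA * wt x"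
  using assms A_measurable A_bound by (auto simp: admissible_def AT_def)

lemma CA_nonneg: "0 \<le> CA"
  using lip_nonneg[of b] Ls_pos q by (simp add: CA_def)

lemma Lin_row_bound:
  assumes a: "admissible a" and w: "\<And>k. \<bar>w x $ k\<bar> \<le> wb" and x: "0 < x" "x < 1"
  shows "\<bar>\<Sum>j\<in>UNIV. a i j x * w x $ j\<bar> \<le> (real CARD('m) * CA * wb) * wt x"
proof -
  have "\<bar>\<Sum>j\<in>UNIV. a i j x * w x $ j\<bar> \<le> (\<Sum>j\<in>UNIV. \<bar>a i j x * w x $ j\<bar>)" by (rule sum_abs)
  also have "\<dots> \<le> (\<Sum>j\<in>(UNIV::'m set). CA * wt x * wb)"
    unfolding abs_mult using admissibleD(2,3)[OF a x] w by (intro sum_mono mult_mono) (auto simp: CA_nonneg wt_def)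
  finally show ?thesis by (simp add: mult_ac)
qed

lemma Lin_integrable:
  assumes a: "admissible a" and wm: "\<And>k. (\<lambda>x. w x $ k) \<in> borel_measurable I01"
    and w: "\<And>x k. 0 < x \<Longrightarrow> x < 1 \<Longrightarrow> \<bar>w x $ k\<bar> \<le> wb"
  shows "integrable I01 (\<lambda>y. \<Sum>j\<in>UNIV. a i j y * w y $ j)" "integrable I01 (\<lambda>y. a i j y * w y $ j)"
proof -
  have m: "(\<lambda>y. a i j y * w y $ j) \<in> borel_measurable I01" for j
    using admissibleD(1)[OF a] wm by (intro borel_measurable_times)
  have "integrable I01 (\<lambda>y. a i j y * w y $ j)" for j
  proof (rule Bochner_Integration.integrable_bound[OF integrable_mult_right[OF wt_integrable, of "CA * wb"] m])
    show "AE y in I01. norm (a i j y * w y $ j) \<le> norm (CA * wb * wt y)"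
    proof (rule AE_I01_I)
      fix y :: real assume y: "0 < y" "y < 1"
      have "\<bar>a i j y\<bar> * \<bar>w y $ j\<bar> \<le> (CA * wt y) * wb"
        using admissibleD(2,3)[OF a y, of i j] w[OF y, of j] by (intro mult_mono) (auto simp: CA_nonneg wt_def)
      also have "\<dots> \<le> \<bar>CA * wb * wt y\<bar>" by (simp add: mult_ac)
      finally show "norm (a i j y * w y $ j) \<le> norm (CA * wb * wt y)" by (simp add: abs_mult)
    qed
  qed
  then show "integrable I01 (\<lambda>y. \<Sum>j\<in>UNIV. a i j y * w y $ j)" "integrable I01 (\<lambda>y. a i j y * w y $ j)" by auto
qed

lemma Lin_integrable':
  assumes a: "admissible a" and w: "nonneg_cont w" and wb: "\<And>x k. w x $ k \<le> wb"
  shows "integrable I01 (\<lambda>y. \<Sum>j\<in>UNIV. a i j y * w y $ j)" "integrable I01 (\<lambda>y. a i j y * w y $ j)"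
  using Lin_integrable[OF a, of w wb i] continuous_measurable_I01'[OF nonneg_contD(2)[OF w]] wb nonneg_contD(3)[OF w]
  by simp_all

lemma Lin_nonneg_cont:
  assumes a: "admissible a" and w: "nonneg_cont w" and wb: "\<And>x k. w x $ k \<le> wb"
  shows "nonneg_cont (Lin a w)"
proof (rule nonneg_contI)
  show "continuous_on {0..1} (\<lambda>x. Lin a w x $ k)" for k
    unfolding Lin_nth by (rule Kop_continuous[OF Lin_integrable'(1)[OF a w wb]])
  show "0 \<le> Lin a w x $ k" for x k
    unfolding Lin_nth using admissibleD(2)[OF a] nonneg_contD(3)[OF w] by (intro Kop_nonneg sum_nonneg mult_nonneg_nonneg) auto
qed

lemma Lin_lipschitz:
  assumes a: "admissible a" and w: "nonneg_cont w" and wb: "\<And>x k. w x $ k \<le> wb" and x: "x \<in> {0..1}" "x' \<in> {0..1}"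
  shows "\<bar>Lin a w x $ k - Lin a w x' $ k\<bar> \<le> \<bar>x - x'\<bar> * (real CARD('m) * CA * wb * integral\<^sup>L I01 wt)"
proof -
  note i = Lin_integrable'(1)[OF a w wb]
  have "\<bar>Lin a w x $ k - Lin a w x' $ k\<bar> \<le> \<bar>x - x'\<bar> * (\<integral>y. \<bar>\<Sum>j\<in>UNIV. a k j y * w y $ j\<bar> \<partial>I01)"
    unfolding Lin_nth by (rule Kop_lipschitz[OF i x])
  also have "(\<integral>y. \<bar>\<Sum>j\<in>UNIV. a k j y * w y $ j\<bar> \<partial>I01) \<le> (\<integral>y. (real CARD('m) * CA * wb) * wt y \<partial>I01)"
    using nonneg_contD(3)[OF w] wb
    by (intro integral_mono_AE AE_I01_I Lin_row_bound a integrable_abs i integrable_mult_right wt_integrable) auto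
  then have "\<bar>x - x'\<bar> * (\<integral>y. \<bar>\<Sum>j\<in>UNIV. a k j y * w y $ j\<bar> \<partial>I01) \<le> \<bar>x - x'\<bar> * (real CARD('m) * CA * wb * integral\<^sup>L I01 wt)"
    by (intro mult_left_mono) auto
  finally show ?thesis .
qed

lemma Lin_tendsto:
  assumes a: "admissible a" and w: "\<And>n. nonneg_cont (w n)" and wb: "\<And>n x k. w n x $ k \<le> wb"
    and v: "nonneg_cont v" and lim: "\<And>x k. (\<lambda>n. w n x $ k) \<longlonglongrightarrow> v x $ k"
  shows "(\<lambda>n. Lin a (w n) x $ i) \<longlonglongrightarrow> Lin a v x $ i"
  unfolding Lin_nth
proof (rule Kop_limit)
  have vb: "v x $ k \<le> wb" for x k by (rule LIMSEQ_le_const2[OF lim]) (use wb in auto)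
  show "(\<lambda>y. \<Sum>j\<in>UNIV. a i j y * w n y $ j) \<in> borel_measurable I01" for n
    using Lin_integrable'(1)[OF a w wb] by blast
  show "(\<lambda>y. \<Sum>j\<in>UNIV. a i j y * v y $ j) \<in> borel_measurable I01"
    using Lin_integrable'(1)[OF a v vb] by blast
  show "integrable I01 (\<lambda>x. (real CARD('m) * CA * wb) * wt x)" by (rule integrable_mult_right[OF wt_integrable])
  show "\<bar>\<Sum>j\<in>UNIV. a i j y * w n y $ j\<bar> \<le> (real CARD('m) * CA * wb) * wt y" if "0 < y" "y < 1" for n y
    using nonneg_contD(3)[OF w] wb by (intro Lin_row_bound a that) auto
  show "(\<lambda>n. \<Sum>j\<in>UNIV. a i j y * w n y $ j) \<longlonglongrightarrow> (\<Sum>j\<in>UNIV. a i j y * v y $ j)" for y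
    by (intro tendsto_intros lim)
qed

lemma Lin_outside: "x \<notin> {0..1} \<Longrightarrow> Lin a w x $ i = 0"
  unfolding Lin_nth by (rule Kop_outside)

end

text \<open>The point at which the lower bound is attained may vary with \<open>n\<close>; this is
  why pointwise convergence would not suffice.\<close>

lemma uniform_limit_nonzero:
  fixes w :: "real \<Rightarrow> real^'n" and s :: "nat \<Rightarrow> real \<Rightarrow> real^'n"
  assumes unif: "\<And>e. e > 0 \<Longrightarrow> \<exists>N. \<forall>n\<ge>N. \<forall>x k. \<bar>s n x $ k - w x $ k\<bar> < e"
    and big: "\<And>n. \<exists>x k. d \<le> s n x $ k" and d: "0 < d"
  obtains x k where "0 < w x $ k"
proof -
  obtain N where N: "\<And>n x k. n \<ge> N \<Longrightarrow> \<bar>s n x $ k - w x $ k\<bar> < d" using unif[OF d] by blast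
  obtain x k where "d \<le> s N x $ k" using big by blast
  then have "0 < w x $ k" using N[of N x k, OF order_refl] by linarith
  then show thesis by (rule that)
qed

section \<open>Positive super- and subsolutions of the linearization\<close>

context extremal_solution begin

lemma D_mono:
  assumes "x \<in> {0..1}" "s > 0" "\<And>k. 0 \<le> u x $ k + s * h x $ k" "\<And>k. h x $ k \<le> h' x $ k"
  shows "D s h i x \<le> D s h' i x"
  unfolding D_def
proof (intro divide_right_mono add_mono mult_left_mono diff_right_mono powr_mono2)
  show "f x (u x + s *\<^sub>R h x) $ i \<le> f x (u x + s *\<^sub>R h' x) $ i"
    using assms by (intro f_mono) (auto simp: orthant_def)
qed (use assms q Ls_pos in auto)

lemma row_tendsto_Kop:
  assumes s: "\<And>n. s n \<noteq> 0" "s \<longlonglongrightarrow> 0" and U: "\<And>n. nonneg_cont (\<lambda>x. u x + s n *\<^sub>R h n x)"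
    and hb: "\<And>n x k. \<bar>h n x $ k\<bar> \<le> hb" and low: "\<And>n x k. x \<in> {0..1} \<Longrightarrow> c0 * bubble x \<le> u x $ k + s n * h n x $ k"
    and up: "\<And>n x k. u x $ k + s n * h n x $ k \<le> b'" "b \<le> b'"
    and w: "nonneg_cont w" and lim: "\<And>x k. (\<lambda>n. h n x $ k) \<longlonglongrightarrow> w x $ k"
  shows "(\<lambda>n. Kop (D (s n) (h n) i) x) \<longlonglongrightarrow> Lin A w x $ i"
  unfolding Lin_nth
proof (rule Kop_limit)
  have wb: "\<bar>w x $ k\<bar> \<le> hb" for x k
    by (rule LIMSEQ_le_const2[OF tendsto_rabs[OF lim]]) (use hb in auto)
  show "D (s n) (h n) i \<in> borel_measurable I01" for n
    by (rule continuous_measurable_I01'[OF D_continuous[OF U s(1)]])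
  show "(\<lambda>y. \<Sum>j\<in>UNIV. A i j y * w y $ j) \<in> borel_measurable I01"
    using Lin_integrable(1)[of A w hb i] continuous_measurable_I01'[OF nonneg_contD(2)[OF w]] wb
    by (auto simp: admissible_def)
  show "integrable I01 (\<lambda>x. (lip b' * real CARD('m) * hb + Ls * (q - 1) * c0 powr (q - 2) * hb) * wt x)"
    by (rule integrable_mult_right[OF wt_integrable])
  show "\<bar>D (s n) (h n) i y\<bar> \<le> (lip b' * real CARD('m) * hb + Ls * (q - 1) * c0 powr (q - 2) * hb) * wt y"
    if "0 < y" "y < 1" for n y
    using that by (intro D_bound s hb low up) auto
  show "(\<lambda>n. D (s n) (h n) i y) \<longlonglongrightarrow> (\<Sum>j\<in>UNIV. A i j y * w y $ j)" if "0 < y" "y < 1" for y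
    using nonneg_contD(3)[OF U] by (intro D_tendsto that s lim) simp
qed

text \<open>The diagonal is positive because of the sublinear term, the off-diagonal entries by
  assumption, as \<open>u\<close> lies in the open orthant inside the interval.\<close>

lemma A_pos: "AE x in I01. 0 < A i j x"
proof (cases "i = j")
  case True
  show ?thesis
  proof (rule AE_I01_I)
    fix x :: real assume x: "0 < x" "x < 1"
    have "0 \<le> jac f x (u x) $ i $ j" using fu_bound[of x "u x" i j] nonneg_contD(4)[OF nu] x by simp
    moreover have "0 < Ls * (q - 1) * (u x $ i) powr (q - 2)" using Ls_pos q u_pos[OF x, of i] by simp
    ultimately show "0 < A i j x" using True by (simp add: A_def)
  qed
next
  case False
  have "AE x in I01. 0 < x \<and> x < 1" by (rule AE_I01_I) auto
  with fu_pos[OF False, unfolded AE_I01] show ?thesis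
    by eventually_elim (use u_pos False in \<open>simp add: A_def\<close>)
qed

text \<open>A strong maximum principle for the coupled system: one component that is positive on an
  interval feeds every row, since all entries of \<open>A\<close> are positive almost
  everywhere.\<close>

lemma supersolution_positive:
  assumes w: "nonneg_cont w" "\<And>x k. w x $ k \<le> wb" and out: "\<And>x k. x \<notin> {0..1} \<Longrightarrow> w x $ k = 0"
    and nz: "0 < w x0 $ j" and super: "\<And>x k. Lin A w x $ k \<le> w x $ k"
  obtains c where "0 < c" "\<And>x k. x \<in> {0..1} \<Longrightarrow> c * bubble x \<le> w x $ k"
proof -
  have adm: "admissible A" by (simp add: admissible_def)
  define I where "I i = (\<integral>y. bubble y * (\<Sum>k\<in>UNIV. A i k y * w y $ k) \<partial>I01)" for i
  have x0: "x0 \<in> {0..1}" using out[of x0 j] nz by fastforce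
  obtain a e where ae: "0 \<le> a" "a < e" "e \<le> 1" "\<And>y. y \<in> {a<..<e} \<Longrightarrow> 0 < w y $ j"
    by (rule continuous_pos_interval[OF nonneg_contD(2)[OF w(1)] x0 nz]) auto
  have row: "0 \<le> A i k y * w y $ k" if "0 < y" "y < 1" for i k y
    using A_bound(1)[OF that] nonneg_contD(3)[OF w(1)] by simp
  have I: "0 < I i" for i unfolding I_def
  proof (rule integral_I01_pos[OF _ _ ae(1-3)])
    show "integrable I01 (\<lambda>y. bubble y * (\<Sum>k\<in>UNIV. A i k y * w y $ k))"
      by (rule bubble_integrable[OF Lin_integrable'(1)[OF adm w]])
    show "AE y in I01. 0 \<le> bubble y * (\<Sum>k\<in>UNIV. A i k y * w y $ k)"
      using row by (intro AE_I01_I mult_nonneg_nonneg[OF mult_nonneg_nonneg sum_nonneg]) auto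
    have "AE x in I01. 0 < x \<and> x < 1" by (rule AE_I01_I) auto
    with A_pos[of i j] show "AE y in I01. y \<in> {a<..<e} \<longrightarrow> 0 < bubble y * (\<Sum>k\<in>UNIV. A i k y * w y $ k)"
    proof eventually_elim
      case (elim y)
      show ?case
      proof
        assume "y \<in> {a<..<e}"
        then have "0 < A i j y * w y $ j" using elim ae(4) by simp
        also have "\<dots> \<le> (\<Sum>k\<in>UNIV. A i k y * w y $ k)"
          using row elim by (intro member_le_sum) auto
        finally show "0 < bubble y * (\<Sum>k\<in>UNIV. A i k y * w y $ k)" using elim by (intro mult_pos_pos) auto
      qed
    qed
  qed
  have "Min (range I) * bubble x \<le> w x $ i" if x: "x \<in> {0..1}" for x i
  proof -
    have "Min (range I) * bubble x \<le> I i * bubble x" using x by (intro mult_right_mono Min_le) auto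
    also have "\<dots> = bubble x * I i" by simp
    also have "\<dots> \<le> Lin A w x $ i"
      unfolding Lin_nth I_def using row
      by (intro Kop_ge_bubble Lin_integrable'(1)[OF adm w] x sum_nonneg) auto
    also have "\<dots> \<le> w x $ i" by (rule super)
    finally show ?thesis .
  qed
  moreover have "0 < Min (range I)" using I by (subst Min_gr_iff) auto
  ultimately show thesis by (intro that)
qed

text \<open>The differences between \<open>u\<close> and the minimal solutions below it, normalised
  to maximal norm 1, satisfy the linearized equation up to a nonnegative term from the parameter
  gap. Dropping this term leaves a supersolution in the limit.\<close>

lemma linear_supersolution:
  obtains w c where "nonneg_cont w" "\<And>x k. w x $ k \<le> 1" "0 < c"
    "\<And>x k. x \<in> {0..1} \<Longrightarrow> c * bubble x \<le> w x $ k" "\<And>x k. Lin A w x $ k \<le> w x $ k"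
proof -
  define l where "l n = Ls * (1 - 1 / (real n + 2))" for n
  have l: "0 < l n" "l n < Ls" for n
  proof -
    have "0 < 1 - 1 / (real n + 2)" by (simp add: field_simps)
    then show "0 < l n" unfolding l_def using Ls_pos by (rule mult_pos_pos[rotated])
    show "l n < Ls" using Ls_pos by (simp add: l_def right_diff_distrib)
  qed
  have "(\<lambda>n. c * (1 - 1 / (real n + 2))) \<longlonglongrightarrow> c" for c :: real by real_asymp
  then have ll: "l \<longlonglongrightarrow> Ls" unfolding l_def .
  define s where "s n = minsol (l n)" for n
  note ms = minsol_props[OF l(1) l(2), folded s_def]
  have su: "s n x $ k \<le> u x $ k" for n x k unfolding s_def l_def by (rule below)
  have slow: "c0 * bubble x \<le> s n x $ k" if "x \<in> {0..1}" for n x k unfolding s_def l_def by (rule c0(2)[OF that])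
  have slim: "(\<lambda>n. s n x $ k) \<longlonglongrightarrow> u x $ k" for x k unfolding s_def l_def by (rule limit)
  have s0: "s 0 x $ k \<le> s n x $ k" for n x k
  proof -
    have "l 0 \<le> l n" unfolding l_def using Ls_pos by (intro mult_left_mono) (auto simp: field_simps)
    then show ?thesis unfolding s_def by (intro minsol_mono l)
  qed
  define z where "z n x = u x - s n x" for n x
  have z0: "0 \<le> z n x $ k" for n x k using su by (simp add: z_def)
  have cz: "continuous_on {0..1} (z n)" for n
    unfolding z_def by (intro continuous_on_diff nonneg_contD(1)[OF nu] nonneg_contD(1)[OF ms(1)])
  have u_out: "u x $ k = 0" if "x \<notin> {0..1}" for x k
    using step_outside[OF that, of Ls u k] fix_u by simp
  have s_out: "s n x $ k = 0" if "x \<notin> {0..1}" for n x k by (rule ms(6)[OF that])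
  have "\<exists>x\<in>{0..1}. \<forall>y\<in>{0..1}. norm (z n y) \<le> norm (z n x)" for n
    by (rule continuous_attains_sup[OF compact_Icc _ continuous_on_norm[OF cz]]) simp
  then have "\<forall>n. \<exists>x. x \<in> {0..1} \<and> (\<forall>y\<in>{0..1}. norm (z n y) \<le> norm (z n x))" by blast
  from choice[OF this] obtain X where X': "\<forall>n. X n \<in> {0..1} \<and> (\<forall>y\<in>{0..1}. norm (z n y) \<le> norm (z n (X n)))" ..
  then have X: "X n \<in> {0..1}" "y \<in> {0..1} \<Longrightarrow> norm (z n y) \<le> norm (z n (X n))" for n y by blast+
  define N where "N n = norm (z n (X n))" for n
  have zN: "norm (z n x) \<le> N n" for n x
  proof (cases "x \<in> {0..1}")
    case False
    then have "z n x = 0" using u_out s_out by (simp add: z_def vec_eq_iff)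
    then show ?thesis by (simp add: N_def)
  qed (use X in \<open>simp add: N_def\<close>)
  define k0 :: 'm where "k0 = undefined"
  \<comment> \<open>The parameter gap alone makes the difference at least
    \<open>(Ls - l n) * g0\<close>, so that after division by \<open>N n\<close> the gap stays
    bounded.\<close>
  define g0 where "g0 = Kop (\<lambda>y. (s 0 y $ k0) powr (q - 1)) (1/2)"
  have ig: "integrable I01 (\<lambda>y. (s n y $ k) powr (q - 1))" for n k
    by (rule integrable_I01_continuous[OF g_continuous[OF ms(1)]])
  have g0: "0 < g0"
  proof -
    have "0 < (\<integral>y. bubble y * (s 0 y $ k0) powr (q - 1) \<partial>I01)"
      using ms(5)[of "1/2" 0 k0]
      by (intro integral_I01_pos_continuous[where ?x0.0 = "1/2"] continuous_on_mult continuous_on_diff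
          continuous_on_id continuous_on_const g_continuous ms(1)) auto
    then have "0 < bubble (1/2) * (\<integral>y. bubble y * (s 0 y $ k0) powr (q - 1) \<partial>I01)" by simp
    also have "\<dots> \<le> g0" unfolding g0_def by (intro Kop_ge_bubble ig) auto
    finally show ?thesis .
  qed
  have Kz: "Kop (\<lambda>y. Nl Ls u y $ k - Nl (l n) (s n) y $ k) x = z n x $ k" for n k x
    using Kop_minsol[OF fix_u] Kop_minsol[OF ms(2)]
    by (subst Kop_diff[OF Nl_integrable[OF nu] Nl_integrable[OF ms(1)]]) (simp add: z_def del: Nl_nth)
  have idiff: "integrable I01 (\<lambda>y. Nl Ls u y $ k - Nl (l n) (s n) y $ k)" for n k
    by (intro Bochner_Integration.integrable_diff Nl_integrable nu ms(1))
  have Ng: "(Ls - l n) * g0 \<le> N n" for n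
  proof -
    have "(Ls - l n) * g0 = Kop (\<lambda>y. (Ls - l n) * (s 0 y $ k0) powr (q - 1)) (1/2)"
      by (simp add: g0_def Kop_cmult)
    also have "\<dots> \<le> Kop (\<lambda>y. Nl Ls u y $ k0 - Nl (l n) (s n) y $ k0) (1/2)"
    proof (rule Kop_mono[OF integrable_mult_right[OF ig] idiff])
      fix y :: real assume y: "0 < y" "y < 1"
      then have y': "y \<in> {0..1}" by auto
      have "f y (s n y) $ k0 \<le> f y (u y) $ k0" by (rule f_mono[OF y' nonneg_contD(4)[OF ms(1)] su])
      moreover have "Ls * (s n y $ k0) powr (q - 1) \<le> Ls * (u y $ k0) powr (q - 1)"
        using su nonneg_contD(3)[OF ms(1)] q Ls_pos by (intro mult_left_mono powr_mono2) auto
      moreover have "(Ls - l n) * (s 0 y $ k0) powr (q - 1) \<le> (Ls - l n) * (s n y $ k0) powr (q - 1)"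
        using s0 nonneg_contD(3)[OF ms(1)] q l(2)[of n] by (intro mult_left_mono powr_mono2) auto
      ultimately show "(Ls - l n) * (s 0 y $ k0) powr (q - 1) \<le> Nl Ls u y $ k0 - Nl (l n) (s n) y $ k0"
        by (simp add: left_diff_distrib)
    qed
    also have "\<dots> = z n (1/2) $ k0" by (rule Kz)
    also have "\<dots> \<le> norm (z n (1/2))" using component_le_norm_cart[of "z n (1/2)" k0] by simp
    also have "\<dots> \<le> N n" by (rule zN)
    finally show ?thesis .
  qed
  have Npos: "0 < N n" for n
  proof -
    have "0 < (Ls - l n) * g0" using l(2)[of n] g0 by simp
    then show ?thesis using Ng[of n] by simp
  qed
  \<comment> \<open>L1 convergence of the right-hand sides becomes uniform convergence through the
    sup bound for \<open>Kop\<close>; pointwise convergence alone would not control the moving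
    maximum points \<open>X n\<close>.\<close>
  have Nlim: "N \<longlonglongrightarrow> 0"
  proof -
    define \<beta> where "\<beta> n = (\<Sum>k\<in>UNIV. \<integral>y. \<bar>Nl (l n) (s n) y $ k - Nl Ls u y $ k\<bar> \<partial>I01)" for n
    have sb: "s n x $ k \<le> b" for n x k using su[of n x k] b[of x k] by simp
    have "\<beta> \<longlonglongrightarrow> (\<Sum>k\<in>(UNIV::'m set). 0)" unfolding \<beta>_def
      by (intro tendsto_sum step_tendsto(3)[OF ms(1) sb ll less_imp_le[OF l(1)] slim])
    then have "\<beta> \<longlonglongrightarrow> 0" by simp
    moreover have "norm (N n) \<le> \<beta> n" for n
    proof -
      have "norm (z n (X n)) \<le> (\<Sum>k\<in>UNIV. \<bar>z n (X n) $ k\<bar>)" by (rule norm_le_l1_cart)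
      also have "\<dots> \<le> (\<Sum>k\<in>UNIV. \<integral>y. \<bar>Nl Ls u y $ k - Nl (l n) (s n) y $ k\<bar> \<partial>I01)"
        unfolding Kz[symmetric] by (intro sum_mono Kop_abs_le(3) idiff X)
      finally show ?thesis using Npos[of n] unfolding \<beta>_def N_def by (simp add: abs_minus_commute del: Nl_nth)
    qed
    ultimately show ?thesis by (intro Lim_null_comparison[of N \<beta>]) auto
  qed
  define h where "h n x = (1 / N n) *\<^sub>R z n x" for n x
  have h0: "0 \<le> h n x $ k" and h1: "h n x $ k \<le> 1" for n x k
  proof -
    show "0 \<le> h n x $ k" using z0[of n x k] Npos[of n] by (simp add: h_def)
    have "z n x $ k \<le> N n" using zN[of n x] component_le_norm_cart[of "z n x" k] by simp
    then show "h n x $ k \<le> 1" using Npos[of n] by (simp add: h_def)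
  qed
  have Us: "u x + (- N n) *\<^sub>R h n x = s n x" for n x
    using Npos[of n] by (simp add: h_def z_def)
  have Us': "u x $ k + (- N n) * h n x $ k = s n x $ k" for n x k
    using arg_cong[OF Us[of x n], of "\<lambda>v. v $ k"] by simp
  \<comment> \<open>The rescaled parameter gap; \<open>Ng\<close> bounds it by
    \<open>1 / g0\<close>.\<close>
  define t where "t n = (Ls - l n) / N n" for n
  have t: "0 \<le> t n" "t n \<le> 1 / g0" for n
    using Npos[of n] Ng[of n] l(2)[of n] g0 by (auto simp: t_def field_simps)
  have Dc: "continuous_on {0..1} (D (- N n) (h n) i)" for n i
  proof (rule D_continuous)
    show "nonneg_cont (\<lambda>x. u x + (- N n) *\<^sub>R h n x)" unfolding Us by (rule ms(1))
  qed (use Npos[of n] in simp)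
  have hK: "h n x $ i = Kop (\<lambda>y. D (- N n) (h n) i y + t n * (s n y $ i) powr (q - 1)) x" for n x i
  proof -
    have "h n x $ i = Kop (\<lambda>y. (1 / N n) * (Nl Ls u y $ i - Nl (l n) (s n) y $ i)) x"
      unfolding Kop_cmult Kz by (simp add: h_def)
    also have "(\<lambda>y. (1 / N n) * (Nl Ls u y $ i - Nl (l n) (s n) y $ i))
       = (\<lambda>y. D (- N n) (h n) i y + t n * (s n y $ i) powr (q - 1))"
    proof
      fix y
      show "(1 / N n) * (Nl Ls u y $ i - Nl (l n) (s n) y $ i)
       = D (- N n) (h n) i y + t n * (s n y $ i) powr (q - 1)"
        unfolding D_def Us Us' Nl_nth t_def using Npos[of n] by (simp add: field_simps)
    qed
    finally show ?thesis .
  qed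
  define M where "M = (lip b * real CARD('m) * 1 + Ls * (q - 1) * c0 powr (q - 2) * 1) + b powr (q - 1) / g0"
  have Db: "\<bar>D (- N n) (h n) i y\<bar> \<le> (lip b * real CARD('m) * 1 + Ls * (q - 1) * c0 powr (q - 2) * 1) * wt y"
    if "0 < y" "y < 1" for n i y
  proof (rule D_bound[OF that])
    show "c0 * bubble y \<le> u y $ k + - N n * h n y $ k" for k unfolding Us' using slow that by simp
    show "u y $ k + - N n * h n y $ k \<le> b" for k unfolding Us' using su[of n y k] b[of y k] by simp
  qed (use Npos[of n] h0 h1 in auto)
  have Mb: "\<bar>D (- N n) (h n) i y + t n * (s n y $ i) powr (q - 1)\<bar> \<le> M * wt y" if "0 < y" "y < 1" for n i y
  proof -
    have "(s n y $ i) powr (q - 1) \<le> b powr (q - 1)"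
      using su[of n y i] b[of y i] nonneg_contD(3)[OF ms(1)] q by (intro powr_mono2) auto
    then have "t n * (s n y $ i) powr (q - 1) \<le> 1 / g0 * b powr (q - 1)"
      using t[of n] g0 by (intro mult_mono) auto
    also have "\<dots> \<le> b powr (q - 1) / g0 * wt y"
      using mult_left_mono[OF wt_ge_1[OF that], of "b powr (q - 1) / g0"] g0 by simp
    finally have 1: "t n * (s n y $ i) powr (q - 1) \<le> b powr (q - 1) / g0 * wt y" .
    have "0 \<le> t n * (s n y $ i) powr (q - 1)" using t(1)[of n] by simp
    then show ?thesis using Db[OF that, of n i] 1 by (simp add: M_def distrib_right)
  qed
  have ip: "integrable I01 (\<lambda>y. D (- N n) (h n) i y + t n * (s n y $ i) powr (q - 1))" for n i
    by (intro integrable_I01_continuous continuous_on_add continuous_on_mult continuous_on_const Dc g_continuous ms(1))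
  have nh: "nonneg_cont (h n)" for n
  proof (rule nonneg_contI)
    show "continuous_on {0..1} (\<lambda>x. h n x $ k)" for k unfolding hK by (rule Kop_continuous[OF ip])
  qed (rule h0)
  have hout: "h n x $ k = 0" if "x \<notin> {0..1}" for n x k unfolding hK by (rule Kop_outside[OF that])
  have hL: "\<bar>h n x $ k - h n x' $ k\<bar> \<le> \<bar>x - x'\<bar> * (M * integral\<^sup>L I01 wt)" if "x \<in> {0..1}" "x' \<in> {0..1}" for n x x' k
  proof -
    have "\<bar>h n x $ k - h n x' $ k\<bar> \<le> \<bar>x - x'\<bar> * (\<integral>y. \<bar>D (- N n) (h n) k y + t n * (s n y $ k) powr (q - 1)\<bar> \<partial>I01)"
      unfolding hK[of n x] hK[of n x'] by (rule Kop_lipschitz[OF ip that])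
    also have "(\<integral>y. \<bar>D (- N n) (h n) k y + t n * (s n y $ k) powr (q - 1)\<bar> \<partial>I01) \<le> (\<integral>y. M * wt y \<partial>I01)"
      by (intro integral_mono_AE AE_I01_I Mb integrable_abs ip integrable_mult_right wt_integrable)
    then have "\<bar>x - x'\<bar> * (\<integral>y. \<bar>D (- N n) (h n) k y + t n * (s n y $ k) powr (q - 1)\<bar> \<partial>I01) \<le> \<bar>x - x'\<bar> * (M * integral\<^sup>L I01 wt)"
      by (intro mult_left_mono) auto
    finally show ?thesis .
  qed
  obtain r w where rw: "strict_mono r" "nonneg_cont w" "\<And>x k. x \<notin> {0..1} \<Longrightarrow> w x $ k = 0"
    "\<And>x k. (\<lambda>n. h (r n) x $ k) \<longlonglongrightarrow> w x $ k"
    "\<And>e. e > 0 \<Longrightarrow> \<exists>N. \<forall>n\<ge>N. \<forall>x k. \<bar>h (r n) x $ k - w x $ k\<bar> < e"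
    by (rule lipschitz_compactness[of h 1 "M * integral\<^sup>L I01 wt", OF nh hout h1 hL]) (assumption | rule that)+
  have w1: "w x $ k \<le> 1" for x k by (rule LIMSEQ_le_const2[OF rw(4)]) (use h1 in auto)
  \<comment> \<open>A vector of norm 1 has a component of size at least 1 over the
    dimension.\<close>
  have big: "\<exists>x k. 1 / real CARD('m) \<le> h n x $ k" for n
  proof (rule ccontr)
    assume "\<not> (\<exists>x k. 1 / real CARD('m) \<le> h n x $ k)"
    then have less: "h n (X n) $ k < 1 / real CARD('m)" for k by (auto simp: not_le)
    have "1 = norm (h n (X n))" using Npos[of n] by (simp add: h_def N_def)
    also have "\<dots> \<le> (\<Sum>k\<in>UNIV. \<bar>h n (X n) $ k\<bar>)" by (rule norm_le_l1_cart)
    also have "\<dots> < (\<Sum>k\<in>(UNIV::'m set). 1 / real CARD('m))" using less h0 by (intro sum_strict_mono) auto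
    also have "\<dots> = 1" by simp
    finally show False by simp
  qed
  obtain x0 j where nz: "0 < w x0 $ j"
    by (rule uniform_limit_nonzero[OF rw(5) big]) auto
  have super: "Lin A w x $ i \<le> w x $ i" for x i
  proof (rule LIMSEQ_le[OF _ rw(4)])
    show "(\<lambda>n. Kop (D (- N (r n)) (h (r n)) i) x) \<longlonglongrightarrow> Lin A w x $ i"
    proof (rule row_tendsto_Kop[where hb = 1 and b' = b])
      show "(\<lambda>n. - N (r n)) \<longlonglongrightarrow> 0"
        using tendsto_minus[OF LIMSEQ_subseq_LIMSEQ[OF Nlim rw(1)]] by (simp add: comp_def)
      show "nonneg_cont (\<lambda>x. u x + - N (r n) *\<^sub>R h (r n) x)" for n unfolding Us by (rule ms(1))
      show "c0 * bubble x \<le> u x $ k + - N (r n) * h (r n) x $ k" if "x \<in> {0..1}" for n x k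
        unfolding Us' by (rule slow[OF that])
      show "u x $ k + - N (r n) * h (r n) x $ k \<le> b" for n x k
        unfolding Us' using su[of "r n" x k] b[of x k] by simp
      show "- N (r n) \<noteq> 0" for n using Npos[of "r n"] by simp
      show "\<bar>h (r n) x $ k\<bar> \<le> 1" for n x k using h0[of "r n" x k] h1[of "r n" x k] by simp
    qed (use rw in auto)
    \<comment> \<open>Here the nonnegative gap term is dropped.\<close>
    have "Kop (D (- N n) (h n) i) x \<le> h n x $ i" for n
      unfolding hK[of n x i] using t(1) by (intro Kop_mono integrable_I01_continuous Dc ip) auto
    then show "\<exists>Na. \<forall>n\<ge>Na. Kop (D (- N (r n)) (h (r n)) i) x \<le> h (r n) x $ i" by blast
  qed
  obtain c where c: "0 < c" "\<And>x k. x \<in> {0..1} \<Longrightarrow> c * bubble x \<le> w x $ k"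
    by (rule supersolution_positive[OF rw(2) w1 rw(3) nz super]) (assumption | rule that)+
  show thesis by (rule that[OF rw(2) w1 c super])
qed

text \<open>If all iterates stayed within \<open>\<rho>\<close> of \<open>u\<close>, their limit would be a solution beyond \<open>Ls\<close>; the
  last iterate before the first escape is the one sought.\<close>

lemma escaping_iterate:
  assumes \<rho>: "0 < \<rho>"
  obtains a where "nonneg_cont a" "\<And>x k. u x $ k \<le> a x $ k" "\<And>x k. a x $ k \<le> u x $ k + \<rho>"
    "\<And>x k. a x $ k \<le> step (Ls + \<rho>\<^sup>2) a x $ k" "\<exists>x k. u x $ k + \<rho> \<le> step (Ls + \<rho>\<^sup>2) a x $ k"
proof -
  define lam where "lam = Ls + \<rho>\<^sup>2"
  have lam: "0 < lam" "Ls < lam" "0 \<le> lam" using Ls_pos \<rho> by (auto simp: lam_def add_pos_pos)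
  have sub: "u x $ k \<le> step lam u x $ k" for x k
    using step_mono[OF nu nu order_refl less_imp_le[OF Ls_pos] less_imp_le[OF lam(2)], of x k] by (simp only: fix_u)
  have inc: "incseq (\<lambda>n. iter lam u n x $ k)" for x k
    by (intro incseq_SucI iter_mono_Suc[OF nu lam(3) sub])
  have ge: "u x $ k \<le> iter lam u n x $ k" for n x k
    using incseqD[OF inc[of x k], of 0 n] by simp
  have "\<exists>j x k. u x $ k + \<rho> < iter lam u j x $ k"
  proof (rule ccontr)
    assume "\<not> (\<exists>j x k. u x $ k + \<rho> < iter lam u j x $ k)"
    then have "iter lam u j x $ k \<le> b + \<rho>" for j x k using b[of x k] by (meson add_right_mono not_le order_trans)
    then obtain v where v: "nonneg_cont v" "step lam v = v" "\<And>n x k. iter lam u n x $ k \<le> v x $ k"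
      by (rule iter_limit[OF nu lam(3) sub]) (assumption | rule that)+
    have "0 < v x $ k" if "0 < x" "x < 1" for x k
      using u_pos[OF that, of k] v(3)[of 0 x k] by simp
    then have "pos_super lam v" unfolding pos_super_def v(2) using v(1) by blast
    then have "lam \<le> Ls" using lam(1) by (intro Lam_le_Ls) (auto simp: Lam_def)
    then show False using lam(2) by simp
  qed
  then have ex: "\<exists>j. \<exists>x k. u x $ k + \<rho> < iter lam u j x $ k" .
  define j where "j = (LEAST j. \<exists>x k. u x $ k + \<rho> < iter lam u j x $ k)"
  have j: "\<exists>x k. u x $ k + \<rho> < iter lam u j x $ k" unfolding j_def by (rule LeastI_ex[OF ex])
  have nj: "iter lam u i x $ k \<le> u x $ k + \<rho>" if "i < j" for i x k
    using not_less_Least[OF that[unfolded j_def]] by (auto simp: not_less)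
  have "j \<noteq> 0" using j \<rho> by (metis add_less_same_cancel1 iter_simps(1) less_asym)
  then obtain i where i: "j = Suc i" by (cases j) auto
  show thesis
  proof (rule that)
    show "nonneg_cont (iter lam u i)" by (rule iter_nonneg_cont[OF nu lam(3)])
    show "u x $ k \<le> iter lam u i x $ k" for x k by (rule ge)
    show "iter lam u i x $ k \<le> u x $ k + \<rho>" for x k by (rule nj) (simp add: i)
    show "iter lam u i x $ k \<le> step (Ls + \<rho>\<^sup>2) (iter lam u i) x $ k" for x k
      using iter_mono_Suc[OF nu lam(3) sub, of i x k] by (simp add: lam_def)
    show "\<exists>x k. u x $ k + \<rho> \<le> step (Ls + \<rho>\<^sup>2) (iter lam u i) x $ k"
      using j unfolding i iter_simps lam_def[symmetric] by (auto intro: less_imp_le)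
  qed
qed

text \<open>The excess \<open>\<rho>\<^sup>2\<close> of the parameter disappears when the distance to \<open>u\<close>, of order \<open>\<rho>\<close>, is
  rescaled to unit size.\<close>

lemma linear_subsolution:
  obtains w wb x0 k0 where "nonneg_cont w" "\<And>x k. w x $ k \<le> wb" "0 < w x0 $ k0"
    "\<And>x k. w x $ k \<le> Lin A w x $ k"
proof -
  define \<rho> where "\<rho> n = 1 / (real n + 1)" for n
  have \<rho>: "0 < \<rho> n" "\<rho> n \<le> 1" for n by (auto simp: \<rho>_def)
  have \<rho>l: "\<rho> \<longlonglongrightarrow> 0" unfolding \<rho>_def by real_asymp
  define P where "P n a \<longleftrightarrow> nonneg_cont a \<and> (\<forall>x k. u x $ k \<le> a x $ k) \<and> (\<forall>x k. a x $ k \<le> u x $ k + \<rho> n) \<and>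
    (\<forall>x k. a x $ k \<le> step (Ls + (\<rho> n)\<^sup>2) a x $ k) \<and> (\<exists>x k. u x $ k + \<rho> n \<le> step (Ls + (\<rho> n)\<^sup>2) a x $ k)" for n a
  have "\<exists>a. P n a" for n
  proof -
    obtain a where "nonneg_cont a" "\<And>x k. u x $ k \<le> a x $ k" "\<And>x k. a x $ k \<le> u x $ k + \<rho> n"
      "\<And>x k. a x $ k \<le> step (Ls + (\<rho> n)\<^sup>2) a x $ k" "\<exists>x k. u x $ k + \<rho> n \<le> step (Ls + (\<rho> n)\<^sup>2) a x $ k"
      by (rule escaping_iterate[OF \<rho>(1)]) (rule that)
    then show ?thesis unfolding P_def by blast
  qed
  then obtain a where "\<And>n. P n (a n)" by metis
  then have na: "\<And>n. nonneg_cont (a n)" and ua: "\<And>n x k. u x $ k \<le> a n x $ k"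
    and a\<rho>: "\<And>n x k. a n x $ k \<le> u x $ k + \<rho> n" and astep: "\<And>n x k. a n x $ k \<le> step (Ls + (\<rho> n)\<^sup>2) (a n) x $ k"
    and esc: "\<And>n. \<exists>x k. u x $ k + \<rho> n \<le> step (Ls + (\<rho> n)\<^sup>2) (a n) x $ k"
    unfolding P_def by blast+
  \<comment> \<open>\<open>a n\<close> is an iterate still within \<open>\<rho> n\<close> of
    \<open>u\<close>, and \<open>c n\<close> is its successor, which reaches that distance
    somewhere.\<close>
  define c where "c n = step (Ls + (\<rho> n)\<^sup>2) (a n)" for n
  have Lp: "0 \<le> Ls + (\<rho> n)\<^sup>2" for n using Ls_pos by (simp add: add_nonneg_nonneg)
  have nc: "nonneg_cont (c n)" for n unfolding c_def by (rule step_nonneg_cont[OF na Lp])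
  have ac: "a n x $ k \<le> c n x $ k" for n x k unfolding c_def by (rule astep)
  \<comment> \<open>The two rescalings share the work: \<open>y\<close> is at most 1, which bounds
    the source of \<open>h\<close>, while \<open>h\<close> is at least 1 somewhere, which keeps the
    limit nonzero.\<close>
  define y where "y n x = (1 / \<rho> n) *\<^sub>R (a n x - u x)" for n x
  define h where "h n x = (1 / \<rho> n) *\<^sub>R (c n x - u x)" for n x
  have Uy: "u x + \<rho> n *\<^sub>R y n x = a n x" and Uh: "u x + \<rho> n *\<^sub>R h n x = c n x" for n x
    using \<rho>(1)[of n] by (simp_all add: y_def h_def)
  have Uy': "u x $ k + \<rho> n * y n x $ k = a n x $ k" and Uh': "u x $ k + \<rho> n * h n x $ k = c n x $ k" for n x k
    using arg_cong[OF Uy[of x n], of "\<lambda>v. v $ k"] arg_cong[OF Uh[of x n], of "\<lambda>v. v $ k"] by simp_all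
  have y0: "0 \<le> y n x $ k" "y n x $ k \<le> 1" for n x k
    using ua[of x k n] a\<rho>[of n x k] \<rho>(1)[of n] by (auto simp: y_def field_simps)
  have yh: "y n x $ k \<le> h n x $ k" for n x k
    using ac[of n x k] \<rho>(1)[of n] by (simp add: y_def h_def divide_right_mono)
  have ab: "a n x $ k \<le> b + 1" for n x k using a\<rho>[of n x k] b[of x k] \<rho>(2)[of n] by simp
  have Dc: "continuous_on {0..1} (D (\<rho> n) (y n) i)" for n i
    by (rule D_continuous) (use na Uy \<rho>(1)[of n] in auto)
  have Dch: "continuous_on {0..1} (D (\<rho> n) (h n) i)" for n i
    by (rule D_continuous) (use nc Uh \<rho>(1)[of n] in auto)
  have hK: "h n x $ i = Kop (\<lambda>s. D (\<rho> n) (y n) i s + \<rho> n * (a n s $ i) powr (q - 1)) x" for n x i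
  proof -
    have "c n x $ i - u x $ i = Kop (\<lambda>s. Nl (Ls + (\<rho> n)\<^sup>2) (a n) s $ i - Nl Ls u s $ i) x"
      unfolding Kop_diff[OF Nl_integrable[OF na] Nl_integrable[OF nu]] Kop_minsol[OF fix_u] c_def step_nth ..
    then have "h n x $ i = Kop (\<lambda>s. (1 / \<rho> n) * (Nl (Ls + (\<rho> n)\<^sup>2) (a n) s $ i - Nl Ls u s $ i)) x"
      unfolding Kop_cmult by (simp add: h_def del: Nl_nth)
    also have "(\<lambda>s. (1 / \<rho> n) * (Nl (Ls + (\<rho> n)\<^sup>2) (a n) s $ i - Nl Ls u s $ i))
       = (\<lambda>s. D (\<rho> n) (y n) i s + \<rho> n * (a n s $ i) powr (q - 1))"
    proof
      fix s
      show "(1 / \<rho> n) * (Nl (Ls + (\<rho> n)\<^sup>2) (a n) s $ i - Nl Ls u s $ i)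
       = D (\<rho> n) (y n) i s + \<rho> n * (a n s $ i) powr (q - 1)"
        unfolding D_def Uy Uy' Nl_nth using \<rho>(1)[of n] by (simp add: field_simps power2_eq_square)
    qed
    finally show ?thesis .
  qed
  define M where "M = (lip (b + 1) * real CARD('m) * 1 + Ls * (q - 1) * c0 powr (q - 2) * 1) + (b + 1) powr (q - 1)"
  have Db: "\<bar>D (\<rho> n) (y n) i s\<bar> \<le> (lip (b + 1) * real CARD('m) * 1 + Ls * (q - 1) * c0 powr (q - 2) * 1) * wt s"
    if "0 < s" "s < 1" for n i s
  proof (rule D_bound[OF that])
    show "c0 * bubble s \<le> u s $ k + \<rho> n * y n s $ k" for k
      unfolding Uy' using u_ge[of s k] ua[of s k n] that by simp
    show "u s $ k + \<rho> n * y n s $ k \<le> b + 1" for k unfolding Uy' by (rule ab)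
  qed (use \<rho>(1)[of n] y0 in auto)
  have ga: "0 \<le> (a n s $ i) powr (q - 1)" "(a n s $ i) powr (q - 1) \<le> (b + 1) powr (q - 1)" for n s i
    using ab[of n s i] nonneg_contD(3)[OF na] q by (auto intro: powr_mono2)
  have Mb: "\<bar>D (\<rho> n) (y n) i s + \<rho> n * (a n s $ i) powr (q - 1)\<bar> \<le> M * wt s" if "0 < s" "s < 1" for n i s
  proof -
    have "\<rho> n * (a n s $ i) powr (q - 1) \<le> 1 * (b + 1) powr (q - 1)"
      using \<rho>[of n] ga by (intro mult_mono) auto
    also have "\<dots> \<le> (b + 1) powr (q - 1) * wt s"
      using mult_left_mono[OF wt_ge_1[OF that], of "(b + 1) powr (q - 1)"] by simp
    finally have 1: "\<rho> n * (a n s $ i) powr (q - 1) \<le> (b + 1) powr (q - 1) * wt s" .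
    have "0 \<le> \<rho> n * (a n s $ i) powr (q - 1)" using \<rho>(1)[of n] by simp
    then show ?thesis using Db[OF that, of n i] 1 by (simp add: M_def distrib_right)
  qed
  have ip: "integrable I01 (\<lambda>s. D (\<rho> n) (y n) i s + \<rho> n * (a n s $ i) powr (q - 1))" for n i
    by (intro integrable_I01_continuous continuous_on_add continuous_on_mult continuous_on_const Dc g_continuous na)
  define B where "B = M * integral\<^sup>L I01 wt"
  have iM: "(\<integral>s. \<bar>D (\<rho> n) (y n) k s + \<rho> n * (a n s $ k) powr (q - 1)\<bar> \<partial>I01) \<le> B" for n k
  proof -
    have "(\<integral>s. \<bar>D (\<rho> n) (y n) k s + \<rho> n * (a n s $ k) powr (q - 1)\<bar> \<partial>I01) \<le> (\<integral>s. M * wt s \<partial>I01)"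
      by (intro integral_mono_AE AE_I01_I Mb integrable_abs ip integrable_mult_right wt_integrable)
    then show ?thesis by (simp add: B_def)
  qed
  have h0: "0 \<le> h n x $ k" for n x k using y0(1)[of n x k] yh[of n x k] by simp
  have hout: "h n x $ k = 0" if "x \<notin> {0..1}" for n x k unfolding hK by (rule Kop_outside[OF that])
  have B0: "0 \<le> B" by (rule order_trans[OF integral_nonneg_AE iM[of 0 undefined]]) simp
  have h1: "h n x $ k \<le> B" for n x k
  proof (cases "x \<in> {0..1}")
    case True
    have "\<bar>h n x $ k\<bar> \<le> B" unfolding hK by (rule order_trans[OF Kop_abs_le(3)[OF ip True] iM])
    then show ?thesis by simp
  next
    case False
    then show ?thesis using hout[OF False, of n k] B0 by simp
  qed
  have nh: "nonneg_cont (h n)" for n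
  proof (rule nonneg_contI)
    show "continuous_on {0..1} (\<lambda>x. h n x $ k)" for k unfolding hK by (rule Kop_continuous[OF ip])
  qed (rule h0)
  have hL: "\<bar>h n x $ k - h n x' $ k\<bar> \<le> \<bar>x - x'\<bar> * B" if "x \<in> {0..1}" "x' \<in> {0..1}" for n x x' k
    unfolding hK[of n x] hK[of n x']
    by (rule order_trans[OF Kop_lipschitz[OF ip that] mult_left_mono[OF iM]]) simp
  obtain r w where rw: "strict_mono r" "nonneg_cont w" "\<And>x k. x \<notin> {0..1} \<Longrightarrow> w x $ k = 0"
    "\<And>x k. (\<lambda>n. h (r n) x $ k) \<longlonglongrightarrow> w x $ k"
    "\<And>e. e > 0 \<Longrightarrow> \<exists>N. \<forall>n\<ge>N. \<forall>x k. \<bar>h (r n) x $ k - w x $ k\<bar> < e"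
    by (rule lipschitz_compactness[of h B B, OF nh hout h1 hL]) (assumption | rule that)+
  have wB: "w x $ k \<le> B" for x k by (rule LIMSEQ_le_const2[OF rw(4)]) (use h1 in auto)
  have big: "\<exists>x k. 1 \<le> h n x $ k" for n
  proof -
    obtain x k where "u x $ k + \<rho> n \<le> c n x $ k" using esc[of n] unfolding c_def by blast
    then have "1 \<le> h n x $ k" using \<rho>(1)[of n] by (simp add: h_def field_simps)
    then show ?thesis by blast
  qed
  obtain x0 j where nz: "0 < w x0 $ j"
    by (rule uniform_limit_nonzero[OF rw(5) big]) auto
  have \<rho>r: "(\<lambda>n. \<rho> (r n)) \<longlonglongrightarrow> 0"
    using LIMSEQ_subseq_LIMSEQ[OF \<rho>l rw(1)] by (simp add: comp_def)
  have sub: "w x $ i \<le> Lin A w x $ i" for x i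
  proof (rule LIMSEQ_le[OF rw(4)])
    define K1 where "K1 = Kop (\<lambda>_. (b + 1) powr (q - 1)) x"
    have "(\<lambda>n. Kop (D (\<rho> (r n)) (h (r n)) i) x) \<longlonglongrightarrow> Lin A w x $ i"
    proof (rule row_tendsto_Kop[where hb = B and b' = "b + B"])
      show "(\<lambda>n. \<rho> (r n)) \<longlonglongrightarrow> 0" by (rule \<rho>r)
      show "nonneg_cont (\<lambda>x. u x + \<rho> (r n) *\<^sub>R h (r n) x)" for n unfolding Uh by (rule nc)
      show "c0 * bubble x \<le> u x $ k + \<rho> (r n) * h (r n) x $ k" if "x \<in> {0..1}" for n x k
        using u_ge[OF that, of k] \<rho>(1)[of "r n"] h0[of "r n" x k] by (simp add: add_increasing2)
      show "u x $ k + \<rho> (r n) * h (r n) x $ k \<le> b + B" for n x k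
      proof -
        have "\<rho> (r n) * h (r n) x $ k \<le> 1 * B"
          using \<rho>[of "r n"] h0[of "r n" x k] h1[of "r n" x k] by (intro mult_mono) auto
        then show ?thesis using b[of x k] by simp
      qed
      show "\<rho> (r n) \<noteq> 0" for n using \<rho>(1)[of "r n"] by simp
      show "\<bar>h (r n) x $ k\<bar> \<le> B" for n x k using h0[of "r n" x k] h1[of "r n" x k] by simp
    qed (use rw B0 in auto)
    then have "(\<lambda>n. Kop (D (\<rho> (r n)) (h (r n)) i) x + \<rho> (r n) * K1) \<longlonglongrightarrow> Lin A w x $ i + 0 * K1"
      by (intro tendsto_add tendsto_mult \<rho>r tendsto_const)
    then show "(\<lambda>n. Kop (D (\<rho> (r n)) (h (r n)) i) x + \<rho> (r n) * K1) \<longlonglongrightarrow> Lin A w x $ i" by simp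
    have "h n x $ i \<le> Kop (D (\<rho> n) (h n) i) x + \<rho> n * K1" for n
    proof -
      have "h n x $ i \<le> Kop (\<lambda>s. D (\<rho> n) (h n) i s + \<rho> n * (b + 1) powr (q - 1)) x"
        unfolding hK[of n x i]
      proof (rule Kop_mono[OF ip])
        show "integrable I01 (\<lambda>s. D (\<rho> n) (h n) i s + \<rho> n * (b + 1) powr (q - 1))"
          by (intro integrable_I01_continuous continuous_on_add continuous_on_const Dch)
        fix s :: real assume s: "0 < s" "s < 1"
        \<comment> \<open>Since \<open>y \<le> h\<close>, monotonicity replaces \<open>y\<close> by
          \<open>h\<close>; the relation between the two becomes a subsolution inequality for
          \<open>h\<close> alone.\<close>
        have "D (\<rho> n) (y n) i s \<le> D (\<rho> n) (h n) i s"
          using s \<rho>(1)[of n] yh nonneg_contD(3)[OF na] by (intro D_mono) (auto simp: Uy')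
        moreover have "\<rho> n * (a n s $ i) powr (q - 1) \<le> \<rho> n * (b + 1) powr (q - 1)"
          using \<rho>(1)[of n] ga by (intro mult_left_mono) auto
        ultimately show "D (\<rho> n) (y n) i s + \<rho> n * (a n s $ i) powr (q - 1) \<le> D (\<rho> n) (h n) i s + \<rho> n * (b + 1) powr (q - 1)"
          by (rule add_mono)
      qed
      also have "\<dots> = Kop (D (\<rho> n) (h n) i) x + Kop (\<lambda>s. \<rho> n * (b + 1) powr (q - 1)) x"
        by (intro Kop_add integrable_I01_continuous Dch continuous_on_const)
      also have "Kop (\<lambda>s. \<rho> n * (b + 1) powr (q - 1)) x = \<rho> n * K1" unfolding K1_def by (rule Kop_cmult)
      finally show ?thesis .
    qed
    then show "\<exists>N. \<forall>n\<ge>N. h (r n) x $ i \<le> Kop (D (\<rho> (r n)) (h (r n)) i) x + \<rho> (r n) * K1" by blast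
  qed
  show thesis by (rule that[OF rw(2) wB nz sub])
qed

section \<open>Duality and the fixed vector of the adjoint\<close>

definition Bf where
  "Bf v w = (\<Sum>i\<in>UNIV. \<Sum>j\<in>UNIV. \<integral>x. A i j x * w x $ j * v x $ i \<partial>I01)"

definition bdd_cont :: "(real \<Rightarrow> (real, 'm) vec) \<Rightarrow> bool" where
  "bdd_cont w \<longleftrightarrow> nonneg_cont w \<and> (\<exists>wb. \<forall>x k. w x $ k \<le> wb)"

lemma bdd_contI: "nonneg_cont w \<Longrightarrow> (\<And>x k. w x $ k \<le> wb) \<Longrightarrow> bdd_cont w"
  by (auto simp: bdd_cont_def)

lemma bdd_cont_Lin:
  assumes a: "admissible a" and w: "bdd_cont w"
  shows "bdd_cont (Lin a w)"
proof -
  obtain wb where wb: "nonneg_cont w" "\<And>x k. w x $ k \<le> wb" using w by (auto simp: bdd_cont_def)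
  have n: "nonneg_cont (Lin a w)" by (rule Lin_nonneg_cont[OF a wb])
  obtain c where c: "0 \<le> c" "\<And>x k. Lin a w x $ k \<le> c"
    by (rule nonneg_cont_bounded[OF n]) (simp_all add: Lin_outside)
  show ?thesis by (rule bdd_contI[OF n c(2)])
qed

lemma Bf_integrable:
  assumes v: "bdd_cont v" and w: "bdd_cont w" and a: "admissible a"
  shows "integrable I01 (\<lambda>x. a i j x * w x $ j * v x $ k)"
proof -
  obtain wb where wb: "nonneg_cont w" "\<And>x k. w x $ k \<le> wb" using w by (auto simp: bdd_cont_def)
  obtain vb where vb: "nonneg_cont v" "\<And>x k. v x $ k \<le> vb" using v by (auto simp: bdd_cont_def)
  have i: "integrable I01 (\<lambda>x. a i j x * w x $ j)" by (rule Lin_integrable'(2)[OF a wb])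
  show ?thesis
  proof (rule Bochner_Integration.integrable_bound[OF integrable_mult_right[OF i, of vb]])
    show "(\<lambda>x. a i j x * w x $ j * v x $ k) \<in> borel_measurable I01"
      using i by (intro borel_measurable_times[OF _ continuous_measurable_I01'[OF nonneg_contD(2)[OF vb(1)]]]) auto
    show "AE x in I01. norm (a i j x * w x $ j * v x $ k) \<le> norm (vb * (a i j x * w x $ j))"
    proof (rule AE_I2)
      fix x
      have "\<bar>v x $ k\<bar> \<le> \<bar>vb\<bar>" using vb(2)[of x k] nonneg_contD(3)[OF vb(1), of x k] by simp
      then have "\<bar>a i j x * w x $ j\<bar> * \<bar>v x $ k\<bar> \<le> \<bar>a i j x * w x $ j\<bar> * \<bar>vb\<bar>" by (rule mult_left_mono) simp
      then show "norm (a i j x * w x $ j * v x $ k) \<le> norm (vb * (a i j x * w x $ j))"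
        unfolding real_norm_def abs_mult by (simp add: mult_ac)
    qed
  qed
qed

lemma adm: "admissible A" "admissible AT"
  by (auto simp: admissible_def)

lemma Bf_mono:
  assumes v: "bdd_cont v" "bdd_cont v'" and w: "bdd_cont w" "bdd_cont w'"
    and le: "\<And>x k. v x $ k \<le> v' x $ k" "\<And>x k. w x $ k \<le> w' x $ k"
  shows "Bf v w \<le> Bf v' w'"
  unfolding Bf_def
proof (intro sum_mono integral_mono_AE AE_I01_I Bf_integrable adm v w)
  fix i j and x :: real assume x: "0 < x" "x < 1"
  have "0 \<le> v x $ i" "0 \<le> w x $ j" "0 \<le> w' x $ j" using v w by (auto simp: bdd_cont_def nonneg_cont_def)
  then show "A i j x * w x $ j * v x $ i \<le> A i j x * w' x $ j * v' x $ i"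
    using le A_bound(1)[OF x] by (intro mult_mono mult_nonneg_nonneg) auto
qed

text \<open>In the plain L2 pairing the adjoint of \<open>Lin A\<close> would apply the matrix after
  \<open>Kop\<close>. The weight \<open>A\<close> inside \<open>Bf\<close> places \<open>Kop\<close>
  between the two matrix factors, so that its symmetry exchanges \<open>Lin A\<close> with
  \<open>Lin AT\<close>.\<close>

lemma Bf_dual:
  assumes v: "bdd_cont v" and w: "bdd_cont w"
  shows "Bf (Lin AT v) w = Bf v (Lin A w)"
proof -
  obtain wb where wb: "nonneg_cont w" "\<And>x k. w x $ k \<le> wb" using w by (auto simp: bdd_cont_def)
  obtain vb where vb: "nonneg_cont v" "\<And>x k. v x $ k \<le> vb" using v by (auto simp: bdd_cont_def)
  note iw = Lin_integrable'(1)[OF adm(1) wb] and iv = Lin_integrable'(1)[OF adm(2) vb]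
  have "Bf (Lin AT v) w = (\<Sum>i\<in>UNIV. \<integral>x. (\<Sum>j\<in>UNIV. A i j x * w x $ j) * Lin AT v x $ i \<partial>I01)"
    unfolding Bf_def sum_distrib_right
    by (intro sum.cong refl Bochner_Integration.integral_sum[symmetric] Bf_integrable adm w bdd_cont_Lin v)
  also have "\<dots> = (\<Sum>i\<in>UNIV. \<integral>x. (\<Sum>j\<in>UNIV. AT i j x * v x $ j) * Lin A w x $ i \<partial>I01)"
    unfolding Lin_nth by (intro sum.cong refl Kop_symmetric iw iv)
  also have "\<dots> = (\<Sum>i\<in>UNIV. \<Sum>j\<in>UNIV. \<integral>x. AT i j x * v x $ j * Lin A w x $ i \<partial>I01)"
    unfolding sum_distrib_right
    by (intro sum.cong refl Bochner_Integration.integral_sum Bf_integrable adm w bdd_cont_Lin v)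
  also have "\<dots> = (\<Sum>j\<in>UNIV. \<Sum>i\<in>UNIV. \<integral>x. AT i j x * v x $ j * Lin A w x $ i \<partial>I01)"
    by (rule sum.swap)
  also have "\<dots> = Bf v (Lin A w)" unfolding Bf_def AT_def by (simp add: mult_ac)
  finally show ?thesis .
qed

text \<open>Paired with the supersolution \<open>w1\<close>, the powers of the adjoint applied to \<open>bubble\<close> do not grow;
  paired with the subsolution \<open>w2\<close>, they do not decay.\<close>

lemma adjoint_solution:
  obtains v vb where "nonneg_cont v" "\<And>x k. v x $ k \<le> vb" "\<exists>x k. 0 < v x $ k" "Lin AT v = v"
proof -
  obtain w1 c where w1: "nonneg_cont w1" "\<And>x k. w1 x $ k \<le> 1" and c: "0 < c"
    "\<And>x k. x \<in> {0..1} \<Longrightarrow> c * bubble x \<le> w1 x $ k" and super: "\<And>x k. Lin A w1 x $ k \<le> w1 x $ k"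
    by (rule linear_supersolution) (rule that)
  obtain w2 wb x0 k0 where w2: "nonneg_cont w2" "\<And>x k. w2 x $ k \<le> wb" and w2p: "0 < w2 x0 $ k0"
    and sub: "\<And>x k. w2 x $ k \<le> Lin A w2 x $ k"
    by (rule linear_subsolution) (rule that)
  have bw1: "bdd_cont w1" and bw2: "bdd_cont w2" by (rule bdd_contI[OF w1], rule bdd_contI[OF w2])
  \<comment> \<open>A Lipschitz start, positive in every component inside the interval, hence with
    positive pairing against \<open>w2\<close>.\<close>
  define v0 where "v0 x = (\<chi> k::'m. if x \<in> {0..1} then bubble x else 0)" for x
  have v0k: "v0 x $ k = (if x \<in> {0..1} then bubble x else 0)" for x k by (simp add: v0_def)
  have b1: "bubble x \<le> 1" if "x \<in> {0..1}" for x using that by (auto intro: mult_le_one)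
  have nv0: "nonneg_cont v0"
  proof (rule nonneg_contI)
    fix k
    show "continuous_on {0..1} (\<lambda>x. v0 x $ k)"
      by (rule continuous_on_eq[of _ bubble]) (auto simp: v0k intro!: continuous_intros)
  qed (auto simp: v0k)
  have v01: "v0 x $ k \<le> 1" for x k using b1[of x] by (simp add: v0k)
  define T where "T = Lin AT"
  define v where "v n = (T ^^ n) v0" for n
  have v0': "v 0 = v0" and vS: "v (Suc n) = Lin AT (v n)" for n by (simp_all add: v_def T_def)
  have bv: "bdd_cont (v n)" for n
  proof (induction n)
    case 0 show ?case unfolding v0' by (rule bdd_contI[OF nv0 v01])
  next
    case (Suc n) then show ?case unfolding vS by (rule bdd_cont_Lin[OF adm(2)])
  qed
  have nv: "nonneg_cont (v n)" for n using bv[of n] by (simp add: bdd_cont_def)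
  define \<beta> where "\<beta> = Bf v0 w1"
  have up: "Bf (v n) w1 \<le> \<beta>" for n
  proof (induction n)
    case (Suc n)
    have "Bf (v (Suc n)) w1 = Bf (v n) (Lin A w1)" unfolding vS by (rule Bf_dual[OF bv bw1])
    also have "\<dots> \<le> Bf (v n) w1"
      by (intro Bf_mono bv bdd_cont_Lin adm bw1 super order_refl)
    finally show ?case using Suc by simp
  qed (simp add: \<beta>_def v0')
  have low: "Bf v0 w2 \<le> Bf (v n) w2" for n
  proof (induction n)
    case (Suc n)
    have "Bf (v n) w2 \<le> Bf (v n) (Lin A w2)"
      by (intro Bf_mono bv bdd_cont_Lin adm bw2 sub order_refl)
    also have "\<dots> = Bf (v (Suc n)) w2" unfolding vS by (rule Bf_dual[OF bv bw2, symmetric])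
    finally show ?case using Suc by simp
  qed (simp add: v0')
  have low0: "0 < Bf v0 w2"
  proof -
    have nn: "0 \<le> A i j x * w2 x $ j * v0 x $ i" if "0 < x" "x < 1" for i j x
      using A_bound(1)[OF that] nonneg_contD(3)[OF w2(1)] nonneg_contD(3)[OF nv0] by simp
    have x0: "x0 \<in> {0..1}"
    proof (rule ccontr)
      assume "x0 \<notin> {0..1}"
      from Lin_outside[OF this, of A w2 k0] sub[of x0 k0] w2p show False by simp
    qed
    obtain a e where ae: "0 \<le> a" "a < e" "e \<le> 1" "\<And>y. y \<in> {a<..<e} \<Longrightarrow> 0 < w2 y $ k0"
      by (rule continuous_pos_interval[OF nonneg_contD(2)[OF w2(1)] x0 w2p]) auto
    have bv0: "bdd_cont v0" using bv[of 0] by (simp add: v0')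
    have "0 < (\<integral>x. A k0 k0 x * w2 x $ k0 * v0 x $ k0 \<partial>I01)"
    proof (rule integral_I01_pos[OF Bf_integrable[OF bv0 bw2 adm(1)] _ ae(1-3)])
      show "AE x in I01. 0 \<le> A k0 k0 x * w2 x $ k0 * v0 x $ k0" by (rule AE_I01_I) (rule nn)
      have "AE x in I01. 0 < x \<and> x < 1" by (rule AE_I01_I) auto
      with A_pos[of k0 k0] show "AE x in I01. x \<in> {a<..<e} \<longrightarrow> 0 < A k0 k0 x * w2 x $ k0 * v0 x $ k0"
        by eventually_elim (use ae(4) in \<open>auto simp: v0k\<close>)
    qed
    also have "\<dots> \<le> (\<Sum>j\<in>UNIV. \<integral>x. A k0 j x * w2 x $ j * v0 x $ k0 \<partial>I01)"
      using nn by (intro member_le_sum integral_nonneg_AE AE_I01_I) auto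
    also have "\<dots> \<le> Bf v0 w2" unfolding Bf_def
      using nn by (intro member_le_sum[where f = "\<lambda>i. \<Sum>j\<in>UNIV. \<integral>x. A i j x * w2 x $ j * v0 x $ i \<partial>I01"] sum_nonneg integral_nonneg_AE AE_I01_I) auto
    finally show ?thesis .
  qed
  \<comment> \<open>The 1 covers the start \<open>v0\<close>, the quotient covers all later
    powers.\<close>
  define vb where "vb = max 1 (\<beta> / c)"
  have vb: "v n x $ k \<le> vb" for n x k
  proof (cases n)
    case 0 then show ?thesis using v01[of x k] by (simp add: v0' vb_def)
  next
    case (Suc m)
    obtain mb where mb: "\<And>x k. v m x $ k \<le> mb" using bv[of m] by (auto simp: bdd_cont_def)
    note im = Lin_integrable'(1)[OF adm(2) nv mb]
    have row: "0 \<le> (\<Sum>j\<in>UNIV. AT k j y * v m y $ j)" if "0 < y" "y < 1" for y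
      using A_bound(1)[OF that] nonneg_contD(3)[OF nv] by (intro sum_nonneg) (simp add: AT_def)
    have "v n x $ k \<le> \<beta> / c"
    proof (cases "x \<in> {0..1}")
      case False
      have "0 \<le> \<beta>" unfolding \<beta>_def Bf_def
        using A_bound(1) nonneg_contD(3)[OF w1(1)] nonneg_contD(3)[OF nv0]
        by (intro sum_nonneg integral_nonneg_AE AE_I01_I) auto
      then show ?thesis using c(1) Lin_outside[OF False, of AT "v m" k] by (simp add: Suc vS)
    next
      case True
      have "v n x $ k = Kop (\<lambda>y. \<Sum>j\<in>UNIV. AT k j y * v m y $ j) x" by (simp add: Suc vS Lin_nth)
      also have "\<dots> \<le> (\<integral>y. bubble y * \<bar>\<Sum>j\<in>UNIV. AT k j y * v m y $ j\<bar> \<partial>I01)"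
        using Kop_abs_le(2)[OF im True, of k] by (rule order_trans[OF abs_ge_self])
      \<comment> \<open>The inequality \<open>bubble \<le> w1 / c\<close> turns the weighted
        integral into part of \<open>Bf (v m) w1\<close>, which is at most \<open>\<beta>\<close>.
        In this way a bound on a pairing becomes a sup bound.\<close>
      also have "\<dots> \<le> (\<integral>y. (1 / c) * (\<Sum>j\<in>UNIV. A j k y * w1 y $ k * v m y $ j) \<partial>I01)"
      proof (intro integral_mono_AE AE_I01_I bubble_integrable integrable_abs im integrable_mult_right
          Bochner_Integration.integrable_sum Bf_integrable bv bw1 adm)
        fix y :: real assume y: "0 < y" "y < 1"
        have cb: "bubble y \<le> w1 y $ k / c" using c(2)[of y k] c(1) y by (simp add: pos_le_divide_eq mult.commute)
        have "bubble y * \<bar>\<Sum>j\<in>UNIV. AT k j y * v m y $ j\<bar> = bubble y * (\<Sum>j\<in>UNIV. AT k j y * v m y $ j)"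
          using row[OF y] by simp
        also have "\<dots> \<le> w1 y $ k / c * (\<Sum>j\<in>UNIV. AT k j y * v m y $ j)"
          by (rule mult_right_mono[OF cb row[OF y]])
        also have "\<dots> = (1 / c) * (\<Sum>j\<in>UNIV. A j k y * w1 y $ k * v m y $ j)"
          by (simp add: sum_distrib_left AT_def mult_ac)
        finally show "bubble y * \<bar>\<Sum>j\<in>UNIV. AT k j y * v m y $ j\<bar> \<le> (1 / c) * (\<Sum>j\<in>UNIV. A j k y * w1 y $ k * v m y $ j)" .
      qed
      also have "\<dots> = (1 / c) * (\<Sum>j\<in>UNIV. \<integral>y. A j k y * w1 y $ k * v m y $ j \<partial>I01)"
        by (simp only: integral_mult_right_zero Bochner_Integration.integral_sum[OF Bf_integrable[OF bv bw1 adm(1)]])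
      also have "\<dots> \<le> (1 / c) * Bf (v m) w1"
      proof (rule mult_left_mono)
        show "(\<Sum>j\<in>UNIV. \<integral>y. A j k y * w1 y $ k * v m y $ j \<partial>I01) \<le> Bf (v m) w1"
          unfolding Bf_def
        proof (rule sum_mono)
          fix j
          have "0 \<le> A j i x * w1 x $ i * v m x $ j" if "0 < x" "x < 1" for i x
            using A_bound(1)[OF that] nonneg_contD(3)[OF w1(1)] nonneg_contD(3)[OF nv] by simp
          then show "(\<integral>y. A j k y * w1 y $ k * v m y $ j \<partial>I01) \<le> (\<Sum>i\<in>UNIV. \<integral>x. A j i x * w1 x $ i * v m x $ j \<partial>I01)"
            by (intro member_le_sum[where f = "\<lambda>i. \<integral>x. A j i x * w1 x $ i * v m x $ j \<partial>I01"] integral_nonneg_AE AE_I01_I) auto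
        qed
      qed (use c in simp)
      also have "\<dots> \<le> (1 / c) * \<beta>" using up[of m] c(1) by (intro mult_left_mono) auto
      finally show ?thesis by simp
    qed
    then show ?thesis by (simp add: vb_def)
  qed
  have vout: "v n x $ k = 0" if "x \<notin> {0..1}" for n x k
  proof (cases n)
    case 0 then show ?thesis unfolding 0 v0' v0k by (simp only: that if_False)
  next
    case (Suc m) then show ?thesis unfolding Suc vS by (simp only: Lin_outside[OF that])
  qed
  define L where "L = 1 + real CARD('m) * CA * vb * integral\<^sup>L I01 wt"
  have vb0: "0 \<le> vb" by (simp add: vb_def)
  have L1: "0 \<le> real CARD('m) * CA * vb * integral\<^sup>L I01 wt"
    using CA_nonneg vb0 wt_integral by simp
  have vL: "\<bar>v n x $ k - v n x' $ k\<bar> \<le> \<bar>x - x'\<bar> * L" if x: "x \<in> {0..1}" "x' \<in> {0..1}" for n x x' k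
  proof (cases n)
    case 0
    have "bubble x - bubble x' = (x - x') * (1 - x - x')" by (simp add: algebra_simps)
    then have "\<bar>bubble x - bubble x'\<bar> = \<bar>x - x'\<bar> * \<bar>1 - x - x'\<bar>" by (simp only: abs_mult)
    also have "\<dots> \<le> \<bar>x - x'\<bar> * 1" using x by (intro mult_left_mono) (auto simp: abs_le_iff)
    also have "\<dots> \<le> \<bar>x - x'\<bar> * L" using L1 by (intro mult_left_mono) (auto simp: L_def)
    finally show ?thesis using x by (simp add: 0 v0' v0k)
  next
    case (Suc m)
    have "\<bar>v n x $ k - v n x' $ k\<bar> \<le> \<bar>x - x'\<bar> * (real CARD('m) * CA * vb * integral\<^sup>L I01 wt)"
      unfolding Suc vS by (rule Lin_lipschitz[OF adm(2) nv vb x])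
    also have "\<dots> \<le> \<bar>x - x'\<bar> * L" by (intro mult_left_mono) (auto simp: L_def)
    finally show ?thesis .
  qed
  \<comment> \<open>The powers are bounded but need not converge; their averages become
    asymptotically invariant.\<close>
  define V where "V n x = (1 / (real n + 1)) *\<^sub>R (\<Sum>m\<le>n. v m x)" for n x
  have Vk: "V n x $ k = (1 / (real n + 1)) * (\<Sum>m\<le>n. v m x $ k)" for n x k by (simp add: V_def)
  have avg: "(1 / (real n + 1)) * (\<Sum>m\<le>n. t) = t" for n and t :: real by (simp add: add.commute)
  have Vb: "V n x $ k \<le> vb" for n x k
  proof -
    have "V n x $ k \<le> (1 / (real n + 1)) * (\<Sum>m\<le>n. vb)" unfolding Vk by (intro mult_left_mono sum_mono vb) simp
    then show ?thesis by (simp only: avg)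
  qed
  have nV: "nonneg_cont (V n)" for n
  proof (rule nonneg_contI)
    show "continuous_on {0..1} (\<lambda>x. V n x $ k)" for k
      unfolding Vk by (intro continuous_on_mult continuous_on_const continuous_on_sum nonneg_contD(2)[OF nv])
    show "0 \<le> V n x $ k" for x k
      unfolding Vk using nonneg_contD(3)[OF nv] by (intro mult_nonneg_nonneg sum_nonneg) auto
  qed
  have Vout: "V n x $ k = 0" if "x \<notin> {0..1}" for n x k unfolding Vk using vout[OF that] by simp
  have VL: "\<bar>V n x $ k - V n x' $ k\<bar> \<le> \<bar>x - x'\<bar> * L" if x: "x \<in> {0..1}" "x' \<in> {0..1}" for n x x' k
  proof -
    have "V n x $ k - V n x' $ k = (1 / (real n + 1)) * (\<Sum>m\<le>n. v m x $ k - v m x' $ k)"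
      by (simp add: Vk sum_subtractf right_diff_distrib)
    then have "\<bar>V n x $ k - V n x' $ k\<bar> = (1 / (real n + 1)) * \<bar>\<Sum>m\<le>n. v m x $ k - v m x' $ k\<bar>"
      by (simp add: abs_mult)
    also have "\<dots> \<le> (1 / (real n + 1)) * (\<Sum>m\<le>n. \<bar>x - x'\<bar> * L)"
      by (intro mult_left_mono order_trans[OF sum_abs] sum_mono vL x) simp
    finally show ?thesis by (simp only: avg)
  qed
  \<comment> \<open>The sum telescopes: only the last and the first power remain, divided by
    \<open>n + 1\<close>.\<close>
  have TV: "Lin AT (V n) x $ k - V n x $ k = (1 / (real n + 1)) * (v (Suc n) x $ k - v0 x $ k)" for n x k
  proof -
    have "Lin AT (V n) x $ k = Kop (\<lambda>y. (1 / (real n + 1)) * (\<Sum>m\<le>n. \<Sum>j\<in>UNIV. AT k j y * v m y $ j)) x"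
    proof -
      have "(\<Sum>j\<in>UNIV. AT k j y * V n y $ j) = (1 / (real n + 1)) * (\<Sum>m\<le>n. \<Sum>j\<in>UNIV. AT k j y * v m y $ j)" for y
        unfolding Vk sum_distrib_left by (subst sum.swap) (simp add: mult_ac)
      then show ?thesis unfolding Lin_nth by simp
    qed
    also have "\<dots> = (1 / (real n + 1)) * (\<Sum>m\<le>n. Lin AT (v m) x $ k)"
      unfolding Kop_cmult Lin_nth by (subst Kop_sum) (auto intro: Lin_integrable'(1)[OF adm(2) nv vb])
    also have "(\<Sum>m\<le>n. Lin AT (v m) x $ k) = (\<Sum>m\<le>n. v m x $ k) + v (Suc n) x $ k - v0 x $ k"
    proof -
      have "(\<Sum>m\<le>n. v (Suc m) x $ k) = (\<Sum>m\<le>Suc n. v m x $ k) - v 0 x $ k"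
        by (subst sum.atMost_Suc_shift) simp
      then show ?thesis by (simp add: vS v0')
    qed
    finally show ?thesis by (simp add: Vk right_diff_distrib distrib_left)
  qed
  obtain r z where rz: "strict_mono r" "nonneg_cont z" "\<And>x k. x \<notin> {0..1} \<Longrightarrow> z x $ k = 0"
    "\<And>x k. (\<lambda>n. V (r n) x $ k) \<longlonglongrightarrow> z x $ k"
    "\<And>e. e > 0 \<Longrightarrow> \<exists>N. \<forall>n\<ge>N. \<forall>x k. \<bar>V (r n) x $ k - z x $ k\<bar> < e"
    by (rule lipschitz_compactness[of V vb L, OF nV Vout Vb VL]) (assumption | rule that)+
  have zb: "z x $ k \<le> vb" for x k by (rule LIMSEQ_le_const2[OF rz(4)]) (use Vb in auto)
  have "Lin AT z x $ k = z x $ k" for x k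
  proof -
    have 1: "(\<lambda>n. Lin AT (V (r n)) x $ k - V (r n) x $ k) \<longlonglongrightarrow> Lin AT z x $ k - z x $ k"
      by (intro tendsto_diff rz Lin_tendsto[OF adm(2) nV Vb])
    have "(\<lambda>n. (1 / (real n + 1)) * (v (Suc n) x $ k - v0 x $ k)) \<longlonglongrightarrow> 0"
    proof (rule Lim_null_comparison)
      have "(\<lambda>n. 1 / (real n + 1)) \<longlonglongrightarrow> 0" by real_asymp
      then have "(\<lambda>n. 1 / (real n + 1) * (vb + 1)) \<longlonglongrightarrow> 0 * (vb + 1)" by (intro tendsto_mult tendsto_const)
      then show "(\<lambda>n. 1 / (real n + 1) * (vb + 1)) \<longlonglongrightarrow> 0" by simp
      show "\<forall>\<^sub>F n in sequentially. norm ((1 / (real n + 1)) * (v (Suc n) x $ k - v0 x $ k)) \<le> 1 / (real n + 1) * (vb + 1)"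
      proof (rule always_eventually, rule allI)
        fix n
        have "\<bar>v (Suc n) x $ k - v0 x $ k\<bar> \<le> vb + 1"
          using vb[of "Suc n" x k] v01[of x k] nonneg_contD(3)[OF nv, of "Suc n" x k] nonneg_contD(3)[OF nv0, of x k] by linarith
        then have "\<bar>1 / (real n + 1)\<bar> * \<bar>v (Suc n) x $ k - v0 x $ k\<bar> \<le> \<bar>1 / (real n + 1)\<bar> * (vb + 1)"
          by (rule mult_left_mono) simp
        then show "norm ((1 / (real n + 1)) * (v (Suc n) x $ k - v0 x $ k)) \<le> 1 / (real n + 1) * (vb + 1)"
          unfolding real_norm_def abs_mult by simp
      qed
    qed
    from LIMSEQ_subseq_LIMSEQ[OF this rz(1)]
    have "(\<lambda>n. Lin AT (V (r n)) x $ k - V (r n) x $ k) \<longlonglongrightarrow> 0" unfolding TV by (simp add: comp_def)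
    from LIMSEQ_unique[OF 1 this] show ?thesis by simp
  qed
  then have "Lin AT z = z" by (simp add: fun_eq_iff vec_eq_iff)
  moreover have "\<exists>x k. 0 < z x $ k"
  proof -
    \<comment> \<open>Constant functions measure smallness: averages everywhere below
      \<open>e\<close> would have pairing at most \<open>e * \<kappa>\<close> with
      \<open>w2\<close>.\<close>
    define one where "one = (\<lambda>x::real. \<chi> k::'m. (1::real))"
    have bone: "bdd_cont (\<lambda>x. e *\<^sub>R one x)" if "e \<ge> 0" for e
      by (rule bdd_contI[OF nonneg_contI, of _ e]) (use that in \<open>auto simp: one_def\<close>)
    define \<kappa> where "\<kappa> = Bf one w2"
    have scale: "Bf (\<lambda>x. e *\<^sub>R one x) w2 = e * \<kappa>" for e
      unfolding \<kappa>_def Bf_def sum_distrib_left by (simp add: one_def mult_ac)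
    have BV: "Bf v0 w2 \<le> Bf (V n) w2" for n
    proof -
      have "Bf (V n) w2 = (1 / (real n + 1)) * (\<Sum>m\<le>n. Bf (v m) w2)"
      proof -
        have e: "(\<integral>x. A i j x * w2 x $ j * V n x $ i \<partial>I01) = (1 / (real n + 1)) * (\<Sum>m\<le>n. \<integral>x. A i j x * w2 x $ j * v m x $ i \<partial>I01)" for i j
        proof -
          have "(\<integral>x. A i j x * w2 x $ j * V n x $ i \<partial>I01) = (\<integral>x. (1 / (real n + 1)) * (\<Sum>m\<le>n. A i j x * w2 x $ j * v m x $ i) \<partial>I01)"
            unfolding Vk by (simp add: sum_distrib_left mult_ac)
          also have "\<dots> = (1 / (real n + 1)) * (\<Sum>m\<le>n. \<integral>x. A i j x * w2 x $ j * v m x $ i \<partial>I01)"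
            by (simp only: integral_mult_right_zero Bochner_Integration.integral_sum[OF Bf_integrable[OF bv bw2 adm(1)]])
          finally show ?thesis .
        qed
        have "Bf (V n) w2 = (1 / (real n + 1)) * (\<Sum>i\<in>UNIV. \<Sum>j\<in>UNIV. \<Sum>m\<le>n. \<integral>x. A i j x * w2 x $ j * v m x $ i \<partial>I01)"
          unfolding Bf_def e by (simp only: sum_distrib_left)
        also have "(\<Sum>i\<in>UNIV. \<Sum>j\<in>UNIV. \<Sum>m\<le>n. \<integral>x. A i j x * w2 x $ j * v m x $ i \<partial>I01) = (\<Sum>m\<le>n. Bf (v m) w2)"
          unfolding Bf_def by (subst (2) sum.swap, subst sum.swap) (rule refl)
        finally show ?thesis .
      qed
      moreover have "(1 / (real n + 1)) * (\<Sum>m\<le>n. Bf v0 w2) \<le> (1 / (real n + 1)) * (\<Sum>m\<le>n. Bf (v m) w2)"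
        by (intro mult_left_mono sum_mono low) simp
      ultimately show ?thesis by (simp only: avg)
    qed
    \<comment> \<open>Small enough that \<open>e * \<kappa>\<close> is at most half the lower bound
      \<open>Bf v0 w2\<close>; the added 1 keeps the denominator positive.\<close>
    define e where "e = Bf v0 w2 / (2 * (\<bar>\<kappa>\<bar> + 1))"
    have e: "0 < e" using low0 by (simp add: e_def add_nonneg_pos)
    have big: "\<exists>x k. e \<le> V n x $ k" for n
    proof (rule ccontr)
      assume "\<not> (\<exists>x k. e \<le> V n x $ k)"
      then have le: "V n x $ k \<le> (e *\<^sub>R one x) $ k" for x k by (auto simp: not_le one_def less_imp_le)
      have "Bf v0 w2 \<le> Bf (V n) w2" by (rule BV)
      also have "\<dots> \<le> Bf (\<lambda>x. e *\<^sub>R one x) w2"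
        by (rule Bf_mono[OF bdd_contI[OF nV Vb] bone[OF less_imp_le[OF e]] bw2 bw2 le order_refl])
      also have "\<dots> = e * \<kappa>" by (rule scale)
      also have "\<dots> \<le> e * (\<bar>\<kappa>\<bar> + 1)" using e by (intro mult_left_mono) auto
      also have "\<dots> = Bf v0 w2 / 2"
      proof -
        have "t / (2 * s) * s = t / 2" if "s \<noteq> 0" for s t :: real using that by simp
        moreover have "\<bar>\<kappa>\<bar> + 1 \<noteq> 0" by linarith
        ultimately show ?thesis unfolding e_def by blast
      qed
      finally show False using low0 by simp
    qed
    show ?thesis by (rule uniform_limit_nonzero[OF rz(5) big e]) blast+
  qed
  ultimately show thesis using that[OF rz(2) zb] by blast
qed

lemma u_solution:
  "u \<in> UU_o" "is_solution f q u Ls"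
  using solution_UU_o[OF nu fix_u less_imp_le[OF Ls_pos]] u_pos by blast+

text \<open>A fixed vector of \<open>Lin AT\<close> is \<open>Kop\<close> of its own right-hand
  side, so \<open>Kop_weak\<close> turns the fixed-point equation into the weak adjoint equation,
  and splitting \<open>A\<close> into its two parts gives \<open>DF_op\<close>. The same
  representation puts \<open>v\<close> into \<open>SS\<close>.\<close>

lemma singular:
  obtains v where "v \<in> SS_nz" "\<And>\<xi>. \<xi> \<in> WW \<Longrightarrow> DF_op f q u Ls \<xi> v = 0"
proof -
  obtain v vb where v: "nonneg_cont v" "\<And>x k. v x $ k \<le> vb" and nz: "\<exists>x k. 0 < v x $ k" and fv: "Lin AT v = v"
    by (rule adjoint_solution) (rule that)
  define p where "p y = (\<chi> i. \<Sum>j\<in>UNIV. AT i j y * v y $ j)" for y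
  have pk: "p y $ i = (\<Sum>j\<in>UNIV. AT i j y * v y $ j)" for y i by (simp add: p_def)
  have ip: "integrable I01 (\<lambda>y. p y $ i)" for i unfolding pk by (rule Lin_integrable'(1)[OF adm(2) v])
  have vK: "v = KV p" using fv unfolding Lin_def p_def by simp
  have vk: "(\<lambda>x. v x $ k) = Kop (\<lambda>y. p y $ k)" for k by (subst vK) simp
  have "KV p \<in> SS" by (rule KV_SS[OF ip]) (use nonneg_contD(3)[OF v(1)] vK in metis)
  then have "v \<in> SS" using vK by simp
  moreover have "v \<noteq> (\<lambda>_. 0)" using nz by auto
  ultimately have vS: "v \<in> SS_nz" by simp
  have "DF_op f q u Ls \<xi> v = 0" if \<xi>: "\<xi> \<in> WW" for \<xi>
  proof -
    have \<xi>k: "(\<lambda>x. \<xi> x $ k) \<in> H01" for k using \<xi> by (simp add: WW_def)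
    have c\<xi>: "continuous_on {0..1} (\<lambda>x. \<xi> x $ k)" for k by (rule H01_D(1)[OF \<xi>k])
    have vm: "(\<lambda>x. v x $ k) \<in> borel_measurable I01" for k by (rule continuous_measurable_I01'[OF nonneg_contD(2)[OF v(1)]])
    have iA: "integrable I01 (\<lambda>x. A i j x * v x $ i * \<xi> x $ j)" for i j
    proof -
      have i: "integrable I01 (\<lambda>x. AT j i x * v x $ i)" by (rule Lin_integrable'(2)[OF adm(2) v])
      have "bounded ((\<lambda>x. \<xi> x $ j) ` {0..1})" by (intro compact_imp_bounded compact_continuous_image c\<xi>) auto
      then obtain M where M: "\<forall>x\<in>{0..1}. \<bar>\<xi> x $ j\<bar> \<le> M" by (auto simp: bounded_iff)
      show ?thesis
      proof (rule Bochner_Integration.integrable_bound[OF integrable_mult_right[OF i, of M]])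
        show "(\<lambda>x. A i j x * v x $ i * \<xi> x $ j) \<in> borel_measurable I01"
          by (intro borel_measurable_times A_measurable vm continuous_measurable_I01'[OF c\<xi>])
        show "AE x in I01. norm (A i j x * v x $ i * \<xi> x $ j) \<le> norm (M * (AT j i x * v x $ i))"
        proof (rule AE_I01_I)
          fix x :: real assume "0 < x" "x < 1"
          then have "\<bar>\<xi> x $ j\<bar> \<le> \<bar>M\<bar>" using bspec[OF M, of x] abs_ge_self[of M] by simp
          then have "\<bar>A i j x * v x $ i\<bar> * \<bar>\<xi> x $ j\<bar> \<le> \<bar>A i j x * v x $ i\<bar> * \<bar>M\<bar>" by (rule mult_left_mono) simp
          then show "norm (A i j x * v x $ i * \<xi> x $ j) \<le> norm (M * (AT j i x * v x $ i))"
            unfolding real_norm_def abs_mult AT_def by (simp add: mult_ac)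
        qed
      qed
    qed
    \<comment> \<open>The diagonal entry of \<open>A\<close> dominates \<open>Ls * (q - 1)\<close>
      times this singular power, so integrability is inherited from \<open>iA\<close>.\<close>
    have i2: "integrable I01 (\<lambda>x. (u x $ k) powr (q - 2) * \<xi> x $ k * v x $ k)" for k
    proof (rule Bochner_Integration.integrable_bound)
      show "integrable I01 (\<lambda>x. (1 / (Ls * (q - 1))) * (A k k x * v x $ k * \<xi> x $ k))"
        by (rule integrable_mult_right[OF iA])
      have "(\<lambda>x. (u x $ k) powr (q - 2)) \<in> borel_measurable I01"
        by (intro powr_real_measurable continuous_measurable_I01'[OF nonneg_contD(2)[OF nu]] borel_measurable_const)
      then show "(\<lambda>x. (u x $ k) powr (q - 2) * \<xi> x $ k * v x $ k) \<in> borel_measurable I01"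
        by (intro borel_measurable_times vm continuous_measurable_I01'[OF c\<xi>])
      show "AE x in I01. norm ((u x $ k) powr (q - 2) * \<xi> x $ k * v x $ k) \<le> norm ((1 / (Ls * (q - 1))) * (A k k x * v x $ k * \<xi> x $ k))"
      proof (rule AE_I01_I)
        fix x :: real assume x: "0 < x" "x < 1"
        have Lq: "0 < Ls * (q - 1)" using Ls_pos q by simp
        have "Ls * (q - 1) * (u x $ k) powr (q - 2) \<le> A k k x"
          using fu_bound[of x "u x" k k] nonneg_contD(4)[OF nu] x by (simp add: A_def)
        then have "(u x $ k) powr (q - 2) \<le> (1 / (Ls * (q - 1))) * A k k x"
          using Lq by (simp add: pos_le_divide_eq mult.commute)
        then have "(u x $ k) powr (q - 2) * (\<bar>\<xi> x $ k\<bar> * \<bar>v x $ k\<bar>) \<le> ((1 / (Ls * (q - 1))) * A k k x) * (\<bar>\<xi> x $ k\<bar> * \<bar>v x $ k\<bar>)"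
          by (rule mult_right_mono) simp
        then show "norm ((u x $ k) powr (q - 2) * \<xi> x $ k * v x $ k) \<le> norm ((1 / (Ls * (q - 1))) * (A k k x * v x $ k * \<xi> x $ k))"
          using A_bound(1)[OF x, of k k] Lq q Ls_pos by (simp add: abs_mult mult_ac)
      qed
    qed
    have d: "dirichlet_form \<xi> v = (\<Sum>k\<in>UNIV. \<Sum>j\<in>UNIV. \<integral>x. A j k x * v x $ j * \<xi> x $ k \<partial>I01)"
    proof -
      have "(\<integral>x. wderiv (\<lambda>y. \<xi> y $ k) x * wderiv (\<lambda>y. v y $ k) x \<partial>I01) = (\<Sum>j\<in>UNIV. \<integral>x. A j k x * v x $ j * \<xi> x $ k \<partial>I01)" for k
      proof -
        have "(\<integral>x. wderiv (\<lambda>y. \<xi> y $ k) x * wderiv (\<lambda>y. v y $ k) x \<partial>I01) = (\<integral>x. p x $ k * \<xi> x $ k \<partial>I01)"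
          unfolding vk using Kop_weak[OF ip \<xi>k, of k k] by (simp add: mult.commute)
        also have "\<dots> = (\<integral>x. (\<Sum>j\<in>UNIV. A j k x * v x $ j * \<xi> x $ k) \<partial>I01)"
          unfolding pk AT_def by (simp only: sum_distrib_right)
        also have "\<dots> = (\<Sum>j\<in>UNIV. \<integral>x. A j k x * v x $ j * \<xi> x $ k \<partial>I01)"
          by (rule Bochner_Integration.integral_sum) (rule iA)
        finally show ?thesis .
      qed
      then show ?thesis by (simp add: dirichlet_form_def LBINT_I01)
    qed
    have "(\<Sum>j\<in>UNIV. \<integral>x. A k j x * v x $ k * \<xi> x $ j \<partial>I01)
       = (\<integral>x. (jac f x (u x) *v \<xi> x) $ k * v x $ k \<partial>I01) + Ls * (q - 1) * (\<integral>x. (u x $ k) powr (q - 2) * \<xi> x $ k * v x $ k \<partial>I01)" for k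
    proof -
      have pt: "(\<Sum>j\<in>UNIV. A k j x * v x $ k * \<xi> x $ j) - Ls * (q - 1) * ((u x $ k) powr (q - 2) * \<xi> x $ k * v x $ k)
          = (jac f x (u x) *v \<xi> x) $ k * v x $ k" for x
      proof -
        have "(\<Sum>j\<in>UNIV. A k j x * v x $ k * \<xi> x $ j) = (\<Sum>j\<in>UNIV. jac f x (u x) $ k $ j * \<xi> x $ j * v x $ k)
           + (\<Sum>j\<in>UNIV. if j = k then Ls * (q - 1) * ((u x $ k) powr (q - 2) * \<xi> x $ k * v x $ k) else 0)"
          unfolding sum.distrib[symmetric] A_def by (intro sum.cong) (auto simp: algebra_simps)
        then show ?thesis by (simp add: matrix_vector_mult_def sum_distrib_right)
      qed
      have "(\<integral>x. (jac f x (u x) *v \<xi> x) $ k * v x $ k \<partial>I01)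
        = (\<integral>x. (\<Sum>j\<in>UNIV. A k j x * v x $ k * \<xi> x $ j) - Ls * (q - 1) * ((u x $ k) powr (q - 2) * \<xi> x $ k * v x $ k) \<partial>I01)"
        unfolding pt ..
      also have "\<dots> = (\<integral>x. (\<Sum>j\<in>UNIV. A k j x * v x $ k * \<xi> x $ j) \<partial>I01)
         - (\<integral>x. Ls * (q - 1) * ((u x $ k) powr (q - 2) * \<xi> x $ k * v x $ k) \<partial>I01)"
        by (intro Bochner_Integration.integral_diff Bochner_Integration.integrable_sum iA integrable_mult_right i2)
      also have "(\<integral>x. (\<Sum>j\<in>UNIV. A k j x * v x $ k * \<xi> x $ j) \<partial>I01) = (\<Sum>j\<in>UNIV. \<integral>x. A k j x * v x $ k * \<xi> x $ j \<partial>I01)"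
        by (rule Bochner_Integration.integral_sum) (rule iA)
      finally show ?thesis by simp
    qed
    then have e: "(\<Sum>k\<in>UNIV. \<Sum>j\<in>UNIV. \<integral>x. A k j x * v x $ k * \<xi> x $ j \<partial>I01)
      = (\<Sum>k\<in>UNIV. \<integral>x. (jac f x (u x) *v \<xi> x) $ k * v x $ k \<partial>I01)
        + Ls * (q - 1) * (\<Sum>k\<in>UNIV. \<integral>x. (u x $ k) powr (q - 2) * \<xi> x $ k * v x $ k \<partial>I01)"
      by (simp add: sum.distrib sum_distrib_left)
    have "dirichlet_form \<xi> v = (\<Sum>k\<in>UNIV. \<Sum>j\<in>UNIV. \<integral>x. A k j x * v x $ k * \<xi> x $ j \<partial>I01)"
      unfolding d by (rule sum.swap)
    then show ?thesis unfolding DF_op_def pairing_I01 LBINT_I01 e by simp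
  qed
  with vS show thesis by (rule that)
qed

end

section \<open>The extremal solution and the minimax value\<close>

context elliptic_system begin

lemma extremal_solution_ex:
  obtains u b c0 where "extremal_solution f q \<gamma> C R \<delta>0 \<theta> u b c0"
proof -
  obtain b where b: "\<And>lam x k. 0 < lam \<Longrightarrow> lam < Ls \<Longrightarrow> minsol lam x $ k \<le> b"
    by (rule minsol_bounded) (rule that)
  have l: "0 < Ls * (1 - 1 / (real n + 2))" "Ls * (1 - 1 / (real n + 2)) < Ls" for n
  proof -
    have "0 < 1 - 1 / (real n + 2)" by (simp add: field_simps)
    with Ls_pos show "0 < Ls * (1 - 1 / (real n + 2))" by (rule mult_pos_pos)
    show "Ls * (1 - 1 / (real n + 2)) < Ls" using Ls_pos by (simp add: right_diff_distrib)
  qed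
  have bl: "minsol (Ls * (1 - 1 / (real n + 2))) x $ k \<le> b" for n x k by (rule b[OF l])
  obtain u where u: "nonneg_cont u" "step Ls u = u"
    "\<And>n x k. minsol (Ls * (1 - 1 / (real n + 2))) x $ k \<le> u x $ k"
    "\<And>x k. (\<lambda>n. minsol (Ls * (1 - 1 / (real n + 2))) x $ k) \<longlonglongrightarrow> u x $ k" "\<And>x k. u x $ k \<le> b"
    by (rule minsol_limit[OF Ls_pos order_refl bl]) (rule that)
  \<comment> \<open>The member \<open>n = 0\<close>, the parameter \<open>Ls / 2\<close>. As minimal
    solutions increase with the parameter, its lower bound serves for all \<open>n\<close>, and the
    minimum over the components serves for all \<open>k\<close>.\<close>
  define l0 where "l0 = Ls * (1 - 1 / (real 0 + 2))"
  have l0: "0 < l0" "l0 < Ls" using l[of 0] by (simp_all only: l0_def)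
  have "\<exists>c>0. \<forall>x\<in>{0..1}. c * bubble x \<le> minsol l0 x $ k" for k
    by (rule pos_super_ge_bubble[OF minsol_props(7)[OF l0] l0(1), of k]) blast
  then obtain c where c: "\<And>k. c k > 0" "\<And>k x. x \<in> {0..1} \<Longrightarrow> c k * bubble x \<le> minsol l0 x $ k" by metis
  define c0 where "c0 = Min (range c)"
  have "c0 * bubble x \<le> minsol (Ls * (1 - 1 / (real n + 2))) x $ k" if x: "x \<in> {0..1}" for n x k
  proof -
    have "c0 * bubble x \<le> c k * bubble x" unfolding c0_def using x by (intro mult_right_mono Min_le) auto
    also have "\<dots> \<le> minsol l0 x $ k" by (rule c(2)[OF x])
    also have "\<dots> \<le> minsol (Ls * (1 - 1 / (real n + 2))) x $ k"
    proof (rule minsol_mono[OF l0(1) _ l(2)])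
      show "l0 \<le> Ls * (1 - 1 / (real n + 2))"
        unfolding l0_def using Ls_pos by (intro mult_left_mono) (auto simp: field_simps)
    qed
    finally show ?thesis .
  qed
  moreover have "0 < c0" unfolding c0_def using c(1) by (subst Min_gr_iff) auto
  ultimately have "extremal_solution f q \<gamma> C R \<delta>0 \<theta> u b c0"
    using u by unfold_locales
  then show thesis by (rule that)
qed

text \<open>Nonemptiness matters here: over the empty set the extended infimum would be
  infinite.\<close>

lemma inf_rayleigh_solution:
  assumes "u \<in> UU_o" "is_solution f q u lam" "SS_nz \<noteq> ({} :: (real \<Rightarrow> (real, 'm) vec) set)"
  shows "inf_rayleigh f q u = ereal lam"
proof -
  have "inf_rayleigh f q u = (INF v\<in>(SS_nz :: (real \<Rightarrow> (real, 'm) vec) set). ereal lam)"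
    unfolding inf_rayleigh_def using rayleigh_solution[OF assms(1,2)] by (intro INF_cong) auto
  then show ?thesis using assms(3) by simp
qed

text \<open>A number strictly between \<open>Ls\<close> and the infimum would make \<open>u\<close>
  a positive supersolution for a parameter beyond the supremum of \<open>Lam\<close>.\<close>

lemma inf_rayleigh_le:
  assumes u: "u \<in> UU_o"
  shows "inf_rayleigh f q u \<le> ereal Ls"
proof (rule ccontr)
  assume "\<not> inf_rayleigh f q u \<le> ereal Ls"
  then have "ereal Ls < inf_rayleigh f q u" by simp
  then obtain lam where lam: "Ls < lam" "ereal lam < inf_rayleigh f q u"
    using ereal_dense2[of "ereal Ls"] by auto
  have "lam \<le> rayleigh f q u v" if "v \<in> SS_nz" for v
  proof -
    have "ereal lam < ereal (rayleigh f q u v)"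
      using lam(2) INF_lower[OF that, of "\<lambda>v. ereal (rayleigh f q u v)"] unfolding inf_rayleigh_def by (rule less_le_trans)
    then show ?thesis by simp
  qed
  then have "pos_super lam u" unfolding pos_super_def
    using UU_oD(1,3)[OF u] rayleigh_super[OF u] by blast
  then have "lam \<in> Lam" using lam Ls_pos by (auto simp: Lam_def)
  then show False using Lam_le_Ls lam by fastforce
qed

text \<open>The quotient is constantly \<open>Ls\<close> at the extremal solution, so the statements
  on infima and minima reduce to nonemptiness. By \<open>inf_rayleigh_le\<close> no solution in
  \<open>UU_o\<close> exists beyond \<open>Ls\<close>, which gives both one-sidedness and
  maximality.\<close>

lemma maximal_saddle_node:
  "\<exists>us lams. us \<in> UU_o \<and> lams > 0 \<and> ereal lams = lambda_star f q \<and>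
      maximal_one_sided_saddle_node f q us lams \<and>
      (\<forall>lam>lams. \<not> (\<exists>u\<in>UU_o. is_solution f q u lam)) \<and>
      (\<exists>vs\<in>SS_nz.
         lams = rayleigh f q us vs \<and>
         ereal lams = inf_rayleigh f q us \<and>
         is_solution f q us lams \<and>
         (\<forall>\<xi>\<in>WW. DF_op f q us lams \<xi> vs = 0) \<and>
         (vs \<in> SS_o \<longrightarrow>
            is_min_over (rayleigh f q us) SS_nz lams \<and>
            is_min_over (rayleigh f q us) SS_o lams))"
proof -
  obtain u b c0 where "extremal_solution f q \<gamma> C R \<delta>0 \<theta> u b c0" by (rule extremal_solution_ex)
  then interpret ext: extremal_solution f q \<gamma> C R \<delta>0 \<theta> u b c0 .
  note us = ext.u_solution
  obtain v where v: "v \<in> SS_nz" "\<And>\<xi>. \<xi> \<in> WW \<Longrightarrow> DF_op f q u Ls \<xi> v = 0"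
    by (rule ext.singular) (rule that)
  then have ne: "SS_nz \<noteq> ({} :: (real \<Rightarrow> (real, 'm) vec) set)" by blast
  have inf: "inf_rayleigh f q u = ereal Ls" by (rule inf_rayleigh_solution[OF us ne])
  have no: "\<not> is_solution f q w lam" if "Ls < lam" "w \<in> UU_o" for lam w
  proof
    assume "is_solution f q w lam"
    from inf_rayleigh_solution[OF that(2) this ne] inf_rayleigh_le[OF that(2)] that(1) show False by simp
  qed
  have star: "lambda_star f q = ereal Ls"
    unfolding lambda_star_def
  proof (rule antisym)
    show "(SUP u\<in>UU_o. inf_rayleigh f q u) \<le> ereal Ls" by (rule SUP_least) (rule inf_rayleigh_le)
    show "ereal Ls \<le> (SUP u\<in>UU_o. inf_rayleigh f q u)"
      using SUP_upper[OF us(1), of "inf_rayleigh f q"] by (simp add: inf)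
  qed
  have ray: "rayleigh f q u w = Ls" if "w \<in> SS_nz" for w by (rule rayleigh_solution[OF us that])
  \<comment> \<open>Nonexistence beyond \<open>Ls\<close> is global, so the radius 1 and the whole
    space serve as \<epsilon> and V.\<close>
  have one: "one_sided_saddle_node f q u Ls"
    unfolding one_sided_saddle_node_def singular_solution_def
  proof (intro conjI us bexI[OF _ v(1)] ballI v(2) exI[of _ 1] exI[of _ WW])
    show "WW_nhd u WW" unfolding WW_nhd_def by (auto intro: exI[of _ 1])
    show "\<not> (\<exists>w\<in>UU_o \<inter> WW. is_solution f q w lam)" if "lam \<in> {Ls<..<Ls + 1}" for lam
      using no that by auto
  qed auto
  have max: "maximal_one_sided_saddle_node f q u Ls"
    unfolding maximal_one_sided_saddle_node_def
  proof (intro conjI one allI impI)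
    fix u' lam' assume "one_sided_saddle_node f q u' lam'"
    then have "u' \<in> UU_o" "is_solution f q u' lam'"
      by (auto simp: one_sided_saddle_node_def singular_solution_def)
    then show "lam' \<le> Ls" using no[of lam' u'] by (cases "Ls < lam'") auto
  qed
  have min: "is_min_over (rayleigh f q u) SS_nz Ls \<and> is_min_over (rayleigh f q u) SS_o Ls" if vo: "v \<in> SS_o"
  proof -
    \<comment> \<open>The open cone lies in its closure, and positivity at \<open>1/2\<close>
      excludes the zero function.\<close>
    have sub: "w \<in> SS_nz" if w: "w \<in> SS_o" for w :: "real \<Rightarrow> (real, 'm) vec"
    proof -
      have wH: "(\<lambda>x. w x $ k) \<in> H01" and wp: "0 < w (1/2) $ k" for k using w by (auto simp: SS_o_def S_o_def)
      have "WW_norm (\<lambda>x. w x - w x) = 0"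
      proof -
        have "H1_norm (\<lambda>x. 0) = 0"
          using H1_norm_C1(2)[of "\<lambda>_. 0" "\<lambda>_. 0"] by simp
        then show ?thesis by (simp add: WW_norm_def)
      qed
      then have "w \<in> SS" using wH w unfolding SS_def WW_def by (auto intro!: bexI[of _ w])
      moreover have "w \<noteq> (\<lambda>_. 0)" using wp by auto
      ultimately show ?thesis by simp
    qed
    show ?thesis unfolding is_min_over_def using ray sub v(1) vo by (auto intro!: image_eqI[of _ _ v])
  qed
  show ?thesis
  proof (intro exI[of _ u] exI[of _ Ls] conjI us(1) Ls_pos star[symmetric] max bexI[OF _ v(1)] ray[OF v(1), symmetric] inf[symmetric] us(2) ballI v(2))
    show "\<forall>lam>Ls. \<not> (\<exists>u\<in>UU_o. is_solution f q u lam)" using no by blast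
    show "v \<in> SS_o \<longrightarrow> is_min_over (rayleigh f q u) SS_nz Ls \<and> is_min_over (rayleigh f q u) SS_o Ls" using min by blast
  qed
qed

end

theorem theorem6p2:
  fixes f :: "real \<Rightarrow> real^('m::{finite,linorder}) \<Rightarrow> real^('m::{finite,linorder})"
    and q \<gamma> C R \<delta>0 \<theta> :: real
  assumes q: "1 < q" "q < 2"
    and f_cont: "\<And>i u. u \<in> orthant \<Longrightarrow> continuous_on {0..1} (\<lambda>x. f x u $ i)"
    and f_C1: "\<And>x. x \<in> {0..1} \<Longrightarrow> C1_orthant f x"
    and f_zero: "\<And>x. x \<in> {0..1} \<Longrightarrow> f x 0 = 0"
    and \<gamma>: "2 < \<gamma>" and C: "C > 0"
    and f_bound: "\<And>i x u. x \<in> {0..1} \<Longrightarrow> u \<in> orthant \<Longrightarrow>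
        0 \<le> f x u $ i \<and> f x u $ i \<le> C * norm u powr (\<gamma> - 1)"
    and fu_bound: "\<And>i j x u. x \<in> {0..1} \<Longrightarrow> u \<in> orthant \<Longrightarrow>
        0 \<le> jac f x u $ i $ j \<and> jac f x u $ i $ j \<le> C * norm u powr (\<gamma> - 2)"
    and fu_pos: "\<And>i j. i \<noteq> j \<Longrightarrow>
        AE x\<in>{0<..<1} in lborel. \<forall>u. (\<forall>k. u $ k > 0) \<longrightarrow> jac f x u $ i $ j > 0"
    and R: "R > 0" and \<delta>0: "\<delta>0 > 0"
    and large_growth: "AE x\<in>{0<..<1} in lborel. \<forall>u\<in>orthant. norm u > R \<longrightarrow>
        (\<Sum>k\<in>UNIV. f x u $ k) \<ge> (principal_eigenvalue + \<delta>0) * (\<Sum>k\<in>UNIV. u $ k)"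
    and radial_mono: "\<And>u v. u \<in> UU_o \<Longrightarrow> v \<in> SS_nz \<Longrightarrow>
        pairing (\<lambda>x. jac f x (u x) *v u x - f x (u x)) v \<ge> 0"
    and \<theta>: "\<theta> > 1"
    and picone: "AE x\<in>{0<..<1} in lborel. \<forall>u\<in>orthant.
        Q_form f x u \<ge> \<theta> * (\<Sum>i\<in>UNIV. f x u $ i * u $ i)"
  shows "\<exists>us lams. us \<in> UU_o \<and> lams > 0 \<and> ereal lams = lambda_star f q \<and>
      maximal_one_sided_saddle_node f q us lams \<and>
      (\<forall>lam>lams. \<not> (\<exists>u\<in>UU_o. is_solution f q u lam)) \<and>
      (\<exists>vs\<in>SS_nz.
         lams = rayleigh f q us vs \<and>
         ereal lams = inf_rayleigh f q us \<and>
         is_solution f q us lams \<and>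
         (\<forall>\<xi>\<in>WW. DF_op f q us lams \<xi> vs = 0) \<and>
         (vs \<in> SS_o \<longrightarrow>
            is_min_over (rayleigh f q us) SS_nz lams \<and>
            is_min_over (rayleigh f q us) SS_o lams))"
proof -
  interpret elliptic_system f q \<gamma> C R \<delta>0 \<theta>
    by unfold_locales (fact q f_cont f_C1 \<gamma> C f_bound fu_bound fu_pos R \<delta>0 large_growth \<theta> picone)+
  show ?thesis by (rule maximal_saddle_node)
qed

end
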